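(* Let $\Psi$ be a branching mechanism satisfying Grey's condition, let $\Phi$ be an immigration mechanism, and let $Y=(Y_t,t\ge0)$ be a $\mathrm{CBI}(\Psi,\Phi)$ process started at $0$. Then the random set $\mathcal Z=\overline{\{t\ge0:Y_t=0\}}$ is infinitely divisible.
   Context: Mechanisms. A branching mechanism is a function $\Psi(q)=dq+\frac12\sigma^2q^2+\int_0^\infty(e^{-qu}-1+qu\mathbf 1_{u\in(0,1)})\,\nu_1(\mathrm du)$, $q\ge0$, with $d\in\mathbb R$, $\sigma^2\ge0$ and $\nu_1$ a measure on $(0,\infty)$ with $\int_0^\infty(1\wedge u^2)\nu_1(\mathrm du)<\infty$. An immigration mechanism is a function $\Phi(q)=\beta q+\int_0^\infty(1-e^{-qu})\,\nu_0(\mathrm du)$, $q\ge 0$, with $\beta\ge0$ and $\int_0^\infty(1\wedge u)\nu_0(\mathrm du)<\infty$. CBI. For $q>0$ let $v_t(q)$ solve $v_t(q)=q-\int_0^t\Psi(v_s(q))\,\mathrm ds$. A $\mathrm{CBI}(\Psi,\Phi)$ (continuous-state branching process with immigration) started at $x\ge0$ is the càdlàg Markov process $Y$ with $Y_0=x$ and $\mathbb E_x[e^{-qY_t}]=\exp\left(-xv_t(q)-\int_0^t\Phi(v_s(q))\,\mathrm ds\right)$ for all $q>0,t\ge0$. Grey's condition: there exists $\theta>0$ such that $\Psi(z)>0$ for all $z\ge\theta$ and $\int_\theta^\infty\frac{\mathrm dq}{\Psi(q)}<\infty$. A regenerative set is the closure of the range of a (possibly killed) subordinator. A regenerative set $\mathcal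 R$ is infinitely divisible if for every $n\ge1$ there exist $n$ independent identically distributed regenerative sets $\mathcal R^1,\dots,\mathcal R^n$ such that $\mathcal R$ has the same law as $\bigcap_{i=1}^n\mathcal R^i$. *)

theory Defs
  imports "HOL-Probability.Probability"
begin

section \<open>Mechanisms\<close>

text \<open>Measures on \<open>(0, \<infinity>)\<close> are measures whose underlying space is \<open>{0<..}\<close>, so that integrals
  against them need no restriction of the domain. Mechanisms are real functions of which only
  the values on \<open>[0, \<infinity>)\<close> matter.\<close>

definition branching_mechanism :: "(real \<Rightarrow> real) \<Rightarrow> bool" where
  "branching_mechanism \<Psi> \<longleftrightarrow>
    (\<exists>(d::real) (sigma2::real) (\<nu>\<^sub>1::real measure).
       0 \<le> sigma2 \<and>
       sets \<nu>\<^sub>1 = sets (restrict_space borel {0<..}) \<and>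
       (\<integral>\<^sup>+u. ennreal (min 1 (u\<^sup>2)) \<partial>\<nu>\<^sub>1) < \<infinity> \<and>
       (\<forall>q\<ge>0. \<Psi> q = d * q + 1/2 * sigma2 * q\<^sup>2
          + (\<integral>u. exp (- q * u) - 1 + q * u * indicator {0<..<1} u \<partial>\<nu>\<^sub>1)))"

definition immigration_mechanism :: "(real \<Rightarrow> real) \<Rightarrow> bool" where
  "immigration_mechanism \<Phi> \<longleftrightarrow>
    (\<exists>(\<beta>::real) (\<nu>\<^sub>0::real measure).
       0 \<le> \<beta> \<and>
       sets \<nu>\<^sub>0 = sets (restrict_space borel {0<..}) \<and>
       (\<integral>\<^sup>+u. ennreal (min 1 u) \<partial>\<nu>\<^sub>0) < \<infinity> \<and>
       (\<forall>q\<ge>0. \<Phi> q = \<beta> * q + (\<integral>u. 1 - exp (- q * u) \<partial>\<nu>\<^sub>0)))"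

definition grey_condition :: "(real \<Rightarrow> real) \<Rightarrow> bool" where
  "grey_condition \<Psi> \<longleftrightarrow>
    (\<exists>\<theta>>0. (\<forall>z\<ge>\<theta>. 0 < \<Psi> z) \<and> (\<integral>\<^sup>+q\<in>{\<theta>..}. ennreal (1 / \<Psi> q) \<partial>lborel) < \<infinity>)"


section \<open>Processes\<close>

text \<open>All processes are indexed by the times \<open>t \<ge> 0\<close> (values at negative times are irrelevant)
  and take values in \<open>[0, \<infinity>]\<close>. For a CBI process the point \<open>\<infinity>\<close> is the absorbing state reached by
  explosion, which the assumptions on the branching mechanism do not exclude; for a
  subordinator it is the cemetery.\<close>

definition cadlag :: "(real \<Rightarrow> 'b::topological_space) \<Rightarrow> bool" where
  "cadlag f \<longleftrightarrow> (\<forall>t\<ge>0. (f \<longlongrightarrow> f t) (at_right t)) \<and> (\<forall>t>0. \<exists>l. (f \<longlongrightarrow> l) (at_left t))"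

definition past :: "'w measure \<Rightarrow> (real \<Rightarrow> 'w \<Rightarrow> ennreal) \<Rightarrow> real \<Rightarrow> 'w set set" where
  "past M X s = sigma_sets (space M)
     {X u -` B \<inter> space M | u B. 0 \<le> u \<and> u \<le> s \<and> B \<in> sets borel}"

definition markov_process ::
    "'w measure \<Rightarrow> (real \<Rightarrow> ennreal \<Rightarrow> ennreal measure) \<Rightarrow> (real \<Rightarrow> 'w \<Rightarrow> ennreal) \<Rightarrow> bool" where
  "markov_process M P X \<longleftrightarrow>
     (\<forall>t\<ge>0. X t \<in> borel_measurable M) \<and>
     (\<forall>s\<ge>0. \<forall>t\<ge>0. \<forall>A\<in>past M X s. \<forall>B\<in>sets borel.
        emeasure M {\<omega>\<in>A. X (s + t) \<omega> \<in> B} = (\<integral>\<^sup>+\<omega>\<in>A. emeasure (P t (X s \<omega>)) B \<partial>M))"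

text \<open>The function \<open>y \<mapsto> exp (- q y)\<close> on \<open>[0, \<infinity>]\<close> for \<open>q > 0\<close>.\<close>

definition laplace_exp :: "real \<Rightarrow> ennreal \<Rightarrow> real" where
  "laplace_exp q y = (if y = \<infinity> then 0 else exp (- q * enn2real y))"

text \<open>Nonnegativity is part of being a solution, since \<open>\<Psi>\<close> is a function on \<open>[0, \<infinity>)\<close>.\<close>

definition cumulant_solution :: "(real \<Rightarrow> real) \<Rightarrow> (real \<Rightarrow> real \<Rightarrow> real) \<Rightarrow> bool" where
  "cumulant_solution \<Psi> v \<longleftrightarrow>
     (\<forall>q>0. \<forall>t\<ge>0. 0 \<le> v t q \<and>
        set_integrable lborel {0..t} (\<lambda>s. \<Psi> (v s q)) \<and>
        v t q = q - (LINT s:{0..t}|lborel. \<Psi> (v s q)))"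

text \<open>\<open>P t x\<close> is the law at time \<open>t\<close> of the process started at \<open>x\<close>. The case \<open>x = \<infinity>\<close> of the
  Laplace transform says that \<open>\<infinity>\<close> is absorbing.\<close>

definition CBI_transition ::
    "(real \<Rightarrow> real) \<Rightarrow> (real \<Rightarrow> real) \<Rightarrow> (real \<Rightarrow> ennreal \<Rightarrow> ennreal measure) \<Rightarrow> bool" where
  "CBI_transition \<Psi> \<Phi> P \<longleftrightarrow>
     (\<forall>t\<ge>0. P t \<in> borel \<rightarrow>\<^sub>M prob_algebra borel) \<and>
     (\<exists>v. cumulant_solution \<Psi> v \<and>
        (\<forall>q>0. \<forall>t\<ge>0. \<forall>x.
           (\<integral>y. laplace_exp q y \<partial>P t x) =
             laplace_exp (v t q) x * exp (- (LINT s:{0..t}|lborel. \<Phi> (v s q)))))"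

definition CBI ::
    "'w measure \<Rightarrow> (real \<Rightarrow> real) \<Rightarrow> (real \<Rightarrow> real) \<Rightarrow> real \<Rightarrow> (real \<Rightarrow> 'w \<Rightarrow> ennreal) \<Rightarrow> bool" where
  "CBI M \<Psi> \<Phi> x Y \<longleftrightarrow>
     0 \<le> x \<and>
     (\<exists>P. CBI_transition \<Psi> \<Phi> P \<and> markov_process M P Y) \<and>
     (\<forall>\<omega>\<in>space M. cadlag (\<lambda>t. Y t \<omega>)) \<and>
     (AE \<omega> in M. Y 0 \<omega> = ennreal x)"

text \<open>A possibly killed subordinator: as long as it is alive, its increments after time \<open>s\<close> are
  independent of the past and distributed as the process itself. The choice \<open>B = {\<infinity>}\<close> shows
  that the lifetime is exponential or infinite.\<close>

definition subordinator :: "'w measure \<Rightarrow> (real \<Rightarrow> 'w \<Rightarrow> ennreal) \<Rightarrow> bool" where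
  "subordinator M \<xi> \<longleftrightarrow>
     (\<forall>t\<ge>0. \<xi> t \<in> borel_measurable M) \<and>
     (\<forall>\<omega>\<in>space M. mono_on {0..} (\<lambda>t. \<xi> t \<omega>) \<and> cadlag (\<lambda>t. \<xi> t \<omega>)) \<and>
     (AE \<omega> in M. \<xi> 0 \<omega> = 0) \<and>
     (\<forall>s\<ge>0. \<forall>t\<ge>0. \<forall>A\<in>past M \<xi> s. \<forall>B\<in>sets borel.
        emeasure M {\<omega>\<in>A. \<xi> s \<omega> < \<infinity> \<and> \<xi> (s + t) \<omega> - \<xi> s \<omega> \<in> B} =
        emeasure M {\<omega>\<in>A. \<xi> s \<omega> < \<infinity>} * emeasure M {\<omega>\<in>space M. \<xi> t \<omega> \<in> B})"


section \<open>Random closed sets\<close>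

text \<open>The closed subsets of the line with the Borel sets of the Fell topology.\<close>

definition closed_sets :: "real set measure" where
  "closed_sets = sigma {F. closed F} {{F. closed F \<and> F \<inter> K \<noteq> {}} | K. compact K}"

text \<open>Events are taken in the completion: for a cadlag process, the event that its zero set
  meets a given interval is analytic, and it need not be measurable before completion.\<close>

definition random_closed_set :: "'w measure \<Rightarrow> ('w \<Rightarrow> real set) \<Rightarrow> bool" where
  "random_closed_set M R \<longleftrightarrow> R \<in> completion M \<rightarrow>\<^sub>M closed_sets"

definition same_law ::
    "'w measure \<Rightarrow> ('w \<Rightarrow> real set) \<Rightarrow> 'v measure \<Rightarrow> ('v \<Rightarrow> real set) \<Rightarrow> bool" where
  "same_law M R N S \<longleftrightarrow>
     random_closed_set M R \<and> random_closed_set N S \<and>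
     distr (completion M) closed_sets R = distr (completion N) closed_sets S"

definition regenerative_set :: "'w measure \<Rightarrow> ('w \<Rightarrow> real set) \<Rightarrow> bool" where
  "regenerative_set M R \<longleftrightarrow>
     random_closed_set M R \<and>
     (\<exists>\<xi>. subordinator M \<xi> \<and>
        (AE \<omega> in M. R \<omega> = closure {enn2real (\<xi> t \<omega>) | t. 0 \<le> t \<and> \<xi> t \<omega> < \<infinity>}))"

text \<open>The sets \<open>S 0, \<dots>, S (n - 1)\<close> may live on any probability space. It is no restriction to
  take the space of sequences of paths, which carries the joint law of \<open>n\<close> subordinators.\<close>

definition infinitely_divisible_set :: "'w measure \<Rightarrow> ('w \<Rightarrow> real set) \<Rightarrow> bool" where
  "infinitely_divisible_set M R \<longleftrightarrow>
     regenerative_set M R \<and>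
     (\<forall>n\<ge>1::nat. \<exists>(N :: (nat \<Rightarrow> real \<Rightarrow> ennreal) measure) S.
        prob_space N \<and>
        (\<forall>i<n. regenerative_set N (S i)) \<and>
        (\<forall>i<n. \<forall>j<n. same_law N (S i) N (S j)) \<and>
        prob_space.indep_vars (completion N) (\<lambda>_. closed_sets) S {..<n} \<and>
        same_law M R N (\<lambda>\<omega>. \<Inter>i<n. S i \<omega>))"

definition zero_set :: "(real \<Rightarrow> 'w \<Rightarrow> ennreal) \<Rightarrow> 'w \<Rightarrow> real set" where
  "zero_set Y \<omega> = closure {t. 0 \<le> t \<and> Y t \<omega> = 0}"

end

theory Submission
  imports Defs
begin

text \<open>Let \<open>V h\<close> be the limit of \<open>v h q\<close> as \<open>q\<close> tends to infinity, which is finite by Grey's condition. Then \<open>u h = exp (- Q h)\<close>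
  with \<open>Q' = \<Phi> \<circ> V\<close> plays the role of the density of the event \<open>Y h = 0\<close>: the functions
  \<open>k h x = u h * exp (- V h * x)\<close> satisfy \<open>E (k h (Y (s + t))) = E (k (t + h) (Y s))\<close>. If \<open>u\<close> is integrable at zero,
  these identities give a local time of \<open>Y\<close> at zero, whose right-continuous inverse is a subordinator with closed range
  the zero set and Laplace exponent \<open>1 / \<integral> exp (- q r) u r dr\<close>; otherwise \<open>Y\<close> does not return to zero. In
  either case \<open>u\<close> determines the law of the zero set.

  On the other hand, cover the half-line by the intervals \<open>(r, r + l)\<close>, where \<open>(r, l)\<close> runs through a Poisson point process
  under which the expected number of intervals longer than \<open>h\<close> per unit of time is \<open>\<Phi> (V h) / n\<close>. The residual length of the covering
  is a Markov process with kernel \<open>k h x = exp (- Q h / n) 1(x \<le> h)\<close> that vanishes on the uncovered set, so the same argument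
  identifies the law of the uncovered set. The intersection of \<open>n\<close> independent copies is
  the uncovered set of the union of the \<open>n\<close> point processes, and its density is \<open>exp (- Q h / n) ^ n = u h\<close>.\<close>

section \<open>Laplace transforms of measures on \<open>[0, \<infinity>]\<close>\<close>

text \<open>Neither process is given with a strong Markov property: a CBI process is known through
  its transitions between fixed times, the residual length through void probabilities. What both
  share is that k (T - s) (W s) is a martingale in s, and \<open>regenerative_kernel\<close> records
  just this. Strong Markov arguments become optional stopping for the discounted local time, proved
  by dyadic approximation of random times from above. The exponent arises as follows. At an inverse
  local time W is 0, so the expected discounted local time still to come is the present discount
  times the constant \<integral> exp (- q r) u r dr. Hence the Laplace transform of the inverse
  local time, as a function of the level, is its own tail integral divided by this constant, and so
  an exponential. The hard point is to match zeros and points of increase: W must vanish whenever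
  the local time resumes growth, and every time at which W is 0 or approaches 0 from the left must
  lie in the closed range. Approach from the left matters because an uncovered time can be the left
  end of a covering interval, where the residual length is positive.\<close>

lemma laplace_exp_nonneg [simp]: "0 \<le> laplace_exp q y"
  by (simp add: laplace_exp_def)

lemma laplace_exp_le_1: "0 \<le> q \<Longrightarrow> laplace_exp q y \<le> 1"
  by (simp add: laplace_exp_def)

lemma laplace_exp_0 [simp]: "laplace_exp q 0 = 1"
  by (simp add: laplace_exp_def)

lemma laplace_exp_top [simp]: "laplace_exp q \<top> = 0"
  by (simp add: laplace_exp_def)

lemma laplace_exp_ennreal: "0 \<le> x \<Longrightarrow> laplace_exp q (ennreal x) = exp (- q * x)"
  by (simp add: laplace_exp_def)

lemma laplace_exp_measurable [measurable]:
  "case_prod laplace_exp \<in> borel_measurable (borel \<Otimes>\<^sub>M borel)"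
  unfolding laplace_exp_def[abs_def] by measurable

lemma laplace_exp_measurable1 [measurable]: "laplace_exp q \<in> borel_measurable borel"
  unfolding laplace_exp_def[abs_def] by measurable

lemma laplace_exp_antimono:
  assumes "0 \<le> q" "x \<le> y" shows "laplace_exp q y \<le> laplace_exp q x"
proof (cases "y = \<infinity>")
  case False
  then have "y < \<top>" by (simp add: top.not_eq_extremum)
  with assms have "x < \<top>" "enn2real x \<le> enn2real y"
    by (auto intro: enn2real_mono)
  with False assms show ?thesis
    by (auto simp: laplace_exp_def intro: mult_left_mono)
qed simp

lemma laplace_exp_add: "laplace_exp q (x + y) = laplace_exp q x * laplace_exp q y"
proof (cases "x = \<top> \<or> y = \<top>")
  case False
  then show ?thesis
    by (simp add: laplace_exp_def enn2real_plus top.not_eq_extremum exp_add[symmetric] algebra_simps)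
qed (auto simp: laplace_exp_def)

lemma laplace_exp_power: "0 < n \<Longrightarrow> laplace_exp (real n) y = laplace_exp 1 y ^ n"
  by (simp add: laplace_exp_def exp_of_nat_mult[symmetric] power_0_left)

lemma isCont_laplace_exp:
  assumes "0 < q" shows "isCont (laplace_exp q) x"
proof (cases "x = \<top>")
  case True
  have "(laplace_exp q \<longlongrightarrow> 0) (at x)"
  proof (rule order_tendstoI)
    fix a :: real assume "0 < a"
    define r where "r = max 0 (- ln a / q)"
    have r: "0 \<le> r" by (simp add: r_def)
    have "eventually (\<lambda>y. ennreal r < y) (at x)"
      using True by (intro order_tendstoD(1)[OF tendsto_ident_at]) simp
    then show "eventually (\<lambda>y. laplace_exp q y < a) (at x)"
    proof eventually_elim
      case (elim y)
      show ?case
      proof (cases "y = \<top>")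
        case False
        then obtain z where z: "y = ennreal z" "0 \<le> z" by (cases y) auto
        with elim r have "r < enn2real y" by (simp add: ennreal_less_iff)
        then have "- ln a / q < enn2real y" by (simp add: r_def)
        then have "- q * enn2real y < ln a" using \<open>0 < q\<close> by (simp add: field_simps)
        then have "exp (- q * enn2real y) < exp (ln a)" by (rule exp_less_mono)
        with False \<open>0 < a\<close> show ?thesis by (simp add: laplace_exp_def)
      qed (use \<open>0 < a\<close> in simp)
    qed
  next
    fix a :: real assume "a < 0"
    then show "eventually (\<lambda>y. a < laplace_exp q y) (at x)"
      by (intro always_eventually allI) (meson laplace_exp_nonneg less_le_trans)
  qed
  with True show ?thesis by (simp add: isCont_def)
next
  case False
  then have lt: "x < \<top>" by (simp add: top.not_eq_extremum)
  have "((\<lambda>y. exp (- q * enn2real y)) \<longlongrightarrow> exp (- q * enn2real x)) (at x)"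
    using lt by (intro tendsto_intros) (auto simp: tendsto_enn2real)
  moreover have "eventually (\<lambda>y. y < \<top>) (at x)"
    using lt by (intro order_tendstoD(2)[OF tendsto_ident_at])
  ultimately have "(laplace_exp q \<longlongrightarrow> exp (- q * enn2real x)) (at x)"
    by (rule tendsto_cong[THEN iffD2, rotated, OF _ eventually_mono]) (auto simp: laplace_exp_def)
  with False show ?thesis by (simp add: isCont_def laplace_exp_def)
qed

text \<open>All moments are at most 1, so the Taylor polynomials of the characteristic function,
  whose coefficients are the moments, approximate it up to
  \<open>2 * \<bar>t\<bar> ^ n / fact n\<close>. Equal moments thus give equal characteristic
  functions.\<close>

lemma real_distribution_unit_interval_moments:
  assumes "real_distribution \<mu>" "real_distribution \<nu>"
    and u: "AE x in \<mu>. 0 \<le> x \<and> x \<le> 1" "AE x in \<nu>. 0 \<le> x \<and> x \<le> 1"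
    and m: "\<And>k. (\<integral>x. x ^ k \<partial>\<mu>) = (\<integral>x. x ^ k \<partial>\<nu>)"
  shows "\<mu> = \<nu>"
proof -
  interpret \<mu>: real_distribution \<mu> by fact
  interpret \<nu>: real_distribution \<nu> by fact
  have [measurable]: "sets \<mu> = sets borel" "sets \<nu> = sets borel" by simp_all
  have i: "integrable \<mu> (\<lambda>x. x ^ k)" for k
    using u by (intro \<mu>.integrable_const_bound[where B=1]) (auto simp: power_le_one)
  have j: "integrable \<nu> (\<lambda>x. x ^ k)" for k
    using u by (intro \<nu>.integrable_const_bound[where B=1]) (auto simp: power_le_one)
  have "\<mu>.expectation (\<lambda>x. \<bar>x\<bar> ^ n) \<le> 1" for n
    using u by (intro \<mu>.integral_le_const) (auto simp: power_le_one intro!: integrable_abs simp flip: power_abs intro: i)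
  then have b1: "cmod (char \<mu> t - (\<Sum>k\<le>n. (\<i> * t) ^ k / fact k * \<mu>.expectation (\<lambda>x. x ^ k))) \<le> 2 * \<bar>t\<bar> ^ n / fact n" for t n
    by (intro order_trans[OF \<mu>.char_approx1[OF i]] mult_left_le) auto
  have "\<nu>.expectation (\<lambda>x. \<bar>x\<bar> ^ n) \<le> 1" for n
    using u by (intro \<nu>.integral_le_const) (auto simp: power_le_one intro!: integrable_abs simp flip: power_abs intro: j)
  then have b2: "cmod (char \<nu> t - (\<Sum>k\<le>n. (\<i> * t) ^ k / fact k * \<mu>.expectation (\<lambda>x. x ^ k))) \<le> 2 * \<bar>t\<bar> ^ n / fact n" for t n
    unfolding m by (intro order_trans[OF \<nu>.char_approx1[OF j]] mult_left_le) auto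
  have "char \<mu> t = char \<nu> t" for t
  proof -
    have z: "(\<lambda>n. 2 * \<bar>t\<bar> ^ n / fact n) \<longlonglongrightarrow> 0"
      using tendsto_mult[OF tendsto_const[of 2] summable_LIMSEQ_zero[OF summable_exp[of "\<bar>t\<bar>"]]]
      by (simp add: field_simps)
    define s where "s n = (\<Sum>k\<le>n. (\<i> * t) ^ k / fact k * \<mu>.expectation (\<lambda>x. x ^ k))" for n
    have "(\<lambda>n. char \<mu> t - s n) \<longlonglongrightarrow> 0" "(\<lambda>n. char \<nu> t - s n) \<longlonglongrightarrow> 0"
      unfolding s_def using b1 b2 by (auto intro!: Lim_null_comparison[OF _ z] always_eventually)
    from tendsto_diff[OF this] have "(\<lambda>n. char \<mu> t - char \<nu> t) \<longlonglongrightarrow> 0" by simp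
    then show ?thesis by (simp add: LIMSEQ_const_iff)
  qed
  then show ?thesis by (intro Levy_uniqueness assms ext)
qed

text \<open>The map \<open>G\<close>, y to exp (- y), embeds [0, \<infinity>] into [0, 1] and sends
  \<infinity> to 0. The Laplace transform at \<open>n\<close> is the \<open>n\<close>-th moment of
  the image measure, and \<open>J\<close> inverts \<open>G\<close>.\<close>

lemma laplace_uniqueness_prob:
  assumes "prob_space \<mu>" "prob_space \<nu>"
    and [measurable_cong]: "sets \<mu> = sets borel" "sets \<nu> = sets borel"
    and L: "\<And>n. 0 < n \<Longrightarrow>
      (\<integral>\<^sup>+y. ennreal (laplace_exp (real n) y) \<partial>\<mu>) = (\<integral>\<^sup>+y. ennreal (laplace_exp (real n) y) \<partial>\<nu>)"
  shows "\<mu> = (\<nu> :: ennreal measure)"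
proof -
  interpret \<mu>: prob_space \<mu> by fact
  interpret \<nu>: prob_space \<nu> by fact
  define G where "G = laplace_exp 1"
  define J where "J x = (if x \<le> 0 then \<infinity> else ennreal (- ln x))" for x :: real
  have [measurable]: "G \<in> borel_measurable borel" by (simp add: G_def)
  have [measurable]: "J \<in> borel_measurable borel" unfolding J_def[abs_def] by measurable
  have JG: "J (G y) = y" for y
    by (cases "y = \<top>") (simp_all add: J_def G_def laplace_exp_def top.not_eq_extremum)
  have G01: "0 \<le> G y" "G y \<le> 1" for y by (auto simp: G_def laplace_exp_le_1)
  have "distr \<mu> borel G = distr \<nu> borel G"
  proof (rule real_distribution_unit_interval_moments)
    show "real_distribution (distr \<mu> borel G)" by simp
    show "real_distribution (distr \<nu> borel G)" by simp
    show "AE x in distr \<mu> borel G. 0 \<le> x \<and> x \<le> 1" "AE x in distr \<nu> borel G. 0 \<le> x \<and> x \<le> 1"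
      by (simp_all add: AE_distr_iff G01)
    show "(\<integral>x. x ^ k \<partial>distr \<mu> borel G) = (\<integral>x. x ^ k \<partial>distr \<nu> borel G)" for k
    \<comment> \<open>The zeroth moment is the total mass; it is not the integral of
      \<open>laplace_exp 0\<close>, which vanishes at \<infinity>.\<close>
    proof (cases "k = 0")
      case True
      interpret \<mu>': prob_space "distr \<mu> borel G" by (rule \<mu>.prob_space_distr) simp
      interpret \<nu>': prob_space "distr \<nu> borel G" by (rule \<nu>.prob_space_distr) simp
      show ?thesis using True \<mu>'.prob_space \<nu>'.prob_space by simp
    next
      case False
      then have "(\<integral>\<^sup>+y. ennreal (G y ^ k) \<partial>\<mu>) = (\<integral>\<^sup>+y. ennreal (G y ^ k) \<partial>\<nu>)"
        using L[of k] unfolding G_def by (simp add: laplace_exp_power[symmetric])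
      then show ?thesis
        by (subst (1 2) integral_distr) (simp_all add: G01 integral_eq_nn_integral)
    qed
  qed
  then have "distr (distr \<mu> borel G) borel J = distr (distr \<nu> borel G) borel J" by simp
  moreover have "distr (distr \<mu> borel G) borel J = \<mu>"
    by (subst distr_distr) (simp_all add: comp_def JG distr_id2 assms)
  moreover have "distr (distr \<nu> borel G) borel J = \<nu>"
    by (subst distr_distr) (simp_all add: comp_def JG distr_id2 assms)
  ultimately show ?thesis by simp
qed

text \<open>Reduction to probability measures by normalization. An atom at \<infinity> is invisible
  to every \<open>laplace_exp n\<close> with \<open>n > 0\<close>; it is fixed by the equality of
  the masses.\<close>

lemma laplace_uniqueness:
  assumes "finite_measure \<mu>" "finite_measure \<nu>"
    and [measurable_cong]: "sets \<mu> = sets borel" "sets \<nu> = sets borel"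
    and mass: "emeasure \<mu> UNIV = emeasure \<nu> UNIV"
    and L: "\<And>n. 0 < n \<Longrightarrow>
      (\<integral>\<^sup>+y. ennreal (laplace_exp (real n) y) \<partial>\<mu>) = (\<integral>\<^sup>+y. ennreal (laplace_exp (real n) y) \<partial>\<nu>)"
  shows "\<mu> = (\<nu> :: ennreal measure)"
proof (cases "emeasure \<mu> UNIV = 0")
  case True
  show ?thesis
  proof (rule measure_eqI)
    fix A assume "A \<in> sets \<mu>"
    have "emeasure \<mu> A \<le> emeasure \<mu> UNIV" "emeasure \<nu> A \<le> emeasure \<nu> UNIV"
      by (intro emeasure_mono; simp add: assms(3,4))+
    with True mass show "emeasure \<mu> A = emeasure \<nu> A" by simp
  qed (simp add: assms(3,4))
next
  case False
  interpret \<mu>: finite_measure \<mu> by fact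
  interpret \<nu>: finite_measure \<nu> by fact
  define c where "c = emeasure \<mu> UNIV"
  have c: "c \<noteq> 0" "c \<noteq> \<top>" using False by (auto simp: c_def)
  have cc: "c / c = 1" using c by (intro ennreal_divide_self) (simp_all add: less_top)
  have sp: "space \<mu> = UNIV" "space \<nu> = UNIV" using assms(3,4)[THEN sets_eq_imp_space_eq] by simp_all
  have "scale_measure (1 / c) \<mu> = scale_measure (1 / c) \<nu>"
  proof (rule laplace_uniqueness_prob)
    have "emeasure (scale_measure (1 / c) \<mu>) UNIV = 1" "emeasure (scale_measure (1 / c) \<nu>) UNIV = 1"
      using cc mass[symmetric] by (simp_all add: ennreal_divide_times c_def)
    then show "prob_space (scale_measure (1 / c) \<mu>)" "prob_space (scale_measure (1 / c) \<nu>)"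
      by (auto intro!: prob_spaceI simp: space_scale_measure sp)
  qed (simp_all add: assms(3,4) nn_integral_scale_measure L)
  then have "scale_measure c (scale_measure (1 / c) \<mu>) = scale_measure c (scale_measure (1 / c) \<nu>)" by simp
  moreover have "c * (1 / c) = 1" by (simp add: ennreal_times_divide cc)
  ultimately show ?thesis unfolding scale_scale_measure by (simp only: scale_measure_1)
qed

section \<open>Closed ranges of cadlag paths\<close>

definition dyadic_times :: "real set" where
  "dyadic_times = {real k / 2 ^ m | k m. True}"

text \<open>Floor plus one puts the approximation strictly to the right of \<open>t\<close>. For a
  random time \<open>T\<close>, the value (i + 1) / 2 ^ m is then taken exactly where i / 2 ^ m
  \<le> T < (i + 1) / 2 ^ m, an event expressible by strict inequalities \<open>T < a\<close>
  alone.\<close>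

definition right_dyadic :: "nat \<Rightarrow> real \<Rightarrow> real" where
  "right_dyadic m t = (of_int \<lfloor>2 ^ m * t\<rfloor> + 1) / 2 ^ m"

lemma countable_dyadic_times: "countable dyadic_times"
proof -
  have "dyadic_times = (\<lambda>(k, m). real k / 2 ^ m) ` UNIV" by (auto simp: dyadic_times_def)
  then show ?thesis by (metis countable_image uncountable_def countableI_type)
qed

lemma dyadic_nonneg: "q \<in> dyadic_times \<Longrightarrow> 0 \<le> q"
  by (auto simp: dyadic_times_def)

lemma dyadic_timesI [intro]: "real k / 2 ^ m \<in> dyadic_times"
  by (auto simp: dyadic_times_def)

lemma zero_dyadic [simp]: "0 \<in> dyadic_times"
  using dyadic_timesI[of 0 0] by simp

lemma dyadic_common_level:
  assumes "p \<in> dyadic_times" "q \<in> dyadic_times"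
  obtains i j m where "p = real i / 2 ^ m" "q = real j / 2 ^ m"
proof -
  from assms obtain i m j n where p: "p = real i / 2 ^ m" and q: "q = real j / 2 ^ n"
    by (auto simp: dyadic_times_def)
  have "p = real (i * 2 ^ n) / 2 ^ (m + n)" "q = real (j * 2 ^ m) / 2 ^ (m + n)"
    by (simp_all add: p q power_add field_simps)
  then show thesis using that by blast
qed

lemma dyadic_add: "p \<in> dyadic_times \<Longrightarrow> q \<in> dyadic_times \<Longrightarrow> p + q \<in> dyadic_times"
  by (erule (1) dyadic_common_level) (auto simp: dyadic_times_def simp flip: add_divide_distrib of_nat_add)

lemma right_dyadic_greater: "t < right_dyadic m t"
  by (simp add: right_dyadic_def field_simps) linarith

lemma right_dyadic_le: "right_dyadic m t \<le> t + 1 / 2 ^ m"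
  by (simp add: right_dyadic_def field_simps)

lemma right_dyadic_dyadic: "0 \<le> t \<Longrightarrow> right_dyadic m t \<in> dyadic_times"
proof -
  assume "0 \<le> t"
  then have "right_dyadic m t = real (nat \<lfloor>2 ^ m * t\<rfloor> + 1) / 2 ^ m"
    by (simp add: right_dyadic_def)
  then show ?thesis by (simp only: dyadic_timesI)
qed

lemma right_dyadic_Suc: "right_dyadic (Suc m) t \<le> right_dyadic m t"
proof -
  have "\<lfloor>2 * (2 ^ m * t)\<rfloor> < 2 * \<lfloor>2 ^ m * t\<rfloor> + 2" by linarith
  then have "of_int \<lfloor>2 * (2 ^ m * t)\<rfloor> + 1 \<le> (2 * (of_int \<lfloor>2 ^ m * t\<rfloor> + 1) :: real)" by simp
  then have "(of_int \<lfloor>2 * (2 ^ m * t)\<rfloor> + 1) / (2 * 2 ^ m) \<le> (2 * (of_int \<lfloor>2 ^ m * t\<rfloor> + 1)) / (2 * 2 ^ m :: real)"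
    by (intro divide_right_mono) auto
  also have "\<dots> = (of_int \<lfloor>2 ^ m * t\<rfloor> + 1) / 2 ^ m" by (simp only: mult_divide_mult_cancel_left_if) simp
  finally show ?thesis by (simp add: right_dyadic_def mult.assoc)
qed

lemma right_dyadic_decseq: "decseq (\<lambda>m. right_dyadic m t)"
  by (intro decseq_SucI right_dyadic_Suc)

lemma right_dyadic_at_right: "filterlim (\<lambda>m. right_dyadic m t) (at_right t) sequentially"
  unfolding filterlim_at
proof (intro conjI always_eventually allI)
  have "(\<lambda>m. (1 / 2) ^ m) \<longlonglongrightarrow> (0::real)" by (intro LIMSEQ_power_zero) simp
  then have "(\<lambda>m. t + 1 / 2 ^ m) \<longlonglongrightarrow> t" using tendsto_add[OF tendsto_const[of t]] by (fastforce simp: power_one_over)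
  then show "(\<lambda>m. right_dyadic m t) \<longlonglongrightarrow> t"
    by (rule real_tendsto_sandwich[rotated 3])
      (auto intro!: always_eventually less_imp_le[OF right_dyadic_greater] right_dyadic_le)
qed (use right_dyadic_greater in \<open>auto simp: less_imp_neq[symmetric]\<close>)

lemma dyadic_between:
  assumes "0 \<le> a" "a < b" obtains q where "q \<in> dyadic_times" "a < q" "q < b"
proof -
  have "eventually (\<lambda>m. right_dyadic m a < b) sequentially"
    using right_dyadic_at_right[of a] \<open>a < b\<close>
    by (auto simp: filterlim_at intro: order_tendstoD)
  then obtain m where "right_dyadic m a < b" by (auto dest: eventually_happens)
  then show thesis using that right_dyadic_dyadic right_dyadic_greater assms by blast
qed

lemma cadlag_dyadic_limit:
  assumes "cadlag f" "0 \<le> t" shows "(\<lambda>m. f (right_dyadic m t)) \<longlonglongrightarrow> f t"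
  using assms by (auto simp: cadlag_def intro: filterlim_compose[OF _ right_dyadic_at_right])

definition range_closure :: "(real \<Rightarrow> ennreal) \<Rightarrow> real set" where
  "range_closure f = closure {enn2real (f t) | t. 0 \<le> t \<and> f t < \<infinity>}"

text \<open>Disjoint closed and compact sets have positive distance, and by right continuity the
  distance to \<open>K\<close> can be tested at dyadic times. Avoidance thus becomes a countable
  condition on the path. Since \<open>infdist x {} = 0\<close>, the empty set is excluded inside the
  condition.\<close>

lemma range_closure_disjoint_iff:
  assumes f: "cadlag f" and K: "compact K"
  shows "range_closure f \<inter> K = {} \<longleftrightarrow>
    (\<exists>n::nat. \<forall>q\<in>dyadic_times. f q \<notin> {y. K \<noteq> {} \<and> y < \<infinity> \<and> infdist (enn2real y) K < 1 / Suc n})"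
    (is "?L \<longleftrightarrow> ?R")
proof (cases "K = {}")
  case False
  show ?thesis
  proof
    assume ?L
    then obtain d where d: "d > 0" "\<And>x y. x \<in> range_closure f \<Longrightarrow> y \<in> K \<Longrightarrow> d \<le> dist x y"
      using separate_closed_compact[of "range_closure f" K] K by (auto simp: range_closure_def)
    from \<open>d > 0\<close> obtain n where n: "1 / Suc n < d" using nat_approx_posE by metis
    have "1 / Suc n \<le> infdist (enn2real (f q)) K" if "q \<in> dyadic_times" "f q < \<infinity>" for q
    proof -
      have "enn2real (f q) \<in> range_closure f"
        unfolding range_closure_def using that dyadic_nonneg by (intro closure_subset[THEN subsetD]) auto
      then have "d \<le> infdist (enn2real (f q)) K"
        using d False by (simp add: infdist_notempty cINF_greatest)
      with n show ?thesis by simp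
    qed
    then show ?R by (force simp: not_less)
  next
    assume ?R
    then obtain n where n: "\<And>q. q \<in> dyadic_times \<Longrightarrow> f q < \<infinity> \<Longrightarrow> 1 / real (Suc n) \<le> infdist (enn2real (f q)) K"
      using False by (fastforce simp: not_less)
    have "1 / Suc n \<le> infdist (enn2real (f t)) K" if t: "0 \<le> t" "f t < \<infinity>" for t
    proof (rule tendsto_lowerbound)
      have l: "(\<lambda>m. f (right_dyadic m t)) \<longlonglongrightarrow> f t" using f t by (intro cadlag_dyadic_limit)
      then have l': "(\<lambda>m. f (right_dyadic m t)) \<longlonglongrightarrow> ennreal (enn2real (f t))" using t by simp
      show "(\<lambda>m. infdist (enn2real (f (right_dyadic m t))) K) \<longlonglongrightarrow> infdist (enn2real (f t)) K"
        using t by (intro tendsto_infdist tendsto_enn2real[OF l']) auto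
      show "eventually (\<lambda>m. 1 / Suc n \<le> infdist (enn2real (f (right_dyadic m t))) K) sequentially"
        using order_tendstoD(2)[OF l, of \<infinity>] t by (auto elim!: eventually_mono intro!: n[simplified] right_dyadic_dyadic)
    qed simp
    then have "{enn2real (f t) | t. 0 \<le> t \<and> f t < \<infinity>} \<subseteq> {x. 1 / Suc n \<le> infdist x K}" by auto
    then have "range_closure f \<subseteq> {x. 1 / Suc n \<le> infdist x K}"
      unfolding range_closure_def by (intro closure_minimal) (auto intro!: closed_Collect_le continuous_intros)
    then show ?L by (force simp: not_less)
  qed
qed simp

section \<open>The Fell sigma-algebra and avoidance events\<close>

lemma space_closed_sets: "space closed_sets = {F. closed F}"
  unfolding closed_sets_def by (rule space_measure_of) auto

lemma avoid_in_closed_sets: "compact K \<Longrightarrow> {F. closed F \<and> F \<inter> K = {}} \<in> sets closed_sets"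
proof -
  assume "compact K"
  then have "{F. closed F \<and> F \<inter> K \<noteq> {}} \<in> sets closed_sets"
    unfolding closed_sets_def by (subst sets_measure_of) auto
  then have "space closed_sets - {F. closed F \<and> F \<inter> K \<noteq> {}} \<in> sets closed_sets" by (rule sets.compl_sets)
  also have "space closed_sets - {F. closed F \<and> F \<inter> K \<noteq> {}} = {F. closed F \<and> F \<inter> K = {}}"
    by (auto simp: space_closed_sets)
  finally show ?thesis .
qed

text \<open>Avoidance events replace the hitting events of the definition because they are stable
  under intersection: avoiding \<open>K\<close> and \<open>L\<close> is avoiding
  \<open>K \<union> L\<close>.\<close>

lemma sets_closed_sets_avoid:
  "sets closed_sets = sigma_sets {F. closed F} {{F. closed F \<and> F \<inter> K = {}} | K. compact K}"
proof
  have "{F. closed F \<and> F \<inter> K \<noteq> {}} \<in> sigma_sets {F. closed F} {{F. closed F \<and> F \<inter> K = {}} | K. compact K}"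
    if "compact K" for K
  proof -
    have "{F. closed F} - {F. closed F \<and> F \<inter> K = {}} \<in> sigma_sets {F. closed F} {{F. closed F \<and> F \<inter> K = {}} | K. compact K}"
      using that by (intro sigma_sets.Compl sigma_sets.Basic) auto
    then show ?thesis by (rule back_subst) auto
  qed
  then show "sets closed_sets \<subseteq> sigma_sets {F. closed F} {{F. closed F \<and> F \<inter> K = {}} | K. compact K}"
    unfolding closed_sets_def by (subst sets_measure_of) (auto intro!: sigma_sets_mono)
  show "sigma_sets {F. closed F} {{F. closed F \<and> F \<inter> K = {}} | K. compact K} \<subseteq> sets closed_sets"
    using sets.sigma_sets_subset[of "{{F. closed F \<and> F \<inter> K = {}} | K. compact K}" closed_sets] avoid_in_closed_sets
    by (auto simp: space_closed_sets)
qed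

lemma measurable_closed_setsI:
  assumes "\<And>\<omega>. \<omega> \<in> space M \<Longrightarrow> closed (R \<omega> :: real set)"
    and "\<And>K. compact K \<Longrightarrow> {\<omega>\<in>space M. R \<omega> \<inter> K = {}} \<in> sets M"
  shows "R \<in> M \<rightarrow>\<^sub>M closed_sets"
proof (rule measurable_sigma_sets[where \<Omega>="{F. closed F}", OF sets_closed_sets_avoid])
  fix E :: "real set set" assume "E \<in> {{F. closed F \<and> F \<inter> K = {}} | K. compact K}"
  then obtain K where "compact K" "E = {F. closed F \<and> F \<inter> K = {}}" by auto
  moreover from this have "R -` E \<inter> space M = {\<omega>\<in>space M. R \<omega> \<inter> K = {}}" using assms(1) by auto
  ultimately show "R -` E \<inter> space M \<in> sets M" using assms(2) by simp
qed (use assms in auto)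

text \<open>The uniqueness half of Choquet's theorem: avoidance events form an intersection-stable
  generator, and avoiding the empty set is the whole space.\<close>

lemma closed_sets_distr_eqI:
  assumes "prob_space M" "prob_space N" and R: "R \<in> M \<rightarrow>\<^sub>M closed_sets" and S: "S \<in> N \<rightarrow>\<^sub>M closed_sets"
    and eq: "\<And>K. compact K \<Longrightarrow> emeasure M {\<omega>\<in>space M. R \<omega> \<inter> K = {}} = emeasure N {\<omega>\<in>space N. S \<omega> \<inter> K = {}}"
  shows "distr M closed_sets R = distr N closed_sets S"
proof (rule measure_eqI_generator_eq[where \<Omega>="{F. closed F}" and E="{{F. closed F \<and> F \<inter> K = {}} | K. compact K}" and A="\<lambda>_. {F. closed F \<and> F \<inter> {} = {}}"])
  interpret M: prob_space M by fact
  interpret N: prob_space N by fact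
  show "Int_stable {{F :: real set. closed F \<and> F \<inter> K = {}} | K. compact K}"
  proof (rule Int_stableI, clarify)
    fix K L :: "real set" assume "compact K" "compact L"
    then show "\<exists>KL. {F. closed F \<and> F \<inter> K = {}} \<inter> {F. closed F \<and> F \<inter> L = {}} = {F. closed F \<and> F \<inter> KL = {}} \<and> compact KL"
      by (intro exI[of _ "K \<union> L"]) auto
  qed
  show "emeasure (distr M closed_sets R) {F. closed F \<and> F \<inter> {} = {}} \<noteq> \<infinity>" for i :: nat
    using M.prob_space_distr[OF R, THEN prob_space.finite_measure, THEN finite_measure.emeasure_finite] by simp
next
  fix X :: "real set set" assume "X \<in> {{F. closed F \<and> F \<inter> K = {}} | K. compact K}"
  then obtain K where K: "compact K" "X = {F. closed F \<and> F \<inter> K = {}}" by auto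
  have "R -` X \<inter> space M = {\<omega>\<in>space M. R \<omega> \<inter> K = {}}" "S -` X \<inter> space N = {\<omega>\<in>space N. S \<omega> \<inter> K = {}}"
    using K measurable_space[OF R] measurable_space[OF S] by (auto simp: space_closed_sets)
  with K eq avoid_in_closed_sets show "emeasure (distr M closed_sets R) X = emeasure (distr N closed_sets S) X"
    by (simp add: emeasure_distr R S)
qed (auto simp: sets_closed_sets_avoid)

lemma range_closure_measurable:
  assumes "\<And>t. 0 \<le> t \<Longrightarrow> \<xi> t \<in> borel_measurable M" and c: "\<And>\<omega>. \<omega> \<in> space M \<Longrightarrow> cadlag (\<lambda>t. \<xi> t \<omega>)"
  shows "(\<lambda>\<omega>. range_closure (\<lambda>t. \<xi> t \<omega>)) \<in> M \<rightarrow>\<^sub>M closed_sets"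
proof (rule measurable_closed_setsI)
  fix K :: "real set" assume K: "compact K"
  have [measurable]: "q \<in> dyadic_times \<Longrightarrow> \<xi> q \<in> borel_measurable M" for q
    using assms(1) dyadic_nonneg by auto
  have [measurable]: "(\<lambda>x. infdist x K) \<in> borel_measurable borel"
    by (intro borel_measurable_continuous_onI continuous_intros)
  have "{\<omega>\<in>space M. range_closure (\<lambda>t. \<xi> t \<omega>) \<inter> K = {}} =
    {\<omega>\<in>space M. \<exists>n::nat. \<forall>q\<in>dyadic_times. \<not> (K \<noteq> {} \<and> \<xi> q \<omega> < \<infinity> \<and> infdist (enn2real (\<xi> q \<omega>)) K < 1 / Suc n)}"
    using range_closure_disjoint_iff[OF c K] by auto
  also have "\<dots> \<in> sets M"
    using countable_dyadic_times by measurable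
  finally show "{\<omega>\<in>space M. range_closure (\<lambda>t. \<xi> t \<omega>) \<inter> K = {}} \<in> sets M" .
qed (simp add: range_closure_def)

section \<open>Pasts as sigma-algebras\<close>

definition past_algebra :: "'w measure \<Rightarrow> (real \<Rightarrow> 'w \<Rightarrow> ennreal) \<Rightarrow> real \<Rightarrow> 'w measure" where
  "past_algebra M X s = sigma (space M) {X u -` B \<inter> space M | u B. 0 \<le> u \<and> u \<le> s \<and> B \<in> sets borel}"

lemma space_past_algebra [simp]: "space (past_algebra M X s) = space M"
  unfolding past_algebra_def by (rule space_measure_of) auto

lemma sets_past_algebra: "sets (past_algebra M X s) = past M X s"
  unfolding past_algebra_def past_def by (rule sets_measure_of) auto

lemma measurable_past_algebra: "0 \<le> u \<Longrightarrow> u \<le> s \<Longrightarrow> X u \<in> borel_measurable (past_algebra M X s)"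
  by (rule measurableI) (auto simp: sets_past_algebra past_def intro!: sigma_sets.Basic)

lemma past_subset_sets:
  assumes "\<And>t. 0 \<le> t \<Longrightarrow> X t \<in> borel_measurable M" shows "past M X s \<subseteq> sets M"
  unfolding past_def using assms by (intro sets.sigma_sets_subset) (auto intro!: measurable_sets)

lemma subalgebra_past_algebra:
  assumes "\<And>t. 0 \<le> t \<Longrightarrow> X t \<in> borel_measurable M" shows "subalgebra M (past_algebra M X s)"
  using past_subset_sets[OF assms] by (simp add: subalgebra_def sets_past_algebra)

lemma past_mono: "s \<le> t \<Longrightarrow> past M X s \<subseteq> past M X t"
  unfolding past_def by (intro sigma_sets_mono') force

text \<open>By \<open>eq\<close>, \<open>f\<close> and \<open>g\<close> have the same conditional
  expectation given \<open>F\<close>; approximation by simple functions extends the test from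
  indicators to nonnegative weights.\<close>

lemma nn_integral_eq_on_subalgebra:
  fixes f g :: "'a \<Rightarrow> ennreal"
  assumes sub: "subalgebra M F" and [measurable]: "f \<in> borel_measurable M" "g \<in> borel_measurable M"
    and eq: "\<And>A. A \<in> sets F \<Longrightarrow> (\<integral>\<^sup>+\<omega>\<in>A. f \<omega> \<partial>M) = (\<integral>\<^sup>+\<omega>\<in>A. g \<omega> \<partial>M)"
    and Z: "Z \<in> borel_measurable F"
  shows "(\<integral>\<^sup>+\<omega>. Z \<omega> * f \<omega> \<partial>M) = (\<integral>\<^sup>+\<omega>. Z \<omega> * g \<omega> \<partial>M)"
  using Z
proof (induction rule: borel_measurable_induct)
  case (cong h h')
  moreover have "space F = space M" using sub by (simp add: subalgebra_def)
  ultimately show ?case by (metis (mono_tags, lifting) nn_integral_cong)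
next
  case (set A)
  then show ?case using eq[of A] by (simp add: mult.commute)
next
  case (mult u c)
  then have [measurable]: "u \<in> borel_measurable M" using measurable_from_subalg[OF sub] by blast
  show ?case using mult by (simp add: mult.assoc nn_integral_cmult)
next
  case (add u v)
  then have [measurable]: "u \<in> borel_measurable M" "v \<in> borel_measurable M" using measurable_from_subalg[OF sub] by blast+
  show ?case using add by (simp add: distrib_right nn_integral_add)
next
  case (seq U)
  then have [measurable]: "U i \<in> borel_measurable M" for i using measurable_from_subalg[OF sub] by blast
  have "(\<integral>\<^sup>+\<omega>. (SUP i. U i) \<omega> * h \<omega> \<partial>M) = (SUP i. \<integral>\<^sup>+\<omega>. U i \<omega> * h \<omega> \<partial>M)"
    if [measurable]: "h \<in> borel_measurable M" for h
    using seq(3) by (subst nn_integral_monotone_convergence_SUP[symmetric])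
      (auto simp: SUP_mult_right_ennreal image_image incseq_def le_fun_def intro!: mult_right_mono)
  then show ?case using seq by simp
qed

section \<open>Regenerative sets with a given potential density\<close>

text \<open>Independence and stationarity of increments in multiplicative form:
  \<open>\<kappa> n t\<close> stands for the Laplace transform of \<open>\<xi> t\<close> at
  \<open>n\<close>. As no difference is formed, killing needs no separate treatment: once killed, a
  path contributes 0 to both sides.\<close>

definition laplace_increments ::
    "'w measure \<Rightarrow> (nat \<Rightarrow> real \<Rightarrow> real) \<Rightarrow> (real \<Rightarrow> 'w \<Rightarrow> ennreal) \<Rightarrow> bool" where
  "laplace_increments M \<kappa> \<xi> \<longleftrightarrow>
     (\<forall>t\<ge>0. \<xi> t \<in> borel_measurable M) \<and>
     (\<forall>\<omega>\<in>space M. mono_on {0..} (\<lambda>t. \<xi> t \<omega>) \<and> cadlag (\<lambda>t. \<xi> t \<omega>)) \<and>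
     (AE \<omega> in M. \<xi> 0 \<omega> = 0) \<and>
     (\<forall>s\<ge>0. \<forall>t\<ge>0. \<forall>A\<in>past M \<xi> s. \<forall>n>0.
        (\<integral>\<^sup>+\<omega>\<in>A. laplace_exp (real n) (\<xi> (s + t) \<omega>) \<partial>M) =
          ennreal (\<kappa> n t) * (\<integral>\<^sup>+\<omega>\<in>A. laplace_exp (real n) (\<xi> s \<omega>) \<partial>M))"

context
  fixes M :: "'w measure" and \<kappa> :: "nat \<Rightarrow> real \<Rightarrow> real" and \<xi> :: "real \<Rightarrow> 'w \<Rightarrow> ennreal"
  assumes \<xi>: "laplace_increments M \<kappa> \<xi>"
begin

lemma laplace_increments_measurable: "0 \<le> t \<Longrightarrow> \<xi> t \<in> borel_measurable M"
  using \<xi> by (simp add: laplace_increments_def)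

lemma laplace_increments_weighted:
  assumes st: "0 \<le> s" "0 \<le> t" and n: "0 < n" and Z: "Z \<in> borel_measurable (past_algebra M \<xi> s)"
  shows "(\<integral>\<^sup>+\<omega>. Z \<omega> * ennreal (laplace_exp (real n) (\<xi> (s + t) \<omega>)) \<partial>M) =
    ennreal (\<kappa> n t) * (\<integral>\<^sup>+\<omega>. Z \<omega> * ennreal (laplace_exp (real n) (\<xi> s \<omega>)) \<partial>M)"
proof -
  have m [measurable]: "\<xi> s \<in> borel_measurable M" "\<xi> (s + t) \<in> borel_measurable M"
    using laplace_increments_measurable st by auto
  note sub = subalgebra_past_algebra[of \<xi> M s, OF laplace_increments_measurable]
  have [measurable]: "Z \<in> borel_measurable M" by (rule measurable_from_subalg[OF sub Z])
  have "(\<integral>\<^sup>+\<omega>. Z \<omega> * ennreal (laplace_exp (real n) (\<xi> (s + t) \<omega>)) \<partial>M) =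
    (\<integral>\<^sup>+\<omega>. Z \<omega> * (ennreal (\<kappa> n t) * ennreal (laplace_exp (real n) (\<xi> s \<omega>))) \<partial>M)"
  proof (rule nn_integral_eq_on_subalgebra[OF sub _ _ _ Z])
    fix A assume A: "A \<in> sets (past_algebra M \<xi> s)"
    then have [measurable]: "A \<in> sets M" using sub by (auto simp: subalgebra_def)
    show "(\<integral>\<^sup>+\<omega>\<in>A. laplace_exp (real n) (\<xi> (s + t) \<omega>) \<partial>M) =
      (\<integral>\<^sup>+\<omega>\<in>A. ennreal (\<kappa> n t) * ennreal (laplace_exp (real n) (\<xi> s \<omega>)) \<partial>M)"
      using \<xi> A st n by (simp add: laplace_increments_def sets_past_algebra mult.assoc nn_integral_cmult)
  qed measurable
  also have "\<dots> = ennreal (\<kappa> n t) * (\<integral>\<^sup>+\<omega>. Z \<omega> * ennreal (laplace_exp (real n) (\<xi> s \<omega>)) \<partial>M)"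
    by (subst nn_integral_cmult[symmetric]) (auto simp: ac_simps)
  finally show ?thesis .
qed

text \<open>For fixed \<open>A\<close>, the law of the increment on \<open>A\<close> before killing
  is compared with \<open>p\<close> times the law of \<open>\<xi> t\<close>. Both have mass
  \<open>p\<close>, and their Laplace transforms agree at all positive integers.\<close>

lemma laplace_increments_subordinator:
  assumes "prob_space M" shows "subordinator M \<xi>"
  unfolding subordinator_def
proof (intro conjI allI impI ballI)
  interpret prob_space M by fact
  fix s t :: real and A B assume st: "0 \<le> s" "0 \<le> t" and A: "A \<in> past M \<xi> s" and B: "B \<in> sets (borel :: ennreal measure)"
  have [measurable]: "\<xi> s \<in> borel_measurable M" "\<xi> t \<in> borel_measurable M" "\<xi> (s + t) \<in> borel_measurable M" "\<xi> 0 \<in> borel_measurable M"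
    using laplace_increments_measurable st by auto
  have [measurable]: "A \<in> sets M" by (rule subsetD[OF past_subset_sets A]) (rule laplace_increments_measurable)
  define h :: "'w \<Rightarrow> ennreal" where "h \<omega> = indicator (A \<inter> {\<omega>\<in>space M. \<xi> s \<omega> < \<infinity>}) \<omega>" for \<omega>
  have [measurable]: "h \<in> borel_measurable M" unfolding h_def[abs_def] by measurable
  define \<mu> where "\<mu> = distr (density M h) borel (\<lambda>\<omega>. \<xi> (s + t) \<omega> - \<xi> s \<omega>)"
  define p where "p = emeasure M {\<omega>\<in>A. \<xi> s \<omega> < \<infinity>}"
  define \<nu> where "\<nu> = scale_measure p (distr M borel (\<xi> t))"
  have AM: "A \<inter> space M = A" using sets.sets_into_space[of A M] by auto
  have eqA: "{\<omega>\<in>A. \<xi> s \<omega> < \<infinity> \<and> \<xi> (s + t) \<omega> - \<xi> s \<omega> \<in> B} =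
      A \<inter> {\<omega>\<in>space M. \<xi> s \<omega> < \<infinity>} \<inter> ((\<lambda>\<omega>. \<xi> (s + t) \<omega> - \<xi> s \<omega>) -` B \<inter> space M)" for B
    using AM by blast
  have \<mu>B: "emeasure \<mu> B = emeasure M {\<omega>\<in>A. \<xi> s \<omega> < \<infinity> \<and> \<xi> (s + t) \<omega> - \<xi> s \<omega> \<in> B}" if [measurable]: "B \<in> sets borel" for B
    unfolding eqA \<mu>_def h_def
    by (subst emeasure_distr; (subst emeasure_density)?) (auto simp flip: nn_integral_indicator simp: indicator_inter_arith intro!: nn_integral_cong)
  have pe: "p = emeasure \<mu> UNIV" unfolding p_def by (subst \<mu>B) auto
  have pt: "p \<noteq> \<top>" unfolding p_def by simp
  have "\<mu> = \<nu>"
  proof (rule laplace_uniqueness)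
    show "finite_measure \<mu>" using pt pe by (intro finite_measureI) (simp add: \<mu>_def)
    have "emeasure (distr M borel (\<xi> t)) UNIV = 1" using prob_space_distr[of "\<xi> t" borel, THEN prob_space.emeasure_space_1] by simp
    then show mass: "emeasure \<mu> UNIV = emeasure \<nu> UNIV" by (simp add: \<nu>_def pe)
    have "space \<nu> = UNIV" by (simp add: \<nu>_def space_scale_measure)
    then show "finite_measure \<nu>"
      by (intro finite_measureI) (simp only: mass[symmetric] pe[symmetric] pt infinity_ennreal_def not_False_eq_True)
    fix n :: nat assume n: "0 < n"
    \<comment> \<open>The weight cancels the discount accumulated up to time \<open>s\<close> and so
      turns the transform of \<open>\<xi> (s + t)\<close> into that of the increment. It is
      unbounded, but nonnegativity is enough.\<close>
    define Z where "Z \<omega> = h \<omega> * ennreal (exp (n * enn2real (\<xi> s \<omega>)))" for \<omega>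
    have [measurable]: "A \<in> sets (past_algebra M \<xi> s)" using A by (simp add: sets_past_algebra)
    have [measurable]: "\<xi> s \<in> borel_measurable (past_algebra M \<xi> s)" "\<xi> 0 \<in> borel_measurable (past_algebra M \<xi> 0)"
      using st by (auto intro: measurable_past_algebra)
    have [measurable]: "{\<omega>\<in>space M. \<xi> s \<omega> < \<infinity>} \<in> sets (past_algebra M \<xi> s)"
      by (subst space_past_algebra[of M \<xi> s, symmetric]) measurable
    have Z: "Z \<in> borel_measurable (past_algebra M \<xi> s)"
      unfolding Z_def[abs_def] h_def[abs_def] by measurable
    have *: "h \<omega> * ennreal (laplace_exp n (\<xi> (s + t) \<omega> - \<xi> s \<omega>)) = Z \<omega> * ennreal (laplace_exp n (\<xi> (s + t) \<omega>))"
      if "\<omega> \<in> space M" for \<omega>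
    proof (cases "\<xi> s \<omega> < \<infinity>")
      case True
      have "\<xi> s \<omega> \<le> \<xi> (s + t) \<omega>"
        using \<xi> that st by (auto simp: laplace_increments_def mono_on_def)
      then have "\<xi> (s + t) \<omega> = \<xi> s \<omega> + (\<xi> (s + t) \<omega> - \<xi> s \<omega>)"
        by (metis add.commute diff_add_cancel_ennreal)
      then have "laplace_exp n (\<xi> (s + t) \<omega>) = exp (- n * enn2real (\<xi> s \<omega>)) * laplace_exp n (\<xi> (s + t) \<omega> - \<xi> s \<omega>)"
        using True laplace_exp_add[of n "\<xi> s \<omega>" "\<xi> (s + t) \<omega> - \<xi> s \<omega>"] by (simp add: laplace_exp_def[of n "\<xi> s \<omega>"])
      then have "exp (n * enn2real (\<xi> s \<omega>)) * laplace_exp n (\<xi> (s + t) \<omega>) = laplace_exp n (\<xi> (s + t) \<omega> - \<xi> s \<omega>)"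
        by (simp add: mult.assoc[symmetric] exp_add[symmetric])
      then show ?thesis by (simp add: Z_def mult.assoc ennreal_mult[symmetric])
    qed (simp add: Z_def h_def)
    have "(\<integral>\<^sup>+y. laplace_exp n y \<partial>\<mu>) = (\<integral>\<^sup>+\<omega>. h \<omega> * laplace_exp n (\<xi> (s + t) \<omega> - \<xi> s \<omega>) \<partial>M)"
      unfolding \<mu>_def by (subst nn_integral_distr; (subst nn_integral_density)?) auto
    also have "\<dots> = (\<integral>\<^sup>+\<omega>. Z \<omega> * laplace_exp n (\<xi> (s + t) \<omega>) \<partial>M)"
      by (intro nn_integral_cong *)
    also have "\<dots> = ennreal (\<kappa> n t) * (\<integral>\<^sup>+\<omega>. Z \<omega> * laplace_exp n (\<xi> s \<omega>) \<partial>M)"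
      by (rule laplace_increments_weighted[OF st n Z])
    also have "(\<integral>\<^sup>+\<omega>. Z \<omega> * laplace_exp n (\<xi> s \<omega>) \<partial>M) = (\<integral>\<^sup>+\<omega>. h \<omega> \<partial>M)"
      by (intro nn_integral_cong) (auto simp: Z_def h_def laplace_exp_def mult.assoc ennreal_mult[symmetric] exp_add[symmetric] split: split_indicator)
    also have "\<dots> = emeasure M (A \<inter> {\<omega>\<in>space M. \<xi> s \<omega> < \<infinity>})"
      unfolding h_def by (rule nn_integral_indicator) measurable
    also have "A \<inter> {\<omega>\<in>space M. \<xi> s \<omega> < \<infinity>} = {\<omega>\<in>A. \<xi> s \<omega> < \<infinity>}"
      using AM by blast
    finally have L: "(\<integral>\<^sup>+y. laplace_exp n y \<partial>\<mu>) = ennreal (\<kappa> n t) * p" unfolding p_def .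
    have "(\<integral>\<^sup>+y. laplace_exp n y \<partial>\<nu>) = p * (\<integral>\<^sup>+\<omega>. 1 * ennreal (laplace_exp n (\<xi> (0 + t) \<omega>)) \<partial>M)"
      unfolding \<nu>_def by (subst nn_integral_scale_measure) (auto simp: nn_integral_distr)
    also have "(\<integral>\<^sup>+\<omega>. 1 * ennreal (laplace_exp n (\<xi> (0 + t) \<omega>)) \<partial>M) = ennreal (\<kappa> n t) * (\<integral>\<^sup>+\<omega>. 1 * ennreal (laplace_exp n (\<xi> 0 \<omega>)) \<partial>M)"
      using st n by (intro laplace_increments_weighted) auto
    also have "(\<integral>\<^sup>+\<omega>. 1 * ennreal (laplace_exp n (\<xi> 0 \<omega>)) \<partial>M) = (\<integral>\<^sup>+\<omega>. 1 \<partial>M)"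
      using \<xi> by (intro nn_integral_cong_AE) (auto simp: laplace_increments_def)
    finally show "(\<integral>\<^sup>+y. laplace_exp n y \<partial>\<mu>) = (\<integral>\<^sup>+y. laplace_exp n y \<partial>\<nu>)"
      unfolding L by (simp add: emeasure_space_1 mult.commute)
  qed (simp_all add: \<mu>_def \<nu>_def)
  then show "emeasure M {\<omega>\<in>A. \<xi> s \<omega> < \<infinity> \<and> \<xi> (s + t) \<omega> - \<xi> s \<omega> \<in> B} =
      emeasure M {\<omega>\<in>A. \<xi> s \<omega> < \<infinity>} * emeasure M {\<omega>\<in>space M. \<xi> t \<omega> \<in> B}"
    using B \<mu>B[OF B] by (simp add: \<nu>_def p_def emeasure_distr vimage_def Int_def conj_commute)
qed (use \<xi> in \<open>auto simp: laplace_increments_def\<close>)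

end

text \<open>Induction on the number of times. Weight the law of \<open>\<xi> (t (Suc k))\<close> by
  the earlier factors. Its Laplace transform at \<open>n\<close> is a constant times the expectation
  of the same product with its last factor multiplied by \<open>laplace_exp n\<close>, which the
  induction hypothesis covers since all factors remain bounded by 1. The bound also keeps the
  weighted laws finite.\<close>

lemma laplace_increments_products_eq:
  fixes M :: "'w measure" and N :: "'v measure"
  assumes "prob_space M" "prob_space N"
    and \<xi>: "laplace_increments M \<kappa> \<xi>" and \<eta>: "laplace_increments N \<kappa> \<eta>"
    and t: "t 0 = 0" "incseq t"
    and g: "\<And>i. i \<le> k \<Longrightarrow> g i \<in> borel_measurable borel" "\<And>i y. i \<le> k \<Longrightarrow> g i y \<le> (1::ennreal)"
  shows "(\<integral>\<^sup>+\<omega>. (\<Prod>i\<le>k. g i (\<xi> (t i) \<omega>)) \<partial>M) = (\<integral>\<^sup>+\<omega>. (\<Prod>i\<le>k. g i (\<eta> (t i) \<omega>)) \<partial>N)"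
  using g
proof (induction k arbitrary: g)
  case 0
  interpret M: prob_space M by fact
  interpret N: prob_space N by fact
  have "(\<integral>\<^sup>+\<omega>. (\<Prod>i\<le>0. g i (\<xi> (t i) \<omega>)) \<partial>M) = (\<integral>\<^sup>+\<omega>. g 0 0 \<partial>M)"
    using \<xi> t by (intro nn_integral_cong_AE) (auto simp: laplace_increments_def)
  moreover have "(\<integral>\<^sup>+\<omega>. (\<Prod>i\<le>0. g i (\<eta> (t i) \<omega>)) \<partial>N) = (\<integral>\<^sup>+\<omega>. g 0 0 \<partial>N)"
    using \<eta> t by (intro nn_integral_cong_AE) (auto simp: laplace_increments_def)
  ultimately show ?case by (simp add: M.emeasure_space_1 N.emeasure_space_1)
next
  case (Suc k)
  interpret M: prob_space M by fact
  interpret N: prob_space N by fact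
  have t0: "0 \<le> t i" for i using t incseqD[of t 0 i] by simp
  have [measurable]: "\<xi> (t i) \<in> borel_measurable M" "\<eta> (t i) \<in> borel_measurable N" for i
    using laplace_increments_measurable[OF \<xi>] laplace_increments_measurable[OF \<eta>] t0 by auto
  note gm [measurable] = Suc.prems(1)
  define h where "h \<omega> = (\<Prod>i\<le>k. g i (\<xi> (t i) \<omega>))" for \<omega>
  define h' where "h' \<omega> = (\<Prod>i\<le>k. g i (\<eta> (t i) \<omega>))" for \<omega>
  have hm: "h \<in> borel_measurable (past_algebra M \<xi> (t k))" "h' \<in> borel_measurable (past_algebra N \<eta> (t k))"
    unfolding h_def[abs_def] h'_def[abs_def]
    using t0 t(2) by (auto intro!: borel_measurable_prod_ennreal measurable_compose[OF measurable_past_algebra gm] dest: incseqD)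
  note sub = subalgebra_past_algebra[of \<xi> M "t k", OF laplace_increments_measurable[OF \<xi>]]
    subalgebra_past_algebra[of \<eta> N "t k", OF laplace_increments_measurable[OF \<eta>]]
  have [measurable]: "h \<in> borel_measurable M" "h' \<in> borel_measurable N"
    using hm by (auto intro: measurable_from_subalg[OF sub(1)] measurable_from_subalg[OF sub(2)])
  have h1: "h \<omega> \<le> 1" "h' \<omega>' \<le> 1" for \<omega> \<omega>'
    unfolding h_def h'_def using Suc.prems(2) by (auto intro!: prod_le_1)
  have IH0: "(\<integral>\<^sup>+\<omega>. h \<omega> \<partial>M) = (\<integral>\<^sup>+\<omega>. h' \<omega> \<partial>N)"
    unfolding h_def h'_def using Suc.prems by (intro Suc.IH) auto
  define \<mu> where "\<mu> = distr (density M h) borel (\<xi> (t (Suc k)))"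
  define \<nu> where "\<nu> = distr (density N h') borel (\<eta> (t (Suc k)))"
  have int: "(\<integral>\<^sup>+y. f y \<partial>\<mu>) = (\<integral>\<^sup>+\<omega>. h \<omega> * f (\<xi> (t (Suc k)) \<omega>) \<partial>M)"
    "(\<integral>\<^sup>+y. f y \<partial>\<nu>) = (\<integral>\<^sup>+\<omega>. h' \<omega> * f (\<eta> (t (Suc k)) \<omega>) \<partial>N)"
    if [measurable]: "f \<in> borel_measurable borel" for f
    unfolding \<mu>_def \<nu>_def by (subst nn_integral_distr; (subst nn_integral_density)?; auto)+
  have mass: "emeasure \<mu> UNIV = (\<integral>\<^sup>+\<omega>. h \<omega> \<partial>M)" "emeasure \<nu> UNIV = (\<integral>\<^sup>+\<omega>. h' \<omega> \<partial>N)"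
    using int[of "\<lambda>_. 1"] by (simp_all add: \<mu>_def \<nu>_def)
  have "(\<integral>\<^sup>+\<omega>. h \<omega> \<partial>M) \<le> (\<integral>\<^sup>+\<omega>. 1 \<partial>M)" using h1 by (intro nn_integral_mono)
  then have fin: "(\<integral>\<^sup>+\<omega>. h \<omega> \<partial>M) \<noteq> \<infinity>" by (auto simp: M.emeasure_space_1 top_unique)
  have "\<mu> = \<nu>"
  proof (rule laplace_uniqueness)
    show "finite_measure \<mu>" "finite_measure \<nu>"
      using fin IH0 mass by (auto intro!: finite_measureI simp: \<mu>_def \<nu>_def)
    show "emeasure \<mu> UNIV = emeasure \<nu> UNIV" using mass IH0 by simp
    fix n :: nat assume n: "0 < n"
    define g' where "g' i y = (if i = k then g i y * laplace_exp n y else g i y)" for i y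
    have g'_prod: "(\<Prod>i\<le>k. g i (x i)) * ennreal (laplace_exp n (x k)) = (\<Prod>i\<le>k. g' i (x i))" for x :: "nat \<Rightarrow> ennreal"
    proof -
      have "(\<Prod>i\<le>k. g' i (x i)) = g' k (x k) * (\<Prod>i<k. g' i (x i))"
        by (simp add: lessThan_Suc_atMost[symmetric] mult.commute)
      also have "(\<Prod>i<k. g' i (x i)) = (\<Prod>i<k. g i (x i))" by (intro prod.cong) (auto simp: g'_def)
      finally show ?thesis by (simp add: lessThan_Suc_atMost[symmetric] g'_def ac_simps)
    qed
    have IH1: "(\<integral>\<^sup>+\<omega>. (\<Prod>i\<le>k. g' i (\<xi> (t i) \<omega>)) \<partial>M) = (\<integral>\<^sup>+\<omega>. (\<Prod>i\<le>k. g' i (\<eta> (t i) \<omega>)) \<partial>N)"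
    proof (rule Suc.IH)
      fix i assume i: "i \<le> k"
      then have "g i \<in> borel_measurable borel" using Suc.prems(1)[of i] by simp
      then show "g' i \<in> borel_measurable borel" unfolding g'_def[abs_def] by (cases "i = k") simp_all
      fix y
      have "g i y * ennreal (laplace_exp n y) \<le> 1 * 1"
        using Suc.prems(2)[of i y] i by (intro mult_mono) (auto simp: laplace_exp_le_1)
      then show "g' i y \<le> 1" using Suc.prems(2)[of i y] i by (auto simp: g'_def)
    qed
    have d: "t k + (t (Suc k) - t k) = t (Suc k)" "0 \<le> t (Suc k) - t k" using t(2) by (auto simp: incseq_SucD)
    have "(\<integral>\<^sup>+y. laplace_exp n y \<partial>\<mu>) = ennreal (\<kappa> n (t (Suc k) - t k)) * (\<integral>\<^sup>+\<omega>. h \<omega> * laplace_exp n (\<xi> (t k) \<omega>) \<partial>M)"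
      using laplace_increments_weighted[OF \<xi> t0 d(2) n hm(1)] by (simp add: int)
    moreover have "(\<integral>\<^sup>+y. laplace_exp n y \<partial>\<nu>) = ennreal (\<kappa> n (t (Suc k) - t k)) * (\<integral>\<^sup>+\<omega>. h' \<omega> * laplace_exp n (\<eta> (t k) \<omega>) \<partial>N)"
      using laplace_increments_weighted[OF \<eta> t0 d(2) n hm(2)] by (simp add: int)
    ultimately show "(\<integral>\<^sup>+y. laplace_exp n y \<partial>\<mu>) = (\<integral>\<^sup>+y. laplace_exp n y \<partial>\<nu>)"
      using IH1 unfolding h_def h'_def
      by (simp add: g'_prod[of "\<lambda>i. \<xi> (t i) \<omega>" for \<omega>] g'_prod[of "\<lambda>i. \<eta> (t i) \<omega>" for \<omega>])
  qed (simp_all add: \<mu>_def \<nu>_def)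
  then show ?case
    using int[OF gm[of "Suc k"]] by (simp add: h_def h'_def)
qed

text \<open>The grid of level \<open>m\<close> has mesh 1 / 2 ^ m and reaches up to 2 ^ m, so the
  finite grids increase to all dyadic times and avoidance is decided by finite-dimensional
  distributions.\<close>

lemma
  assumes X: "prob_space X" "laplace_increments X \<kappa> \<zeta>" and [measurable]: "C \<in> sets borel"
  defines "E \<equiv> \<lambda>m::nat. {\<omega>\<in>space X. \<forall>i\<le>4 ^ m. \<zeta> (real i / 2 ^ m) \<omega> \<notin> C}"
  shows INF_avoid_dyadic_grid:
      "(INF m. emeasure X (E m)) = emeasure X {\<omega>\<in>space X. \<forall>q\<in>dyadic_times. \<zeta> q \<omega> \<notin> C}"
    and emeasure_avoid_dyadic_grid:
      "emeasure X (E m) = (\<integral>\<^sup>+\<omega>. (\<Prod>i\<le>4 ^ m. indicator (- C) (\<zeta> (real i / 2 ^ m) \<omega>)) \<partial>X)"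
proof -
  interpret prob_space X by fact
  have [measurable]: "\<zeta> (real i / 2 ^ m) \<in> borel_measurable X" for i m
    using laplace_increments_measurable[OF X(2)] by simp
  have [measurable]: "E m \<in> sets X" for m unfolding E_def by measurable
  have "decseq E"
  proof (rule decseq_SucI, unfold E_def, safe)
    fix \<omega> m i assume *: "\<forall>i\<le>4 ^ Suc m. \<zeta> (real i / 2 ^ Suc m) \<omega> \<notin> C" and i: "i \<le> 4 ^ m" "\<zeta> (real i / 2 ^ m) \<omega> \<in> C"
    have "2 * i \<le> 4 ^ Suc m" using i by simp
    moreover have "real (2 * i) / 2 ^ Suc m = real i / 2 ^ m" by simp
    ultimately show False using * i by metis
  qed
  then have "(INF m. emeasure X (E m)) = emeasure X (\<Inter>m. E m)"
    by (intro INF_emeasure_decseq) auto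
  also have "(\<Inter>m. E m) = {\<omega>\<in>space X. \<forall>q\<in>dyadic_times. \<zeta> q \<omega> \<notin> C}"
  proof safe
    fix \<omega> q assume *: "\<omega> \<in> (\<Inter>m. E m)" and "q \<in> dyadic_times" "\<zeta> q \<omega> \<in> C"
    then obtain k m where q: "q = real k / 2 ^ m" by (auto simp: dyadic_times_def)
    \<comment> \<open>A time k / 2 ^ m may lie beyond the grid of its own level; after k further
      refinements its index k * 2 ^ k is at most 4 ^ (m + k).\<close>
    have "q = real (k * 2 ^ k) / 2 ^ (m + k)" by (simp add: q power_add)
    moreover have "k * 2 ^ k \<le> 4 ^ (m + k)"
    proof -
      have "k * 2 ^ k \<le> 2 ^ k * 2 ^ k" using less_exp[of k] by (intro mult_right_mono) auto
      also have "\<dots> = 4 ^ k" by (simp add: power_mult_distrib[symmetric])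
      also have "\<dots> \<le> 4 ^ (m + k)" by (intro power_increasing) auto
      finally show ?thesis .
    qed
    ultimately show False using * \<open>\<zeta> q \<omega> \<in> C\<close> unfolding E_def by blast
  qed (auto simp: E_def)
  finally show "(INF m. emeasure X (E m)) = emeasure X {\<omega>\<in>space X. \<forall>q\<in>dyadic_times. \<zeta> q \<omega> \<notin> C}" .
  show "emeasure X (E m) = (\<integral>\<^sup>+\<omega>. (\<Prod>i\<le>4 ^ m. indicator (- C) (\<zeta> (real i / 2 ^ m) \<omega>)) \<partial>X)"
  proof (subst nn_integral_indicator[symmetric], simp, rule nn_integral_cong)
    fix \<omega> assume "\<omega> \<in> space X"
    then show "indicator (E m) \<omega> = (\<Prod>i\<le>4 ^ m. indicator (- C) (\<zeta> (real i / 2 ^ m) \<omega>) :: ennreal)"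
      by (auto simp: E_def prod.neutral indicator_def prod_zero_iff)
  qed
qed

lemma laplace_increments_avoid_eq:
  assumes M: "prob_space M" "prob_space N"
    and \<xi>: "laplace_increments M \<kappa> \<xi>" and \<eta>: "laplace_increments N \<kappa> \<eta>" and C [measurable]: "C \<in> sets borel"
  shows "emeasure M {\<omega>\<in>space M. \<forall>q\<in>dyadic_times. \<xi> q \<omega> \<notin> C} = emeasure N {\<omega>\<in>space N. \<forall>q\<in>dyadic_times. \<eta> q \<omega> \<notin> C}"
  unfolding INF_avoid_dyadic_grid[OF M(1) \<xi> C, symmetric] INF_avoid_dyadic_grid[OF M(2) \<eta> C, symmetric]
    emeasure_avoid_dyadic_grid[OF M(1) \<xi> C] emeasure_avoid_dyadic_grid[OF M(2) \<eta> C]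
  by (intro INF_cong refl laplace_increments_products_eq[OF M \<xi> \<eta>])
    (auto simp: incseq_def divide_right_mono indicator_def)

text \<open>The sets \<open>C n\<close> shrink as \<open>n\<close> grows, so
  \<open>range_closure_disjoint_iff\<close> presents the avoidance of \<open>K\<close> as an
  increasing union of events that involve dyadic times only.\<close>

lemma emeasure_range_closure_avoid:
  assumes X: "laplace_increments X \<kappa> \<zeta>" and K: "compact K"
  defines "C \<equiv> \<lambda>n::nat. {y::ennreal. K \<noteq> {} \<and> y < \<infinity> \<and> infdist (enn2real y) K < 1 / Suc n}"
  shows "emeasure X {\<omega>\<in>space X. range_closure (\<lambda>t. \<zeta> t \<omega>) \<inter> K = {}} =
      (SUP n. emeasure X {\<omega>\<in>space X. \<forall>q\<in>dyadic_times. \<zeta> q \<omega> \<notin> C n})"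
    and "C n \<in> sets borel"
proof -
  have [measurable]: "(\<lambda>x. infdist x K) \<in> borel_measurable borel"
    by (intro borel_measurable_continuous_onI continuous_intros)
  show C [measurable]: "C n \<in> sets borel" for n
    unfolding C_def by measurable
  have anti: "y \<in> C m" if "m \<le> n" "y \<in> C n" for m n y
    using that frac_le[of 1 1 "real (Suc m)" "real (Suc n)"] unfolding C_def by force
  have [measurable]: "\<zeta> q \<in> borel_measurable X" if "q \<in> dyadic_times" for q
    using laplace_increments_measurable[OF X] dyadic_nonneg[OF that] by simp
  have m: "{\<omega>\<in>space X. \<forall>q\<in>dyadic_times. \<zeta> q \<omega> \<notin> C n} \<in> sets X" for n
    using countable_dyadic_times by measurable
  have "{\<omega>\<in>space X. range_closure (\<lambda>t. \<zeta> t \<omega>) \<inter> K = {}} =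
      (\<Union>n. {\<omega>\<in>space X. \<forall>q\<in>dyadic_times. \<zeta> q \<omega> \<notin> C n})"
    using X range_closure_disjoint_iff[OF _ K] unfolding C_def laplace_increments_def by auto
  also have "emeasure X \<dots> = (SUP n. emeasure X {\<omega>\<in>space X. \<forall>q\<in>dyadic_times. \<zeta> q \<omega> \<notin> C n})"
    using m by (intro SUP_emeasure_incseq[symmetric]) (auto simp: incseq_def dest: anti)
  finally show "emeasure X {\<omega>\<in>space X. range_closure (\<lambda>t. \<zeta> t \<omega>) \<inter> K = {}} =
      (SUP n. emeasure X {\<omega>\<in>space X. \<forall>q\<in>dyadic_times. \<zeta> q \<omega> \<notin> C n})" .
qed

lemma emeasure_range_closure_avoid_eq:
  assumes M: "prob_space M" "prob_space N"
    and \<xi>: "laplace_increments M \<kappa> \<xi>" and \<eta>: "laplace_increments N \<kappa> \<eta>" and K: "compact K"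
  shows "emeasure M {\<omega>\<in>space M. range_closure (\<lambda>t. \<xi> t \<omega>) \<inter> K = {}} =
    emeasure N {\<omega>\<in>space N. range_closure (\<lambda>t. \<eta> t \<omega>) \<inter> K = {}}"
  unfolding emeasure_range_closure_avoid(1)[OF \<xi> K] emeasure_range_closure_avoid(1)[OF \<eta> K]
  by (intro SUP_cong refl laplace_increments_avoid_eq[OF M \<xi> \<eta>] emeasure_range_closure_avoid(2)[OF \<xi> K])

text \<open>The function \<open>u\<close> is a potential density: the Laplace exponent of the subordinator is the reciprocal
  of the Laplace transform of \<open>u\<close>. If \<open>u\<close> is not integrable at zero, the exponent vanishes.\<close>

definition has_regenerative_density :: "'w measure \<Rightarrow> ('w \<Rightarrow> real set) \<Rightarrow> (real \<Rightarrow> real) \<Rightarrow> bool" where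
  "has_regenerative_density M R u \<longleftrightarrow>
     (\<forall>\<omega>\<in>space M. closed (R \<omega>)) \<and>
     (if set_integrable lborel {0<..1} u
      then \<exists>\<xi>. laplace_increments M (\<lambda>n t. exp (- t / (LINT r:{0<..}|lborel. exp (- real n * r) * u r))) \<xi> \<and>
        (AE \<omega> in M. R \<omega> = range_closure (\<lambda>t. \<xi> t \<omega>))
      else (AE \<omega> in M. R \<omega> = {0}))"

lemma laplace_increments_0: "laplace_increments M (\<lambda>_ _. 1) (\<lambda>_ _. 0)"
  by (auto simp: laplace_increments_def cadlag_def mono_on_def)

text \<open>Treats both cases as one: the range {0} of the degenerate case belongs to the zero
  subordinator, for which \<open>\<kappa>\<close> is constantly 1.\<close>

lemma has_regenerative_density_cases:
  assumes "has_regenerative_density M R u"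
  obtains \<xi> where "laplace_increments M (if set_integrable lborel {0<..1} u
      then (\<lambda>n t. exp (- t / (LINT r:{0<..}|lborel. exp (- real n * r) * u r))) else (\<lambda>_ _. 1)) \<xi>"
    "AE \<omega> in M. R \<omega> = range_closure (\<lambda>t. \<xi> t \<omega>)"
proof (cases "set_integrable lborel {0<..1} u")
  case False
  have "{enn2real 0 | t::real. 0 \<le> t \<and> 0 < (\<infinity>::ennreal)} = {0}" by auto
  then have "range_closure (\<lambda>_. 0) = {0}" by (simp add: range_closure_def)
  with False show thesis using assms that[of "\<lambda>_ _. 0"] laplace_increments_0[of M]
    by (simp add: has_regenerative_density_def)
qed (use assms that in \<open>auto simp: has_regenerative_density_def\<close>)

text \<open>The avoidance events of \<open>R\<close> differ from those of a measurable random set by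
  subsets of null sets, hence are measurable for the completion.\<close>

lemma random_closed_set_AE_eq:
  assumes S: "S \<in> M \<rightarrow>\<^sub>M closed_sets" and ae: "AE \<omega> in M. R \<omega> = S \<omega>"
    and cl: "\<And>\<omega>. \<omega> \<in> space M \<Longrightarrow> closed (R \<omega>)"
  shows "random_closed_set M R"
  unfolding random_closed_set_def
proof (rule measurable_closed_setsI)
  fix K :: "real set" assume K: "compact K"
  have "{\<omega>\<in>space M. S \<omega> \<inter> K = {}} = S -` {F. closed F \<and> F \<inter> K = {}} \<inter> space M"
    using measurable_space[OF S] by (auto simp: space_closed_sets)
  also have "\<dots> \<in> sets M" using S avoid_in_closed_sets[OF K] by (rule measurable_sets)
  finally have "{\<omega>\<in>space M. S \<omega> \<inter> K = {}} \<in> sets (completion M)" by (rule sets_completionI_sets)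
  moreover have "AE \<omega> in completion M. \<omega> \<in> {\<omega>\<in>space M. S \<omega> \<inter> K = {}} \<longleftrightarrow> \<omega> \<in> {\<omega>\<in>space M. R \<omega> \<inter> K = {}}"
    using AE_completion[OF ae] by (auto elim: eventually_mono)
  ultimately show "{\<omega>\<in>space (completion M). R \<omega> \<inter> K = {}} \<in> sets (completion M)"
    by (intro completion.in_sets_AE[of "{\<omega>\<in>space M. S \<omega> \<inter> K = {}}" "{\<omega>\<in>space (completion M). R \<omega> \<inter> K = {}}" M]) simp_all
qed (use cl in simp)

lemma has_regenerative_density_regenerative_set:
  assumes M: "prob_space M" and R: "has_regenerative_density M R u"
  shows "regenerative_set M R"
  using R
proof (rule has_regenerative_density_cases)
  fix \<kappa> \<xi> assume \<xi>: "laplace_increments M \<kappa> \<xi>" and ae: "AE \<omega> in M. R \<omega> = range_closure (\<lambda>t. \<xi> t \<omega>)"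
  have "(\<lambda>\<omega>. range_closure (\<lambda>t. \<xi> t \<omega>)) \<in> M \<rightarrow>\<^sub>M closed_sets"
    using \<xi> by (intro range_closure_measurable) (auto simp: laplace_increments_def)
  from random_closed_set_AE_eq[OF this ae] R have "random_closed_set M R" by (auto simp: has_regenerative_density_def)
  with laplace_increments_subordinator[OF \<xi> M] ae show "regenerative_set M R"
    by (auto simp: regenerative_set_def range_closure_def)
qed

text \<open>The increments are governed by a \<open>\<kappa>\<close> computed from \<open>u\<close>
  alone, and \<open>\<kappa>\<close> determines all avoidance probabilities. Sets built from
  unrelated processes on different probability spaces can therefore be compared through
  \<open>u\<close>.\<close>

lemma has_regenerative_density_same_law:
  assumes M: "prob_space M" "prob_space N"
    and R: "has_regenerative_density M R u" and S: "has_regenerative_density N S u"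
  shows "same_law M R N S"
proof -
  define \<kappa> where "\<kappa> = (if set_integrable lborel {0<..1} u
      then (\<lambda>(n::nat) t. exp (- t / (LINT r:{0<..}|lborel. exp (- real n * r) * u r))) else (\<lambda>_ _. 1))"
  obtain \<xi> where \<xi>: "laplace_increments M \<kappa> \<xi>" "AE \<omega> in M. R \<omega> = range_closure (\<lambda>t. \<xi> t \<omega>)"
    using R unfolding \<kappa>_def by (rule has_regenerative_density_cases)
  obtain \<eta> where \<eta>: "laplace_increments N \<kappa> \<eta>" "AE \<omega> in N. S \<omega> = range_closure (\<lambda>t. \<eta> t \<omega>)"
    using S unfolding \<kappa>_def by (rule has_regenerative_density_cases)
  have rc: "random_closed_set M R" "random_closed_set N S"
    using has_regenerative_density_regenerative_set M R S by (auto simp: regenerative_set_def)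
  have [measurable]: "(\<lambda>\<omega>. range_closure (\<lambda>t. \<xi> t \<omega>)) \<in> M \<rightarrow>\<^sub>M closed_sets" "(\<lambda>\<omega>. range_closure (\<lambda>t. \<eta> t \<omega>)) \<in> N \<rightarrow>\<^sub>M closed_sets"
    using \<xi> \<eta> by (intro range_closure_measurable; auto simp: laplace_increments_def)+
  have "distr (completion M) closed_sets R = distr (completion M) closed_sets (\<lambda>\<omega>. range_closure (\<lambda>t. \<xi> t \<omega>))"
    using rc AE_completion[OF \<xi>(2)] by (intro distr_cong_AE) (auto simp: random_closed_set_def intro: measurable_completion)
  also have "\<dots> = distr M closed_sets (\<lambda>\<omega>. range_closure (\<lambda>t. \<xi> t \<omega>))"
    by (rule distr_completion) measurable
  also have "\<dots> = distr N closed_sets (\<lambda>\<omega>. range_closure (\<lambda>t. \<eta> t \<omega>))"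
    by (rule closed_sets_distr_eqI[OF M]) (auto intro: emeasure_range_closure_avoid_eq[OF M \<xi>(1) \<eta>(1)])
  also have "\<dots> = distr (completion N) closed_sets (\<lambda>\<omega>. range_closure (\<lambda>t. \<eta> t \<omega>))"
    by (rule distr_completion[symmetric]) measurable
  also have "\<dots> = distr (completion N) closed_sets S"
    using rc AE_completion[OF \<eta>(2)] by (intro distr_cong_AE) (auto simp: random_closed_set_def intro: measurable_completion)
  finally show ?thesis using rc by (simp add: same_law_def)
qed

section \<open>Regenerative kernels and the polar case\<close>

lemma dyadic_diff:
  assumes "p \<in> dyadic_times" "q \<in> dyadic_times" "p \<le> q" shows "q - p \<in> dyadic_times"
proof -
  obtain i j m where p: "p = real i / 2 ^ m" "q = real j / 2 ^ m"
    by (rule dyadic_common_level[OF assms(1,2)])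
  with assms have "i \<le> j" by (simp add: field_simps)
  then have "q - p = real (j - i) / 2 ^ m" by (simp add: p of_nat_diff diff_divide_distrib)
  then show ?thesis by (simp only: dyadic_timesI)
qed

text \<open>For small \<open>\<epsilon>\<close>, \<open>k h x\<close> is to be thought of as the probability that the process started at \<open>x\<close> is below \<open>\<epsilon>\<close>
  at time \<open>h\<close>, divided by a normalization that does not depend on \<open>h\<close> and \<open>x\<close>. No transition semigroup is
  needed: the Markov property only enters through \<open>k_shift\<close>.\<close>

locale regenerative_kernel = prob_space M for M :: "'w measure" +
  fixes W :: "real \<Rightarrow> 'w \<Rightarrow> ennreal" and F :: "real \<Rightarrow> 'w measure" and k :: "real \<Rightarrow> ennreal \<Rightarrow> real"
  assumes F_sub: "0 \<le> t \<Longrightarrow> subalgebra M (F t)"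
    and F_mono: "0 \<le> s \<Longrightarrow> s \<le> t \<Longrightarrow> sets (F s) \<subseteq> sets (F t)"
    and F_null: "0 \<le> t \<Longrightarrow> N \<in> null_sets M \<Longrightarrow> N \<in> sets (F t)"
    and W_adapted: "0 \<le> t \<Longrightarrow> W t \<in> borel_measurable (F t)"
    and W_cadlag: "\<omega> \<in> space M \<Longrightarrow> cadlag (\<lambda>t. W t \<omega>)"
    and W_0: "AE \<omega> in M. W 0 \<omega> = 0"
    and k_meas: "case_prod k \<in> borel_measurable (borel \<Otimes>\<^sub>M borel)"
    and k_nonneg [simp]: "0 \<le> k r x"
    and k_neg: "r \<le> 0 \<Longrightarrow> k r x = 0"
    and k_anti: "x \<le> y \<Longrightarrow> k r y \<le> k r x"
    and k_cont: "AE r in lborel. isCont (k r) x"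
    and k_pos: "0 < r \<Longrightarrow> 0 < k r 0"
    and k_dec: "0 < r \<Longrightarrow> r \<le> r' \<Longrightarrow> k r' 0 \<le> k r 0"
    and k_shift: "0 \<le> s \<Longrightarrow> 0 \<le> t \<Longrightarrow> 0 < h \<Longrightarrow> A \<in> sets (F s) \<Longrightarrow>
      (\<integral>\<^sup>+\<omega>\<in>A. k h (W (s + t) \<omega>) \<partial>M) = (\<integral>\<^sup>+\<omega>\<in>A. k (t + h) (W s \<omega>) \<partial>M)"
begin

lemma F_sets: "0 \<le> t \<Longrightarrow> A \<in> sets (F t) \<Longrightarrow> A \<in> sets M"
  using F_sub[of t] by (auto simp: subalgebra_def)

lemma F_space [simp]: "0 \<le> t \<Longrightarrow> space (F t) = space M"
  using F_sub[of t] by (auto simp: subalgebra_def)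

lemma F_subalgebra: "0 \<le> s \<Longrightarrow> s \<le> t \<Longrightarrow> subalgebra (F t) (F s)"
  using F_mono[of s t] by (auto simp: subalgebra_def)

lemma F_measurable_mono: "0 \<le> s \<Longrightarrow> s \<le> t \<Longrightarrow> f \<in> measurable (F s) N \<Longrightarrow> f \<in> measurable (F t) N"
  by (rule measurable_from_subalg[OF F_subalgebra])

lemma F_measurable: "0 \<le> t \<Longrightarrow> f \<in> measurable (F t) N \<Longrightarrow> f \<in> measurable M N"
  by (rule measurable_from_subalg[OF F_sub])

lemma W_measurable: "0 \<le> t \<Longrightarrow> W t \<in> borel_measurable M"
  using F_measurable W_adapted by blast

lemma k_measurable_compose [measurable (raw)]:
  "f \<in> borel_measurable N \<Longrightarrow> g \<in> borel_measurable N \<Longrightarrow> (\<lambda>x. k (f x) (g x)) \<in> borel_measurable N"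
  using measurable_compose[OF measurable_Pair k_meas, of f N g] by simp

lemma k_le_0: "k r x \<le> k r 0"
  by (rule k_anti) simp

text \<open>Integrates \<open>k_shift\<close> over \<open>h\<close> against \<open>w\<close> and
  substitutes r = t + h. As \<open>k\<close> vanishes at nonpositive times, only h > 0
  contributes.\<close>

lemma k_shift_integral:
  fixes w :: "real \<Rightarrow> ennreal"
  assumes st: "0 \<le> s" "0 \<le> t" and A: "A \<in> sets (F s)" and [measurable]: "w \<in> borel_measurable borel"
  shows "(\<integral>\<^sup>+\<omega>\<in>A. (\<integral>\<^sup>+h. w h * k h (W (s + t) \<omega>) \<partial>lborel) \<partial>M) =
    (\<integral>\<^sup>+\<omega>\<in>A. (\<integral>\<^sup>+r\<in>{t<..}. w (r - t) * k r (W s \<omega>) \<partial>lborel) \<partial>M)"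
proof -
  have [measurable]: "W s \<in> borel_measurable M" "W (s + t) \<in> borel_measurable M" using W_measurable st by auto
  have [measurable]: "A \<in> sets M" using F_sets st A by blast
  interpret pair_sigma_finite M lborel ..
  have "(\<integral>\<^sup>+\<omega>\<in>A. (\<integral>\<^sup>+h. w h * k h (W (s + t) \<omega>) \<partial>lborel) \<partial>M) =
      (\<integral>\<^sup>+\<omega>. (\<integral>\<^sup>+h. w h * k h (W (s + t) \<omega>) * indicator A \<omega> \<partial>lborel) \<partial>M)"
    by (intro nn_integral_cong nn_integral_multc[symmetric]) measurable
  also have "\<dots> = (\<integral>\<^sup>+h. (\<integral>\<^sup>+\<omega>. w h * k h (W (s + t) \<omega>) * indicator A \<omega> \<partial>M) \<partial>lborel)"
    by (rule Fubini'[symmetric]) measurable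
  also have "\<dots> = (\<integral>\<^sup>+h. w h * (\<integral>\<^sup>+\<omega>\<in>A. k h (W (s + t) \<omega>) \<partial>M) \<partial>lborel)"
    by (intro nn_integral_cong) (simp add: mult.assoc nn_integral_cmult)
  also have "\<dots> = (\<integral>\<^sup>+h. w h * indicator {0<..} h * (\<integral>\<^sup>+\<omega>\<in>A. k (t + h) (W s \<omega>) \<partial>M) \<partial>lborel)"
    using k_shift[OF st _ A] by (intro nn_integral_cong) (auto simp: k_neg split: split_indicator)
  also have "\<dots> = (\<integral>\<^sup>+r. w (r - t) * indicator {0<..} (r - t) * (\<integral>\<^sup>+\<omega>\<in>A. k r (W s \<omega>) \<partial>M) \<partial>lborel)"
    by (subst nn_integral_real_affine[where c=1 and t="-t"]) auto
  also have "\<dots> = (\<integral>\<^sup>+r. (\<integral>\<^sup>+\<omega>. w (r - t) * k r (W s \<omega>) * indicator {t<..} r * indicator A \<omega> \<partial>M) \<partial>lborel)"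
    by (intro nn_integral_cong) (auto simp: nn_integral_cmult[symmetric] mult.assoc split: split_indicator intro!: nn_integral_cong)
  also have "\<dots> = (\<integral>\<^sup>+\<omega>. (\<integral>\<^sup>+r. w (r - t) * k r (W s \<omega>) * indicator {t<..} r * indicator A \<omega> \<partial>lborel) \<partial>M)"
    by (rule Fubini') measurable
  also have "\<dots> = (\<integral>\<^sup>+\<omega>\<in>A. (\<integral>\<^sup>+r\<in>{t<..}. w (r - t) * k r (W s \<omega>) \<partial>lborel) \<partial>M)"
    by (intro nn_integral_cong nn_integral_multc) measurable
  finally show ?thesis .
qed

text \<open>Up to normalization, the \<theta>-potential density at zero for the process started at
  \<open>x\<close>; it becomes the expected discounted local time at zero once a local time is
  available.\<close>

definition potential :: "real \<Rightarrow> ennreal \<Rightarrow> ennreal" where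
  "potential \<theta> x = (\<integral>\<^sup>+r. ennreal (exp (- \<theta> * r)) * k r x \<partial>lborel)"

lemma potential_measurable [measurable]: "potential \<theta> \<in> borel_measurable borel"
  unfolding potential_def[abs_def] by measurable

lemma potential_anti: "x \<le> y \<Longrightarrow> potential \<theta> y \<le> potential \<theta> x"
  unfolding potential_def by (intro nn_integral_mono mult_left_mono ennreal_leI k_anti) auto

lemma potential_shift:
  assumes st: "0 \<le> s" "0 \<le> t" and A: "A \<in> sets (F s)"
  shows "(\<integral>\<^sup>+\<omega>\<in>A. potential \<theta> (W (s + t) \<omega>) \<partial>M) =
    ennreal (exp (\<theta> * t)) * (\<integral>\<^sup>+\<omega>\<in>A. (\<integral>\<^sup>+r\<in>{t<..}. ennreal (exp (- \<theta> * r)) * k r (W s \<omega>) \<partial>lborel) \<partial>M)"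
proof -
  have [measurable]: "W s \<in> borel_measurable M" using W_measurable st by auto
  have [measurable]: "A \<in> sets M" using F_sets st A by blast
  have "ennreal (exp (- \<theta> * (r - t))) = ennreal (exp (\<theta> * t)) * ennreal (exp (- \<theta> * r))" for r
    by (simp add: ennreal_mult[symmetric] exp_add[symmetric] algebra_simps)
  then have eqn: "ennreal (exp (- \<theta> * (r - t))) * y * z = ennreal (exp (\<theta> * t)) * (ennreal (exp (- \<theta> * r)) * y * z)" for r y z
    by (simp only: mult.assoc)
  have "(\<integral>\<^sup>+\<omega>\<in>A. potential \<theta> (W (s + t) \<omega>) \<partial>M) =
      (\<integral>\<^sup>+\<omega>\<in>A. (\<integral>\<^sup>+r\<in>{t<..}. ennreal (exp (- \<theta> * (r - t))) * k r (W s \<omega>) \<partial>lborel) \<partial>M)"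
    unfolding potential_def by (rule k_shift_integral[OF st A]) measurable
  also have "\<dots> = (\<integral>\<^sup>+\<omega>\<in>A. (\<integral>\<^sup>+r. ennreal (exp (\<theta> * t)) * (ennreal (exp (- \<theta> * r)) * k r (W s \<omega>) * indicator {t<..} r) \<partial>lborel) \<partial>M)"
    by (simp only: eqn)
  also have "\<dots> = (\<integral>\<^sup>+\<omega>. ennreal (exp (\<theta> * t)) * ((\<integral>\<^sup>+r\<in>{t<..}. ennreal (exp (- \<theta> * r)) * k r (W s \<omega>) \<partial>lborel) * indicator A \<omega>) \<partial>M)"
    by (intro nn_integral_cong) (simp add: nn_integral_cmult mult.assoc)
  also have "\<dots> = ennreal (exp (\<theta> * t)) * (\<integral>\<^sup>+\<omega>\<in>A. (\<integral>\<^sup>+r\<in>{t<..}. ennreal (exp (- \<theta> * r)) * k r (W s \<omega>) \<partial>lborel) \<partial>M)"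
    by (rule nn_integral_cmult) measurable
  finally show ?thesis .
qed

definition disc_potential :: "real \<Rightarrow> 'w \<Rightarrow> ennreal" where
  "disc_potential t \<omega> = ennreal (exp (- t)) * potential 1 (W t \<omega>)"

lemma disc_potential_measurable: "0 \<le> t \<Longrightarrow> disc_potential t \<in> borel_measurable (F t)"
  unfolding disc_potential_def[abs_def]
  by (intro borel_measurable_times_ennreal borel_measurable_const measurable_compose[OF W_adapted potential_measurable])

text \<open>By \<open>potential_shift\<close> the later value retains only the part r > t - s of the
  integral.\<close>

lemma disc_potential_supermartingale:
  assumes st: "0 \<le> s" "s \<le> t" and A: "A \<in> sets (F s)"
  shows "(\<integral>\<^sup>+\<omega>\<in>A. disc_potential t \<omega> \<partial>M) \<le> (\<integral>\<^sup>+\<omega>\<in>A. disc_potential s \<omega> \<partial>M)"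
proof -
  have [measurable]: "W s \<in> borel_measurable M" "W t \<in> borel_measurable M" using W_measurable st by auto
  have [measurable]: "A \<in> sets M" using F_sets st A by blast
  have "(\<integral>\<^sup>+\<omega>\<in>A. disc_potential t \<omega> \<partial>M) = ennreal (exp (- t)) * (\<integral>\<^sup>+\<omega>\<in>A. potential 1 (W (s + (t - s)) \<omega>) \<partial>M)"
    by (simp add: disc_potential_def mult.assoc nn_integral_cmult)
  also have "\<dots> = ennreal (exp (- t)) * (ennreal (exp (t - s)) * (\<integral>\<^sup>+\<omega>\<in>A. (\<integral>\<^sup>+r\<in>{t - s<..}. ennreal (exp (- 1 * r)) * k r (W s \<omega>) \<partial>lborel) \<partial>M))"
    using st by (subst potential_shift[OF _ _ A]) auto
  also have "\<dots> \<le> ennreal (exp (- t)) * (ennreal (exp (t - s)) * (\<integral>\<^sup>+\<omega>\<in>A. potential 1 (W s \<omega>) \<partial>M))"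
    unfolding potential_def by (intro mult_left_mono nn_integral_mono mult_right_mono) (auto split: split_indicator)
  also have "\<dots> = (\<integral>\<^sup>+\<omega>\<in>A. disc_potential s \<omega> \<partial>M)"
    by (simp add: disc_potential_def mult.assoc[symmetric] ennreal_mult[symmetric] exp_add[symmetric])
      (simp add: mult.assoc nn_integral_cmult)
  finally show ?thesis .
qed

text \<open>Seen from time 0, the potential at time \<open>e\<close> involves only
  \<open>k r\<close> with r > e, and this is at most \<open>k e 0\<close>. At time 0 the value may
  be infinite, whence the positive starting time.\<close>

lemma disc_potential_finite:
  assumes "0 < e" shows "(\<integral>\<^sup>+\<omega>. disc_potential e \<omega> \<partial>M) < \<infinity>"
proof -
  have [measurable]: "W e \<in> borel_measurable M" using W_measurable assms by auto
  have A: "space M \<in> sets (F 0)" using sets.top[of "F 0"] by simp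
  have "(\<integral>\<^sup>+\<omega>. disc_potential e \<omega> \<partial>M) \<le> (\<integral>\<^sup>+\<omega>\<in>space M. potential 1 (W (0 + e) \<omega>) \<partial>M)"
    unfolding disc_potential_def using assms
    by (intro nn_integral_mono) (auto intro!: mult_right_mono[of "ennreal (exp (- e))" 1, simplified])
  also have "\<dots> = ennreal (exp e) * (\<integral>\<^sup>+\<omega>\<in>space M. (\<integral>\<^sup>+r\<in>{e<..}. ennreal (exp (- 1 * r)) * k r (W 0 \<omega>) \<partial>lborel) \<partial>M)"
    using assms by (subst potential_shift[OF _ _ A]) auto
  also have "\<dots> \<le> ennreal (exp e) * (\<integral>\<^sup>+\<omega>\<in>space M. (\<integral>\<^sup>+r. ennreal (k e 0) * (ennreal (r ^ 0 * exp (- r)) * indicator {0..} r) \<partial>lborel) \<partial>M)"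
  proof (intro mult_left_mono nn_integral_mono mult_right_mono)
    fix \<omega> r
    have "k r (W 0 \<omega>) \<le> k e 0" if "e < r" using k_le_0[of r "W 0 \<omega>"] k_dec[of e r] that assms by linarith
    then show "ennreal (exp (- 1 * r)) * ennreal (k r (W 0 \<omega>)) * indicator {e<..} r \<le> ennreal (k e 0) * (ennreal (r ^ 0 * exp (- r)) * indicator {0..} r)"
      using assms by (auto split: split_indicator simp: ennreal_mult[symmetric] mult.commute intro!: ennreal_leI mult_left_mono)
  qed auto
  also have "\<dots> < \<infinity>"
    by (subst nn_integral_cmult) (auto simp: nn_intergal_power_times_exp_Ici[of 0, simplified] emeasure_space_1 ennreal_mult_less_top)
  finally show ?thesis .
qed

text \<open>Doob's maximal inequality for a nonnegative supermartingale on a finite grid. The second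
  summand, the expectation over the paths that have not yet reached the level, makes the induction
  close.\<close>

lemma disc_potential_maximal_grid:
  fixes a :: real and d e :: real
  assumes "0 \<le> a" "0 \<le> d" "0 \<le> e"
  shows "ennreal a * emeasure M {\<omega>\<in>space M. \<exists>j<n. ennreal a \<le> disc_potential (e + real j * d) \<omega>}
     + (\<integral>\<^sup>+\<omega>\<in>{\<omega>\<in>space M. \<forall>j<n. disc_potential (e + real j * d) \<omega> < a}. disc_potential (e + real n * d) \<omega> \<partial>M)
    \<le> (\<integral>\<^sup>+\<omega>. disc_potential e \<omega> \<partial>M)"
proof (induction n)
  case 0
  show ?case by (auto intro!: nn_integral_mono split: split_indicator)
next
  case (Suc n)
  define X where "X j = disc_potential (e + real j * d)" for j
  define C where "C n = {\<omega>\<in>space M. \<forall>j<n. X j \<omega> < a}" for n :: nat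
  define B where "B n = {\<omega>\<in>space M. \<exists>j<n. ennreal a \<le> X j \<omega>}" for n :: nat
  have nn: "0 \<le> e + real j * d" for j using assms by simp
  have XF: "X j \<in> borel_measurable (F (e + real i * d))" if "j \<le> i" for i j
    unfolding X_def using that assms
    by (intro F_measurable_mono[OF nn _ disc_potential_measurable[OF nn]]) (auto intro!: mult_right_mono)
  have [measurable]: "X j \<in> borel_measurable M" for j
    using F_measurable[OF nn XF[OF order_refl]] .
  have CF: "C (Suc n) \<in> sets (F (e + real n * d))"
  proof -
    have [measurable]: "X j \<in> borel_measurable (F (e + real n * d))" if "j < Suc n" for j using XF that by simp
    have "{\<omega>\<in>space (F (e + real n * d)). \<forall>j\<in>{..<Suc n}. X j \<omega> < a} \<in> sets (F (e + real n * d))" by measurable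
    also have "{\<omega>\<in>space (F (e + real n * d)). \<forall>j\<in>{..<Suc n}. X j \<omega> < a} = C (Suc n)"
      unfolding F_space[OF nn] C_def by blast
    finally show ?thesis .
  qed
  have [measurable]: "B n \<in> sets M" "C n \<in> sets M" "B (Suc n) \<in> sets M" "C (Suc n) \<in> sets M" for n
    unfolding B_def C_def by simp_all
  have 0: "ennreal a * emeasure M (B (Suc n)) = ennreal a * emeasure M (B n) + ennreal a * emeasure M (C n - C (Suc n))"
    unfolding distrib_left[symmetric]
    by (subst plus_emeasure) (auto simp: B_def C_def less_Suc_eq not_less intro!: arg_cong[where f="emeasure M"] arg_cong[where f="\<lambda>x. ennreal a * x"])
  have "ennreal a * emeasure M (C n - C (Suc n)) \<le> (\<integral>\<^sup>+\<omega>\<in>C n - C (Suc n). X n \<omega> \<partial>M)"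
    unfolding nn_integral_cmult_indicator[symmetric, OF sets.Diff[OF \<open>C n \<in> sets M\<close> \<open>C (Suc n) \<in> sets M\<close>]]
    by (intro nn_integral_mono) (auto simp: C_def less_Suc_eq not_less split: split_indicator)
  then have 1: "ennreal a * emeasure M (B (Suc n)) \<le> ennreal a * emeasure M (B n) + (\<integral>\<^sup>+\<omega>\<in>C n - C (Suc n). X n \<omega> \<partial>M)"
    unfolding 0 by (rule add_left_mono)
  have 2: "(\<integral>\<^sup>+\<omega>\<in>C (Suc n). X (Suc n) \<omega> \<partial>M) \<le> (\<integral>\<^sup>+\<omega>\<in>C (Suc n). X n \<omega> \<partial>M)"
    unfolding X_def using nn assms by (intro disc_potential_supermartingale CF) (auto intro!: mult_right_mono)
  have 3: "(\<integral>\<^sup>+\<omega>\<in>C n - C (Suc n). X n \<omega> \<partial>M) + (\<integral>\<^sup>+\<omega>\<in>C (Suc n). X n \<omega> \<partial>M) = (\<integral>\<^sup>+\<omega>\<in>C n. X n \<omega> \<partial>M)"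
    by (subst nn_integral_add[symmetric]) (auto simp: C_def less_Suc_eq split: split_indicator intro!: nn_integral_cong)
  have "ennreal a * emeasure M (B (Suc n)) + (\<integral>\<^sup>+\<omega>\<in>C (Suc n). X (Suc n) \<omega> \<partial>M)
      \<le> (ennreal a * emeasure M (B n) + (\<integral>\<^sup>+\<omega>\<in>C n - C (Suc n). X n \<omega> \<partial>M)) + (\<integral>\<^sup>+\<omega>\<in>C (Suc n). X n \<omega> \<partial>M)"
    by (intro add_mono 1 2)
  also have "\<dots> = ennreal a * emeasure M (B n) + (\<integral>\<^sup>+\<omega>\<in>C n. X n \<omega> \<partial>M)"
    by (simp add: 3[symmetric] add.assoc)
  also have "\<dots> \<le> (\<integral>\<^sup>+\<omega>. disc_potential e \<omega> \<partial>M)"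
    using Suc.IH by (simp add: B_def C_def X_def)
  finally show ?case by (simp add: B_def C_def X_def)
qed

text \<open>The maximal inequality on finer and longer grids bounds \<open>a\<close> times the
  probability of ever reaching the level \<open>a\<close> by the finite expectation
  \<open>I\<close>; now let \<open>a\<close> tend to infinity.\<close>

lemma disc_potential_bounded:
  assumes "0 < e"
  shows "AE \<omega> in M. \<exists>a::nat. \<forall>p\<in>dyadic_times. disc_potential (e + p) \<omega> < of_nat a"
proof -
  define I where "I = (\<integral>\<^sup>+\<omega>. disc_potential e \<omega> \<partial>M)"
  have dm [measurable]: "disc_potential (e + p) \<in> borel_measurable M" if "p \<in> dyadic_times" for p
    using dyadic_nonneg[OF that] assms by (intro F_measurable[OF _ disc_potential_measurable]) auto
  define B where "B a = {\<omega>\<in>space M. \<exists>p\<in>dyadic_times. of_nat a \<le> disc_potential (e + p) \<omega>}" for a :: nat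
  have [measurable]: "B a \<in> sets M" for a unfolding B_def using countable_dyadic_times by measurable
  have Ba: "of_nat a * emeasure M (B a) \<le> I" for a :: nat
  proof -
    define E where "E m = {\<omega>\<in>space M. \<exists>j<4 ^ m. ennreal (real a) \<le> disc_potential (e + real j * (1 / 2 ^ m)) \<omega>}" for m :: nat
    have [measurable]: "disc_potential (e + real j / 2 ^ m) \<in> borel_measurable M" for j m
      by (rule dm[OF dyadic_timesI])
    have [measurable]: "E m \<in> sets M" for m unfolding E_def by simp
    have inc: "incseq E"
    proof (rule incseq_SucI, unfold E_def, safe)
      fix \<omega> m and j :: nat assume *: "j < 4 ^ m" "ennreal (real a) \<le> disc_potential (e + real j * (1 / 2 ^ m)) \<omega>"
      then have "2 * j < 4 ^ Suc m" "real (2 * j) * (1 / 2 ^ Suc m) = real j * (1 / 2 ^ m)" by simp_all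
      with * show "\<exists>j<4 ^ Suc m. ennreal (real a) \<le> disc_potential (e + real j * (1 / 2 ^ Suc m)) \<omega>" by metis
    qed
    have "B a = (\<Union>m. E m)"
    proof safe
      fix \<omega> assume "\<omega> \<in> B a"
      then obtain j m where \<omega>: "\<omega> \<in> space M" "of_nat a \<le> disc_potential (e + real j / 2 ^ m) \<omega>"
        by (auto simp: B_def dyadic_times_def)
      have "real j / 2 ^ m = real (j * 2 ^ j) * (1 / 2 ^ (m + j))" by (simp add: power_add)
      moreover have "j * 2 ^ j < 4 ^ (m + j)"
      proof -
        have "j * 2 ^ j < 2 ^ j * 2 ^ j" using less_exp[of j] by (intro mult_strict_right_mono) auto
        also have "\<dots> = 4 ^ j" by (simp add: power_mult_distrib[symmetric])
        also have "\<dots> \<le> 4 ^ (m + j)" by (intro power_increasing) auto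
        finally show ?thesis .
      qed
      ultimately have "\<omega> \<in> E (m + j)" using \<omega> unfolding E_def by (auto simp: ennreal_of_nat_eq_real_of_nat intro!: exI[of _ "j * 2 ^ j"])
      then show "\<omega> \<in> (\<Union>m. E m)" by blast
    next
      fix \<omega> m assume "\<omega> \<in> E m" then show "\<omega> \<in> B a"
        by (auto simp: E_def B_def ennreal_of_nat_eq_real_of_nat)
    qed
    then have "of_nat a * emeasure M (B a) = (SUP m. of_nat a * emeasure M (E m))"
      using inc by (subst SUP_mult_left_ennreal[symmetric]) (auto intro!: SUP_emeasure_incseq[symmetric] arg_cong[where f="\<lambda>x. _ * x"])
    also have "\<dots> \<le> I"
    proof (rule SUP_least)
      fix m
      show "of_nat a * emeasure M (E m) \<le> I"
        unfolding E_def I_def ennreal_of_nat_eq_real_of_nat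
        using disc_potential_maximal_grid[of "real a" "1 / 2 ^ m" e "4 ^ m"] assms
        by (intro order_trans[OF _ disc_potential_maximal_grid[of "real a" "1 / 2 ^ m" e "4 ^ m"]]) auto
    qed
    finally show ?thesis .
  qed
  have bound: "of_nat a * emeasure M (\<Inter>a. B a) \<le> I" for a :: nat
    by (rule order_trans[OF mult_left_mono[OF emeasure_mono] Ba[of a]]) auto
  have "emeasure M (\<Inter>a. B a) = 0"
  proof (rule ccontr)
    assume nz: "emeasure M (\<Inter>a. B a) \<noteq> 0"
    have "I < \<infinity>" unfolding I_def by (rule disc_potential_finite[OF assms])
    then have "I / emeasure M (\<Inter>a. B a) \<noteq> \<top>" using nz by (auto simp: ennreal_divide_eq_top_iff)
    then obtain a :: nat where a: "I / emeasure M (\<Inter>a. B a) < of_nat a"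
      by (auto dest!: ennreal_Ex_less_of_nat[OF less_top[THEN iffD1]])
    then have "I < of_nat a * emeasure M (\<Inter>a. B a)"
      using nz by (subst (asm) divide_less_ennreal) (auto simp: less_top[symmetric] zero_less_iff_neq_zero)
    with bound[of a] show False by simp
  qed
  then have "(\<Inter>a. B a) \<in> null_sets M" by auto
  then have "AE \<omega> in M. \<omega> \<notin> (\<Inter>a. B a)" by (rule AE_not_in)
  then show ?thesis using AE_space by eventually_elim (auto simp: B_def not_le)
qed

text \<open>Fatou's lemma: if the potential is infinite at 0, it cannot stay bounded along states
  that tend to 0.\<close>

lemma potential_tendsto_0:
  assumes x: "x \<longlonglongrightarrow> 0" and top: "potential \<theta> 0 = \<infinity>" and fin: "c < \<infinity>"
  shows "\<exists>n. c < potential \<theta> (x n)"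
proof (rule ccontr)
  assume "\<not> (\<exists>n. c < potential \<theta> (x n))"
  then have le: "potential \<theta> (x n) \<le> c" for n by (simp add: not_less)
  have "potential \<theta> 0 = (\<integral>\<^sup>+r. liminf (\<lambda>n. ennreal (exp (- \<theta> * r)) * k r (x n)) \<partial>lborel)"
    unfolding potential_def using k_cont[of 0]
  proof (intro nn_integral_cong_AE, eventually_elim)
    case (elim r)
    have "(\<lambda>n. k r (x n)) \<longlonglongrightarrow> k r 0" by (rule isCont_tendsto_compose[OF _ x]) (rule elim)
    then have "(\<lambda>n. ennreal (exp (- \<theta> * r)) * k r (x n)) \<longlonglongrightarrow> ennreal (exp (- \<theta> * r)) * k r 0"
      by (intro ennreal_tendsto_cmult tendsto_ennrealI) simp_all
    then show "ennreal (exp (- \<theta> * r)) * k r 0 = liminf (\<lambda>n. ennreal (exp (- \<theta> * r)) * k r (x n))"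
      by (intro lim_imp_Liminf[symmetric]) simp_all
  qed
  also have "\<dots> \<le> liminf (\<lambda>n. potential \<theta> (x n))"
    unfolding potential_def by (rule nn_integral_liminf) measurable
  also have "\<dots> \<le> liminf (\<lambda>n. c)" by (intro Liminf_mono always_eventually allI le)
  also have "\<dots> = c" by (simp add: Liminf_const)
  finally show False using top fin by (simp add: top_unique)
qed

text \<open>A density that is not integrable at zero makes the potential infinite at 0. A return to
  zero at a positive time, or an approach from the left, would then make the discounted potential
  unbounded along dyadic times, against \<open>disc_potential_bounded\<close>.\<close>

theorem polar_zero_set:
  assumes polar: "\<not> set_integrable lborel {0<..1} (\<lambda>r. k r 0)"
  shows "AE \<omega> in M. \<forall>t>0. W t \<omega> \<noteq> 0 \<and> \<not> ((\<lambda>s. W s \<omega>) \<longlongrightarrow> 0) (at_left t)"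
proof -
  have "(\<integral>\<^sup>+r\<in>{0<..1}. k r 0 \<partial>lborel) = \<infinity>"
  proof (rule ccontr)
    assume "(\<integral>\<^sup>+r\<in>{0<..1}. k r 0 \<partial>lborel) \<noteq> \<infinity>"
    then have "(\<integral>\<^sup>+r. ennreal (norm (indicat_real {0<..1} r *\<^sub>R k r 0)) \<partial>lborel) < \<infinity>"
      by (simp add: ennreal_mult ennreal_indicator mult.commute less_top[symmetric] ennreal_mult'' )
    then have "set_integrable lborel {0<..1} (\<lambda>r. k r 0)"
      unfolding set_integrable_def by (intro integrableI_bounded) measurable
    with polar show False by simp
  qed
  then have "\<infinity> = ennreal (exp (- 1)) * (\<integral>\<^sup>+r\<in>{0<..1}. k r 0 \<partial>lborel)" by (simp add: ennreal_mult_top)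
  also have "ennreal (exp (- 1)) * (\<integral>\<^sup>+r\<in>{0<..1}. k r 0 \<partial>lborel) = (\<integral>\<^sup>+r. ennreal (exp (- 1)) * (ennreal (k r 0) * indicator {0<..1} r) \<partial>lborel)"
    by (rule nn_integral_cmult[symmetric]) measurable
  also have "\<dots> \<le> potential 1 0"
    unfolding potential_def by (intro nn_integral_mono) (auto split: split_indicator intro!: mult_right_mono ennreal_leI)
  finally have top: "potential 1 0 = \<infinity>" by (simp add: top_unique)
  have "AE \<omega> in M. \<forall>n. \<exists>a::nat. \<forall>p\<in>dyadic_times. disc_potential (1 / 2 ^ n + p) \<omega> < of_nat a"
    by (subst AE_all_countable) (auto intro: disc_potential_bounded)
  with AE_space show ?thesis
  proof eventually_elim
    case (elim \<omega>)
    have approach: False if t: "0 < t" and s: "\<And>m. s m \<in> dyadic_times" "\<And>m. t / 2 < s m" "\<And>m. s m < t + 1"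
      and W: "(\<lambda>m. W (s m) \<omega>) \<longlonglongrightarrow> 0" for t s
    proof -
      have "(\<lambda>n. 1 / 2 ^ n) \<longlonglongrightarrow> (0::real)"
        using LIMSEQ_power_zero[of "1 / 2 :: real"] by (simp add: power_one_over)
      then have "eventually (\<lambda>n. 1 / 2 ^ n < t / 2) sequentially" using t by (intro order_tendstoD) auto
      \<comment> \<open>Boundedness is available from a positive time on; \<open>n\<close> is chosen
        to put this time below all \<open>s m\<close>.\<close>
      then obtain n where n: "1 / 2 ^ n < t / 2" by (auto dest: eventually_happens)
      obtain a :: nat where a: "\<And>p. p \<in> dyadic_times \<Longrightarrow> disc_potential (1 / 2 ^ n + p) \<omega> < of_nat a"
        using elim by blast
      have "1 / 2 ^ n \<in> dyadic_times" using dyadic_timesI[of 1 n] by simp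
      then have "s m - 1 / 2 ^ n \<in> dyadic_times" for m using s(1,2)[of m] n by (intro dyadic_diff) auto
      from a[OF this] have b: "disc_potential (s m) \<omega> < of_nat a" for m by simp
      have "potential 1 (W (s m) \<omega>) \<le> ennreal (exp (t + 1)) * of_nat a" for m
      proof -
        have "potential 1 (W (s m) \<omega>) = ennreal (exp (s m)) * disc_potential (s m) \<omega>"
          by (simp add: disc_potential_def mult.assoc[symmetric] ennreal_mult[symmetric] exp_add[symmetric])
        also have "\<dots> \<le> ennreal (exp (t + 1)) * of_nat a"
          using b[of m] s(3)[of m] by (intro mult_mono ennreal_leI) auto
        finally show ?thesis .
      qed
      moreover have "ennreal (exp (t + 1)) * of_nat a < \<infinity>" by (simp add: ennreal_mult_less_top of_nat_less_top)
      ultimately show False using potential_tendsto_0[OF W top] by (metis not_le)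
    qed
    show ?case
    proof (intro allI impI conjI notI)
      fix t :: real assume t: "0 < t" and "W t \<omega> = 0"
      then have l: "(\<lambda>m. W (right_dyadic m t) \<omega>) \<longlonglongrightarrow> 0"
        using cadlag_dyadic_limit[OF W_cadlag[OF elim(1)], of t] by simp
      have "right_dyadic (Suc m) t < t + 1" for m
      proof -
        have "1 / 2 ^ Suc m < (1::real)" using one_less_power[of "2::real" "Suc m"] by (simp add: field_simps)
        with right_dyadic_le[of "Suc m" t] show ?thesis by linarith
      qed
      moreover have "t / 2 < right_dyadic (Suc m) t" for m
        using t right_dyadic_greater[of t "Suc m"] by linarith
      ultimately show False
        using t by (intro approach[OF t, of "\<lambda>m. right_dyadic (Suc m) t"] LIMSEQ_Suc[OF l] right_dyadic_dyadic) auto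
    next
      fix t :: real assume t: "0 < t" and l: "((\<lambda>s. W s \<omega>) \<longlongrightarrow> 0) (at_left t)"
      have "\<exists>q. q \<in> dyadic_times \<and> max (t / 2) (t - 1 / real (Suc m)) < q \<and> q < t" for m
      proof -
        have "0 \<le> max (t / 2) (t - 1 / real (Suc m))" using t by (intro max.coboundedI1) simp
        moreover have "max (t / 2) (t - 1 / real (Suc m)) < t" using t by simp
        ultimately show ?thesis by (blast elim: dyadic_between)
      qed
      then obtain s where s: "\<And>m. s m \<in> dyadic_times \<and> max (t / 2) (t - 1 / real (Suc m)) < s m \<and> s m < t" by metis
      have "s \<longlonglongrightarrow> t"
      proof (rule real_tendsto_sandwich)
        show "(\<lambda>m. t - 1 / real (Suc m)) \<longlonglongrightarrow> t"
          using tendsto_diff[OF tendsto_const[of t] LIMSEQ_inverse_real_of_nat] by (simp add: inverse_eq_divide)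
        show "(\<lambda>m. t) \<longlonglongrightarrow> t" by simp
      qed (use s in \<open>auto intro!: always_eventually less_imp_le simp: less_max_iff_disj\<close>)
      moreover have "s m \<noteq> t" "s m < t" for m using s[of m] by auto
      ultimately have "filterlim s (at_left t) sequentially"
        by (auto simp: filterlim_at intro!: always_eventually)
      then have "(\<lambda>m. W (s m) \<omega>) \<longlonglongrightarrow> 0" by (rule filterlim_compose[OF l])
      then show False using s t by (intro approach[OF t, of s]) (auto intro: less_trans[of _ t])
    qed
  qed
qed

end

section \<open>Approximation of the local time\<close>

lemma (in finite_measure) AE_summable_of_L1:
  fixes f :: "nat \<Rightarrow> 'a \<Rightarrow> real"
  assumes f: "\<And>n. integrable M (f n)" and c: "\<And>n. (\<integral>\<omega>. \<bar>f n \<omega>\<bar> \<partial>M) \<le> c n" "summable c"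
  shows "AE \<omega> in M. summable (\<lambda>n. \<bar>f n \<omega>\<bar>)"
proof -
  have [measurable]: "f n \<in> borel_measurable M" for n using f by auto
  have "(\<integral>\<^sup>+\<omega>. (\<Sum>n. ennreal \<bar>f n \<omega>\<bar>) \<partial>M) = (\<Sum>n. \<integral>\<^sup>+\<omega>. ennreal \<bar>f n \<omega>\<bar> \<partial>M)"
    by (rule nn_integral_suminf) measurable
  also have "\<dots> \<le> (\<Sum>n. ennreal (c n))"
    using c f by (intro suminf_le) (auto simp: nn_integral_eq_integral intro!: ennreal_leI)
  also have "\<dots> = ennreal (\<Sum>n. c n)"
    by (rule suminf_ennreal2[OF order_trans[OF integral_nonneg_AE c(1)] c(2)]) auto
  finally have "(\<integral>\<^sup>+\<omega>. (\<Sum>n. ennreal \<bar>f n \<omega>\<bar>) \<partial>M) \<noteq> \<infinity>" by (auto simp: top_unique)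
  then have "AE \<omega> in M. (\<Sum>n. ennreal \<bar>f n \<omega>\<bar>) \<noteq> \<infinity>"
    by (rule nn_integral_PInf_AE[rotated]) measurable
  then show ?thesis by eventually_elim (auto intro: summable_suminf_not_top)
qed

text \<open>The series of increments converges absolutely almost surely, and \<open>w\<close>, built
  from the initial value and all absolute increments, is an integrable majorant of the whole
  sequence.\<close>

lemma (in finite_measure) L1_Cauchy_limit:
  fixes X :: "nat \<Rightarrow> 'a \<Rightarrow> real"
  assumes X: "\<And>n. integrable M (X n)"
    and c: "\<And>n. (\<integral>\<omega>. \<bar>X (Suc n) \<omega> - X n \<omega>\<bar> \<partial>M) \<le> c n" "summable c"
  shows "AE \<omega> in M. convergent (\<lambda>n. X n \<omega>)"
    and "Y \<in> borel_measurable M \<Longrightarrow> AE \<omega> in M. (\<lambda>n. X n \<omega>) \<longlonglongrightarrow> Y \<omega> \<Longrightarrow> integrable M Y"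
    and "Y \<in> borel_measurable M \<Longrightarrow> AE \<omega> in M. (\<lambda>n. X n \<omega>) \<longlonglongrightarrow> Y \<omega> \<Longrightarrow> A \<in> sets M \<Longrightarrow>
      (\<lambda>n. \<integral>\<omega>. indicator A \<omega> * X n \<omega> \<partial>M) \<longlonglongrightarrow> (\<integral>\<omega>. indicator A \<omega> * Y \<omega> \<partial>M)"
proof -
  define f where "f n \<omega> = X (Suc n) \<omega> - X n \<omega>" for n \<omega>
  have f: "integrable M (f n)" for n unfolding f_def using X by auto
  have [measurable]: "X n \<in> borel_measurable M" "f n \<in> borel_measurable M" for n using X f by auto
  have sm: "AE \<omega> in M. summable (\<lambda>n. \<bar>f n \<omega>\<bar>)"
    using f c unfolding f_def by (rule AE_summable_of_L1)
  have sum: "(\<Sum>i<n. f i \<omega>) = X n \<omega> - X 0 \<omega>" for n \<omega>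
    unfolding f_def by (rule sum_lessThan_telescope)
  show "AE \<omega> in M. convergent (\<lambda>n. X n \<omega>)"
    using sm
  proof eventually_elim
    case (elim \<omega>)
    then have "(\<lambda>n. X n \<omega> - X 0 \<omega>) \<longlonglongrightarrow> suminf (\<lambda>i. f i \<omega>)"
      using summable_LIMSEQ[OF summable_rabs_cancel[OF elim]] by (simp add: sum)
    from tendsto_add[OF this tendsto_const[of "X 0 \<omega>"]] show ?case by (auto simp: convergent_def)
  qed
  define w where "w \<omega> = \<bar>X 0 \<omega>\<bar> + (\<Sum>n. \<bar>f n \<omega>\<bar>)" for \<omega>
  have "summable (\<lambda>n. \<integral>\<omega>. \<bar>f n \<omega>\<bar> \<partial>M)"
    using c unfolding f_def by (intro summable_comparison_test'[OF c(2)]) auto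
  then have w: "integrable M w"
    unfolding w_def using f sm X by (intro Bochner_Integration.integrable_add integrable_abs integrable_suminf) auto
  have dom: "AE \<omega> in M. \<forall>n. \<bar>X n \<omega>\<bar> \<le> w \<omega>"
    using sm
  proof (eventually_elim, intro allI)
    fix \<omega> n assume s: "summable (\<lambda>n. \<bar>f n \<omega>\<bar>)"
    have "\<bar>X n \<omega>\<bar> = \<bar>X 0 \<omega> + (\<Sum>i<n. f i \<omega>)\<bar>" by (simp add: sum)
    also have "\<dots> \<le> \<bar>X 0 \<omega>\<bar> + (\<Sum>i<n. \<bar>f i \<omega>\<bar>)"
      by (intro order_trans[OF abs_triangle_ineq] add_left_mono sum_abs)
    also have "\<dots> \<le> w \<omega>" unfolding w_def by (intro add_left_mono sum_le_suminf s) auto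
    finally show "\<bar>X n \<omega>\<bar> \<le> w \<omega>" .
  qed
  {
    assume [measurable]: "Y \<in> borel_measurable M" and lim: "AE \<omega> in M. (\<lambda>n. X n \<omega>) \<longlonglongrightarrow> Y \<omega>"
    show "integrable M Y"
      using dom by (intro integrable_dominated_convergence[OF _ _ w lim]) auto
    assume [measurable]: "A \<in> sets M"
    show "(\<lambda>n. \<integral>\<omega>. indicator A \<omega> * X n \<omega> \<partial>M) \<longlonglongrightarrow> (\<integral>\<omega>. indicator A \<omega> * Y \<omega> \<partial>M)"
    proof (rule integral_dominated_convergence[OF _ _ w])
      show "AE \<omega> in M. (\<lambda>n. indicat_real A \<omega> * X n \<omega>) \<longlonglongrightarrow> indicator A \<omega> * Y \<omega>"
        using lim by eventually_elim (intro tendsto_mult tendsto_const)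
      show "AE \<omega> in M. norm (indicat_real A \<omega> * X n \<omega>) \<le> w \<omega>" for n
        using dom by eventually_elim (auto split: split_indicator simp: abs_mult intro: order_trans[OF abs_ge_zero])
    qed measurable
  }
qed

text \<open>\<open>k_integrable\<close> keeps the mean local time finite; \<open>k_decay\<close> is
  what makes the local time constant while the process stays away from zero.\<close>

locale nonpolar_kernel = regenerative_kernel +
  assumes k_integrable: "set_integrable lborel {0<..1} (\<lambda>r. k r 0)"
    and k_decay: "0 < d \<Longrightarrow> ((\<lambda>h. k h d) \<longlongrightarrow> 0) (at_right 0)"
begin

definition g :: "real \<Rightarrow> ennreal \<Rightarrow> real" where
  "g s x = enn2real (\<integral>\<^sup>+r\<in>{..s}. k r x \<partial>lborel)"

text \<open>The bound of \<open>g s\<close> over all states. It tends to 0 with \<open>s\<close>, at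
  no known rate, and controls all second moments below.\<close>

definition U :: "real \<Rightarrow> real" where "U s = g s 0"

text \<open>The content is finiteness: near zero by \<open>k_integrable\<close>, beyond 1 because
  \<open>k r 0\<close> is nonincreasing.\<close>

lemma g_ennreal: "ennreal (g s x) = (\<integral>\<^sup>+r\<in>{..s}. k r x \<partial>lborel)"
proof -
  have "(\<integral>\<^sup>+r\<in>{0<..1}. k r 0 \<partial>lborel) = (\<integral>\<^sup>+r. ennreal (norm (indicat_real {0<..1} r *\<^sub>R k r 0)) \<partial>lborel)"
    by (intro nn_integral_cong) (auto split: split_indicator)
  also have "\<dots> < \<infinity>"
    using k_integrable unfolding set_integrable_def integrable_iff_bounded by simp
  finally have 1: "(\<integral>\<^sup>+r\<in>{0<..1}. k r 0 \<partial>lborel) < \<infinity>" .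
  have "(\<integral>\<^sup>+r\<in>{..s}. k r x \<partial>lborel) \<le> (\<integral>\<^sup>+r. ennreal (k r 0) * indicator {0<..1} r + ennreal (k 1 0) * indicator {1..s} r \<partial>lborel)"
  proof (intro nn_integral_mono)
    fix r :: real
    consider "r \<le> 0" | "0 < r" "r \<le> 1" | "1 < r" by linarith
    then show "ennreal (k r x) * indicator {..s} r \<le> ennreal (k r 0) * indicator {0<..1} r + ennreal (k 1 0) * indicator {1..s} r"
    proof cases
      case 3
      then have "k r x \<le> k 1 0" using k_le_0[of r x] k_dec[of 1 r] by linarith
      with 3 show ?thesis by (auto split: split_indicator intro: ennreal_leI)
    qed (use k_le_0[of r x] in \<open>auto simp: k_neg split: split_indicator intro!: add_increasing2 ennreal_leI\<close>)
  qed
  also have "\<dots> = (\<integral>\<^sup>+r\<in>{0<..1}. k r 0 \<partial>lborel) + ennreal (k 1 0) * emeasure lborel {1..s}"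
    by (subst nn_integral_add) (auto simp: nn_integral_cmult)
  also have "\<dots> < \<infinity>" using 1 by (simp add: ennreal_mult_less_top emeasure_lborel_Icc_eq)
  finally show ?thesis by (simp add: g_def less_top[symmetric])
qed

lemma g_nonneg [simp]: "0 \<le> g s x" by (simp add: g_def)

lemma U_nonneg [simp]: "0 \<le> U s" by (simp add: U_def)

lemma g_measurable [measurable]: "g s \<in> borel_measurable borel"
  unfolding g_def[abs_def] by measurable

lemma g_mono: "s \<le> t \<Longrightarrow> g s x \<le> g t x"
  by (subst ennreal_le_iff[symmetric], simp, unfold g_ennreal)
    (auto intro!: nn_integral_mono split: split_indicator)

lemma g_anti: "x \<le> y \<Longrightarrow> g s y \<le> g s x"
  by (subst ennreal_le_iff[symmetric], simp, unfold g_ennreal)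
    (auto intro!: nn_integral_mono ennreal_leI k_anti split: split_indicator)

lemma g_le_U: "g s x \<le> U s" unfolding U_def by (rule g_anti) simp

lemma U_mono: "s \<le> t \<Longrightarrow> U s \<le> U t" unfolding U_def by (rule g_mono)

lemma g_0 [simp]: "g 0 x = 0"
proof -
  have "(\<integral>\<^sup>+r\<in>{..0}. k r x \<partial>lborel) = (\<integral>\<^sup>+r. 0 \<partial>(lborel :: real measure))"
    by (intro nn_integral_cong) (auto simp: k_neg split: split_indicator)
  then show ?thesis by (simp add: g_def)
qed

lemma U_tendsto_0: "(\<lambda>m. U (1 / 2 ^ m)) \<longlonglongrightarrow> 0"
proof -
  have "(\<lambda>m. \<integral>\<^sup>+r\<in>{..1 / 2 ^ m}. k r 0 \<partial>lborel) \<longlonglongrightarrow> (\<integral>\<^sup>+r. 0 \<partial>(lborel :: real measure))"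
  proof (rule nn_integral_dominated_convergence[where w="\<lambda>r. ennreal (k r 0) * indicator {..1} r"])
    show "(\<integral>\<^sup>+r\<in>{..1}. k r 0 \<partial>lborel) < \<infinity>" by (simp add: g_ennreal[symmetric])
    show "AE r in lborel. ennreal (k r 0) * indicator {..1 / 2 ^ m} r \<le> ennreal (k r 0) * indicator {..1} r" for m
    proof (rule AE_I2)
      fix r :: real
      have "1 / 2 ^ m \<le> (1::real)" by simp
      then have "r \<le> 1" if "r \<le> 1 / 2 ^ m" using that by linarith
      then show "ennreal (k r 0) * indicator {..1 / 2 ^ m} r \<le> ennreal (k r 0) * indicator {..1} r"
        by (auto split: split_indicator)
    qed
    show "AE r in lborel. (\<lambda>m. ennreal (k r 0) * indicator {..1 / 2 ^ m} r) \<longlonglongrightarrow> 0"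
    proof (rule AE_I2)
      fix r :: real
      show "(\<lambda>m. ennreal (k r 0) * indicator {..1 / 2 ^ m} r) \<longlonglongrightarrow> 0"
      proof (cases "r \<le> 0")
        case False
        have "(\<lambda>m. 1 / 2 ^ m) \<longlonglongrightarrow> (0::real)"
          using LIMSEQ_power_zero[of "1 / 2 :: real"] by (simp add: power_one_over)
        then have "eventually (\<lambda>m. 1 / 2 ^ m < r) sequentially" using False by (intro order_tendstoD) auto
        then have "eventually (\<lambda>m. ennreal (k r 0) * indicator {..1 / 2 ^ m} r = 0) sequentially"
          by eventually_elim auto
        then show ?thesis by (rule tendsto_eventually)
      qed (simp add: k_neg)
    qed
  qed measurable
  then have "(\<lambda>m. ennreal (U (1 / 2 ^ m))) \<longlonglongrightarrow> ennreal 0" by (simp add: U_def g_ennreal)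
  then show ?thesis by (subst (asm) tendsto_ennreal_iff) auto
qed

lemma g_shift:
  assumes st: "0 \<le> s" "0 \<le> t" "0 \<le> d" and A: "A \<in> sets (F s)"
  shows "(\<integral>\<^sup>+\<omega>\<in>A. g d (W (s + t) \<omega>) \<partial>M) = (\<integral>\<^sup>+\<omega>\<in>A. (g (t + d) (W s \<omega>) - g t (W s \<omega>)) \<partial>M)"
proof -
  have "(\<integral>\<^sup>+\<omega>\<in>A. g d (W (s + t) \<omega>) \<partial>M) = (\<integral>\<^sup>+\<omega>\<in>A. (\<integral>\<^sup>+h. indicator {..d} h * ennreal (k h (W (s + t) \<omega>)) \<partial>lborel) \<partial>M)"
    by (simp add: g_ennreal mult.commute)
  also have "\<dots> = (\<integral>\<^sup>+\<omega>\<in>A. (\<integral>\<^sup>+r\<in>{t<..}. indicator {..d} (r - t) * ennreal (k r (W s \<omega>)) \<partial>lborel) \<partial>M)"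
    by (rule k_shift_integral[OF st(1,2) A]) measurable
  also have "\<dots> = (\<integral>\<^sup>+\<omega>\<in>A. (g (t + d) (W s \<omega>) - g t (W s \<omega>)) \<partial>M)"
  proof (intro nn_integral_cong arg_cong2[where f="(*)"] refl)
    fix \<omega>
    define x where "x = W s \<omega>"
    have "ennreal (g (t + d) x) = (\<integral>\<^sup>+r. ennreal (k r x) * indicator {..t} r + indicator {..d} (r - t) * ennreal (k r x) * indicator {t<..} r \<partial>lborel)"
      unfolding g_ennreal using st by (intro nn_integral_cong) (auto split: split_indicator)
    also have "\<dots> = ennreal (g t x) + (\<integral>\<^sup>+r\<in>{t<..}. indicator {..d} (r - t) * ennreal (k r x) \<partial>lborel)"
      by (subst nn_integral_add) (auto simp: g_ennreal)
    finally show "(\<integral>\<^sup>+r\<in>{t<..}. indicator {..d} (r - t) * ennreal (k r (W s \<omega>)) \<partial>lborel) = ennreal (g (t + d) (W s \<omega>) - g t (W s \<omega>))"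
      unfolding ennreal_minus[OF g_nonneg, symmetric] by (simp add: x_def ennreal_add_diff_cancel_left)
  qed
  finally show ?thesis .
qed

text \<open>The conditional expectation of the increment of the local time over \<open>[t, t + s]\<close> given the past
  is \<open>g s (W t)\<close>, so the local time at time \<open>i / 2 ^ m\<close> is the limit of the sums of these compensators.\<close>

definition S :: "nat \<Rightarrow> nat \<Rightarrow> 'a \<Rightarrow> real" where
  "S m i \<omega> = (\<Sum>j<i. g (1 / 2 ^ m) (W (real j / 2 ^ m) \<omega>))"

lemma S_0 [simp]: "S m 0 \<omega> = 0" by (simp add: S_def)

lemma S_Suc: "S m (Suc i) \<omega> = S m i \<omega> + g (1 / 2 ^ m) (W (real i / 2 ^ m) \<omega>)" by (simp add: S_def)

lemma S_mono: "i \<le> j \<Longrightarrow> S m i \<omega> \<le> S m j \<omega>"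
  unfolding S_def by (intro sum_mono2) auto

lemma S_nonneg [simp]: "0 \<le> S m i \<omega>" using S_mono[of 0 i m \<omega>] by simp

lemma S_bound: "S m i \<omega> \<le> real i * U (1 / 2 ^ m)"
  unfolding S_def by (rule order_trans[OF sum_mono[OF g_le_U]]) simp

lemma gW_measurable: "0 \<le> s \<Longrightarrow> s \<le> t \<Longrightarrow> (\<lambda>\<omega>. g d (W s \<omega>)) \<in> borel_measurable (F t)"
  by (intro F_measurable_mono[of s t] measurable_compose[OF W_adapted g_measurable])

lemma S_adapted: "real i / 2 ^ m \<le> t \<Longrightarrow> S m i \<in> borel_measurable (F t)"
  unfolding S_def[abs_def]
proof (intro borel_measurable_sum gW_measurable)
  fix j assume "real i / 2 ^ m \<le> t" "j \<in> {..<i}"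
  moreover from this have "real j / 2 ^ m \<le> real i / 2 ^ m" by (intro divide_right_mono) auto
  ultimately show "real j / 2 ^ m \<le> t" by linarith
qed simp

lemma gW_borel [measurable]: "0 \<le> s \<Longrightarrow> (\<lambda>\<omega>. g d (W s \<omega>)) \<in> borel_measurable M"
  by (rule measurable_compose[OF W_measurable g_measurable])

lemma S_measurable [measurable]: "S m i \<in> borel_measurable M"
  by (rule F_measurable[OF _ S_adapted[OF order_refl]]) simp

text \<open>By \<open>g_shift\<close> the conditional mean of each term is a difference of two
  consecutive values of \<open>g\<close> at the present state, so the sum telescopes. The result
  depends on the two times but not on the mesh.\<close>

lemma S_increment:
  assumes "A \<in> sets (F (real i / 2 ^ m))"
  shows "(\<integral>\<^sup>+\<omega>\<in>A. (S m (i + n) \<omega> - S m i \<omega>) \<partial>M) = (\<integral>\<^sup>+\<omega>\<in>A. g (real n / 2 ^ m) (W (real i / 2 ^ m) \<omega>) \<partial>M)"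
proof (induction n)
  case (Suc n)
  have [measurable]: "A \<in> sets M" using assms by (rule F_sets[rotated]) simp
  let ?s = "real i / 2 ^ m" and ?t = "real n / 2 ^ m" and ?d = "1 / 2 ^ m :: real"
  have [measurable]: "(\<lambda>\<omega>. g d (W ?s \<omega>)) \<in> borel_measurable M" "(\<lambda>\<omega>. g d (W (?s + ?t) \<omega>)) \<in> borel_measurable M" for d
    by (intro gW_borel; simp)+
  have st: "?s + ?t = real (i + n) / 2 ^ m" "?t + ?d = real (Suc n) / 2 ^ m" by (simp_all add: add_divide_distrib)
  have "(\<integral>\<^sup>+\<omega>\<in>A. (S m (i + Suc n) \<omega> - S m i \<omega>) \<partial>M) = (\<integral>\<^sup>+\<omega>. ennreal (S m (i + n) \<omega> - S m i \<omega>) * indicator A \<omega> + ennreal (g ?d (W (?s + ?t) \<omega>)) * indicator A \<omega> \<partial>M)"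
    unfolding st(1) by (intro nn_integral_cong) (auto simp: S_Suc S_mono ennreal_plus[symmetric] algebra_simps simp del: ennreal_plus split: split_indicator)
  also have "\<dots> = (\<integral>\<^sup>+\<omega>\<in>A. (S m (i + n) \<omega> - S m i \<omega>) \<partial>M) + (\<integral>\<^sup>+\<omega>\<in>A. g ?d (W (?s + ?t) \<omega>) \<partial>M)"
    by (rule nn_integral_add) measurable
  also have "\<dots> = (\<integral>\<^sup>+\<omega>\<in>A. g ?t (W ?s \<omega>) \<partial>M) + (\<integral>\<^sup>+\<omega>\<in>A. (g (?t + ?d) (W ?s \<omega>) - g ?t (W ?s \<omega>)) \<partial>M)"
    unfolding Suc.IH by (subst g_shift) (auto simp: assms)
  also have "\<dots> = (\<integral>\<^sup>+\<omega>. ennreal (g ?t (W ?s \<omega>)) * indicator A \<omega> + ennreal (g (?t + ?d) (W ?s \<omega>) - g ?t (W ?s \<omega>)) * indicator A \<omega> \<partial>M)"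
    by (rule nn_integral_add[symmetric]) measurable
  also have "\<dots> = (\<integral>\<^sup>+\<omega>\<in>A. g (real (Suc n) / 2 ^ m) (W ?s \<omega>) \<partial>M)"
    unfolding st(2)[symmetric]
    by (intro nn_integral_cong) (auto simp: g_mono ennreal_plus[symmetric] simp del: ennreal_plus split: split_indicator)
  finally show ?case .
qed simp

lemma S_increment_weighted:
  fixes Z :: "'a \<Rightarrow> real"
  assumes Z: "Z \<in> borel_measurable (F (real i / 2 ^ m))" and nn: "\<And>\<omega>. 0 \<le> Z \<omega>"
  shows "expectation (\<lambda>\<omega>. Z \<omega> * (S m (i + n) \<omega> - S m i \<omega>)) = expectation (\<lambda>\<omega>. Z \<omega> * g (real n / 2 ^ m) (W (real i / 2 ^ m) \<omega>))"
proof -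
  have [measurable]: "Z \<in> borel_measurable M" by (rule F_measurable[OF _ Z]) simp
  have "(\<integral>\<^sup>+\<omega>. ennreal (Z \<omega>) * ennreal (S m (i + n) \<omega> - S m i \<omega>) \<partial>M) = (\<integral>\<^sup>+\<omega>. ennreal (Z \<omega>) * ennreal (g (real n / 2 ^ m) (W (real i / 2 ^ m) \<omega>)) \<partial>M)"
    using Z by (intro nn_integral_eq_on_subalgebra[OF F_sub[of "real i / 2 ^ m"]] S_increment) auto
  then show ?thesis
    by (subst (1 2) integral_eq_nn_integral) (auto simp: nn S_mono ennreal_mult)
qed

text \<open>Boundedness passes to sums and products, which settles the integrability conditions in
  the second moment estimates.\<close>

definition bounded_rv :: "('a \<Rightarrow> real) \<Rightarrow> bool" where
  "bounded_rv f \<longleftrightarrow> f \<in> borel_measurable M \<and> (\<exists>B. \<forall>\<omega>. \<bar>f \<omega>\<bar> \<le> B)"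

lemma bounded_rv_integrable: "bounded_rv f \<Longrightarrow> integrable M f"
  unfolding bounded_rv_def by (elim conjE exE) (rule integrable_const_bound, auto)

lemma bounded_rv_const: "bounded_rv (\<lambda>_. c)" by (auto simp: bounded_rv_def)

lemma bounded_rv_g: "0 \<le> t \<Longrightarrow> bounded_rv (\<lambda>\<omega>. g d (W t \<omega>))"
  unfolding bounded_rv_def by (auto intro!: exI[of _ "U d"] g_le_U)

lemma bounded_rv_S: "bounded_rv (S m i)"
  unfolding bounded_rv_def using S_bound by (auto intro!: exI[of _ "real i * U (1 / 2 ^ m)"])

lemma bounded_rv_add: "bounded_rv f \<Longrightarrow> bounded_rv h \<Longrightarrow> bounded_rv (\<lambda>\<omega>. f \<omega> + h \<omega>)"
  unfolding bounded_rv_def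
proof safe
  fix B C assume "\<forall>\<omega>. \<bar>f \<omega>\<bar> \<le> B" "\<forall>\<omega>. \<bar>h \<omega>\<bar> \<le> C"
  then have "\<bar>f \<omega> + h \<omega>\<bar> \<le> B + C" for \<omega> by (intro order_trans[OF abs_triangle_ineq] add_mono) auto
  then show "\<exists>B. \<forall>\<omega>. \<bar>f \<omega> + h \<omega>\<bar> \<le> B" by blast
qed auto

lemma bounded_rv_mult: "bounded_rv f \<Longrightarrow> bounded_rv h \<Longrightarrow> bounded_rv (\<lambda>\<omega>. f \<omega> * h \<omega>)"
  unfolding bounded_rv_def
proof safe
  fix B C assume b: "\<forall>\<omega>. \<bar>f \<omega>\<bar> \<le> B" "\<forall>\<omega>. \<bar>h \<omega>\<bar> \<le> C"
  have "\<bar>f \<omega> * h \<omega>\<bar> \<le> B * C" for \<omega>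
    unfolding abs_mult using b by (intro mult_mono) (auto intro: order_trans[OF abs_ge_zero])
  then show "\<exists>B. \<forall>\<omega>. \<bar>f \<omega> * h \<omega>\<bar> \<le> B" by blast
qed auto

lemma bounded_rv_diff: "bounded_rv f \<Longrightarrow> bounded_rv h \<Longrightarrow> bounded_rv (\<lambda>\<omega>. f \<omega> - h \<omega>)"
  using bounded_rv_add[OF _ bounded_rv_mult[OF bounded_rv_const[of "-1"]], of f h] by simp

lemmas bounded_rv_intros = bounded_rv_const bounded_rv_g bounded_rv_S bounded_rv_add bounded_rv_mult bounded_rv_diff

lemma S_expectation: "expectation (\<lambda>\<omega>. S m (i + n) \<omega> - S m i \<omega>) = expectation (\<lambda>\<omega>. g (real n / 2 ^ m) (W (real i / 2 ^ m) \<omega>))"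
  using S_increment_weighted[of "\<lambda>_. 1" i m n] by simp

lemma S_expectation_le: "expectation (S m i) \<le> U (real i / 2 ^ m)"
  using S_expectation[of m 0 i] g_le_U
  by (auto intro!: integral_le_const bounded_rv_integrable bounded_rv_intros)

text \<open>Write the increment as R = g + R' with g its first term. Then R^2 \<le> R'^2 + 2 g R,
  and given the past the mean of R is at most \<open>U (real (Suc n) / 2 ^ m)\<close>, so each
  induction step costs at most twice this bound times the mean of g.\<close>

lemma S_increment_square:
  "expectation (\<lambda>\<omega>. (S m (i + n) \<omega> - S m i \<omega>)\<^sup>2) \<le> 2 * U (real n / 2 ^ m) * expectation (\<lambda>\<omega>. S m (i + n) \<omega> - S m i \<omega>)"
proof (induction n arbitrary: i)
  case (Suc n)
  let ?g = "\<lambda>\<omega>. g (1 / 2 ^ m) (W (real i / 2 ^ m) \<omega>)"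
  let ?R = "\<lambda>\<omega>. S m (i + Suc n) \<omega> - S m i \<omega>" and ?R' = "\<lambda>\<omega>. S m (Suc i + n) \<omega> - S m (Suc i) \<omega>"
  have R: "?R \<omega> = ?g \<omega> + ?R' \<omega>" for \<omega> by (simp add: S_Suc)
  have int: "integrable M ?R" "integrable M ?R'" "integrable M ?g"
    by (intro bounded_rv_integrable bounded_rv_intros; simp)+
  have sq: "integrable M (\<lambda>\<omega>. (?R \<omega>)\<^sup>2)" "integrable M (\<lambda>\<omega>. (?R' \<omega>)\<^sup>2)" "integrable M (\<lambda>\<omega>. ?g \<omega> * ?R \<omega>)"
    unfolding power2_eq_square by (intro bounded_rv_integrable bounded_rv_intros; simp)+
  have "expectation (\<lambda>\<omega>. (?R \<omega>)\<^sup>2) \<le> expectation (\<lambda>\<omega>. (?R' \<omega>)\<^sup>2 + 2 * (?g \<omega> * ?R \<omega>))"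
  proof (rule integral_mono)
    fix \<omega>
    show "(?R \<omega>)\<^sup>2 \<le> (?R' \<omega>)\<^sup>2 + 2 * (?g \<omega> * ?R \<omega>)"
      unfolding R by (simp add: power2_eq_square algebra_simps)
  qed (use sq in auto)
  also have "\<dots> = expectation (\<lambda>\<omega>. (?R' \<omega>)\<^sup>2) + 2 * expectation (\<lambda>\<omega>. ?g \<omega> * ?R \<omega>)"
    using sq by simp
  also have "expectation (\<lambda>\<omega>. ?g \<omega> * ?R \<omega>) = expectation (\<lambda>\<omega>. ?g \<omega> * g (real (Suc n) / 2 ^ m) (W (real i / 2 ^ m) \<omega>))"
    by (rule S_increment_weighted) (auto intro: gW_measurable)
  also have "\<dots> \<le> expectation (\<lambda>\<omega>. U (real (Suc n) / 2 ^ m) * ?g \<omega>)"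
  proof (rule integral_mono)
    fix \<omega>
    show "?g \<omega> * g (real (Suc n) / 2 ^ m) (W (real i / 2 ^ m) \<omega>) \<le> U (real (Suc n) / 2 ^ m) * ?g \<omega>"
      by (subst mult.commute) (intro mult_right_mono g_le_U g_nonneg)
  qed (intro bounded_rv_integrable bounded_rv_intros; simp)+
  also have "\<dots> = U (real (Suc n) / 2 ^ m) * expectation ?g" by simp
  also have "expectation (\<lambda>\<omega>. (?R' \<omega>)\<^sup>2) \<le> 2 * U (real (Suc n) / 2 ^ m) * expectation ?R'"
  proof (rule order_trans[OF Suc.IH])
    have "0 \<le> expectation ?R'" by (intro integral_nonneg_AE) (auto intro!: S_mono)
    moreover have "U (real n / 2 ^ m) \<le> U (real (Suc n) / 2 ^ m)" by (intro U_mono divide_right_mono) auto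
    ultimately show "2 * U (real n / 2 ^ m) * expectation ?R' \<le> 2 * U (real (Suc n) / 2 ^ m) * expectation ?R'"
      by (intro mult_right_mono mult_left_mono) auto
  qed
  also have "2 * U (real (Suc n) / 2 ^ m) * expectation ?R' + 2 * (U (real (Suc n) / 2 ^ m) * expectation ?g)
      = 2 * U (real (Suc n) / 2 ^ m) * (expectation ?g + expectation ?R')" by (simp add: algebra_simps)
  also have "expectation ?g + expectation ?R' = expectation ?R"
    unfolding R using int by (intro Bochner_Integration.integral_add[symmetric]) auto
  finally show ?case by simp
qed simp

text \<open>At the times i / 2 ^ m the difference of the two sums is a martingale, because the
  coarse term \<open>?b\<close> is the conditional mean of the fine increment \<open>?a\<close>.
  Hence second moments add up. In the constant 3, a 2 comes from \<open>S_increment_square\<close>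
  for \<open>?a\<close> and a 1 from bounding the square of \<open>?b\<close> by
  \<open>U (1 / 2 ^ m)\<close> times \<open>?b\<close>.\<close>

lemma S_refine_square:
  assumes "m \<le> m'"
  shows "expectation (\<lambda>\<omega>. (S m' (i * 2 ^ (m' - m)) \<omega> - S m i \<omega>)\<^sup>2) \<le> 3 * U (1 / 2 ^ m) * expectation (S m' (i * 2 ^ (m' - m)))"
proof (induction i)
  case (Suc i)
  define p :: nat where "p = 2 ^ (m' - m)"
  have p: "real (i * p) / 2 ^ m' = real i / 2 ^ m" "real p / 2 ^ m' = 1 / 2 ^ m" for i
  proof -
    have "(2::real) ^ m' = 2 ^ (m' - m) * 2 ^ m" using assms by (simp flip: power_add)
    then show "real (i * p) / 2 ^ m' = real i / 2 ^ m" "real p / 2 ^ m' = 1 / 2 ^ m" by (simp_all add: p_def)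
  qed
  let ?D = "\<lambda>\<omega>. S m' (i * p) \<omega> - S m i \<omega>"
  let ?a = "\<lambda>\<omega>. S m' (i * p + p) \<omega> - S m' (i * p) \<omega>" and ?b = "\<lambda>\<omega>. g (1 / 2 ^ m) (W (real i / 2 ^ m) \<omega>)"
  have D: "S m' (Suc i * p) \<omega> - S m (Suc i) \<omega> = ?D \<omega> + (?a \<omega> - ?b \<omega>)" for \<omega>
    by (simp add: S_Suc add.commute)
  have int: "integrable M ?a" "integrable M ?b"
    by (intro bounded_rv_integrable bounded_rv_intros; simp)+
  have ip: "integrable M (\<lambda>\<omega>. (?D \<omega>)\<^sup>2)" "integrable M (\<lambda>\<omega>. (?a \<omega>)\<^sup>2)"
    "integrable M (\<lambda>\<omega>. ?D \<omega> * ?a \<omega>)" "integrable M (\<lambda>\<omega>. ?D \<omega> * ?b \<omega>)"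
    "integrable M (\<lambda>\<omega>. S m' (i * p) \<omega> * ?a \<omega>)" "integrable M (\<lambda>\<omega>. S m i \<omega> * ?a \<omega>)"
    "integrable M (\<lambda>\<omega>. S m' (i * p) \<omega> * ?b \<omega>)" "integrable M (\<lambda>\<omega>. S m i \<omega> * ?b \<omega>)"
    unfolding power2_eq_square by (intro bounded_rv_integrable bounded_rv_intros; simp)+
  \<comment> \<open>Orthogonality is checked separately for the two parts of \<open>?D\<close>,
    since \<open>S_increment_weighted\<close> asks for a nonnegative weight.\<close>
  have "expectation (\<lambda>\<omega>. S m' (i * p) \<omega> * ?a \<omega>) = expectation (\<lambda>\<omega>. S m' (i * p) \<omega> * ?b \<omega>)"
    "expectation (\<lambda>\<omega>. S m i \<omega> * ?a \<omega>) = expectation (\<lambda>\<omega>. S m i \<omega> * ?b \<omega>)"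
    using S_increment_weighted[of "S m' (i * p)" "i * p" m' p] S_increment_weighted[of "S m i" "i * p" m' p]
      S_adapted[of "i * p" m' "real i / 2 ^ m"] S_adapted[of i m "real i / 2 ^ m"]
    unfolding p by auto
  then have orth: "expectation (\<lambda>\<omega>. ?D \<omega> * ?a \<omega>) = expectation (\<lambda>\<omega>. ?D \<omega> * ?b \<omega>)"
    using ip by (simp add: left_diff_distrib)
  have ab: "expectation ?b = expectation ?a" using S_expectation[of m' "i * p" p] unfolding p by simp
  have "expectation (\<lambda>\<omega>. (?D \<omega> + (?a \<omega> - ?b \<omega>))\<^sup>2)
      \<le> expectation (\<lambda>\<omega>. (?D \<omega>)\<^sup>2 + 2 * (?D \<omega> * ?a \<omega>) - 2 * (?D \<omega> * ?b \<omega>) + (?a \<omega>)\<^sup>2 + U (1 / 2 ^ m) * ?b \<omega>)"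
  proof (rule integral_mono)
    show "integrable M (\<lambda>\<omega>. (?D \<omega> + (?a \<omega> - ?b \<omega>))\<^sup>2)"
      unfolding power2_eq_square by (intro bounded_rv_integrable bounded_rv_intros) simp_all
    show "integrable M (\<lambda>\<omega>. (?D \<omega>)\<^sup>2 + 2 * (?D \<omega> * ?a \<omega>) - 2 * (?D \<omega> * ?b \<omega>) + (?a \<omega>)\<^sup>2 + U (1 / 2 ^ m) * ?b \<omega>)"
      using ip int by (intro Bochner_Integration.integrable_add Bochner_Integration.integrable_diff integrable_mult_right) auto
    fix \<omega>
    have "?b \<omega> * ?b \<omega> \<le> U (1 / 2 ^ m) * ?b \<omega>" by (intro mult_right_mono g_le_U) simp
    moreover have "0 \<le> ?a \<omega> * ?b \<omega>" by (intro mult_nonneg_nonneg) (auto intro!: S_mono)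
    moreover have "(x + (y - z))\<^sup>2 = x\<^sup>2 + 2 * (x * y) - 2 * (x * z) + y\<^sup>2 + z * z - 2 * (y * z)" for x y z :: real
      by (simp add: power2_eq_square algebra_simps)
    ultimately show "(?D \<omega> + (?a \<omega> - ?b \<omega>))\<^sup>2 \<le> (?D \<omega>)\<^sup>2 + 2 * (?D \<omega> * ?a \<omega>) - 2 * (?D \<omega> * ?b \<omega>) + (?a \<omega>)\<^sup>2 + U (1 / 2 ^ m) * ?b \<omega>"
      by (smt (verit, ccfv_threshold))
  qed
  also have "\<dots> = expectation (\<lambda>\<omega>. (?D \<omega>)\<^sup>2) + expectation (\<lambda>\<omega>. (?a \<omega>)\<^sup>2) + U (1 / 2 ^ m) * expectation ?a"
    using ip int orth ab by simp
  also have "\<dots> \<le> 3 * U (1 / 2 ^ m) * expectation (S m' (i * p)) + 2 * U (1 / 2 ^ m) * expectation ?a + U (1 / 2 ^ m) * expectation ?a"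
    using Suc.IH S_increment_square[of m' "i * p" p] by (simp add: p p_def[symmetric])
  also have "\<dots> = 3 * U (1 / 2 ^ m) * expectation (S m' (Suc i * p))"
  proof -
    have "expectation (S m' (i * p + p)) = expectation (S m' (i * p)) + expectation ?a"
      by (simp add: bounded_rv_integrable bounded_rv_S)
    then show ?thesis by (simp add: algebra_simps)
  qed
  finally show ?case by (simp only: p_def[symmetric] D)
qed simp

end

text \<open>If all increments over cells of mesh 1 / 2 ^ m are at most e / 4, the extension varies
  by less than e over three adjacent cells.\<close>

lemma dyadic_extension:
  fixes l :: "real \<Rightarrow> real"
  assumes l0: "l 0 = 0"
    and mono: "\<And>p q. p \<in> dyadic_times \<Longrightarrow> q \<in> dyadic_times \<Longrightarrow> p \<le> q \<Longrightarrow> l p \<le> l q"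
    and osc: "\<And>T e. 0 < e \<Longrightarrow> \<exists>m. \<forall>j<T * 2 ^ m. l (real (Suc j) / 2 ^ m) - l (real j / 2 ^ m) \<le> e"
  defines "L \<equiv> \<lambda>t. SUP q\<in>{q\<in>dyadic_times. q \<le> t}. l q"
  shows "q \<in> dyadic_times \<Longrightarrow> L q = l q" and "mono_on {0..} L" and "continuous_on {0..} L"
proof -
  show eq: "L q = l q" if "q \<in> dyadic_times" for q
    unfolding L_def using that mono by (intro cSup_eq_maximum) auto
  have bdd: "bdd_above (l ` {q\<in>dyadic_times. q \<le> t})" if "0 \<le> t" for t
    using that mono right_dyadic_dyadic right_dyadic_greater[of t 0]
    by (intro bdd_aboveI[of _ "l (right_dyadic 0 t)"]) auto
  show mono_L: "mono_on {0..} L"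
  proof (rule mono_onI)
    fix s t :: real assume "s \<in> {0..}" "t \<in> {0..}" "s \<le> t"
    then show "L s \<le> L t"
      unfolding L_def by (intro cSUP_subset_mono bdd) (auto intro: exI[of _ 0])
  qed
  show "continuous_on {0..} L"
    unfolding continuous_on_iff
  proof (intro ballI allI impI)
    fix t e :: real assume t: "t \<in> {0..}" and e: "0 < e"
    \<comment> \<open>The 4 leaves room for the cells after the one containing
      \<open>t\<close>.\<close>
    define T where "T = nat \<lceil>t\<rceil> + 4"
    obtain m where m: "\<And>j. j < T * 2 ^ m \<Longrightarrow> l (real (Suc j) / 2 ^ m) - l (real j / 2 ^ m) \<le> e / 4"
      using osc[of "e / 4" T] e by auto
    define j where "j = nat \<lfloor>t * 2 ^ m\<rfloor>"
    have j: "real j \<le> t * 2 ^ m" "t * 2 ^ m < real j + 1" using t by (auto simp: j_def)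
    have "t \<le> real (nat \<lceil>t\<rceil>)" by linarith
    then have "t * 2 ^ m \<le> real (nat \<lceil>t\<rceil>) * 2 ^ m" by (intro mult_right_mono) auto
    with j(1) have "real j \<le> real (nat \<lceil>t\<rceil>) * 2 ^ m" by linarith
    then have "real j \<le> real (nat \<lceil>t\<rceil> * 2 ^ m)" by simp
    then have "j \<le> nat \<lceil>t\<rceil> * 2 ^ m" by (simp only: of_nat_le_iff)
    moreover have "1 \<le> (2::nat) ^ m" by simp
    ultimately have jT: "j + 3 < T * 2 ^ m" unfolding T_def distrib_right by linarith
    \<comment> \<open>The cell of \<open>t\<close> with its two neighbours contains every
      \<open>s\<close> at distance less than 1 / 2 ^ m. For \<open>j = 0\<close> the truncated
      subtraction cuts this window off at 0.\<close>
    define a b where "a = real (j - 1) / 2 ^ m" and "b = real (j + 2) / 2 ^ m"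
    have ab: "L b - L a < e"
    proof -
      have i: "l (real (j + 2) / 2 ^ m) - l (real (j + 1) / 2 ^ m) \<le> e / 4" "l (real (j + 1) / 2 ^ m) - l (real j / 2 ^ m) \<le> e / 4"
        using m[of "j + 1"] m[of j] jT by (simp_all add: algebra_simps)
      have "l (real j / 2 ^ m) - l (real (j - 1) / 2 ^ m) \<le> e / 4"
        using m[of "j - 1"] jT e by (cases j) auto
      with i e show ?thesis unfolding a_def b_def eq[OF dyadic_timesI] by linarith
    qed
    show "\<exists>d>0. \<forall>s\<in>{0..}. dist s t < d \<longrightarrow> dist (L s) (L t) < e"
    proof (intro exI[of _ "1 / 2 ^ m"] conjI ballI impI)
      fix s :: real assume s: "s \<in> {0..}" "dist s t < 1 / 2 ^ m"
      then have "\<bar>s - t\<bar> * 2 ^ m < 1" by (simp add: dist_real_def pos_less_divide_eq)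
      moreover have "\<bar>s - t\<bar> * 2 ^ m = \<bar>s * 2 ^ m - t * 2 ^ m\<bar>" by (simp add: left_diff_distrib[symmetric] abs_mult)
      ultimately have d: "s * 2 ^ m < t * 2 ^ m + 1" "t * 2 ^ m < s * 2 ^ m + 1" by linarith+
      have "0 \<le> s * 2 ^ m" "0 \<le> t * 2 ^ m" using s t by simp_all
      moreover have "real (j - 1) = 0 \<or> real (j - 1) = real j - 1" by (cases j) auto
      ultimately have "real (j - 1) \<le> s * 2 ^ m" "s * 2 ^ m \<le> real (j + 2)" "real (j - 1) \<le> t * 2 ^ m" "t * 2 ^ m \<le> real (j + 2)"
        using j d by auto
      then have "a \<le> s" "s \<le> b" "a \<le> t" "t \<le> b" by (simp_all add: a_def b_def pos_divide_le_eq pos_le_divide_eq)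
      moreover have "0 \<le> a" by (simp add: a_def)
      ultimately have "L a \<le> L s" "L s \<le> L b" "L a \<le> L t" "L t \<le> L b"
        using mono_L by (auto simp: mono_on_def)
      with ab show "dist (L s) (L t) < e" by (simp add: dist_real_def abs_less_iff)
    qed simp
  qed
qed

section \<open>The almost sure limit along dyadic times\<close>

context nonpolar_kernel
begin

lemma integrable_indicator_mult:
  "A \<in> sets M \<Longrightarrow> integrable M f \<Longrightarrow> integrable M (\<lambda>\<omega>. indicator A \<omega> * f \<omega> :: real)"
  using integrable_real_mult_indicator[of A M f] by (simp add: mult.commute)

text \<open>A subsequence of levels that forces a rate on the convergence of \<open>U\<close> to 0.
  The rate 1 / 8 ^ n stays summable after the multiplication by 2 ^ n in
  \<open>approx_Cauchy\<close>.\<close>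

definition lev :: "nat \<Rightarrow> nat" where
  "lev = (SOME r. strict_mono r \<and> (\<forall>n. U (1 / 2 ^ r n) \<le> 1 / 8 ^ n))"

lemma lev: "strict_mono lev" "U (1 / 2 ^ lev n) \<le> 1 / 8 ^ n"
proof -
  have "\<exists>N. \<forall>m\<ge>N. U (1 / 2 ^ m) \<le> 1 / 8 ^ n" for n :: nat
    using order_tendstoD(2)[OF U_tendsto_0, of "1 / 8 ^ n"] by (auto simp: eventually_sequentially intro: less_imp_le)
  then obtain N where N: "\<And>n m. N n \<le> m \<Longrightarrow> U (1 / 2 ^ m) \<le> 1 / 8 ^ n" by metis
  define r where "r n = n + (\<Sum>i\<le>n. N i)" for n
  have "strict_mono r" by (auto simp: strict_mono_Suc_iff r_def)
  moreover have "N n \<le> r n" for n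
    unfolding r_def by (intro trans_le_add2 member_le_sum) auto
  ultimately have "\<exists>r. strict_mono r \<and> (\<forall>n. U (1 / 2 ^ r n) \<le> 1 / 8 ^ n)" using N by blast
  from someI_ex[OF this] show "strict_mono lev" "U (1 / 2 ^ lev n) \<le> 1 / 8 ^ n" unfolding lev_def by auto
qed

lemma lev_ge: "n \<le> lev n" using lev(1) by (rule strict_mono_imp_increasing)

lemma lev_mono: "m \<le> n \<Longrightarrow> lev m \<le> lev n" using lev(1) by (simp add: strict_mono_less_eq)

definition approx :: "nat \<Rightarrow> real \<Rightarrow> 'a \<Rightarrow> real" where
  "approx n t = S (lev n) (nat \<lfloor>t * 2 ^ lev n\<rfloor>)"

lemma approx_dyadic: "l \<le> lev n \<Longrightarrow> approx n (real i / 2 ^ l) = S (lev n) (i * 2 ^ (lev n - l))"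
proof -
  assume l: "l \<le> lev n"
  then have "(2::real) ^ lev n = 2 ^ (lev n - l) * 2 ^ l" by (simp flip: power_add)
  then have "real i / 2 ^ l * 2 ^ lev n = real (i * 2 ^ (lev n - l))" by simp
  then show ?thesis by (simp only: approx_def floor_of_nat nat_int)
qed

lemma approx_mono: "0 \<le> s \<Longrightarrow> s \<le> t \<Longrightarrow> approx n s \<omega> \<le> approx n t \<omega>"
  unfolding approx_def by (intro S_mono nat_mono floor_mono mult_right_mono) auto

lemma approx_0 [simp]: "approx n 0 \<omega> = 0" by (simp add: approx_def)

lemma approx_measurable [measurable]: "approx n t \<in> borel_measurable M" by (simp add: approx_def)

lemma approx_adapted: "0 \<le> t \<Longrightarrow> approx n t \<in> borel_measurable (F t)"
  unfolding approx_def by (intro S_adapted) (simp add: pos_divide_le_eq)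

lemma approx_integrable: "integrable M (approx n t)"
  unfolding approx_def by (intro bounded_rv_integrable bounded_rv_S)

lemma dyadic_index_scale: "l \<le> m \<Longrightarrow> real (i * 2 ^ (m - l)) / 2 ^ m = real i / 2 ^ l"
proof -
  assume l: "l \<le> m"
  then have "(2::real) ^ m = 2 ^ (m - l) * 2 ^ l" by (simp flip: power_add)
  then show ?thesis by simp
qed

text \<open>\<open>S_refine_square\<close> bounds the second moment of the difference by a multiple
  of 1 / 8 ^ n, and \<bar>x\<bar> \<le> 1 / 2 ^ n + 2 ^ n x^2 turns this into a summable bound in
  L1.\<close>

lemma approx_Cauchy:
  assumes "l \<le> n"
  shows "expectation (\<lambda>\<omega>. \<bar>approx (Suc n) (real i / 2 ^ l) \<omega> - approx n (real i / 2 ^ l) \<omega>\<bar>) \<le> (1 / 2) ^ n * (1 + 3 * U (real i / 2 ^ l))"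
proof -
  define t where "t = real i / 2 ^ l"
  have ln: "l \<le> lev n" "l \<le> lev (Suc n)" "lev n \<le> lev (Suc n)" using lev_ge[of n] lev_mono[of n "Suc n"] assms by auto
  have idx: "i * 2 ^ (lev n - l) * 2 ^ (lev (Suc n) - lev n) = i * 2 ^ (lev (Suc n) - l)"
    using ln by (simp add: mult.assoc flip: power_add)
  let ?d = "\<lambda>\<omega>. approx (Suc n) t \<omega> - approx n t \<omega>"
  have "expectation (\<lambda>\<omega>. (?d \<omega>)\<^sup>2) \<le> 3 * U (1 / 2 ^ lev n) * expectation (approx (Suc n) t)"
    using S_refine_square[OF ln(3), of "i * 2 ^ (lev n - l)"]
    unfolding t_def idx approx_dyadic[OF ln(1)] approx_dyadic[OF ln(2)] .
  also have "\<dots> \<le> 3 * (1 / 8 ^ n) * U t"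
  proof (intro mult_mono lev)
    show "expectation (approx (Suc n) t) \<le> U t"
      using S_expectation_le[of "lev (Suc n)" "i * 2 ^ (lev (Suc n) - l)"]
      unfolding t_def approx_dyadic[OF ln(2)] dyadic_index_scale[OF ln(2)] .
    show "0 \<le> expectation (approx (Suc n) t)" by (intro integral_nonneg_AE) (simp add: approx_def)
  qed (auto simp: lev)
  finally have sq: "expectation (\<lambda>\<omega>. (?d \<omega>)\<^sup>2) \<le> 3 * (1 / 8 ^ n) * U t" .
  have int: "integrable M (\<lambda>\<omega>. (?d \<omega>)\<^sup>2)" "integrable M ?d"
    unfolding power2_eq_square approx_def by (intro bounded_rv_integrable bounded_rv_intros)+
  have "expectation (\<lambda>\<omega>. \<bar>?d \<omega>\<bar>) \<le> expectation (\<lambda>\<omega>. (1 / 2) ^ n + 2 ^ n * (?d \<omega>)\<^sup>2)"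
  proof (rule integral_mono)
    fix \<omega>
    define x where "x = \<bar>?d \<omega>\<bar>"
    have "x \<le> (1 / 2) ^ n + 2 ^ n * x\<^sup>2"
    proof (cases "x \<le> (1 / 2) ^ n")
      case True
      moreover have "0 \<le> 2 ^ n * x\<^sup>2" by simp
      ultimately show ?thesis by linarith
    next
      case False
      then have "1 < 2 ^ n * x" by (simp add: power_one_over field_simps)
      moreover have "0 \<le> x" by (simp add: x_def)
      ultimately have "1 * x \<le> (2 ^ n * x) * x" by (intro mult_right_mono) auto
      moreover have "0 \<le> (1 / 2 :: real) ^ n" by simp
      ultimately show ?thesis unfolding power2_eq_square by (simp only: mult.assoc)
    qed
    then show "\<bar>?d \<omega>\<bar> \<le> (1 / 2) ^ n + 2 ^ n * (?d \<omega>)\<^sup>2" by (simp add: x_def)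
  qed (use int in auto)
  also have "\<dots> = (1 / 2) ^ n + 2 ^ n * expectation (\<lambda>\<omega>. (?d \<omega>)\<^sup>2)" using int by (simp add: prob_space)
  also have "\<dots> \<le> (1 / 2) ^ n + 2 ^ n * (3 * (1 / 8 ^ n) * U t)"
    using sq by (intro add_left_mono mult_left_mono) auto
  also have "2 ^ n * (3 * (1 / 8 ^ n) * U t) = (1 / 4) ^ n * (3 * U t)"
  proof -
    have "(8::real) ^ n = 2 ^ n * 4 ^ n" by (simp flip: power_mult_distrib)
    then show ?thesis by (simp add: power_one_over field_simps)
  qed
  also have "(1 / 4) ^ n * (3 * U t) \<le> (1 / 2) ^ n * (3 * U t)"
    by (intro mult_right_mono power_mono) auto
  finally show ?thesis by (simp add: t_def algebra_simps)
qed

definition dlim :: "real \<Rightarrow> 'a \<Rightarrow> real" where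
  "dlim t \<omega> = lim (\<lambda>n. approx n t \<omega>)"

lemma dlim_measurable [measurable]: "dlim t \<in> borel_measurable M"
  unfolding dlim_def[abs_def] by measurable

lemma approx_limit:
  assumes "t \<in> dyadic_times"
  shows "AE \<omega> in M. (\<lambda>n. approx n t \<omega>) \<longlonglongrightarrow> dlim t \<omega>"
    and "integrable M (dlim t)"
    and "A \<in> sets M \<Longrightarrow> (\<lambda>n. expectation (\<lambda>\<omega>. indicator A \<omega> * approx n t \<omega>)) \<longlonglongrightarrow> expectation (\<lambda>\<omega>. indicator A \<omega> * dlim t \<omega>)"
proof -
  from assms obtain i l where t: "t = real i / 2 ^ l" by (auto simp: dyadic_times_def)
  have c: "expectation (\<lambda>\<omega>. \<bar>approx (Suc n + l) t \<omega> - approx (n + l) t \<omega>\<bar>) \<le> (1 / 2) ^ (n + l) * (1 + 3 * U t)" for n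
    using approx_Cauchy[of l "n + l" i] by (simp add: t)
  have s: "summable (\<lambda>n. (1 / 2) ^ (n + l) * (1 + 3 * U t))"
    by (intro summable_mult2 summable_ignore_initial_segment summable_geometric) simp
  note L1 = L1_Cauchy_limit[of "\<lambda>n. approx (n + l) t", OF approx_integrable c s]
  show lim: "AE \<omega> in M. (\<lambda>n. approx n t \<omega>) \<longlonglongrightarrow> dlim t \<omega>"
    using L1(1)
  proof eventually_elim
    case (elim \<omega>)
    then have "convergent (\<lambda>n. approx n t \<omega>)" by (auto simp: convergent_def dest: LIMSEQ_offset)
    then show ?case by (simp add: dlim_def convergent_LIMSEQ_iff)
  qed
  then have lim': "AE \<omega> in M. (\<lambda>n. approx (n + l) t \<omega>) \<longlonglongrightarrow> dlim t \<omega>"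
    by eventually_elim (rule LIMSEQ_ignore_initial_segment)
  show "integrable M (dlim t)" by (rule L1(2)[OF dlim_measurable lim'])
  show "(\<lambda>n. expectation (\<lambda>\<omega>. indicator A \<omega> * approx n t \<omega>)) \<longlonglongrightarrow> expectation (\<lambda>\<omega>. indicator A \<omega> * dlim t \<omega>)"
    if "A \<in> sets M"
    using L1(3)[OF dlim_measurable lim' that] by (rule LIMSEQ_offset)
qed

text \<open>For \<open>n \<ge> l\<close> both times lie on the grid of level \<open>lev n\<close>,
  where the approximations satisfy the identity exactly; what remains is the L1 limit.\<close>

lemma dlim_increment:
  assumes t: "t \<in> dyadic_times" and s: "s \<in> dyadic_times" and A: "A \<in> sets (F t)"
  shows "expectation (\<lambda>\<omega>. indicator A \<omega> * (dlim (t + s) \<omega> - dlim t \<omega>)) = expectation (\<lambda>\<omega>. indicator A \<omega> * g s (W t \<omega>))"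
proof -
  obtain i j l where ij: "t = real i / 2 ^ l" "s = real j / 2 ^ l"
    by (rule dyadic_common_level[OF t s])
  have ts: "t + s = real (i + j) / 2 ^ l" by (simp add: ij add_divide_distrib)
  have [measurable]: "A \<in> sets M" by (rule F_sets[OF dyadic_nonneg[OF t] A])
  have int: "integrable M (\<lambda>\<omega>. indicator A \<omega> * approx n q \<omega>)" for n q
    using approx_integrable[of n q] by (intro integrable_indicator_mult) auto
  have eq: "expectation (\<lambda>\<omega>. indicator A \<omega> * (approx n (t + s) \<omega> - approx n t \<omega>)) = expectation (\<lambda>\<omega>. indicator A \<omega> * g s (W t \<omega>))" if "l \<le> n" for n
  proof -
    have l: "l \<le> lev n" using that lev_ge[of n] by simp
    note sc = dyadic_index_scale[OF l]
    have "indicator A \<in> borel_measurable (F (real (i * 2 ^ (lev n - l)) / 2 ^ lev n))"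
      using A unfolding sc ij(1)[symmetric] by (rule borel_measurable_indicator)
    from S_increment_weighted[OF this, of "j * 2 ^ (lev n - l)"] show ?thesis
      unfolding ts unfolding ij sc distrib_right[symmetric] approx_dyadic[OF l] by simp
  qed
  have "(\<lambda>n. expectation (\<lambda>\<omega>. indicator A \<omega> * approx n (t + s) \<omega>) - expectation (\<lambda>\<omega>. indicator A \<omega> * approx n t \<omega>))
     \<longlonglongrightarrow> expectation (\<lambda>\<omega>. indicator A \<omega> * dlim (t + s) \<omega>) - expectation (\<lambda>\<omega>. indicator A \<omega> * dlim t \<omega>)"
    using t s by (intro tendsto_diff approx_limit(3) dyadic_add) auto
  then have "(\<lambda>n. expectation (\<lambda>\<omega>. indicator A \<omega> * (approx n (t + s) \<omega> - approx n t \<omega>)))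
     \<longlonglongrightarrow> expectation (\<lambda>\<omega>. indicator A \<omega> * dlim (t + s) \<omega>) - expectation (\<lambda>\<omega>. indicator A \<omega> * dlim t \<omega>)"
    using int by (simp add: right_diff_distrib)
  moreover have "(\<lambda>n. expectation (\<lambda>\<omega>. indicator A \<omega> * (approx n (t + s) \<omega> - approx n t \<omega>)))
     \<longlonglongrightarrow> expectation (\<lambda>\<omega>. indicator A \<omega> * g s (W t \<omega>))"
    using eq by (intro tendsto_eventually) (auto simp: eventually_sequentially)
  ultimately have "expectation (\<lambda>\<omega>. indicator A \<omega> * dlim (t + s) \<omega>) - expectation (\<lambda>\<omega>. indicator A \<omega> * dlim t \<omega>) = expectation (\<lambda>\<omega>. indicator A \<omega> * g s (W t \<omega>))"
    by (rule LIMSEQ_unique)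
  moreover have "integrable M (\<lambda>\<omega>. indicator A \<omega> * dlim q \<omega>)" if "q \<in> dyadic_times" for q
    using approx_limit(2)[OF that] by (intro integrable_indicator_mult) auto
  ultimately show ?thesis using t s by (simp add: right_diff_distrib dyadic_add)
qed

text \<open>Fatou's lemma carries \<open>S_increment_square\<close> over to the almost sure
  limit.\<close>

lemma dlim_increment_square:
  "(\<integral>\<^sup>+\<omega>. ennreal ((dlim (real (Suc j) / 2 ^ l) \<omega> - dlim (real j / 2 ^ l) \<omega>)\<^sup>2) \<partial>M)
    \<le> ennreal (2 * U (1 / 2 ^ l) * expectation (\<lambda>\<omega>. g (1 / 2 ^ l) (W (real j / 2 ^ l) \<omega>)))"
proof -
  let ?t = "real j / 2 ^ l" and ?t' = "real (Suc j) / 2 ^ l"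
  let ?d = "\<lambda>n \<omega>. (approx n ?t' \<omega> - approx n ?t \<omega>)\<^sup>2"
  have "(\<integral>\<^sup>+\<omega>. ennreal ((dlim ?t' \<omega> - dlim ?t \<omega>)\<^sup>2) \<partial>M) = (\<integral>\<^sup>+\<omega>. liminf (\<lambda>n. ennreal (?d n \<omega>)) \<partial>M)"
    using approx_limit(1)[OF dyadic_timesI, of j l] approx_limit(1)[OF dyadic_timesI, of "Suc j" l]
  proof (intro nn_integral_cong_AE, eventually_elim)
    case (elim \<omega>)
    then have "(\<lambda>n. ennreal (?d n \<omega>)) \<longlonglongrightarrow> ennreal ((dlim ?t' \<omega> - dlim ?t \<omega>)\<^sup>2)"
      by (intro tendsto_ennrealI tendsto_power tendsto_diff)
    then show ?case by (intro lim_imp_Liminf[symmetric]) simp_all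
  qed
  also have "\<dots> \<le> liminf (\<lambda>n. \<integral>\<^sup>+\<omega>. ennreal (?d n \<omega>) \<partial>M)"
    by (rule nn_integral_liminf) measurable
  also have "\<dots> \<le> liminf (\<lambda>n. ennreal (2 * U (1 / 2 ^ l) * expectation (\<lambda>\<omega>. g (1 / 2 ^ l) (W ?t \<omega>))))"
  proof (rule Liminf_mono, unfold eventually_sequentially, intro exI allI impI)
    fix n assume "l \<le> n"
    then have l: "l \<le> lev n" using lev_ge[of n] by simp
    let ?p = "2 ^ (lev n - l) :: nat"
    have sc: "real (j * ?p) / 2 ^ lev n = ?t" "real ?p / 2 ^ lev n = 1 / 2 ^ l"
      using dyadic_index_scale[OF l, of j] dyadic_index_scale[OF l, of 1] by simp_all
    have ap: "approx n ?t = S (lev n) (j * ?p)" "approx n ?t' = S (lev n) (j * ?p + ?p)"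
      unfolding approx_dyadic[OF l] by (simp_all add: add.commute)
    have "(\<integral>\<^sup>+\<omega>. ennreal (?d n \<omega>) \<partial>M) = ennreal (expectation (?d n))"
      unfolding power2_eq_square ap
      by (intro nn_integral_eq_integral bounded_rv_integrable bounded_rv_intros) auto
    also have "\<dots> \<le> ennreal (2 * U (1 / 2 ^ l) * expectation (\<lambda>\<omega>. g (1 / 2 ^ l) (W ?t \<omega>)))"
      using S_increment_square[of "lev n" "j * ?p" ?p] S_expectation[of "lev n" "j * ?p" ?p]
      unfolding ap sc by (intro ennreal_leI) simp
    finally show "(\<integral>\<^sup>+\<omega>. ennreal (?d n \<omega>) \<partial>M) \<le> ennreal (2 * U (1 / 2 ^ l) * expectation (\<lambda>\<omega>. g (1 / 2 ^ l) (W ?t \<omega>)))" .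
  qed
  also have "\<dots> = ennreal (2 * U (1 / 2 ^ l) * expectation (\<lambda>\<omega>. g (1 / 2 ^ l) (W ?t \<omega>)))"
    by (simp add: Liminf_const)
  finally show ?thesis .
qed

definition oscillation :: "nat \<Rightarrow> nat \<Rightarrow> 'a \<Rightarrow> real" where
  "oscillation T n \<omega> = (\<Sum>j<T * 2 ^ lev n. (dlim (real (Suc j) / 2 ^ lev n) \<omega> - dlim (real j / 2 ^ lev n) \<omega>)\<^sup>2)"

text \<open>A sum of squares bounds every single increment, so this is the source of continuity. By
  \<open>dlim_increment_square\<close> its mean is at most 2 U(T) / 8 ^ n, which is summable in
  \<open>n\<close>.\<close>

lemma oscillation_tendsto_0: "AE \<omega> in M. (\<lambda>n. oscillation T n \<omega>) \<longlonglongrightarrow> 0"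
proof -
  have [measurable]: "oscillation T n \<in> borel_measurable M" for n unfolding oscillation_def[abs_def] by measurable
  have nn: "0 \<le> oscillation T n \<omega>" for n \<omega> unfolding oscillation_def by (intro sum_nonneg) auto
  have le: "(\<integral>\<^sup>+\<omega>. oscillation T n \<omega> \<partial>M) \<le> ennreal (2 * U (real T) * (1 / 8) ^ n)" for n
  proof -
    let ?l = "lev n"
    have "(\<integral>\<^sup>+\<omega>. oscillation T n \<omega> \<partial>M) = (\<Sum>j<T * 2 ^ ?l. \<integral>\<^sup>+\<omega>. ennreal ((dlim (real (Suc j) / 2 ^ ?l) \<omega> - dlim (real j / 2 ^ ?l) \<omega>)\<^sup>2) \<partial>M)"
      unfolding oscillation_def by (subst nn_integral_sum[symmetric]) (auto simp: sum_ennreal)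
    also have "\<dots> \<le> (\<Sum>j<T * 2 ^ ?l. ennreal (2 * U (1 / 2 ^ ?l) * expectation (\<lambda>\<omega>. g (1 / 2 ^ ?l) (W (real j / 2 ^ ?l) \<omega>))))"
      by (intro sum_mono dlim_increment_square)
    also have "\<dots> = ennreal (\<Sum>j<T * 2 ^ ?l. 2 * U (1 / 2 ^ ?l) * expectation (\<lambda>\<omega>. g (1 / 2 ^ ?l) (W (real j / 2 ^ ?l) \<omega>)))"
      by (intro sum_ennreal mult_nonneg_nonneg integral_nonneg_AE) auto
    also have "(\<Sum>j<T * 2 ^ ?l. 2 * U (1 / 2 ^ ?l) * expectation (\<lambda>\<omega>. g (1 / 2 ^ ?l) (W (real j / 2 ^ ?l) \<omega>)))
        = 2 * U (1 / 2 ^ ?l) * expectation (S ?l (T * 2 ^ ?l))"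
      unfolding S_def[abs_def] sum_distrib_left[symmetric]
      by (subst Bochner_Integration.integral_sum) (auto intro!: bounded_rv_integrable bounded_rv_g)
    also have "ennreal (2 * U (1 / 2 ^ ?l) * expectation (S ?l (T * 2 ^ ?l))) \<le> ennreal (2 * (1 / 8 ^ n) * U (real T))"
      using S_expectation_le[of ?l "T * 2 ^ ?l"] lev(2)[of n]
      by (intro ennreal_leI mult_mono) (auto intro!: integral_nonneg_AE)
    finally show ?thesis by (simp add: power_one_over mult.commute mult.left_commute)
  qed
  have "(\<integral>\<^sup>+\<omega>. (\<Sum>n. ennreal (oscillation T n \<omega>)) \<partial>M) = (\<Sum>n. \<integral>\<^sup>+\<omega>. oscillation T n \<omega> \<partial>M)"
    by (rule nn_integral_suminf) measurable
  also have "\<dots> \<le> (\<Sum>n. ennreal (2 * U (real T) * (1 / 8) ^ n))" by (intro suminf_le le) auto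
  also have "\<dots> = ennreal (\<Sum>n. 2 * U (real T) * (1 / 8) ^ n)"
    by (intro suminf_ennreal2 summable_mult summable_geometric) auto
  finally have "(\<integral>\<^sup>+\<omega>. (\<Sum>n. ennreal (oscillation T n \<omega>)) \<partial>M) \<noteq> \<infinity>" by (auto simp: top_unique)
  then have "AE \<omega> in M. (\<Sum>n. ennreal (oscillation T n \<omega>)) \<noteq> \<infinity>"
    by (rule nn_integral_PInf_AE[rotated]) measurable
  then show ?thesis
  proof eventually_elim
    case (elim \<omega>)
    then show ?case using nn by (intro summable_LIMSEQ_zero summable_suminf_not_top) auto
  qed
qed

text \<open>The quantity is the average of \<open>k h d\<close> over 0 < h \<le> 1 / 2 ^ m.\<close>

lemma g_decay:
  assumes "0 < d" shows "(\<lambda>m. 2 ^ m * g (1 / 2 ^ m) d) \<longlonglongrightarrow> 0"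
proof (rule order_tendstoI)
  fix e :: real assume e: "0 < e"
  obtain b where b: "0 < b" "\<And>h. 0 < h \<Longrightarrow> h < b \<Longrightarrow> k h d < e / 2"
    using order_tendstoD(2)[OF k_decay[OF assms], of "e / 2"] e by (auto simp: eventually_at_right_field)
  have "(\<lambda>m. 1 / 2 ^ m) \<longlonglongrightarrow> (0::real)"
    using LIMSEQ_power_zero[of "1 / 2 :: real"] by (simp add: power_one_over)
  then have "eventually (\<lambda>m. 1 / 2 ^ m < b) sequentially" using b by (intro order_tendstoD) auto
  then show "eventually (\<lambda>m. 2 ^ m * g (1 / 2 ^ m) d < e) sequentially"
  proof eventually_elim
    case (elim m)
    have "ennreal (g (1 / 2 ^ m) d) \<le> (\<integral>\<^sup>+r. ennreal (e / 2) * indicator {0..1 / 2 ^ m :: real} r \<partial>lborel)"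
      unfolding g_ennreal
    proof (intro nn_integral_mono)
      fix r :: real
      show "ennreal (k r d) * indicator {..1 / 2 ^ m} r \<le> ennreal (e / 2) * indicator {0..1 / 2 ^ m} r"
        using b(2)[of r] elim e by (cases "r \<le> 0") (auto simp: k_neg split: split_indicator intro!: ennreal_leI less_imp_le)
    qed
    also have "\<dots> = ennreal (e / 2 * (1 / 2 ^ m))"
      using e by (subst nn_integral_cmult) (auto simp: ennreal_mult[symmetric])
    finally have "g (1 / 2 ^ m) d \<le> e / 2 * (1 / 2 ^ m)" using e by (subst (asm) ennreal_le_iff) auto
    then have "2 ^ m * g (1 / 2 ^ m) d \<le> e / 2" by (simp add: field_simps)
    with e show ?case by linarith
  qed
next
  fix e :: real assume "e < 0"
  then show "eventually (\<lambda>m. e < 2 ^ m * g (1 / 2 ^ m) d) sequentially"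
    by (intro always_eventually allI) (rule less_le_trans[of e 0], auto)
qed

text \<open>While W \<ge> d, each of the (b - a) 2 ^ m terms of the sum is at most
  \<open>g (1 / 2 ^ m) d\<close>, which by \<open>g_decay\<close> is of smaller order than 1 / 2 ^
  m.\<close>

lemma approx_flat:
  assumes ab: "a \<in> dyadic_times" "b \<in> dyadic_times" "a \<le> b" and d: "0 < d"
    and W: "\<And>s. a \<le> s \<Longrightarrow> s \<le> b \<Longrightarrow> d \<le> W s \<omega>"
  shows "(\<lambda>n. approx n b \<omega> - approx n a \<omega>) \<longlonglongrightarrow> 0"
proof -
  obtain i j l where ij: "a = real i / 2 ^ l" "b = real j / 2 ^ l"
    by (rule dyadic_common_level[OF ab(1,2)])
  have lim: "(\<lambda>n. (b - a) * (2 ^ lev n * g (1 / 2 ^ lev n) d)) \<longlonglongrightarrow> (b - a) * 0"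
    by (intro tendsto_mult tendsto_const filterlim_compose[OF g_decay[OF d] filterlim_subseq[OF lev(1)]])
  have "eventually (\<lambda>n. norm (approx n b \<omega> - approx n a \<omega>) \<le> (b - a) * (2 ^ lev n * g (1 / 2 ^ lev n) d)) sequentially"
    unfolding eventually_sequentially
  proof (intro exI allI impI)
    fix n assume "l \<le> n"
    then have l: "l \<le> lev n" using lev_ge[of n] by simp
    let ?m = "lev n"
    let ?i = "i * 2 ^ (?m - l)" and ?j = "j * 2 ^ (?m - l)"
    have sc: "a = real ?i / 2 ^ ?m" "b = real ?j / 2 ^ ?m" using dyadic_index_scale[OF l] ij by simp_all
    have le: "?i \<le> ?j" using ab(3) by (simp add: ij field_simps)
    have "S ?m ?j \<omega> - S ?m ?i \<omega> = (\<Sum>q\<in>{?i..<?j}. g (1 / 2 ^ ?m) (W (real q / 2 ^ ?m) \<omega>))"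
      unfolding S_def using le by (simp add: lessThan_atLeast0 sum_diff_nat_ivl)
    also have "\<dots> \<le> (\<Sum>q\<in>{?i..<?j}. g (1 / 2 ^ ?m) d)"
    proof (intro sum_mono g_anti W)
      fix q assume "q \<in> {?i..<?j}"
      then have "real ?i \<le> real q" "real q \<le> real ?j" by (simp_all only: of_nat_le_iff atLeastLessThan_iff) simp
      then show "a \<le> real q / 2 ^ ?m" "real q / 2 ^ ?m \<le> b" unfolding sc by (intro divide_right_mono; simp)+
    qed
    also have "\<dots> = (real ?j - real ?i) * g (1 / 2 ^ ?m) d" using le by (simp add: of_nat_diff del: of_nat_mult)
    also have "real ?j - real ?i = (b - a) * 2 ^ ?m" unfolding sc by (simp add: diff_divide_distrib[symmetric])
    finally show "norm (approx n b \<omega> - approx n a \<omega>) \<le> (b - a) * (2 ^ lev n * g (1 / 2 ^ lev n) d)"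
      using approx_mono[of a b n \<omega>] ab dyadic_nonneg by (simp add: ij approx_dyadic[OF l] mult.assoc)
  qed
  from Lim_null_comparison[OF this] lim show ?thesis by simp
qed

end

section \<open>The continuous local time\<close>

context nonpolar_kernel
begin

definition local_time :: "(real \<Rightarrow> 'a \<Rightarrow> real) \<Rightarrow> bool" where
  "local_time L \<longleftrightarrow>
     (\<forall>t\<ge>0. L t \<in> borel_measurable (F t)) \<and>
     (\<forall>\<omega>\<in>space M. L 0 \<omega> = 0 \<and> mono_on {0..} (\<lambda>t. L t \<omega>) \<and> continuous_on {0..} (\<lambda>t. L t \<omega>)) \<and>
     (\<forall>t\<in>dyadic_times. \<forall>s\<in>dyadic_times. \<forall>A\<in>sets (F t).
        (\<integral>\<^sup>+\<omega>\<in>A. (L (t + s) \<omega> - L t \<omega>) \<partial>M) = (\<integral>\<^sup>+\<omega>\<in>A. g s (W t \<omega>) \<partial>M)) \<and>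
     (\<forall>\<omega>\<in>space M. \<forall>a\<ge>0. \<forall>b\<ge>a. \<forall>d>0. (\<forall>s\<in>{a..b}. d \<le> W s \<omega>) \<longrightarrow> L b \<omega> = L a \<omega>)"

text \<open>All limits hold off a null set \<open>N\<close>, on which the local time is set to 0.
  Adaptedness survives because \<open>F_null\<close> puts \<open>N\<close> into every
  \<open>F t\<close>.\<close>

theorem local_time_exists: "\<exists>L. local_time L"
proof -
  define good where "good \<omega> \<longleftrightarrow> (\<forall>t\<in>dyadic_times. (\<lambda>n. approx n t \<omega>) \<longlonglongrightarrow> dlim t \<omega>) \<and>
    (\<forall>T. (\<lambda>n. oscillation T n \<omega>) \<longlonglongrightarrow> 0)" for \<omega>
  have "AE \<omega> in M. \<forall>t\<in>dyadic_times. (\<lambda>n. approx n t \<omega>) \<longlonglongrightarrow> dlim t \<omega>"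
    by (subst AE_ball_countable[OF countable_dyadic_times]) (auto intro: approx_limit(1))
  moreover have "AE \<omega> in M. \<forall>T. (\<lambda>n. oscillation T n \<omega>) \<longlonglongrightarrow> 0"
    by (subst AE_all_countable) (auto intro: oscillation_tendsto_0)
  ultimately have "AE \<omega> in M. good \<omega>" by eventually_elim (simp add: good_def)
  then obtain N where N: "{\<omega>\<in>space M. \<not> good \<omega>} \<subseteq> N" "N \<in> null_sets M"
    by (auto elim!: AE_E)
  have gd: "good \<omega>" if "\<omega> \<in> space M" "\<omega> \<notin> N" for \<omega> using N that by auto
  define L where "L t \<omega> = (if \<omega> \<in> N then 0 else SUP q\<in>{q\<in>dyadic_times. q \<le> t}. dlim q \<omega>)" for t \<omega>
  have mono: "dlim p \<omega> \<le> dlim q \<omega>" if "good \<omega>" "p \<in> dyadic_times" "q \<in> dyadic_times" "p \<le> q" for p q \<omega>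
    using that dyadic_nonneg by (intro LIMSEQ_le[of "\<lambda>n. approx n p \<omega>" _ "\<lambda>n. approx n q \<omega>"]) (auto simp: good_def intro!: approx_mono)
  have zero: "dlim 0 \<omega> = 0" for \<omega> by (simp add: dlim_def)
  have osc: "\<exists>m. \<forall>j<T * 2 ^ m. dlim (real (Suc j) / 2 ^ m) \<omega> - dlim (real j / 2 ^ m) \<omega> \<le> e"
    if "good \<omega>" "0 < e" for T e \<omega>
  proof -
    have "eventually (\<lambda>n. oscillation T n \<omega> < e\<^sup>2) sequentially"
      using that by (intro order_tendstoD(2)) (auto simp: good_def)
    then obtain n where n: "oscillation T n \<omega> < e\<^sup>2" by (auto dest: eventually_happens)
    have "dlim (real (Suc j) / 2 ^ lev n) \<omega> - dlim (real j / 2 ^ lev n) \<omega> \<le> e" if "j < T * 2 ^ lev n" for j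
    proof -
      have "(dlim (real (Suc j) / 2 ^ lev n) \<omega> - dlim (real j / 2 ^ lev n) \<omega>)\<^sup>2 \<le> oscillation T n \<omega>"
        unfolding oscillation_def using that by (intro member_le_sum) auto
      with n have "(dlim (real (Suc j) / 2 ^ lev n) \<omega> - dlim (real j / 2 ^ lev n) \<omega>)\<^sup>2 \<le> e\<^sup>2" by linarith
      then show ?thesis using \<open>0 < e\<close> by (rule power2_le_imp_le[OF _ less_imp_le])
    qed
    then show ?thesis by blast
  qed
  have ext: "q \<in> dyadic_times \<Longrightarrow> L q \<omega> = dlim q \<omega>" "mono_on {0..} (\<lambda>t. L t \<omega>)" "continuous_on {0..} (\<lambda>t. L t \<omega>)"
    if "\<omega> \<in> space M" "\<omega> \<notin> N" for \<omega> q
    using dyadic_extension[of "\<lambda>q. dlim q \<omega>", OF zero mono[OF gd[OF that]] osc[OF gd[OF that]]] that by (auto simp: L_def)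
  have L_nice: "L 0 \<omega> = 0" "mono_on {0..} (\<lambda>t. L t \<omega>)" "continuous_on {0..} (\<lambda>t. L t \<omega>)" if "\<omega> \<in> space M" for \<omega>
    by (cases "\<omega> \<in> N"; use ext[OF that] zero in \<open>auto simp: L_def[abs_def] mono_on_def\<close>)+
  have "local_time L"
    unfolding local_time_def
  proof (intro conjI allI impI ballI L_nice)
    fix t :: real assume t: "0 \<le> t"
    have [measurable]: "N \<in> sets (F t)" using F_null[OF t N(2)] .
    have [measurable]: "dlim q \<in> borel_measurable (F t)" if "q \<in> dyadic_times" "q \<le> t" for q
    proof -
      have [measurable]: "approx n q \<in> borel_measurable (F t)" for n
        using that dyadic_nonneg[OF that(1)] by (intro F_measurable_mono[OF _ _ approx_adapted]) auto
      show ?thesis unfolding dlim_def[abs_def] by measurable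
    qed
    have "(\<lambda>\<omega>. SUP q\<in>{q\<in>dyadic_times. q \<le> t}. if \<omega> \<in> N then 0 else dlim q \<omega>) \<in> borel_measurable (F t)"
    proof (rule borel_measurable_cSUP)
      show "countable {q \<in> dyadic_times. q \<le> t}"
        by (rule countable_subset[OF _ countable_dyadic_times]) auto
      show "bdd_above ((\<lambda>q. if \<omega> \<in> N then 0 else dlim q \<omega>) ` {q \<in> dyadic_times. q \<le> t})" if "\<omega> \<in> space (F t)" for \<omega>
      proof (cases "\<omega> \<in> N")
        case False
        then show ?thesis
          using that t mono[OF gd] right_dyadic_dyadic[OF t] right_dyadic_greater[of t 0]
          by (intro bdd_aboveI[of _ "dlim (right_dyadic 0 t) \<omega>"]) auto
      qed (auto simp: image_constant_conv)
    qed measurable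
    moreover have "(\<lambda>\<omega>. SUP q\<in>{q\<in>dyadic_times. q \<le> t}. if \<omega> \<in> N then 0 else dlim q \<omega>) = L t"
    proof
      fix \<omega>
      have "{q \<in> dyadic_times. q \<le> t} \<noteq> {}" using t zero_dyadic by blast
      then have "(SUP q\<in>{q\<in>dyadic_times. q \<le> t}. 0) = (0::real)" by (rule cSUP_const)
      then show "(SUP q\<in>{q\<in>dyadic_times. q \<le> t}. if \<omega> \<in> N then 0 else dlim q \<omega>) = L t \<omega>"
        by (cases "\<omega> \<in> N") (simp_all add: L_def)
    qed
    ultimately show "L t \<in> borel_measurable (F t)" by simp
  next
    fix t s A assume t: "t \<in> dyadic_times" and s: "s \<in> dyadic_times" and A: "A \<in> sets (F t)"
    have t0: "0 \<le> t" "0 \<le> s" using t s dyadic_nonneg by auto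
    have [measurable]: "A \<in> sets M" using F_sets[OF t0(1) A] .
    have ts: "t + s \<in> dyadic_times" using t s by (rule dyadic_add)
    have nn: "AE \<omega> in M. 0 \<le> dlim (t + s) \<omega> - dlim t \<omega>"
      using \<open>AE \<omega> in M. good \<omega>\<close> by eventually_elim (use mono t ts t0 in auto)
    have i: "integrable M (\<lambda>\<omega>. indicator A \<omega> * (dlim (t + s) \<omega> - dlim t \<omega>))"
      using approx_limit(2)[OF t] approx_limit(2)[OF ts] by (intro integrable_indicator_mult) auto
    have "(\<integral>\<^sup>+\<omega>\<in>A. (L (t + s) \<omega> - L t \<omega>) \<partial>M) = (\<integral>\<^sup>+\<omega>. ennreal (indicator A \<omega> * (dlim (t + s) \<omega> - dlim t \<omega>)) \<partial>M)"
      using AE_not_in[OF N(2)] AE_space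
      by (intro nn_integral_cong_AE, eventually_elim) (auto simp: ext t ts split: split_indicator)
    also have "\<dots> = ennreal (expectation (\<lambda>\<omega>. indicator A \<omega> * (dlim (t + s) \<omega> - dlim t \<omega>)))"
      using i nn by (intro nn_integral_eq_integral) auto
    also have "\<dots> = ennreal (expectation (\<lambda>\<omega>. indicator A \<omega> * g s (W t \<omega>)))"
      by (simp only: dlim_increment[OF t s A])
    also have "\<dots> = (\<integral>\<^sup>+\<omega>. ennreal (indicator A \<omega> * g s (W t \<omega>)) \<partial>M)"
      using bounded_rv_integrable[OF bounded_rv_g[OF t0(1)]]
      by (intro nn_integral_eq_integral[symmetric] integrable_indicator_mult) auto
    also have "\<dots> = (\<integral>\<^sup>+\<omega>\<in>A. g s (W t \<omega>) \<partial>M)"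
      by (intro nn_integral_cong) (auto split: split_indicator)
    finally show "(\<integral>\<^sup>+\<omega>\<in>A. (L (t + s) \<omega> - L t \<omega>) \<partial>M) = (\<integral>\<^sup>+\<omega>\<in>A. g s (W t \<omega>) \<partial>M)" .
  next
    fix \<omega> a b d assume \<omega>: "\<omega> \<in> space M" and ab: "(0::real) \<le> a" "a \<le> b" and d: "(0::ennreal) < d" and W: "\<forall>s\<in>{a..b}. d \<le> W s \<omega>"
    show "L b \<omega> = L a \<omega>"
    proof (cases "\<omega> \<in> N")
      case False
      have flat: "L q \<omega> = L p \<omega>" if pq: "p \<in> dyadic_times" "q \<in> dyadic_times" "a \<le> p" "p \<le> q" "q \<le> b" for p q
      proof -
        have "(\<lambda>n. approx n q \<omega> - approx n p \<omega>) \<longlonglongrightarrow> 0"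
          using pq W by (intro approx_flat[OF _ _ _ d]) auto
        moreover have "(\<lambda>n. approx n q \<omega> - approx n p \<omega>) \<longlonglongrightarrow> dlim q \<omega> - dlim p \<omega>"
          using gd[OF \<omega> False] pq by (intro tendsto_diff) (auto simp: good_def)
        ultimately have "dlim q \<omega> - dlim p \<omega> = 0" by (rule LIMSEQ_unique[symmetric])
        with pq ext(1)[OF \<omega> False] show ?thesis by simp
      qed
      show ?thesis
      proof (rule ccontr)
        assume "L b \<omega> \<noteq> L a \<omega>"
        moreover have le: "L a \<omega> \<le> L b \<omega>" using L_nice(2)[OF \<omega>] ab by (auto simp: mono_on_def)
        ultimately have lt: "L a \<omega> < L b \<omega>" by simp
        then have "a < b" using ab by (cases "a = b") auto
        \<comment> \<open>Flatness is known between dyadic times only. By continuity there are a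
          dyadic \<open>p\<close> just after \<open>a\<close> and a dyadic \<open>q\<close> just
          before \<open>b\<close> whose values are separated by the midpoint
          \<open>c\<close>.\<close>
        define c where "c = (L a \<omega> + L b \<omega>) / 2"
        have c: "L a \<omega> < c" "c < L b \<omega>" using lt by (auto simp: c_def)
        have cont: "isCont (\<lambda>t. L (max 0 t) \<omega>) x" for x
        proof -
          have "continuous_on UNIV (\<lambda>t. L (max 0 t) \<omega>)"
            by (rule continuous_on_compose2[OF L_nice(3)[OF \<omega>]]) (auto intro!: continuous_intros)
          then show ?thesis by (simp add: continuous_on_eq_continuous_at)
        qed
        have "eventually (\<lambda>x. L (max 0 x) \<omega> < c) (at_right a)"
          using cont[of a] c ab by (intro order_tendstoD(2)[where y="L (max 0 a) \<omega>"]) (auto simp: isCont_def filterlim_at_split)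
        then obtain a' where a': "a < a'" "\<And>x. a < x \<Longrightarrow> x < a' \<Longrightarrow> L (max 0 x) \<omega> < c"
          by (auto simp: eventually_at_right_field)
        have "eventually (\<lambda>x. c < L (max 0 x) \<omega>) (at_left b)"
          using cont[of b] c ab by (intro order_tendstoD(1)[where y="L (max 0 b) \<omega>"]) (auto simp: isCont_def filterlim_at_split)
        then obtain b' where b': "b' < b" "\<And>x. b' < x \<Longrightarrow> x < b \<Longrightarrow> c < L (max 0 x) \<omega>"
          by (auto simp: eventually_at_left_field)
        obtain p where p: "p \<in> dyadic_times" "a < p" "p < min a' b"
          using dyadic_between[of a "min a' b"] ab \<open>a < b\<close> a' by auto
        have "0 \<le> max p b'" "max p b' < b" using p ab b' by (auto intro: max.coboundedI1)
        then obtain q where q: "q \<in> dyadic_times" "max p b' < q" "q < b" by (rule dyadic_between)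
        have "0 \<le> p" "0 \<le> q" "b' < q" using p q ab by auto
        then have "L p \<omega> < c" "c < L q \<omega>" using a'(2)[of p] b'(2)[of q] p q by auto
        with flat[of p q] p q show False by auto
      qed
    qed (simp add: L_def)
  qed
  then show ?thesis by blast
qed

end

section \<open>Optional stopping for the local time\<close>

text \<open>Each approximating process is constant in time on dyadic cells, hence a countable
  patchwork of random variables. The maximum with 0 extends the process to negative times.\<close>

lemma joint_measurable_right_dyadic:
  fixes X :: "real \<Rightarrow> 'a \<Rightarrow> real"
  assumes X: "\<And>q. q \<in> dyadic_times \<Longrightarrow> X q \<in> borel_measurable M"
    and lim: "\<And>\<omega> t. \<omega> \<in> space M \<Longrightarrow> 0 \<le> t \<Longrightarrow> (\<lambda>m. X (right_dyadic m t) \<omega>) \<longlonglongrightarrow> X t \<omega>"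
  shows "(\<lambda>p. X (max 0 (fst p)) (snd p)) \<in> borel_measurable (borel \<Otimes>\<^sub>M M)"
proof (rule borel_measurable_LIMSEQ_real[where u="\<lambda>m p. X (right_dyadic m (max 0 (fst p))) (snd p)"])
  show "(\<lambda>m. X (right_dyadic m (max 0 (fst p))) (snd p)) \<longlonglongrightarrow> X (max 0 (fst p)) (snd p)"
    if "p \<in> space (borel \<Otimes>\<^sub>M M)" for p
    using that by (intro lim) (auto simp: space_pair_measure)
  show "(\<lambda>p. X (right_dyadic m (max 0 (fst p))) (snd p)) \<in> borel_measurable (borel \<Otimes>\<^sub>M M)" for m
  proof -
    have "(\<lambda>p. X (real (Suc (nat \<lfloor>2 ^ m * max 0 (fst p) :: real\<rfloor>)) / 2 ^ m) (snd p)) \<in> borel_measurable (borel \<Otimes>\<^sub>M M)"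
    proof (rule measurable_compose_countable[where f="\<lambda>i p. X (real (Suc i) / 2 ^ m) (snd p)" and g="\<lambda>p. nat \<lfloor>2 ^ m * max 0 (fst p) :: real\<rfloor>"])
      show "(\<lambda>p. X (real (Suc i) / 2 ^ m) (snd p)) \<in> borel_measurable (borel \<Otimes>\<^sub>M M)" for i :: nat
        by (intro measurable_compose[OF measurable_snd X]) (rule dyadic_timesI)
    qed measurable
    moreover have "real (Suc (nat \<lfloor>2 ^ m * max 0 t\<rfloor>)) / 2 ^ m = right_dyadic m (max 0 t)" for t :: real
    proof -
      have "0 \<le> \<lfloor>2 ^ m * max 0 t\<rfloor>" by simp
      then show ?thesis unfolding right_dyadic_def by (simp add: add.commute)
    qed
    ultimately show ?thesis by simp
  qed
qed

text \<open>Comparing the integral over short intervals with rectangles gives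
  \<open>(1 - h / c) \<gamma> a \<le> \<gamma> (a + h)\<close> and \<open>(1 + h / c) \<gamma> (a + h) \<le> \<gamma> a\<close>, hence the exponential
  as a limit of powers.\<close>

lemma exponential_of_tail_integral:
  fixes \<gamma> :: "real \<Rightarrow> real"
  assumes c: "0 < c" and nn: "\<And>t. 0 \<le> \<gamma> t" and anti: "\<And>a b. s \<le> a \<Longrightarrow> a \<le> b \<Longrightarrow> \<gamma> b \<le> \<gamma> a"
    and tail: "\<And>t. s \<le> t \<Longrightarrow> ennreal (c * \<gamma> t) = (\<integral>\<^sup>+r\<in>{t..}. ennreal (\<gamma> r) \<partial>lborel)"
    and meas: "\<gamma> \<in> borel_measurable borel" and t: "0 \<le> t"
  shows "\<gamma> (s + t) = exp (- t / c) * \<gamma> s"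
proof -
  note meas [measurable]
  have split: "c * (\<gamma> a - \<gamma> (a + h)) \<le> h * \<gamma> a" "h * \<gamma> (a + h) \<le> c * (\<gamma> a - \<gamma> (a + h))"
    if ah: "s \<le> a" "0 \<le> h" for a h
  proof -
    have "ennreal (c * \<gamma> a) = (\<integral>\<^sup>+r. ennreal (\<gamma> r) * indicator {a..<a + h} r + ennreal (\<gamma> r) * indicator {a + h..} r \<partial>lborel)"
      unfolding tail[OF ah(1)] using ah by (intro nn_integral_cong) (auto split: split_indicator)
    also have "\<dots> = (\<integral>\<^sup>+r\<in>{a..<a + h}. ennreal (\<gamma> r) \<partial>lborel) + ennreal (c * \<gamma> (a + h))"
      using ah by (subst nn_integral_add) (auto simp: tail)
    finally have eq: "ennreal (c * \<gamma> a) = (\<integral>\<^sup>+r\<in>{a..<a + h}. ennreal (\<gamma> r) \<partial>lborel) + ennreal (c * \<gamma> (a + h))" .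
    have "(\<integral>\<^sup>+r\<in>{a..<a + h}. ennreal (\<gamma> r) \<partial>lborel) \<le> (\<integral>\<^sup>+r\<in>{a..<a + h}. ennreal (\<gamma> a) \<partial>lborel)"
      using ah anti by (intro nn_integral_mono) (auto split: split_indicator intro!: ennreal_leI)
    also have "\<dots> = ennreal (h * \<gamma> a)"
      using ah nn by (simp add: nn_integral_cmult ennreal_mult[symmetric] mult.commute)
    finally have "ennreal (c * \<gamma> a) \<le> ennreal (h * \<gamma> a) + ennreal (c * \<gamma> (a + h))" unfolding eq by (rule add_right_mono)
    then have "ennreal (c * \<gamma> a) \<le> ennreal (h * \<gamma> a + c * \<gamma> (a + h))" using ah c nn by (simp add: ennreal_plus)
    then have "c * \<gamma> a \<le> h * \<gamma> a + c * \<gamma> (a + h)" using ah c nn by (subst (asm) ennreal_le_iff) auto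
    then show "c * (\<gamma> a - \<gamma> (a + h)) \<le> h * \<gamma> a" by (simp add: right_diff_distrib)
    have "ennreal (h * \<gamma> (a + h)) = (\<integral>\<^sup>+r\<in>{a..<a + h}. ennreal (\<gamma> (a + h)) \<partial>lborel)"
      using ah nn by (simp add: nn_integral_cmult ennreal_mult[symmetric] mult.commute)
    also have "\<dots> \<le> (\<integral>\<^sup>+r\<in>{a..<a + h}. ennreal (\<gamma> r) \<partial>lborel)"
      using ah anti by (intro nn_integral_mono) (auto split: split_indicator intro!: ennreal_leI)
    finally have "ennreal (h * \<gamma> (a + h)) + ennreal (c * \<gamma> (a + h)) \<le> ennreal (c * \<gamma> a)" unfolding eq by (rule add_right_mono)
    then have "ennreal (h * \<gamma> (a + h) + c * \<gamma> (a + h)) \<le> ennreal (c * \<gamma> a)" using ah c nn by (simp add: ennreal_plus)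
    then have "h * \<gamma> (a + h) + c * \<gamma> (a + h) \<le> c * \<gamma> a" using ah c nn by (subst (asm) ennreal_le_iff) auto
    then show "h * \<gamma> (a + h) \<le> c * (\<gamma> a - \<gamma> (a + h))" by (simp add: right_diff_distrib)
  qed
  have step: "(1 - h / c) * \<gamma> a \<le> \<gamma> (a + h)" "(1 + h / c) * \<gamma> (a + h) \<le> \<gamma> a" if ah: "s \<le> a" "0 \<le> h" for a h
    using split[OF ah] c by (simp_all add: field_simps)
  have iter: "(1 + h / c) ^ n * \<gamma> (s + real n * h) \<le> \<gamma> s" "h \<le> c \<Longrightarrow> (1 - h / c) ^ n * \<gamma> s \<le> \<gamma> (s + real n * h)" if h: "0 \<le> h" for n h
  proof (induction n)
    case (Suc n)
    have e: "s + real (Suc n) * h = (s + real n * h) + h" by (simp add: algebra_simps)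
    have sn: "s \<le> s + real n * h" using h by simp
    {
      case 1
      have "(1 + h / c) ^ Suc n * \<gamma> (s + real (Suc n) * h) = (1 + h / c) ^ n * ((1 + h / c) * \<gamma> ((s + real n * h) + h))"
        unfolding e by (simp add: mult_ac)
      also have "\<dots> \<le> (1 + h / c) ^ n * \<gamma> (s + real n * h)"
        using step(2)[OF sn h] h c by (intro mult_left_mono zero_le_power) auto
      finally show ?case using Suc.IH(1) by linarith
    next
      case 2
      have "(1 - h / c) ^ Suc n * \<gamma> s = (1 - h / c) * ((1 - h / c) ^ n * \<gamma> s)" by simp
      also have "\<dots> \<le> (1 - h / c) * \<gamma> (s + real n * h)" using 2 c Suc.IH(2) by (intro mult_left_mono) auto
      also have "\<dots> \<le> \<gamma> (s + real (Suc n) * h)" unfolding e by (rule step(1)[OF sn h])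
      finally show ?case .
    }
  qed auto
  show ?thesis
  proof (rule antisym)
    have "(\<lambda>n. (1 + (t / c) / real n) ^ n * \<gamma> (s + t)) \<longlonglongrightarrow> exp (t / c) * \<gamma> (s + t)"
      by (intro tendsto_mult tendsto_exp_limit_sequentially tendsto_const)
    moreover have "(1 + (t / c) / real n) ^ n * \<gamma> (s + t) \<le> \<gamma> s" if "1 \<le> n" for n
      using iter(1)[of "t / real n" n] t that by (simp add: mult.commute)
    ultimately have "exp (t / c) * \<gamma> (s + t) \<le> \<gamma> s"
      by (intro LIMSEQ_le_const2[where X="\<lambda>n. (1 + (t / c) / real n) ^ n * \<gamma> (s + t)"]) auto
    then have "exp (- t / c) * (exp (t / c) * \<gamma> (s + t)) \<le> exp (- t / c) * \<gamma> s" by (intro mult_left_mono) auto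
    then show "\<gamma> (s + t) \<le> exp (- t / c) * \<gamma> s" by (simp add: mult.assoc[symmetric] exp_add[symmetric])
    have "(\<lambda>n. (1 + (- t / c) / real n) ^ n * \<gamma> s) \<longlonglongrightarrow> exp (- t / c) * \<gamma> s"
      by (intro tendsto_mult tendsto_exp_limit_sequentially tendsto_const)
    moreover have "(1 + (- t / c) / real n) ^ n * \<gamma> s \<le> \<gamma> (s + t)" if "nat \<lceil>t / c\<rceil> + 1 \<le> n" for n
    proof -
      have "t / c \<le> real n" using that by linarith
      then have "t / real n \<le> c" using c that by (simp add: field_simps)
      then show ?thesis using iter(2)[of "t / real n" n] t that by (simp add: mult.commute)
    qed
    ultimately show "exp (- t / c) * \<gamma> s \<le> \<gamma> (s + t)"
      by (intro LIMSEQ_le_const2[where X="\<lambda>n. (1 + (- t / c) / real n) ^ n * \<gamma> s"]) blast+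
  qed
qed

text \<open>The infimum of the empty set is \<infinity>: a path with bounded local time is killed at
  its total local time.\<close>

definition right_inverse :: "(real \<Rightarrow> real) \<Rightarrow> real \<Rightarrow> ennreal" where
  "right_inverse l t = (INF s\<in>{s. 0 \<le> s \<and> t < l s}. ennreal s)"

lemma cadlag_mono_ennreal:
  fixes f :: "real \<Rightarrow> ennreal"
  assumes mono: "mono_on {0..} f" and right: "\<And>t y. 0 \<le> t \<Longrightarrow> f t < y \<Longrightarrow> \<exists>b>t. f b < y"
  shows "cadlag f"
  unfolding cadlag_def
proof safe
  fix t :: real assume t: "0 \<le> t"
  show "(f \<longlongrightarrow> f t) (at_right t)"
  proof (rule order_tendstoI)
    fix y assume "y < f t"
    then show "eventually (\<lambda>x. y < f x) (at_right t)"
      unfolding eventually_at_right_field using t mono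
      by (intro exI[of _ "t + 1"]) (auto simp: mono_on_def intro: less_le_trans)
  next
    fix y assume "f t < y"
    then obtain b where "t < b" "f b < y" using right t by blast
    moreover have "f x \<le> f b" if "t < x" "x < b" for x using mono that t by (auto simp: mono_on_def)
    ultimately show "eventually (\<lambda>x. f x < y) (at_right t)"
      unfolding eventually_at_right_field by (intro exI[of _ b]) (auto intro: le_less_trans)
  qed
next
  fix t :: real assume t: "0 < t"
  have "(f \<longlongrightarrow> (SUP s\<in>{0..<t}. f s)) (at_left t)"
  proof (rule order_tendstoI)
    fix y assume "y < (SUP s\<in>{0..<t}. f s)"
    then obtain s where "0 \<le> s" "s < t" "y < f s" by (auto simp: less_SUP_iff)
    then show "eventually (\<lambda>x. y < f x) (at_left t)"
      unfolding eventually_at_left_field using mono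
      by (intro exI[of _ s]) (auto simp: mono_on_def intro: less_le_trans)
  next
    fix y assume y: "(SUP s\<in>{0..<t}. f s) < y"
    have "f x < y" if "0 < x" "x < t" for x
      using that by (intro le_less_trans[OF SUP_upper y]) auto
    then show "eventually (\<lambda>x. f x < y) (at_left t)"
      unfolding eventually_at_left_field using t by (intro exI[of _ 0]) auto
  qed
  then show "\<exists>l. (f \<longlongrightarrow> l) (at_left t)" ..
qed

context
  fixes l :: "real \<Rightarrow> real"
  assumes l0: "l 0 = 0" and lmono: "mono_on {0..} l" and lcont: "continuous_on {0..} l"
begin

text \<open>Continuity of \<open>l\<close> gives the strict form: if \<open>l\<close> exceeds
  \<open>t\<close> at \<open>a\<close>, it does so already shortly before \<open>a\<close>. The
  event thus depends on \<open>l a\<close> only, that is, on what is known at time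
  \<open>a\<close>.\<close>

lemma right_inverse_less_iff:
  assumes "0 \<le> t" "0 \<le> a" shows "right_inverse l t < ennreal a \<longleftrightarrow> t < l a"
proof
  assume "right_inverse l t < ennreal a"
  then obtain s where "0 \<le> s" "t < l s" "s < a" by (auto simp: right_inverse_def INF_less_iff ennreal_less_iff)
  then show "t < l a" using lmono by (auto simp: mono_on_def intro: less_le_trans)
next
  assume tl: "t < l a"
  with l0 assms have "0 < a" by (cases "a = 0") auto
  have "(l \<longlongrightarrow> l a) (at a within {0..a})"
    using lcont assms by (intro continuous_within_subset[of a "{0..}" l "{0..a}", unfolded continuous_within]) (auto simp: continuous_on_eq_continuous_within continuous_within)
  then have "(l \<longlongrightarrow> l a) (at_left a)" using at_within_Icc_at_left[OF \<open>0 < a\<close>] by simp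
  then have "eventually (\<lambda>s. t < l s) (at_left a)" using tl by (rule order_tendstoD)
  then obtain b where b: "b < a" "\<And>s. b < s \<Longrightarrow> s < a \<Longrightarrow> t < l s" by (auto simp: eventually_at_left_field)
  define s where "s = (max b 0 + a) / 2"
  have "b < s" "s < a" "0 \<le> s" using b(1) \<open>0 < a\<close> by (auto simp: s_def)
  then have "right_inverse l t \<le> ennreal s" unfolding right_inverse_def using b(2) by (intro INF_lower) auto
  also have "\<dots> < ennreal a" using \<open>s < a\<close> \<open>0 \<le> s\<close> by (simp add: ennreal_less_iff)
  finally show "right_inverse l t < ennreal a" .
qed

lemma right_inverse_mono: "mono_on {0..} (right_inverse l)"
  unfolding right_inverse_def by (intro mono_onI INF_superset_mono) auto

lemma right_inverse_cadlag: "cadlag (right_inverse l)"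
proof (rule cadlag_mono_ennreal[OF right_inverse_mono])
  fix t y assume t: "0 \<le> t" and "right_inverse l t < y"
  then obtain s where s: "0 \<le> s" "t < l s" "ennreal s < y" by (auto simp: right_inverse_def INF_less_iff)
  then have "right_inverse l ((t + l s) / 2) \<le> ennreal s"
    unfolding right_inverse_def by (intro INF_lower) auto
  with s show "\<exists>b>t. right_inverse l b < y" by (intro exI[of _ "(t + l s) / 2"]) auto
qed

lemma right_inverse_level:
  assumes t: "0 \<le> t" and a: "0 \<le> a" and inv: "right_inverse l t = ennreal a"
  shows "l a = t"
proof (rule antisym)
  show "l a \<le> t" using right_inverse_less_iff[OF t a] inv by auto
  have "t \<le> l b" if "a < b" for b
    using right_inverse_less_iff[OF t, of b] inv that a by (auto simp: ennreal_less_iff)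
  moreover have "(l \<longlongrightarrow> l a) (at a within {0..})" using lcont a by (auto simp: continuous_on_def)
  then have "(l \<longlongrightarrow> l a) (at_right a)" by (rule tendsto_within_subset) (use a in auto)
  ultimately show "t \<le> l a"
    by (intro tendsto_lowerbound[where f=l and F="at_right a"]) (auto simp: eventually_at_right_field intro!: exI[of _ "a + 1"])
qed

lemma right_inverse_ge: "0 \<le> q \<Longrightarrow> ennreal q \<le> right_inverse l (l q)"
proof -
  assume q: "0 \<le> q"
  then have "0 \<le> l q" using mono_onD[OF lmono, of 0 q] l0 by simp
  with right_inverse_less_iff[of "l q" q] q show ?thesis by (simp add: not_less[symmetric])
qed

text \<open>The increment \<open>l s - l a\<close> is the length of the set of levels r \<ge> t with
  r < l s. After exchanging the integrals, level r receives the exponential mass beyond its inverse,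
  which is the discount at that inverse and 0 if the inverse is \<infinity>.\<close>

lemma right_inverse_integral:
  assumes t: "0 \<le> t" and a: "0 \<le> a" and inv: "right_inverse l t = ennreal a" and c: "0 < c"
  shows "(\<integral>\<^sup>+s\<in>{a<..}. ennreal (c * exp (- c * s)) * ennreal (l (max 0 s) - l a) \<partial>lborel) =
    (\<integral>\<^sup>+r\<in>{t..}. ennreal (laplace_exp c (right_inverse l r)) \<partial>lborel)"
proof -
  have la: "l a = t" using right_inverse_level[OF t a inv] .
  have [measurable]: "(\<lambda>s. l (max 0 s)) \<in> borel_measurable borel"
    by (intro borel_measurable_continuous_onI continuous_on_compose2[OF lcont] continuous_intros) auto
  have "(\<integral>\<^sup>+s\<in>{a<..}. ennreal (c * exp (- c * s)) * ennreal (l (max 0 s) - l a) \<partial>lborel) =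
      (\<integral>\<^sup>+s. (\<integral>\<^sup>+r. ennreal (c * exp (- c * s)) * indicator {a<..} s * (indicator {t..} r * (if r < l (max 0 s) then 1 else 0)) \<partial>lborel) \<partial>lborel)"
  proof (rule nn_integral_cong)
    fix s :: real
    have "(\<integral>\<^sup>+r. indicator {t..} r * (if r < l (max 0 s) then 1 else 0) \<partial>lborel) = (\<integral>\<^sup>+r. indicator {t..<l (max 0 s)} r \<partial>(lborel :: real measure))"
      by (intro nn_integral_cong) (auto split: split_indicator)
    also have "\<dots> = ennreal (l (max 0 s) - l a)" if "a < s"
    proof -
      have "l a \<le> l (max 0 s)" using lmono that a by (auto simp: mono_on_def)
      then show ?thesis by (simp add: la)
    qed
    finally show "ennreal (c * exp (- c * s)) * ennreal (l (max 0 s) - l a) * indicator {a<..} s =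
      (\<integral>\<^sup>+r. ennreal (c * exp (- c * s)) * indicator {a<..} s * (indicator {t..} r * (if r < l (max 0 s) then 1 else 0)) \<partial>lborel)"
      by (subst nn_integral_cmult) (auto split: split_indicator)
  qed
  also have "\<dots> = (\<integral>\<^sup>+r. (\<integral>\<^sup>+s. ennreal (c * exp (- c * s)) * indicator {a<..} s * (indicator {t..} r * (if r < l (max 0 s) then 1 else 0)) \<partial>lborel) \<partial>lborel)"
    by (rule lborel_pair.Fubini'[symmetric]) measurable
  also have "\<dots> = (\<integral>\<^sup>+r\<in>{t..}. ennreal (laplace_exp c (right_inverse l r)) \<partial>lborel)"
  proof (rule nn_integral_cong)
    fix r :: real
    show "(\<integral>\<^sup>+s. ennreal (c * exp (- c * s)) * indicator {a<..} s * (indicator {t..} r * (if r < l (max 0 s) then 1 else 0)) \<partial>lborel) =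
       ennreal (laplace_exp c (right_inverse l r)) * indicator {t..} r"
    proof (cases "t \<le> r")
      case True
      then have r: "0 \<le> r" using t by simp
      have ge: "ennreal a \<le> right_inverse l r"
        unfolding inv[symmetric] using right_inverse_mono t True by (auto simp: mono_on_def)
      show ?thesis
      proof (cases "right_inverse l r")
        case (real b)
        then have ab: "a \<le> b" using ge by simp
        have eqi: "indicator {a<..} s * (indicator {t..} r * (if r < l (max 0 s) then 1 else 0)) = (indicator {b<..} s :: ennreal)" for s
          using right_inverse_less_iff[OF r, of s] real ab a True by (cases "0 \<le> s") (auto split: split_indicator simp: ennreal_less_iff)
        have "(\<integral>\<^sup>+s. ennreal (c * exp (- c * s)) * indicator {a<..} s * (indicator {t..} r * (if r < l (max 0 s) then 1 else 0)) \<partial>lborel) =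
            (\<integral>\<^sup>+s. ennreal (c * exp (- c * s)) * indicator {b<..} s \<partial>lborel)"
          by (simp only: mult.assoc eqi)
        also have "\<dots> = (\<integral>\<^sup>+s. ennreal (c * exp (- c * s)) * indicator {b..} s \<partial>lborel)"
          using AE_lborel_singleton[of b] by (intro nn_integral_cong_AE, eventually_elim) (auto split: split_indicator)
        also have "\<dots> = 0 - (- exp (- c * b))"
        proof (rule nn_integral_FTC_atLeast)
          show "((\<lambda>s. - exp (- c * s)) \<longlongrightarrow> 0) at_top"
            using tendsto_minus[OF filterlim_compose[OF exp_at_bot filterlim_tendsto_neg_mult_at_bot[OF tendsto_const[of "- c"] _ filterlim_ident]]] c
            by simp
        qed (use c in \<open>auto intro!: derivative_eq_intros\<close>)
        finally show ?thesis using True real by (simp add: laplace_exp_ennreal)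
      next
        case top
        have eqi: "indicator {a<..} s * (indicator {t..} r * (if r < l (max 0 s) then 1 else 0)) = (0 :: ennreal)" for s
          using right_inverse_less_iff[OF r, of s] top a by (cases "0 \<le> s") (auto split: split_indicator)
        show ?thesis unfolding mult.assoc eqi using top by simp
      qed
    qed simp
  qed
  finally show ?thesis .
qed

end

section \<open>The inverse local time\<close>

lemma nn_integral_exponential_tail:
  assumes "0 < c" shows "(\<integral>\<^sup>+s\<in>{b..}. ennreal (c * exp (- c * s)) \<partial>lborel) = ennreal (exp (- c * b))"
proof -
  have "(\<integral>\<^sup>+s\<in>{b..}. ennreal (c * exp (- c * s)) \<partial>lborel) = 0 - (- exp (- c * b))"
  proof (rule nn_integral_FTC_atLeast)
    show "((\<lambda>s. - exp (- c * s)) \<longlongrightarrow> 0) at_top"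
      using tendsto_minus[OF filterlim_compose[OF exp_at_bot filterlim_tendsto_neg_mult_at_bot[OF tendsto_const[of "- c"] _ filterlim_ident]]] assms
      by simp
  qed (use assms in \<open>auto intro!: derivative_eq_intros\<close>)
  then show ?thesis by simp
qed

lemma laplace_exp_inject:
  assumes "0 < q" "laplace_exp q x = laplace_exp q y" shows "x = y"
  using assms by (cases x; cases y) (auto simp: laplace_exp_def)

lemma AE_eq_of_nn_integral_eq:
  fixes f g :: "'a \<Rightarrow> ennreal"
  assumes [measurable]: "f \<in> borel_measurable M" "g \<in> borel_measurable M" and le: "AE x in M. f x \<le> g x"
    and eq: "(\<integral>\<^sup>+x. f x \<partial>M) = (\<integral>\<^sup>+x. g x \<partial>M)" and fin: "(\<integral>\<^sup>+x. g x \<partial>M) < \<infinity>"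
  shows "AE x in M. f x = g x"
proof -
  have "(\<integral>\<^sup>+x. g x - f x \<partial>M) = (\<integral>\<^sup>+x. g x \<partial>M) - (\<integral>\<^sup>+x. f x \<partial>M)"
    using le eq fin by (intro nn_integral_diff) auto
  also have "\<dots> = 0" using eq fin by simp
  finally have "AE x in M. g x - f x = 0" by (subst (asm) nn_integral_0_iff_AE) auto
  with le show ?thesis by eventually_elim (auto simp: diff_eq_0_iff_ennreal)
qed

context nonpolar_kernel
begin

lemma potential_finite:
  assumes "0 < c" shows "potential c x < \<infinity>"
proof -
  have "potential c x \<le> (\<integral>\<^sup>+r. ennreal (k r 0) * indicator {..1} r + ennreal (k 1 0 / c) * (ennreal (c * exp (- c * r)) * indicator {1..} r) \<partial>lborel)"
    unfolding potential_def
  proof (intro nn_integral_mono)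
    fix r :: real
    show "ennreal (exp (- c * r)) * ennreal (k r x) \<le> ennreal (k r 0) * indicator {..1} r + ennreal (k 1 0 / c) * (ennreal (c * exp (- c * r)) * indicator {1..} r)"
    proof (cases "r \<le> 1")
      case True
      have "exp (- c * r) * k r x \<le> k r 0"
      proof (cases "r \<le> 0")
        case False
        then have "exp (- c * r) \<le> 1" using assms by simp
        then have "exp (- c * r) * k r x \<le> 1 * k r x" by (intro mult_right_mono) auto
        then show ?thesis using k_le_0[of r x] by simp
      qed (simp add: k_neg)
      then show ?thesis using True by (auto simp: ennreal_mult[symmetric] intro!: add_increasing2 ennreal_leI)
    next
      case False
      then have "k r x \<le> k 1 0" using k_le_0[of r x] k_dec[of 1 r] by linarith
      then have "exp (- c * r) * k r x \<le> k 1 0 / c * (c * exp (- c * r))" using assms by (simp add: mult_left_mono)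
      then show ?thesis using False assms by (auto simp: ennreal_mult[symmetric] intro!: ennreal_leI)
    qed
  qed
  also have "\<dots> = ennreal (U 1) + ennreal (k 1 0 / c) * ennreal (exp (- c * 1))"
    by (subst nn_integral_add) (auto simp: nn_integral_cmult nn_integral_exponential_tail[OF assms, simplified] U_def g_ennreal)
  also have "\<dots> < \<infinity>" by (simp add: ennreal_mult_less_top)
  finally show ?thesis .
qed

text \<open>Dominated convergence with the value at 0 as majorant. Since r is integrated out, a
  kernel may jump in x at a place that varies with r.\<close>

lemma potential_tendsto:
  assumes c: "0 < c" and x: "x \<longlonglongrightarrow> y"
  shows "(\<lambda>n. potential c (x n)) \<longlonglongrightarrow> potential c y"
  unfolding potential_def
proof (rule nn_integral_dominated_convergence[where w="\<lambda>r. ennreal (exp (- c * r)) * k r 0"])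
  show "(\<integral>\<^sup>+r. ennreal (exp (- c * r)) * ennreal (k r 0) \<partial>lborel) < \<infinity>"
    using potential_finite[OF c, of 0] by (simp add: potential_def)
  show "AE r in lborel. (\<lambda>n. ennreal (exp (- c * r)) * ennreal (k r (x n))) \<longlonglongrightarrow> ennreal (exp (- c * r)) * ennreal (k r y)"
    using k_cont[of y]
  proof eventually_elim
    case (elim r)
    have "(\<lambda>n. k r (x n)) \<longlonglongrightarrow> k r y" by (rule isCont_tendsto_compose[OF elim x])
    then show ?case by (intro ennreal_tendsto_cmult tendsto_ennrealI) simp_all
  qed
qed (auto intro!: mult_left_mono ennreal_leI k_le_0)

text \<open>For small h, \<open>k h x\<close> lies below half of \<open>k 1 0\<close>, hence below
  half of \<open>k h 0\<close>, so a gap remains on an interval (0, d]. A maximal potential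
  therefore identifies the state 0.\<close>

lemma potential_less:
  assumes c: "0 < c" and x: "0 < x" shows "potential c x < potential c 0"
proof -
  have k1: "0 < k 1 0" using k_pos[of 1] by simp
  obtain b where b: "0 < b" "\<And>h. 0 < h \<Longrightarrow> h < b \<Longrightarrow> k h x < k 1 0 / 2"
    using order_tendstoD(2)[OF k_decay[OF x], of "k 1 0 / 2"] k1 by (auto simp: eventually_at_right_field)
  define d where "d = min (b / 2) 1"
  have d: "0 < d" "d < b" "d \<le> 1" using b by (auto simp: d_def)
  define e where "e = exp (- c * d) * (k 1 0 / 2)"
  have e: "0 < e" using k1 by (simp add: e_def)
  have "potential c x + ennreal e * ennreal d = (\<integral>\<^sup>+r. ennreal (exp (- c * r)) * k r x + ennreal e * indicator {0<..d} r \<partial>lborel)"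
    using d k1 unfolding potential_def by (subst nn_integral_add) (auto simp: nn_integral_cmult)
  also have "\<dots> \<le> potential c 0"
    unfolding potential_def
  proof (intro nn_integral_mono)
    fix r :: real
    show "ennreal (exp (- c * r)) * ennreal (k r x) + ennreal e * indicator {0<..d} r \<le> ennreal (exp (- c * r)) * ennreal (k r 0)"
    proof (cases "r \<in> {0<..d}")
      case True
      then have "k r x < k 1 0 / 2" "k 1 0 \<le> k r 0" using b(2)[of r] d k_dec[of r 1] by auto
      then have le: "k r x + k 1 0 / 2 \<le> k r 0" by simp
      have "exp (- c * d) * (k 1 0 / 2) \<le> exp (- c * r) * (k 1 0 / 2)" using True c k1 by (intro mult_right_mono) auto
      moreover have "exp (- c * r) * (k r x + k 1 0 / 2) \<le> exp (- c * r) * k r 0" using le by (intro mult_left_mono) auto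
      ultimately have "exp (- c * r) * k r x + e \<le> exp (- c * r) * k r 0" by (simp add: distrib_left e_def)
      then show ?thesis using True k1 e by (simp add: ennreal_mult[symmetric] ennreal_plus[symmetric] ennreal_leI del: ennreal_plus)
    qed (auto intro!: mult_left_mono ennreal_leI k_le_0)
  qed
  finally have le: "potential c x + ennreal e * ennreal d \<le> potential c 0" .
  have "potential c x + 0 < potential c x + ennreal e * ennreal d"
    using potential_finite[OF c, of x] d e by (intro ennreal_add_left_cancel_less[THEN iffD2]) (auto simp: ennreal_zero_less_mult_iff)
  from less_le_trans[OF this le] show ?thesis by (simp only: add_0_right)
qed

lemma g_right_dyadic: "(\<lambda>m. g (right_dyadic m s) x) \<longlonglongrightarrow> g s x"
proof -
  have "(\<lambda>m. ennreal (g (right_dyadic m s) x)) \<longlonglongrightarrow> ennreal (g s x)"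
    unfolding g_ennreal
  proof (rule nn_integral_dominated_convergence[where w="\<lambda>r. ennreal (k r x) * indicator {..right_dyadic 0 s} r"])
    show "(\<integral>\<^sup>+r\<in>{..right_dyadic 0 s}. ennreal (k r x) \<partial>lborel) < \<infinity>" by (simp add: g_ennreal[symmetric])
    show "AE r in lborel. ennreal (k r x) * indicator {..right_dyadic m s} r \<le> ennreal (k r x) * indicator {..right_dyadic 0 s} r" for m
      using decseqD[OF right_dyadic_decseq[of s], of 0 m] by (auto split: split_indicator)
    show "AE r in lborel. (\<lambda>m. ennreal (k r x) * indicator {..right_dyadic m s} r) \<longlonglongrightarrow> ennreal (k r x) * indicator {..s} r"
    proof (rule AE_I2)
      fix r
      have "eventually (\<lambda>m. ennreal (k r x) * indicator {..right_dyadic m s} r = ennreal (k r x) * indicator {..s} r) sequentially"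
      proof (cases "r \<le> s")
        case True
        then have "r \<le> right_dyadic m s" for m using right_dyadic_greater[of s m] by linarith
        with True show ?thesis by simp
      next
        case False
        then have "eventually (\<lambda>m. right_dyadic m s < r) sequentially"
          using right_dyadic_at_right[of s] by (auto simp: filterlim_at intro: order_tendstoD)
        then show ?thesis by eventually_elim (use False in \<open>simp add: not_le\<close>)
      qed
      then show "(\<lambda>m. ennreal (k r x) * indicator {..right_dyadic m s} r) \<longlonglongrightarrow> ennreal (k r x) * indicator {..s} r"
        by (rule tendsto_eventually)
    qed
  qed measurable
  then show ?thesis by (subst (asm) tendsto_ennreal_iff) auto
qed

lemma g_nonpos: "s \<le> 0 \<Longrightarrow> g s x = 0"
  using g_mono[of s 0 x] by (simp add: antisym)

text \<open>Integration by parts by way of Fubini: exp (- c (t + r)) is the integral of c exp (- c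
  s) over s \<ge> t + r.\<close>

lemma potential_eq_g:
  assumes c: "0 < c"
  shows "ennreal (exp (- c * t)) * potential c x = (\<integral>\<^sup>+s\<in>{t<..}. ennreal (c * exp (- c * s)) * ennreal (g (s - t) x) \<partial>lborel)"
proof -
  have "(\<integral>\<^sup>+s\<in>{t<..}. ennreal (c * exp (- c * s)) * ennreal (g (s - t) x) \<partial>lborel) = (\<integral>\<^sup>+s. ennreal (c * exp (- c * s)) * ennreal (g (s - t) x) \<partial>lborel)"
    by (intro nn_integral_cong) (auto simp: g_nonpos split: split_indicator)
  also have "\<dots> = (\<integral>\<^sup>+s. (\<integral>\<^sup>+r. ennreal (c * exp (- c * s)) * (k r x * (if r \<le> s - t then 1 else 0)) \<partial>lborel) \<partial>lborel)"
    unfolding g_ennreal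
    by (intro nn_integral_cong, subst nn_integral_cmult[symmetric]) (auto intro!: nn_integral_cong split: split_indicator)
  also have "\<dots> = (\<integral>\<^sup>+r. (\<integral>\<^sup>+s. ennreal (c * exp (- c * s)) * (k r x * (if r \<le> s - t then 1 else 0)) \<partial>lborel) \<partial>lborel)"
    by (rule lborel_pair.Fubini'[symmetric]) measurable
  also have "\<dots> = (\<integral>\<^sup>+r. k r x * (\<integral>\<^sup>+s\<in>{t + r..}. ennreal (c * exp (- c * s)) \<partial>lborel) \<partial>lborel)"
    by (intro nn_integral_cong, subst nn_integral_cmult[symmetric]) (auto intro!: nn_integral_cong split: split_indicator simp: mult.commute)
  also have "\<dots> = (\<integral>\<^sup>+r. ennreal (exp (- c * t)) * (ennreal (exp (- c * r)) * k r x) \<partial>lborel)"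
    unfolding nn_integral_exponential_tail[OF c]
    by (intro nn_integral_cong) (simp add: ennreal_mult[symmetric] exp_add[symmetric] mult.assoc[symmetric] distrib_left mult.commute[of _ "k _ _"])
  also have "\<dots> = ennreal (exp (- c * t)) * potential c x"
    unfolding potential_def by (rule nn_integral_cmult) measurable
  finally show ?thesis ..
qed

end

section \<open>Conditional means and optional stopping\<close>

locale local_time_kernel = nonpolar_kernel +
  fixes L :: "real \<Rightarrow> 'a \<Rightarrow> real"
  assumes L: "local_time L"
begin

lemma L_adapted: "0 \<le> t \<Longrightarrow> L t \<in> borel_measurable (F t)"
  using L unfolding local_time_def by blast

lemma
  assumes "\<omega> \<in> space M"
  shows L_0: "L 0 \<omega> = 0"
    and L_mono_on: "mono_on {0..} (\<lambda>t. L t \<omega>)"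
    and L_continuous_on: "continuous_on {0..} (\<lambda>t. L t \<omega>)"
  using L assms unfolding local_time_def by blast+

lemma L_flat:
  assumes "\<omega> \<in> space M" "0 \<le> a" "a \<le> b" "0 < d" "\<And>s. a \<le> s \<Longrightarrow> s \<le> b \<Longrightarrow> d \<le> W s \<omega>"
  shows "L b \<omega> = L a \<omega>"
proof -
  have "\<forall>s\<in>{a..b}. d \<le> W s \<omega>" using assms by auto
  with L assms(1-4) show ?thesis unfolding local_time_def by blast
qed

lemma L_mono: "\<omega> \<in> space M \<Longrightarrow> 0 \<le> s \<Longrightarrow> s \<le> t \<Longrightarrow> L s \<omega> \<le> L t \<omega>"
  using L_mono_on by (auto simp: mono_on_def)

lemma L_nonneg: "\<omega> \<in> space M \<Longrightarrow> 0 \<le> t \<Longrightarrow> 0 \<le> L t \<omega>"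
  using L_mono[of \<omega> 0 t] L_0 by simp

lemma L_measurable: "0 \<le> t \<Longrightarrow> L t \<in> borel_measurable M"
  by (rule F_measurable[OF _ L_adapted])

lemma L_right_limit:
  assumes "\<omega> \<in> space M" "0 \<le> t" shows "((\<lambda>s. L s \<omega>) \<longlongrightarrow> L t \<omega>) (at_right t)"
proof -
  have "((\<lambda>s. L s \<omega>) \<longlongrightarrow> L t \<omega>) (at t within {0..})" using L_continuous_on[OF assms(1)] assms by (auto simp: continuous_on_def)
  then show ?thesis by (rule tendsto_within_subset) (use assms in auto)
qed

lemma L_right_dyadic: "\<omega> \<in> space M \<Longrightarrow> 0 \<le> t \<Longrightarrow> (\<lambda>m. L (right_dyadic m t) \<omega>) \<longlonglongrightarrow> L t \<omega>"
  by (rule filterlim_compose[OF L_right_limit right_dyadic_at_right])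

lemma L_joint: "(\<lambda>p. L (max 0 (fst p)) (snd p)) \<in> borel_measurable (borel \<Otimes>\<^sub>M M)"
  using L_right_dyadic L_measurable dyadic_nonneg by (intro joint_measurable_right_dyadic) auto

lemma L_joint_compose [measurable (raw)]:
  assumes "f \<in> borel_measurable N" "h \<in> measurable N M"
  shows "(\<lambda>x. L (max 0 (f x)) (h x)) \<in> borel_measurable N"
  using measurable_compose[OF measurable_Pair[OF assms] L_joint] by simp

text \<open>Right limits extend the identity from dyadic to arbitrary \<open>s\<close>, over which
  it will be integrated.\<close>

lemma L_increment:
  assumes t: "t \<in> dyadic_times" and s: "0 \<le> s" and A: "A \<in> sets (F t)"
  shows "(\<integral>\<^sup>+\<omega>\<in>A. (L (t + s) \<omega> - L t \<omega>) \<partial>M) = (\<integral>\<^sup>+\<omega>\<in>A. g s (W t \<omega>) \<partial>M)"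
proof -
  have t0: "0 \<le> t" using t by (rule dyadic_nonneg)
  have [measurable]: "A \<in> sets M" by (rule F_sets[OF t0 A])
  define \<tau> where "\<tau> m = right_dyadic m s" for m
  have \<tau>: "\<tau> m \<in> dyadic_times" "0 \<le> \<tau> m" "\<tau> m \<le> \<tau> 0" for m
    using right_dyadic_dyadic[OF s] right_dyadic_greater[of s m] s decseqD[OF right_dyadic_decseq[of s], of 0 m] by (auto simp: \<tau>_def)
  have [measurable]: "L (t + \<tau> m) \<in> borel_measurable M" "L t \<in> borel_measurable M" "L (t + s) \<in> borel_measurable M" for m
    using t0 \<tau>(2)[of m] s by (auto intro: L_measurable)
  have [measurable]: "(\<lambda>\<omega>. g d (W t \<omega>)) \<in> borel_measurable M" for d using t0 by (rule gW_borel)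
  have eq: "(\<integral>\<^sup>+\<omega>\<in>A. (L (t + \<tau> m) \<omega> - L t \<omega>) \<partial>M) = (\<integral>\<^sup>+\<omega>\<in>A. g (\<tau> m) (W t \<omega>) \<partial>M)" for m
    using L t \<tau>(1)[of m] A by (auto simp: local_time_def)
  have Ufin: "(\<integral>\<^sup>+\<omega>\<in>A. U (\<tau> 0) \<partial>M) < \<infinity>"
    using emeasure_finite[of A] by (simp add: nn_integral_cmult ennreal_mult_eq_top_iff less_top[symmetric])
  have "(\<lambda>m. \<integral>\<^sup>+\<omega>\<in>A. g (\<tau> m) (W t \<omega>) \<partial>M) \<longlonglongrightarrow> (\<integral>\<^sup>+\<omega>\<in>A. g s (W t \<omega>) \<partial>M)"
  proof (rule nn_integral_dominated_convergence[OF _ _ _ _ Ufin])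
    show "AE \<omega> in M. ennreal (g (\<tau> m) (W t \<omega>)) * indicator A \<omega> \<le> ennreal (U (\<tau> 0)) * indicator A \<omega>" for m
      using g_le_U U_mono[OF \<tau>(3)] by (intro AE_I2 mult_right_mono ennreal_leI) (auto intro: order_trans)
    show "AE \<omega> in M. (\<lambda>m. ennreal (g (\<tau> m) (W t \<omega>)) * indicator A \<omega>) \<longlonglongrightarrow> ennreal (g s (W t \<omega>)) * indicator A \<omega>"
      using g_right_dyadic[of s] unfolding \<tau>_def by (intro AE_I2) (auto split: split_indicator intro!: tendsto_ennrealI)
  qed measurable
  moreover have "(\<lambda>m. \<integral>\<^sup>+\<omega>\<in>A. (L (t + \<tau> m) \<omega> - L t \<omega>) \<partial>M) \<longlonglongrightarrow> (\<integral>\<^sup>+\<omega>\<in>A. (L (t + s) \<omega> - L t \<omega>) \<partial>M)"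
  proof (rule nn_integral_dominated_convergence[where w="\<lambda>\<omega>. ennreal (L (t + \<tau> 0) \<omega> - L t \<omega>) * indicator A \<omega>"])
    have "(\<integral>\<^sup>+\<omega>\<in>A. (L (t + \<tau> 0) \<omega> - L t \<omega>) \<partial>M) \<le> (\<integral>\<^sup>+\<omega>\<in>A. U (\<tau> 0) \<partial>M)"
      unfolding eq using g_le_U by (intro nn_integral_mono mult_right_mono ennreal_leI) auto
    with Ufin show "(\<integral>\<^sup>+\<omega>\<in>A. (L (t + \<tau> 0) \<omega> - L t \<omega>) \<partial>M) < \<infinity>" by simp
    show "AE \<omega> in M. ennreal (L (t + \<tau> m) \<omega> - L t \<omega>) * indicator A \<omega> \<le> ennreal (L (t + \<tau> 0) \<omega> - L t \<omega>) * indicator A \<omega>" for m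
      using \<tau> t0 by (intro AE_I2 mult_right_mono ennreal_leI diff_right_mono L_mono) auto
    show "AE \<omega> in M. (\<lambda>m. ennreal (L (t + \<tau> m) \<omega> - L t \<omega>) * indicator A \<omega>) \<longlonglongrightarrow> ennreal (L (t + s) \<omega> - L t \<omega>) * indicator A \<omega>"
    proof (rule AE_I2)
      fix \<omega> assume \<omega>: "\<omega> \<in> space M"
      have "filterlim (\<lambda>m. t + \<tau> m) (at_right (t + s)) sequentially"
        unfolding filterlim_at \<tau>_def using right_dyadic_at_right[of s] right_dyadic_greater[of s]
        by (auto simp: filterlim_at intro!: tendsto_add)
      from filterlim_compose[OF L_right_limit[OF \<omega>] this] have "(\<lambda>m. L (t + \<tau> m) \<omega>) \<longlonglongrightarrow> L (t + s) \<omega>" using t0 s by simp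
      then show "(\<lambda>m. ennreal (L (t + \<tau> m) \<omega> - L t \<omega>) * indicator A \<omega>) \<longlonglongrightarrow> ennreal (L (t + s) \<omega> - L t \<omega>) * indicator A \<omega>"
        by (auto split: split_indicator intro!: tendsto_ennrealI tendsto_diff)
    qed
  qed measurable
  ultimately show ?thesis unfolding eq by (rule LIMSEQ_unique[symmetric])
qed

text \<open>The discounted local time after \<open>t\<close>, that is the Stieltjes integral of exp
  (- c s) against the local time over s > t, rewritten by parts.\<close>

definition J :: "real \<Rightarrow> real \<Rightarrow> 'a \<Rightarrow> ennreal" where
  "J c t \<omega> = (\<integral>\<^sup>+s\<in>{t<..}. ennreal (c * exp (- c * s)) * ennreal (L (max 0 s) \<omega> - L t \<omega>) \<partial>lborel)"

lemma J_measurable: "0 \<le> t \<Longrightarrow> J c t \<in> borel_measurable M"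
proof -
  assume "0 \<le> t"
  then have [measurable]: "L t \<in> borel_measurable M" by (rule L_measurable)
  show ?thesis unfolding J_def[abs_def] by measurable
qed

lemma J_expectation:
  assumes t: "t \<in> dyadic_times" and c: "0 < c" and A: "A \<in> sets (F t)"
  shows "(\<integral>\<^sup>+\<omega>\<in>A. J c t \<omega> \<partial>M) = (\<integral>\<^sup>+\<omega>\<in>A. ennreal (exp (- c * t)) * potential c (W t \<omega>) \<partial>M)"
proof -
  have t0: "0 \<le> t" using t by (rule dyadic_nonneg)
  have [measurable]: "A \<in> sets M" by (rule F_sets[OF t0 A])
  have [measurable]: "L t \<in> borel_measurable M" "W t \<in> borel_measurable M" using t0 L_measurable W_measurable by auto
  interpret P: pair_sigma_finite M lborel ..
  have gm [measurable]: "(\<lambda>p. ennreal (g (snd p - t) (W t (fst p)))) \<in> borel_measurable (M \<Otimes>\<^sub>M lborel)"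
  proof -
    have "(\<lambda>p. \<integral>\<^sup>+r. ennreal (k r (W t (fst p))) * (if r \<le> snd p - t then 1 else 0) \<partial>lborel) \<in> borel_measurable (M \<Otimes>\<^sub>M lborel)"
      by measurable
    also have "(\<lambda>p. \<integral>\<^sup>+r. ennreal (k r (W t (fst p))) * (if r \<le> snd p - t then 1 else 0) \<partial>lborel) = (\<lambda>p. ennreal (g (snd p - t) (W t (fst p))))"
      unfolding g_ennreal by (intro ext nn_integral_cong) (auto split: split_indicator)
    finally show ?thesis .
  qed
  have "(\<integral>\<^sup>+\<omega>\<in>A. J c t \<omega> \<partial>M) = (\<integral>\<^sup>+\<omega>. (\<integral>\<^sup>+s. ennreal (c * exp (- c * s)) * indicator {t<..} s * (ennreal (L (max 0 s) \<omega> - L t \<omega>) * indicator A \<omega>) \<partial>lborel) \<partial>M)"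
    unfolding J_def by (intro nn_integral_cong, subst nn_integral_multc[symmetric]) (auto intro!: nn_integral_cong simp: mult_ac)
  also have "\<dots> = (\<integral>\<^sup>+s. (\<integral>\<^sup>+\<omega>. ennreal (c * exp (- c * s)) * indicator {t<..} s * (ennreal (L (max 0 s) \<omega> - L t \<omega>) * indicator A \<omega>) \<partial>M) \<partial>lborel)"
    by (rule P.Fubini'[symmetric]) measurable
  also have "\<dots> = (\<integral>\<^sup>+s. (\<integral>\<^sup>+\<omega>. ennreal (c * exp (- c * s)) * indicator {t<..} s * (ennreal (g (s - t) (W t \<omega>)) * indicator A \<omega>) \<partial>M) \<partial>lborel)"
  proof (rule nn_integral_cong)
    fix s :: real
    have [measurable]: "(\<lambda>\<omega>. g (s - t) (W t \<omega>)) \<in> borel_measurable M" using t0 by (rule gW_borel)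
    have "(\<integral>\<^sup>+\<omega>\<in>A. (L (max 0 s) \<omega> - L t \<omega>) \<partial>M) = (\<integral>\<^sup>+\<omega>\<in>A. g (s - t) (W t \<omega>) \<partial>M)" if "t < s"
      using L_increment[OF t _ A, of "s - t"] that t0 by simp
    then show "(\<integral>\<^sup>+\<omega>. ennreal (c * exp (- c * s)) * indicator {t<..} s * (ennreal (L (max 0 s) \<omega> - L t \<omega>) * indicator A \<omega>) \<partial>M) =
        (\<integral>\<^sup>+\<omega>. ennreal (c * exp (- c * s)) * indicator {t<..} s * (ennreal (g (s - t) (W t \<omega>)) * indicator A \<omega>) \<partial>M)"
      by (subst (1 2) nn_integral_cmult) (auto split: split_indicator)
  qed
  also have "\<dots> = (\<integral>\<^sup>+\<omega>. (\<integral>\<^sup>+s. ennreal (c * exp (- c * s)) * indicator {t<..} s * (ennreal (g (s - t) (W t \<omega>)) * indicator A \<omega>) \<partial>lborel) \<partial>M)"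
    using gm by (intro P.Fubini') (simp add: split_beta')
  also have "\<dots> = (\<integral>\<^sup>+\<omega>\<in>A. ennreal (exp (- c * t)) * potential c (W t \<omega>) \<partial>M)"
  proof (rule nn_integral_cong)
    fix \<omega> assume \<omega>: "\<omega> \<in> space M"
    have [measurable]: "(\<lambda>s. ennreal (g (s - t) (W t \<omega>))) \<in> borel_measurable lborel"
      using measurable_compose[OF measurable_Pair1'[OF \<omega>] gm] by simp
    show "(\<integral>\<^sup>+s. ennreal (c * exp (- c * s)) * indicator {t<..} s * (ennreal (g (s - t) (W t \<omega>)) * indicator A \<omega>) \<partial>lborel)
      = ennreal (exp (- c * t)) * potential c (W t \<omega>) * indicator A \<omega>"
      unfolding potential_eq_g[OF c] by (subst nn_integral_multc[symmetric]) (auto intro!: nn_integral_cong simp: mult_ac)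
  qed
  finally show ?thesis .
qed

lemma J_right_dyadic:
  assumes \<omega>: "\<omega> \<in> space M" and t: "0 \<le> t"
  shows "(\<lambda>m. J c (right_dyadic m t) \<omega>) \<longlonglongrightarrow> J c t \<omega>" and "incseq (\<lambda>m. J c (right_dyadic m t) \<omega>)"
proof -
  define \<tau> where "\<tau> m = right_dyadic m t" for m
  have \<tau>: "t < \<tau> m" "m \<le> n \<Longrightarrow> \<tau> n \<le> \<tau> m" for m n
    using right_dyadic_greater[of t m] decseqD[OF right_dyadic_decseq[of t], of m n] by (auto simp: \<tau>_def)
  define f where "f m s = ennreal (c * exp (- c * s)) * ennreal (L (max 0 s) \<omega> - L (\<tau> m) \<omega>) * indicator {\<tau> m<..} s" for m s
  have Lt: "(\<lambda>m. L (\<tau> m) \<omega>) \<longlonglongrightarrow> L t \<omega>" unfolding \<tau>_def by (rule L_right_dyadic[OF \<omega> t])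
  have inc: "incseq f"
  proof (rule incseq_SucI, rule le_funI)
    fix m s
    have "\<tau> (Suc m) \<le> \<tau> m" "0 \<le> \<tau> (Suc m)" using \<tau>(1)[of "Suc m"] \<tau>(2)[of m "Suc m"] t by auto
    then have "L (\<tau> (Suc m)) \<omega> \<le> L (\<tau> m) \<omega>" using \<omega> by (intro L_mono) auto
    with \<open>\<tau> (Suc m) \<le> \<tau> m\<close> show "f m s \<le> f (Suc m) s"
      unfolding f_def by (auto split: split_indicator intro!: mult_left_mono ennreal_leI)
  qed
  have [measurable]: "(\<lambda>s. L (max 0 s) \<omega>) \<in> borel_measurable borel"
    using \<omega> by (intro L_joint_compose) auto
  have fm: "f m \<in> borel_measurable lborel" for m unfolding f_def[abs_def] by measurable
  have lim: "(\<lambda>m. f m s) \<longlonglongrightarrow> ennreal (c * exp (- c * s)) * ennreal (L (max 0 s) \<omega> - L t \<omega>) * indicator {t<..} s" for s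
  proof (cases "t < s")
    case True
    have "(\<lambda>m. ennreal (c * exp (- c * s)) * ennreal (L (max 0 s) \<omega> - L (\<tau> m) \<omega>)) \<longlonglongrightarrow> ennreal (c * exp (- c * s)) * ennreal (L (max 0 s) \<omega> - L t \<omega>)"
      by (intro ennreal_tendsto_cmult tendsto_ennrealI tendsto_diff tendsto_const Lt) simp
    moreover have "eventually (\<lambda>m. \<tau> m < s) sequentially"
      using right_dyadic_at_right[of t] True unfolding \<tau>_def by (auto simp: filterlim_at intro: order_tendstoD)
    then have "eventually (\<lambda>m. f m s = ennreal (c * exp (- c * s)) * ennreal (L (max 0 s) \<omega> - L (\<tau> m) \<omega>)) sequentially"
      by eventually_elim (simp add: f_def)
    ultimately have "(\<lambda>m. f m s) \<longlonglongrightarrow> ennreal (c * exp (- c * s)) * ennreal (L (max 0 s) \<omega> - L t \<omega>)"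
      by (simp add: tendsto_cong)
    with True show ?thesis by simp
  next
    case False
    then have "f m s = 0" for m using \<tau>(1)[of m] by (simp add: f_def)
    with False show ?thesis by simp
  qed
  have J: "J c (\<tau> m) \<omega> = (\<integral>\<^sup>+s. f m s \<partial>lborel)" for m by (simp add: J_def f_def)
  show "(\<lambda>m. J c (right_dyadic m t) \<omega>) \<longlonglongrightarrow> J c t \<omega>"
    using nn_integral_LIMSEQ[OF inc fm lim] unfolding \<tau>_def[symmetric] J by (simp add: J_def)
  show "incseq (\<lambda>m. J c (right_dyadic m t) \<omega>)"
    unfolding \<tau>_def[symmetric] J using inc by (rule incseq_nn_integral)
qed

text \<open>The hypothesis on \<open>A\<close> and \<open>T\<close> says that \<open>A\<close>
  belongs to the past at the random time \<open>T\<close>. The discretized time takes the value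
  \<open>q i\<close> on \<open>B i\<close>, an event of \<open>F (q i)\<close>, so an identity known
  at fixed dyadic times can be summed over \<open>i\<close>.\<close>

lemma stopping_discretization:
  fixes \<Phi> \<Psi> :: "real \<Rightarrow> 'a \<Rightarrow> ennreal"
  assumes A: "A \<subseteq> space M" and T: "\<And>a. 0 < a \<Longrightarrow> {\<omega>\<in>A. T \<omega> < ennreal a} \<in> sets (F a)"
    and meas: "\<And>q. q \<in> dyadic_times \<Longrightarrow> \<Phi> q \<in> borel_measurable M"
  defines "A' \<equiv> {\<omega>\<in>A. T \<omega> < \<infinity>}"
  shows "(\<lambda>\<omega>. \<Phi> (right_dyadic m (enn2real (T \<omega>))) \<omega> * indicator A' \<omega>) \<in> borel_measurable M"
    and "(\<And>q. q \<in> dyadic_times \<Longrightarrow> \<Psi> q \<in> borel_measurable M) \<Longrightarrow>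
      (\<And>q B. q \<in> dyadic_times \<Longrightarrow> B \<in> sets (F q) \<Longrightarrow> (\<integral>\<^sup>+\<omega>\<in>B. \<Phi> q \<omega> \<partial>M) = (\<integral>\<^sup>+\<omega>\<in>B. \<Psi> q \<omega> \<partial>M)) \<Longrightarrow>
      (\<integral>\<^sup>+\<omega>\<in>A'. \<Phi> (right_dyadic m (enn2real (T \<omega>))) \<omega> \<partial>M) = (\<integral>\<^sup>+\<omega>\<in>A'. \<Psi> (right_dyadic m (enn2real (T \<omega>))) \<omega> \<partial>M)"
proof -
  define q where "q i = real (Suc i) / 2 ^ m" for i
  have q: "q i \<in> dyadic_times" "0 < q i" for i unfolding q_def by (rule dyadic_timesI, simp)
  define B where "B i = {\<omega>\<in>A. T \<omega> < ennreal (q i)} - {\<omega>\<in>A. T \<omega> < ennreal (real i / 2 ^ m)}" for i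
  have BF: "B i \<in> sets (F (q i))" for i
  proof -
    have "{\<omega>\<in>A. T \<omega> < ennreal (real i / 2 ^ m)} \<in> sets (F (q i))"
    proof (cases "i = 0")
      case False
      have le: "real i / 2 ^ m \<le> q i" unfolding q_def by (intro divide_right_mono) auto
      have "0 < real i / 2 ^ m" using False by simp
      from T[OF this] F_mono[OF less_imp_le[OF this] le] show ?thesis by auto
    qed simp
    then show ?thesis unfolding B_def using T[OF q(2)] by (intro sets.Diff) auto
  qed
  have [measurable]: "B i \<in> sets M" for i using F_sets[OF less_imp_le[OF q(2)] BF] .
  have decomp: "X (right_dyadic m (enn2real (T \<omega>))) \<omega> * indicator A' \<omega> = (\<Sum>i. X (q i) \<omega> * indicator (B i) \<omega>)" for X :: "real \<Rightarrow> 'a \<Rightarrow> ennreal" and \<omega>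
  proof (cases "\<omega> \<in> A'")
    case True
    define x where "x = enn2real (T \<omega>)"
    have x: "T \<omega> = ennreal x" "0 \<le> x" using True by (auto simp: x_def A'_def)
    define i where "i = nat \<lfloor>2 ^ m * x\<rfloor>"
    have "0 \<le> \<lfloor>2 ^ m * x\<rfloor>" using x by simp
    then have rd: "right_dyadic m x = q i" by (simp add: right_dyadic_def q_def i_def add.commute)
    have inB: "\<omega> \<in> B j \<longleftrightarrow> j = i" for j
    proof -
      have "\<omega> \<in> B j \<longleftrightarrow> x < q j \<and> real j / 2 ^ m \<le> x"
        using True x by (auto simp: B_def A'_def ennreal_less_iff not_less)
      also have "\<dots> \<longleftrightarrow> 2 ^ m * x < real j + 1 \<and> real j \<le> 2 ^ m * x"
        by (auto simp: q_def field_simps)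
      also have "\<dots> \<longleftrightarrow> \<lfloor>2 ^ m * x\<rfloor> = int j" by (auto simp: floor_eq_iff)
      also have "\<dots> \<longleftrightarrow> j = i" using \<open>0 \<le> \<lfloor>2 ^ m * x\<rfloor>\<close> by (auto simp: i_def)
      finally show ?thesis .
    qed
    have "(\<lambda>j. X (q j) \<omega> * indicator (B j) \<omega>) sums (X (q i) \<omega> * indicator (B i) \<omega>)"
      using inB by (intro sums_single[of i "\<lambda>j. X (q j) \<omega> * indicator (B j) \<omega>", THEN sums_cong[THEN iffD1, rotated]]) auto
    then show ?thesis using True rd inB[of i] by (simp add: sums_iff x_def)
  next
    case False
    have "\<omega> \<notin> B i" for i
    proof
      assume "\<omega> \<in> B i"
      then have "\<omega> \<in> A" "T \<omega> < ennreal (q i)" by (auto simp: B_def)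
      then have "T \<omega> < \<infinity>" by (auto intro: less_trans)
      with \<open>\<omega> \<in> A\<close> False show False by (simp add: A'_def)
    qed
    with False show ?thesis by simp
  qed
  note meas[OF q(1), measurable]
  show "(\<lambda>\<omega>. \<Phi> (right_dyadic m (enn2real (T \<omega>))) \<omega> * indicator A' \<omega>) \<in> borel_measurable M"
    unfolding decomp by measurable
  assume m2: "\<And>q. q \<in> dyadic_times \<Longrightarrow> \<Psi> q \<in> borel_measurable M"
    and eq: "\<And>q B. q \<in> dyadic_times \<Longrightarrow> B \<in> sets (F q) \<Longrightarrow> (\<integral>\<^sup>+\<omega>\<in>B. \<Phi> q \<omega> \<partial>M) = (\<integral>\<^sup>+\<omega>\<in>B. \<Psi> q \<omega> \<partial>M)"
  note m2[OF q(1), measurable]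
  show "(\<integral>\<^sup>+\<omega>\<in>A'. \<Phi> (right_dyadic m (enn2real (T \<omega>))) \<omega> \<partial>M) = (\<integral>\<^sup>+\<omega>\<in>A'. \<Psi> (right_dyadic m (enn2real (T \<omega>))) \<omega> \<partial>M)"
    unfolding decomp by (subst (1 2) nn_integral_suminf) (measurable, simp add: eq[OF q(1) BF])
qed

text \<open>\<open>J_expectation\<close> at the discretized times passes to the limit: for the
  potential by right continuity of \<open>W\<close> and dominated convergence, for \<open>J\<close>
  by monotone convergence, since \<open>J\<close> grows when its starting time decreases. This takes
  the place of the strong Markov property.\<close>

theorem optional_stopping:
  assumes A: "A \<subseteq> space M" and T: "\<And>a. 0 < a \<Longrightarrow> {\<omega>\<in>A. T \<omega> < ennreal a} \<in> sets (F a)" and c: "0 < c"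
  defines "A' \<equiv> {\<omega>\<in>A. T \<omega> < \<infinity>}"
  shows "(\<lambda>\<omega>. ennreal (laplace_exp c (T \<omega>)) * potential c (W (enn2real (T \<omega>)) \<omega>) * indicator A' \<omega>) \<in> borel_measurable M"
    and "(\<lambda>\<omega>. J c (enn2real (T \<omega>)) \<omega> * indicator A' \<omega>) \<in> borel_measurable M"
    and "(\<integral>\<^sup>+\<omega>\<in>A'. ennreal (laplace_exp c (T \<omega>)) * potential c (W (enn2real (T \<omega>)) \<omega>) \<partial>M) = (\<integral>\<^sup>+\<omega>\<in>A'. J c (enn2real (T \<omega>)) \<omega> \<partial>M)"
proof -
  define \<tau> where "\<tau> m \<omega> = right_dyadic m (enn2real (T \<omega>))" for m \<omega>
  define \<Phi> where "\<Phi> t \<omega> = ennreal (exp (- c * t)) * potential c (W t \<omega>)" for t \<omega>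
  have pm: "\<Phi> q \<in> borel_measurable M" if "q \<in> dyadic_times" for q
    unfolding \<Phi>_def[abs_def] using W_measurable[OF dyadic_nonneg[OF that]] by measurable
  have Jm: "J c q \<in> borel_measurable M" if "q \<in> dyadic_times" for q
    by (rule J_measurable[OF dyadic_nonneg[OF that]])
  have fm: "(\<lambda>\<omega>. \<Phi> (\<tau> m \<omega>) \<omega> * indicator A' \<omega>) \<in> borel_measurable M" for m
    unfolding \<tau>_def A'_def using A T pm by (rule stopping_discretization)
  have gm: "(\<lambda>\<omega>. J c (\<tau> m \<omega>) \<omega> * indicator A' \<omega>) \<in> borel_measurable M" for m
    unfolding \<tau>_def A'_def using A T Jm by (rule stopping_discretization)
  have eq: "(\<integral>\<^sup>+\<omega>\<in>A'. \<Phi> (\<tau> m \<omega>) \<omega> \<partial>M) = (\<integral>\<^sup>+\<omega>\<in>A'. J c (\<tau> m \<omega>) \<omega> \<partial>M)" for m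
    unfolding \<tau>_def A'_def
    by (rule stopping_discretization(2)[OF A T pm Jm]) (simp_all add: \<Phi>_def J_expectation c)
  have limf: "(\<lambda>m. \<Phi> (\<tau> m \<omega>) \<omega> * indicator A' \<omega>) \<longlonglongrightarrow> ennreal (laplace_exp c (T \<omega>)) * potential c (W (enn2real (T \<omega>)) \<omega>) * indicator A' \<omega>" for \<omega>
  proof (cases "\<omega> \<in> A'")
    case True
    then have \<omega>: "\<omega> \<in> space M" using A by (auto simp: A'_def)
    define x where "x = enn2real (T \<omega>)"
    have x: "T \<omega> = ennreal x" "0 \<le> x" using True by (auto simp: x_def A'_def)
    have 1: "(\<lambda>m. ennreal (exp (- c * right_dyadic m x))) \<longlonglongrightarrow> ennreal (exp (- c * x))"
      using right_dyadic_at_right[of x] by (intro tendsto_ennrealI tendsto_intros) (auto simp: filterlim_at)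
    have 2: "(\<lambda>m. potential c (W (right_dyadic m x) \<omega>)) \<longlonglongrightarrow> potential c (W x \<omega>)"
      using cadlag_dyadic_limit[OF W_cadlag[OF \<omega>] x(2)] by (rule potential_tendsto[OF c])
    have "(\<lambda>m. \<Phi> (right_dyadic m x) \<omega>) \<longlonglongrightarrow> ennreal (exp (- c * x)) * potential c (W x \<omega>)"
      unfolding \<Phi>_def using potential_finite[OF c, of "W x \<omega>"] by (intro tendsto_mult_ennreal 1 2) auto
    then show ?thesis using True x by (simp add: \<tau>_def laplace_exp_ennreal)
  qed simp
  have limg: "(\<lambda>m. J c (\<tau> m \<omega>) \<omega> * indicator A' \<omega>) \<longlonglongrightarrow> J c (enn2real (T \<omega>)) \<omega> * indicator A' \<omega>" for \<omega>
  proof (cases "\<omega> \<in> A'")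
    case True
    then have \<omega>: "\<omega> \<in> space M" using A by (auto simp: A'_def)
    then show ?thesis using True J_right_dyadic(1)[OF \<omega>] by (simp add: \<tau>_def)
  qed simp
  show "(\<lambda>\<omega>. ennreal (laplace_exp c (T \<omega>)) * potential c (W (enn2real (T \<omega>)) \<omega>) * indicator A' \<omega>) \<in> borel_measurable M"
    using limf fm by (rule borel_measurable_LIMSEQ_order)
  then have l1: "(\<lambda>m. \<integral>\<^sup>+\<omega>\<in>A'. \<Phi> (\<tau> m \<omega>) \<omega> \<partial>M) \<longlonglongrightarrow> (\<integral>\<^sup>+\<omega>\<in>A'. ennreal (laplace_exp c (T \<omega>)) * potential c (W (enn2real (T \<omega>)) \<omega>) \<partial>M)"
  proof (intro nn_integral_dominated_convergence[where w="\<lambda>_. potential c 0"] AE_I2 limf fm)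
    show "(\<integral>\<^sup>+\<omega>. potential c 0 \<partial>M) < \<infinity>" using potential_finite[OF c, of 0] by (simp add: emeasure_space_1)
    fix m \<omega>
    have "0 \<le> \<tau> m \<omega>" unfolding \<tau>_def using right_dyadic_greater[of "enn2real (T \<omega>)" m] by (intro order_trans[OF enn2real_nonneg less_imp_le])
    then have "ennreal (exp (- c * \<tau> m \<omega>)) * potential c (W (\<tau> m \<omega>) \<omega>) \<le> 1 * potential c 0"
      using c by (intro mult_mono potential_anti) auto
    then show "\<Phi> (\<tau> m \<omega>) \<omega> * indicator A' \<omega> \<le> potential c 0" by (auto simp: \<Phi>_def split: split_indicator)
  qed auto
  show "(\<lambda>\<omega>. J c (enn2real (T \<omega>)) \<omega> * indicator A' \<omega>) \<in> borel_measurable M"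
    using limg gm by (rule borel_measurable_LIMSEQ_order)
  have "incseq (\<lambda>m \<omega>. J c (\<tau> m \<omega>) \<omega> * indicator A' \<omega>)"
  proof (rule incseq_SucI, rule le_funI)
    fix m \<omega>
    show "J c (\<tau> m \<omega>) \<omega> * indicator A' \<omega> \<le> J c (\<tau> (Suc m) \<omega>) \<omega> * indicator A' \<omega>"
      using J_right_dyadic(2)[of \<omega> "enn2real (T \<omega>)" c] A
      by (auto simp: \<tau>_def A'_def incseq_Suc_iff split: split_indicator)
  qed
  then have l2: "(\<lambda>m. \<integral>\<^sup>+\<omega>\<in>A'. J c (\<tau> m \<omega>) \<omega> \<partial>M) \<longlonglongrightarrow> (\<integral>\<^sup>+\<omega>\<in>A'. J c (enn2real (T \<omega>)) \<omega> \<partial>M)"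
    using gm limg by (rule nn_integral_LIMSEQ)
  show "(\<integral>\<^sup>+\<omega>\<in>A'. ennreal (laplace_exp c (T \<omega>)) * potential c (W (enn2real (T \<omega>)) \<omega>) \<partial>M) = (\<integral>\<^sup>+\<omega>\<in>A'. J c (enn2real (T \<omega>)) \<omega> \<partial>M)"
    using l1 l2 unfolding eq by (rule LIMSEQ_unique)
qed

end

section \<open>The inverse local time and the zeros of the path\<close>

context local_time_kernel
begin

definition \<xi> :: "real \<Rightarrow> 'a \<Rightarrow> ennreal" where
  "\<xi> t \<omega> = right_inverse (\<lambda>s. L s \<omega>) t"

context
  fixes \<omega> assumes \<omega>: "\<omega> \<in> space M"
begin

lemma \<xi>_less_iff: "0 \<le> t \<Longrightarrow> 0 \<le> a \<Longrightarrow> \<xi> t \<omega> < ennreal a \<longleftrightarrow> t < L a \<omega>"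
  unfolding \<xi>_def by (rule right_inverse_less_iff[OF L_0 L_mono_on L_continuous_on]) (rule \<omega>)+

lemma \<xi>_mono_on: "mono_on {0..} (\<lambda>t. \<xi> t \<omega>)"
  unfolding \<xi>_def by (rule right_inverse_mono[OF L_0[OF \<omega>] L_mono_on[OF \<omega>] L_continuous_on[OF \<omega>]])

lemma \<xi>_cadlag: "cadlag (\<lambda>t. \<xi> t \<omega>)"
  unfolding \<xi>_def by (rule right_inverse_cadlag[OF L_0[OF \<omega>] L_mono_on[OF \<omega>] L_continuous_on[OF \<omega>]])

lemma \<xi>_level: "0 \<le> t \<Longrightarrow> 0 \<le> a \<Longrightarrow> \<xi> t \<omega> = ennreal a \<Longrightarrow> L a \<omega> = t"
  unfolding \<xi>_def by (rule right_inverse_level[OF L_0[OF \<omega>] L_mono_on[OF \<omega>] L_continuous_on[OF \<omega>]])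

lemma \<xi>_L_ge: "0 \<le> q \<Longrightarrow> ennreal q \<le> \<xi> (L q \<omega>) \<omega>"
  unfolding \<xi>_def by (rule right_inverse_ge[OF L_0[OF \<omega>] L_mono_on[OF \<omega>] L_continuous_on[OF \<omega>]])

lemma J_\<xi>:
  assumes "0 \<le> t" "0 < c" "\<xi> t \<omega> < \<infinity>"
  shows "J c (enn2real (\<xi> t \<omega>)) \<omega> = (\<integral>\<^sup>+r\<in>{t..}. ennreal (laplace_exp c (\<xi> r \<omega>)) \<partial>lborel)"
proof -
  have "right_inverse (\<lambda>s. L s \<omega>) t = ennreal (enn2real (\<xi> t \<omega>))" using assms by (simp add: \<xi>_def)
  from right_inverse_integral[OF L_0 L_mono_on L_continuous_on assms(1) enn2real_nonneg this assms(2), OF \<omega> \<omega> \<omega>]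
  show ?thesis by (simp add: J_def \<xi>_def)
qed

text \<open>Between \<open>q\<close> and the next increase of the local time nothing is added, so
  the discounted local time may be started at either time. If no increase follows, it is 0.\<close>

lemma J_after_\<xi>:
  assumes q: "0 \<le> q"
  shows "J c q \<omega> = (if \<xi> (L q \<omega>) \<omega> < \<infinity> then J c (enn2real (\<xi> (L q \<omega>) \<omega>)) \<omega> else 0)"
proof (cases "\<xi> (L q \<omega>) \<omega>")
  case (real a)
  then have a: "q \<le> a" using \<xi>_L_ge[OF q] by simp
  have La: "L a \<omega> = L q \<omega>" using real by (intro \<xi>_level L_nonneg \<omega> q) auto
  have "J c q \<omega> = J c a \<omega>"
    unfolding J_def
  proof (rule nn_integral_cong)
    fix s :: real
    have "L s \<omega> = L q \<omega>" if "q < s" "s \<le> a"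
      using L_mono[OF \<omega>, of q s] L_mono[OF \<omega>, of s a] that q La by simp
    then show "ennreal (c * exp (- c * s)) * ennreal (L (max 0 s) \<omega> - L q \<omega>) * indicator {q<..} s =
        ennreal (c * exp (- c * s)) * ennreal (L (max 0 s) \<omega> - L a \<omega>) * indicator {a<..} s"
      using a q La by (cases "s \<le> a") (auto split: split_indicator simp: max_def)
  qed
  with real show ?thesis by simp
next
  case top
  have "L s \<omega> = L q \<omega>" if "q < s" for s
    using \<xi>_less_iff[OF L_nonneg[OF \<omega> q], of s] top L_mono[OF \<omega>, of q s] that q by simp
  then have "J c q \<omega> = (\<integral>\<^sup>+s. 0 \<partial>(lborel :: real measure))"
    unfolding J_def using q by (intro nn_integral_cong) (auto split: split_indicator simp: max_def)
  with top show ?thesis by simp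
qed

end

lemma \<xi>_less_adapted:
  assumes "0 \<le> t" "0 \<le> a" shows "{\<omega>\<in>space M. \<xi> t \<omega> < ennreal a} \<in> sets (F a)"
proof -
  have "{\<omega>\<in>space M. \<xi> t \<omega> < ennreal a} = {\<omega>\<in>space (F a). t < L a \<omega>}"
    using assms \<xi>_less_iff by auto
  also have "\<dots> \<in> sets (F a)" using L_adapted[OF assms(2)] by measurable
  finally show ?thesis .
qed

lemma \<xi>_measurable: "0 \<le> t \<Longrightarrow> \<xi> t \<in> borel_measurable M"
proof (rule borel_measurableI_less)
  fix y assume t: "0 \<le> t"
  show "{\<omega>\<in>space M. \<xi> t \<omega> < y} \<in> sets M"
  proof (cases y)
    case (real r)
    then show ?thesis using F_sets[OF _ \<xi>_less_adapted[OF t, of r]] by simp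
  next
    case top
    have "{\<omega>\<in>space M. \<xi> t \<omega> < y} = (\<Union>n::nat. {\<omega>\<in>space M. \<xi> t \<omega> < ennreal (real n)})"
      unfolding top by (auto simp: ennreal_of_nat_eq_real_of_nat[symmetric] dest: ennreal_Ex_less_of_nat intro: less_trans[OF _ of_nat_less_top])
    also have "\<dots> \<in> sets M" using F_sets[OF _ \<xi>_less_adapted[OF t]] by auto
    finally show ?thesis .
  qed
qed

text \<open>The first time \<open>\<sigma> q\<close> after \<open>q\<close> at which the local time increases is compared with the first time
  \<open>\<delta> n q\<close> at which \<open>W\<close> falls below \<open>1 / (n + 1)\<close>. The local time is constant in between, so optional stopping at both
  times forces them to agree in the limit.\<close>

definition \<sigma> :: "real \<Rightarrow> 'a \<Rightarrow> ennreal" where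
  "\<sigma> q \<omega> = \<xi> (L q \<omega>) \<omega>"

definition \<delta> :: "nat \<Rightarrow> real \<Rightarrow> 'a \<Rightarrow> ennreal" where
  "\<delta> n q \<omega> = (INF s\<in>{s. q \<le> s \<and> W s \<omega> < ennreal (1 / Suc n)}. ennreal s)"

lemma \<sigma>_less_adapted:
  assumes q: "0 \<le> q" and a: "0 < a" shows "{\<omega>\<in>space M. \<sigma> q \<omega> < ennreal a} \<in> sets (F a)"
proof (cases "q \<le> a")
  case True
  have "{\<omega>\<in>space M. \<sigma> q \<omega> < ennreal a} = {\<omega>\<in>space (F a). L q \<omega> < L a \<omega>}"
    using q a \<xi>_less_iff L_nonneg by (auto simp: \<sigma>_def)
  also have "\<dots> \<in> sets (F a)"
    using L_adapted[OF less_imp_le[OF a]] F_measurable_mono[OF q True L_adapted[OF q]] by measurable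
  finally show ?thesis .
next
  case False
  have "\<not> \<sigma> q \<omega> < ennreal a" if "\<omega> \<in> space M" for \<omega>
    using order_trans[OF ennreal_leI[of a q] \<xi>_L_ge[OF that q]] False by (simp add: \<sigma>_def not_less)
  then have "{\<omega>\<in>space M. \<sigma> q \<omega> < ennreal a} = {}" by auto
  then show ?thesis by (simp only: sets.empty_sets)
qed

text \<open>By right continuity, a path strictly below the threshold at \<open>s\<close> is still
  below it at a dyadic time shortly afterwards.\<close>

lemma \<delta>_less_iff:
  assumes \<omega>: "\<omega> \<in> space M" and q: "0 \<le> q" and a: "0 < a"
  shows "\<delta> n q \<omega> < ennreal a \<longleftrightarrow> (\<exists>s\<in>dyadic_times. q \<le> s \<and> s < a \<and> W s \<omega> < ennreal (1 / Suc n))"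
proof
  assume "\<delta> n q \<omega> < ennreal a"
  then obtain s where s: "q \<le> s" "W s \<omega> < ennreal (1 / Suc n)" "s < a"
    using q by (auto simp: \<delta>_def INF_less_iff ennreal_less_iff)
  then have s0: "0 \<le> s" using q by simp
  have "eventually (\<lambda>m. W (right_dyadic m s) \<omega> < ennreal (1 / Suc n)) sequentially"
    using cadlag_dyadic_limit[OF W_cadlag[OF \<omega>] s0] s(2) by (rule order_tendstoD)
  moreover have "eventually (\<lambda>m. right_dyadic m s < a) sequentially"
    using right_dyadic_at_right[of s] s by (auto simp: filterlim_at intro: order_tendstoD)
  ultimately have "eventually (\<lambda>m. W (right_dyadic m s) \<omega> < ennreal (1 / Suc n) \<and> right_dyadic m s < a) sequentially"
    by eventually_elim simp
  then obtain m where "W (right_dyadic m s) \<omega> < ennreal (1 / Suc n)" "right_dyadic m s < a" by (auto dest: eventually_happens)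
  then show "\<exists>s\<in>dyadic_times. q \<le> s \<and> s < a \<and> W s \<omega> < ennreal (1 / Suc n)"
    using right_dyadic_dyadic[OF s0, of m] right_dyadic_greater[of s m] s(1) by (intro bexI[of _ "right_dyadic m s"]) auto
next
  assume "\<exists>s\<in>dyadic_times. q \<le> s \<and> s < a \<and> W s \<omega> < ennreal (1 / Suc n)"
  then obtain s where s: "q \<le> s" "s < a" "W s \<omega> < ennreal (1 / Suc n)" by blast
  then have "\<delta> n q \<omega> \<le> ennreal s" unfolding \<delta>_def by (intro INF_lower) auto
  also have "\<dots> < ennreal a" using s a by (intro ennreal_lessI)
  finally show "\<delta> n q \<omega> < ennreal a" .
qed

lemma \<delta>_less_adapted:
  assumes q: "0 \<le> q" and a: "0 < a" shows "{\<omega>\<in>space M. \<delta> n q \<omega> < ennreal a} \<in> sets (F a)"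
proof -
  have [measurable]: "W s \<in> borel_measurable (F a)" if "s \<in> {s\<in>dyadic_times. q \<le> s \<and> s < a}" for s
    using that q by (intro F_measurable_mono[OF _ _ W_adapted]) auto
  have c: "countable {s\<in>dyadic_times. q \<le> s \<and> s < a}"
    by (rule countable_subset[OF _ countable_dyadic_times]) auto
  have "{\<omega>\<in>space M. \<delta> n q \<omega> < ennreal a} = {\<omega>\<in>space (F a). \<exists>s\<in>{s\<in>dyadic_times. q \<le> s \<and> s < a}. W s \<omega> < ennreal (1 / Suc n)}"
    using \<delta>_less_iff[OF _ q a] a by auto
  also have "\<dots> \<in> sets (F a)" using c by measurable
  finally show ?thesis .
qed

text \<open>If \<open>W\<close> exceeded the threshold at the infimum, it would do so for a while
  longer, and the infimum would be larger.\<close>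

lemma W_at_\<delta>:
  assumes \<omega>: "\<omega> \<in> space M" and q: "0 \<le> q" and fin: "\<delta> n q \<omega> < \<infinity>"
  shows "W (enn2real (\<delta> n q \<omega>)) \<omega> \<le> ennreal (1 / Suc n)"
proof (rule ccontr)
  define d where "d = enn2real (\<delta> n q \<omega>)"
  have d: "\<delta> n q \<omega> = ennreal d" "0 \<le> d" using fin by (auto simp: d_def)
  assume "\<not> W (enn2real (\<delta> n q \<omega>)) \<omega> \<le> ennreal (1 / Suc n)"
  then have gt: "ennreal (1 / Suc n) < W d \<omega>" by (simp add: d_def)
  have "((\<lambda>s. W s \<omega>) \<longlongrightarrow> W d \<omega>) (at_right d)" using W_cadlag[OF \<omega>] d by (auto simp: cadlag_def)
  from order_tendstoD(1)[OF this gt] obtain b where b: "d < b" "\<And>s. d < s \<Longrightarrow> s < b \<Longrightarrow> ennreal (1 / Suc n) < W s \<omega>"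
    by (auto simp: eventually_at_right_field)
  have "ennreal b \<le> \<delta> n q \<omega>"
    unfolding \<delta>_def
  proof (rule INF_greatest)
    fix s assume s: "s \<in> {s. q \<le> s \<and> W s \<omega> < ennreal (1 / Suc n)}"
    then have "\<delta> n q \<omega> \<le> ennreal s" unfolding \<delta>_def by (intro INF_lower)
    then have "d \<le> s" using d s q by (auto simp: ennreal_le_iff)
    moreover have "s \<noteq> d" using s gt by auto
    moreover have "\<not> (d < s \<and> s < b)" using s b(2)[of s] by auto
    ultimately show "ennreal b \<le> ennreal s" by (intro ennreal_leI) linarith
  qed
  with d b(1) show False by simp
qed

text \<open>By \<open>L_flat\<close> the local time is constant as long as W \<ge> 1 / (n + 1), so
  it cannot increase before \<open>\<delta> n q\<close>.\<close>

lemma \<delta>_le_\<sigma>: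
  assumes \<omega>: "\<omega> \<in> space M" and q: "0 \<le> q" shows "\<delta> n q \<omega> \<le> \<sigma> q \<omega>"
proof (rule ccontr)
  assume "\<not> \<delta> n q \<omega> \<le> \<sigma> q \<omega>"
  then have lt: "\<sigma> q \<omega> < \<delta> n q \<omega>" by simp
  then obtain b where b: "\<sigma> q \<omega> < ennreal b" "ennreal b < \<delta> n q \<omega>" "0 \<le> b"
    using dense[OF lt] by (metis ennreal_cases less_top_ennreal top.not_eq_extremum top_greatest leD)
  have "q \<le> b" using \<xi>_L_ge[OF \<omega> q] b by (auto simp: \<sigma>_def dest: le_less_trans simp: ennreal_less_iff[OF q])
  have "L b \<omega> = L q \<omega>"
  proof (rule L_flat[OF \<omega> q \<open>q \<le> b\<close>, of "ennreal (1 / Suc n)"])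
    fix s assume s: "q \<le> s" "s \<le> b"
    show "ennreal (1 / Suc n) \<le> W s \<omega>"
    proof (rule ccontr)
      assume "\<not> ennreal (1 / Suc n) \<le> W s \<omega>"
      then have "\<delta> n q \<omega> \<le> ennreal s" unfolding \<delta>_def using s by (intro INF_lower) auto
      also have "\<dots> \<le> ennreal b" using s by (intro ennreal_leI)
      finally show False using b by simp
    qed
  qed simp
  moreover have "L q \<omega> < L b \<omega>" using b(1) \<xi>_less_iff[OF \<omega> L_nonneg[OF \<omega> q] b(3)] by (simp add: \<sigma>_def)
  ultimately show False by simp
qed

lemma \<delta>_mono: "m \<le> n \<Longrightarrow> \<delta> m q \<omega> \<le> \<delta> n q \<omega>"
  unfolding \<delta>_def
proof (intro INF_superset_mono subsetI)
  fix s assume mn: "m \<le> n" and s: "s \<in> {s. q \<le> s \<and> W s \<omega> < ennreal (1 / Suc n)}"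
  have "ennreal (1 / Suc n) \<le> ennreal (1 / Suc m)" using mn by (intro ennreal_leI frac_le) auto
  with s show "s \<in> {s. q \<le> s \<and> W s \<omega> < ennreal (1 / Suc m)}" by (auto intro: less_le_trans)
qed simp

lemma less_adapted_measurable:
  assumes "\<And>a. 0 < a \<Longrightarrow> {\<omega>\<in>space M. T \<omega> < ennreal a} \<in> sets (F a)"
  shows "T \<in> borel_measurable M"
proof (rule borel_measurableI_less)
  have m: "{\<omega>\<in>space M. T \<omega> < ennreal a} \<in> sets M" for a
  proof (cases "0 < a")
    case True
    then show ?thesis using F_sets[OF _ assms[OF True]] by simp
  qed (simp add: ennreal_neg)
  fix y show "{\<omega>\<in>space M. T \<omega> < y} \<in> sets M"
  proof (cases y)
    case (real r)
    then show ?thesis using m[of r] by simp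
  next
    case top
    have "{\<omega>\<in>space M. T \<omega> < y} = (\<Union>n::nat. {\<omega>\<in>space M. T \<omega> < ennreal (real n)})"
      unfolding top by (auto simp: ennreal_of_nat_eq_real_of_nat[symmetric] dest: ennreal_Ex_less_of_nat intro: less_trans[OF _ of_nat_less_top])
    also have "\<dots> \<in> sets M" using m by auto
    finally show ?thesis .
  qed
qed

text \<open>With \<open>P\<close> the 1-potential and \<open>ds\<close> the limit of the times
  \<open>\<delta> n q\<close>, the chain I = E exp (- \<sigma>) P (W \<sigma>) \<le> P 0 E exp (-
  \<sigma>) \<le> P 0 E exp (- ds) \<le> I consists of equalities. Equality in the second inequality
  gives \<sigma> = ds, in the first P (W \<sigma>) = P 0, so that W vanishes at \<sigma> by
  \<open>potential_less\<close>. This does the work of quasi-left continuity.\<close>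

lemma \<sigma>_eq_approach:
  assumes q: "q \<in> dyadic_times"
  shows "AE \<omega> in M. (SUP n. \<delta> n q \<omega>) = \<sigma> q \<omega> \<and> (\<sigma> q \<omega> < \<infinity> \<longrightarrow> W (enn2real (\<sigma> q \<omega>)) \<omega> = 0)"
proof -
  have q0: "0 \<le> q" using q by (rule dyadic_nonneg)
  define P where "P = potential 1"
  define e where "e = laplace_exp 1"
  define ds where "ds \<omega> = (SUP n. \<delta> n q \<omega>)" for \<omega>
  have [measurable]: "\<delta> n q \<in> borel_measurable M" "\<sigma> q \<in> borel_measurable M" for n
    using \<delta>_less_adapted[OF q0] \<sigma>_less_adapted[OF q0] by (auto intro: less_adapted_measurable)
  have [measurable]: "ds \<in> borel_measurable M" unfolding ds_def[abs_def] by measurable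
  have [measurable]: "e \<in> borel_measurable borel" by (simp add: e_def)
  have ds_le: "ds \<omega> \<le> \<sigma> q \<omega>" if "\<omega> \<in> space M" for \<omega> unfolding ds_def by (intro SUP_least \<delta>_le_\<sigma>[OF that q0])
  have anti: "e y \<le> e x" if "x \<le> y" for x y unfolding e_def using that by (intro laplace_exp_antimono) auto
  have Jm: "J 1 q \<in> borel_measurable M" by (rule J_measurable[OF q0])
  define I where "I = (\<integral>\<^sup>+\<omega>. J 1 q \<omega> \<partial>M)"
  define A where "A = {\<omega>\<in>space M. \<sigma> q \<omega> < \<infinity>}"
  define h where "h \<omega> = ennreal (e (\<sigma> q \<omega>)) * P (W (enn2real (\<sigma> q \<omega>)) \<omega>) * indicator A \<omega>" for \<omega>
  note os = optional_stopping[of "space M" "\<sigma> q" 1, OF order_refl \<sigma>_less_adapted[OF q0] zero_less_one]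
  have hm [measurable]: "h \<in> borel_measurable M" using os(1) by (simp add: h_def[abs_def] A_def e_def P_def)
  have Ih: "I = (\<integral>\<^sup>+\<omega>. h \<omega> \<partial>M)"
  proof -
    have "I = (\<integral>\<^sup>+\<omega>\<in>A. J 1 (enn2real (\<sigma> q \<omega>)) \<omega> \<partial>M)"
      unfolding I_def by (intro nn_integral_cong) (auto simp: J_after_\<xi>[OF _ q0] A_def \<sigma>_def split: split_indicator)
    also have "\<dots> = (\<integral>\<^sup>+\<omega>. h \<omega> \<partial>M)" using os(3) by (simp add: h_def A_def e_def P_def)
    finally show ?thesis .
  qed
  \<comment> \<open>Optional stopping at \<open>\<delta> n q\<close>, where W \<le> 1 / (n + 1)
    bounds the potential from below by a quantity that tends to \<open>P 0\<close>.\<close>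
  have lower: "P (ennreal (1 / Suc n)) * (\<integral>\<^sup>+\<omega>. e (ds \<omega>) \<partial>M) \<le> I" for n
  proof -
    define B where "B = {\<omega>\<in>space M. \<delta> n q \<omega> < \<infinity>}"
    note os = optional_stopping[of "space M" "\<delta> n q" 1, OF order_refl \<delta>_less_adapted[OF q0] zero_less_one]
    have "P (ennreal (1 / Suc n)) * (\<integral>\<^sup>+\<omega>. e (ds \<omega>) \<partial>M) = (\<integral>\<^sup>+\<omega>. P (ennreal (1 / Suc n)) * e (ds \<omega>) \<partial>M)"
      by (rule nn_integral_cmult[symmetric]) measurable
    also have "\<dots> \<le> (\<integral>\<^sup>+\<omega>\<in>B. ennreal (e (\<delta> n q \<omega>)) * P (W (enn2real (\<delta> n q \<omega>)) \<omega>) \<partial>M)"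
    proof (rule nn_integral_mono)
      fix \<omega> assume \<omega>: "\<omega> \<in> space M"
      have le: "e (ds \<omega>) \<le> e (\<delta> n q \<omega>)" unfolding ds_def by (intro anti SUP_upper) simp
      show "P (ennreal (1 / Suc n)) * ennreal (e (ds \<omega>)) \<le> ennreal (e (\<delta> n q \<omega>)) * P (W (enn2real (\<delta> n q \<omega>)) \<omega>) * indicator B \<omega>"
      proof (cases "\<omega> \<in> B")
        case True
        then have "P (ennreal (1 / Suc n)) \<le> P (W (enn2real (\<delta> n q \<omega>)) \<omega>)"
          unfolding P_def by (intro potential_anti W_at_\<delta> q0) (auto simp: B_def)
        then show ?thesis using True le by (subst mult.commute) (auto intro!: mult_mono ennreal_leI)
      next
        case False
        then have "\<delta> n q \<omega> = \<top>" using \<omega> by (auto simp: B_def less_top[symmetric])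
        then have "e (ds \<omega>) = 0" using le by (simp add: e_def antisym)
        then show ?thesis by simp
      qed
    qed
    also have "\<dots> = (\<integral>\<^sup>+\<omega>\<in>B. J 1 (enn2real (\<delta> n q \<omega>)) \<omega> \<partial>M)"
      using os(3) by (simp add: B_def e_def P_def)
    also have "\<dots> \<le> I"
      unfolding I_def
    proof (rule nn_integral_mono)
      fix \<omega> assume \<omega>: "\<omega> \<in> space M"
      show "J 1 (enn2real (\<delta> n q \<omega>)) \<omega> * indicator B \<omega> \<le> J 1 q \<omega>"
      proof (cases "\<omega> \<in> B")
        case True
        have "ennreal q \<le> \<delta> n q \<omega>" unfolding \<delta>_def by (intro INF_greatest ennreal_leI) auto
        also have "\<delta> n q \<omega> = ennreal (enn2real (\<delta> n q \<omega>))" using True by (simp add: B_def)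
        finally have le: "q \<le> enn2real (\<delta> n q \<omega>)" by (simp add: ennreal_le_iff)
        then have "L q \<omega> \<le> L (enn2real (\<delta> n q \<omega>)) \<omega>" using \<omega> q0 by (intro L_mono)
        with True le show ?thesis
          unfolding J_def by (auto intro!: nn_integral_mono mult_mono ennreal_leI split: split_indicator)
      qed simp
    qed
    finally show ?thesis .
  qed
  have efin: "(\<integral>\<^sup>+\<omega>. e (ds \<omega>) \<partial>M) \<le> 1"
  proof -
    have "(\<integral>\<^sup>+\<omega>. e (ds \<omega>) \<partial>M) \<le> (\<integral>\<^sup>+\<omega>. 1 \<partial>M)"
      unfolding e_def by (intro nn_integral_mono) (simp add: laplace_exp_le_1)
    then show ?thesis by (simp add: emeasure_space_1)
  qed
  have P0: "P 0 < \<infinity>" "0 < P 0"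
    using potential_finite[of 1 0] potential_less[of 1 1] by (auto simp: P_def zero_less_iff_neq_zero)
  have inv: "(\<lambda>n. ennreal (1 / Suc n)) \<longlonglongrightarrow> 0"
    using tendsto_ennrealI[OF LIMSEQ_inverse_real_of_nat] by (simp add: inverse_eq_divide)
  have "P 0 * (\<integral>\<^sup>+\<omega>. e (ds \<omega>) \<partial>M) \<le> I"
  proof (rule LIMSEQ_le_const2)
    have "(\<lambda>n. (\<integral>\<^sup>+\<omega>. e (ds \<omega>) \<partial>M) * P (ennreal (1 / Suc n))) \<longlonglongrightarrow> (\<integral>\<^sup>+\<omega>. e (ds \<omega>) \<partial>M) * P 0"
      unfolding P_def using efin by (intro ennreal_tendsto_cmult potential_tendsto[OF zero_less_one inv]) (auto intro: le_less_trans)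
    then show "(\<lambda>n. P (ennreal (1 / Suc n)) * (\<integral>\<^sup>+\<omega>. e (ds \<omega>) \<partial>M)) \<longlonglongrightarrow> P 0 * (\<integral>\<^sup>+\<omega>. e (ds \<omega>) \<partial>M)"
      by (simp add: mult.commute)
  qed (use lower in blast)
  then have l1: "(\<integral>\<^sup>+\<omega>. P 0 * e (ds \<omega>) \<partial>M) \<le> (\<integral>\<^sup>+\<omega>. h \<omega> \<partial>M)"
    unfolding Ih by (subst nn_integral_cmult) auto
  have h_le: "h \<omega> \<le> P 0 * e (\<sigma> q \<omega>)" for \<omega>
    unfolding h_def P_def by (subst mult.commute[of "potential 1 0"]) (auto split: split_indicator intro!: mult_left_mono potential_anti)
  have s_le: "P 0 * e (\<sigma> q \<omega>) \<le> P 0 * e (ds \<omega>)" if "\<omega> \<in> space M" for \<omega>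
    using ds_le[OF that] by (intro mult_left_mono ennreal_leI anti) auto
  have l2: "(\<integral>\<^sup>+\<omega>. h \<omega> \<partial>M) \<le> (\<integral>\<^sup>+\<omega>. P 0 * e (\<sigma> q \<omega>) \<partial>M)" by (intro nn_integral_mono h_le)
  have l3: "(\<integral>\<^sup>+\<omega>. P 0 * e (\<sigma> q \<omega>) \<partial>M) \<le> (\<integral>\<^sup>+\<omega>. P 0 * e (ds \<omega>) \<partial>M)" by (intro nn_integral_mono s_le)
  have fin: "(\<integral>\<^sup>+\<omega>. P 0 * e (ds \<omega>) \<partial>M) < \<infinity>"
    using efin P0 by (subst nn_integral_cmult) (auto simp: ennreal_mult_less_top intro: le_less_trans)
  have eq1: "AE \<omega> in M. P 0 * ennreal (e (\<sigma> q \<omega>)) = P 0 * ennreal (e (ds \<omega>))"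
    using l1 l2 l3 fin s_le by (intro AE_eq_of_nn_integral_eq) auto
  have eq2: "AE \<omega> in M. h \<omega> = P 0 * ennreal (e (\<sigma> q \<omega>))"
    using l1 l2 l3 fin h_le by (intro AE_eq_of_nn_integral_eq) auto
  from eq1 eq2 AE_space show ?thesis
  proof eventually_elim
    case (elim \<omega>)
    have "ennreal (e (\<sigma> q \<omega>)) = ennreal (e (ds \<omega>))" using elim(1) P0 by (subst (asm) ennreal_mult_cancel_left) auto
    then have "e (\<sigma> q \<omega>) = e (ds \<omega>)" by (simp add: e_def)
    then have "\<sigma> q \<omega> = ds \<omega>" unfolding e_def by (rule laplace_exp_inject[rotated]) simp
    moreover have "W (enn2real (\<sigma> q \<omega>)) \<omega> = 0" if fin: "\<sigma> q \<omega> < \<infinity>"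
    proof (rule ccontr)
      assume "W (enn2real (\<sigma> q \<omega>)) \<omega> \<noteq> 0"
      then have "P (W (enn2real (\<sigma> q \<omega>)) \<omega>) < P 0" unfolding P_def by (intro potential_less) (auto simp: zero_less_iff_neq_zero)
      moreover have "\<omega> \<in> A" using fin elim by (simp add: A_def)
      moreover have "ennreal (e (\<sigma> q \<omega>)) \<noteq> 0" "ennreal (e (\<sigma> q \<omega>)) \<noteq> \<top>" using fin by (auto simp: e_def laplace_exp_def)
      moreover have "ennreal (e (\<sigma> q \<omega>)) * P (W (enn2real (\<sigma> q \<omega>)) \<omega>) = ennreal (e (\<sigma> q \<omega>)) * P 0"
        using elim(2) \<open>\<omega> \<in> A\<close> by (simp add: h_def mult.commute)
      ultimately show False by (subst (asm) ennreal_mult_cancel_left) auto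
    qed
    ultimately show ?case by (simp add: ds_def)
  qed
qed

definition regular :: "'a \<Rightarrow> bool" where
  "regular \<omega> \<longleftrightarrow> W 0 \<omega> = 0 \<and>
    (\<forall>q\<in>dyadic_times. (SUP n. \<delta> n q \<omega>) = \<sigma> q \<omega> \<and> (\<sigma> q \<omega> < \<infinity> \<longrightarrow> W (enn2real (\<sigma> q \<omega>)) \<omega> = 0))"

lemma AE_regular: "AE \<omega> in M. regular \<omega>"
proof -
  have "AE \<omega> in M. \<forall>q\<in>dyadic_times. (SUP n. \<delta> n q \<omega>) = \<sigma> q \<omega> \<and> (\<sigma> q \<omega> < \<infinity> \<longrightarrow> W (enn2real (\<sigma> q \<omega>)) \<omega> = 0)"
    by (subst AE_ball_countable[OF countable_dyadic_times]) (intro ballI \<sigma>_eq_approach)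
  with W_0 show ?thesis by eventually_elim (simp add: regular_def)
qed

context
  fixes \<omega> assumes \<omega>: "\<omega> \<in> space M" and reg: "regular \<omega>"
begin

text \<open>\<open>regular\<close> controls the times \<open>\<sigma> q\<close> with dyadic
  \<open>q\<close>. If \<open>W\<close> were positive at \<open>a = \<xi> t\<close>, it would be
  positive on some interval (a, b). A dyadic \<open>q\<close> slightly after \<open>a\<close>, at
  which the local time is still below its value at \<open>b\<close>, has \<open>\<sigma> q\<close>
  in [q, b), where \<open>W\<close> is 0.\<close>

lemma W_at_\<xi>:
  assumes t: "0 \<le> t" and fin: "\<xi> t \<omega> < \<infinity>" shows "W (enn2real (\<xi> t \<omega>)) \<omega> = 0"
proof (rule ccontr)
  define a where "a = enn2real (\<xi> t \<omega>)"
  have a: "\<xi> t \<omega> = ennreal a" "0 \<le> a" using fin by (auto simp: a_def)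
  assume "W (enn2real (\<xi> t \<omega>)) \<omega> \<noteq> 0"
  then have "0 < W a \<omega>" by (simp add: a_def zero_less_iff_neq_zero)
  moreover have "((\<lambda>s. W s \<omega>) \<longlongrightarrow> W a \<omega>) (at_right a)" using W_cadlag[OF \<omega>] a by (auto simp: cadlag_def)
  ultimately have "eventually (\<lambda>s. 0 < W s \<omega>) (at_right a)" by (intro order_tendstoD)
  then obtain b where b: "a < b" "\<And>s. a < s \<Longrightarrow> s < b \<Longrightarrow> 0 < W s \<omega>" by (auto simp: eventually_at_right_field)
  have La: "L a \<omega> = t" by (rule \<xi>_level[OF \<omega> t a(2,1)])
  have Lb: "t < L b \<omega>" using \<xi>_less_iff[OF \<omega> t, of b] a b by (simp add: ennreal_less_iff)
  have "eventually (\<lambda>s. L s \<omega> < L b \<omega>) (at_right a)"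
    using L_right_limit[OF \<omega> a(2)] La Lb by (intro order_tendstoD(2)[where y="L a \<omega>"]) auto
  then obtain b' where b': "a < b'" "\<And>s. a < s \<Longrightarrow> s < b' \<Longrightarrow> L s \<omega> < L b \<omega>" by (auto simp: eventually_at_right_field)
  obtain q where q: "q \<in> dyadic_times" "a < q" "q < b'" using dyadic_between[OF a(2) b'(1)] by blast
  have q0: "0 \<le> q" using q by (intro dyadic_nonneg)
  have "\<sigma> q \<omega> < ennreal b"
    unfolding \<sigma>_def using b'(2)[of q] q b a by (subst \<xi>_less_iff[OF \<omega> L_nonneg[OF \<omega> q0]]) auto
  moreover have "ennreal q \<le> \<sigma> q \<omega>" unfolding \<sigma>_def by (rule \<xi>_L_ge[OF \<omega> q0])
  ultimately obtain s where s: "\<sigma> q \<omega> = ennreal s" "q \<le> s" "s < b" "0 \<le> s"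
    using q0 by (cases "\<sigma> q \<omega>") (auto simp: ennreal_less_iff ennreal_le_iff)
  have "W s \<omega> = 0" using reg q(1) s by (auto simp: regular_def)
  with b(2)[of s] s q show False by simp
qed

text \<open>For dyadic q < t the path comes arbitrarily close to 0 between \<open>q\<close> and
  \<open>t\<close>, so all \<open>\<delta> n q\<close>, and with them \<open>\<sigma> q\<close>, lie
  in [q, t]. As \<open>\<sigma> q\<close> belongs to the range, letting \<open>q\<close> tend to
  \<open>t\<close> puts \<open>t\<close> into the closure.\<close>

lemma approach_in_range:
  assumes "(t = 0) \<or> (0 < t \<and> (W t \<omega> = 0 \<or> ((\<lambda>s. W s \<omega>) \<longlongrightarrow> 0) (at_left t)))"
  shows "t \<in> range_closure (\<lambda>r. \<xi> r \<omega>)"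
proof -
  have key: "\<exists>s. \<sigma> q \<omega> = ennreal s \<and> q \<le> s \<and> s \<le> t"
    if q: "q \<in> dyadic_times" and qt: "\<And>n. \<delta> n q \<omega> \<le> ennreal t" and t: "0 \<le> t" for q
  proof -
    have "\<sigma> q \<omega> = (SUP n. \<delta> n q \<omega>)" using reg q by (simp add: regular_def)
    also have "\<dots> \<le> ennreal t" by (intro SUP_least qt)
    finally have "\<sigma> q \<omega> \<le> ennreal t" .
    moreover have "ennreal q \<le> \<sigma> q \<omega>" unfolding \<sigma>_def by (rule \<xi>_L_ge[OF \<omega> dyadic_nonneg[OF q]])
    ultimately show ?thesis using t dyadic_nonneg[OF q] by (cases "\<sigma> q \<omega>") (auto simp: top_unique)
  qed
  have inR: "s \<in> {enn2real (\<xi> r \<omega>) | r. 0 \<le> r \<and> \<xi> r \<omega> < \<infinity>}" if "\<sigma> q \<omega> = ennreal s" "0 \<le> s" "0 \<le> q" for q s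
    using that L_nonneg[OF \<omega> that(3)] by (auto simp: \<sigma>_def intro!: exI[of _ "L q \<omega>"])
  show ?thesis
  proof (cases "t = 0")
    case True
    have "\<delta> n 0 \<omega> \<le> ennreal 0" for n
      unfolding \<delta>_def using reg by (intro INF_lower) (auto simp: regular_def)
    then obtain s where "\<sigma> 0 \<omega> = ennreal s" "0 \<le> s" "s \<le> 0" using key[of 0] True by auto
    then have "t \<in> {enn2real (\<xi> r \<omega>) | r. 0 \<le> r \<and> \<xi> r \<omega> < \<infinity>}" using inR[of 0 s] True by simp
    then show ?thesis unfolding range_closure_def by (rule closure_subset[THEN subsetD])
  next
    case False
    with assms have t: "0 < t" and z: "W t \<omega> = 0 \<or> ((\<lambda>s. W s \<omega>) \<longlongrightarrow> 0) (at_left t)" by auto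
    show ?thesis
      unfolding range_closure_def closure_approachable
    proof (intro allI impI)
      fix e :: real assume e: "0 < e"
      have "0 \<le> max 0 (t - e)" "max 0 (t - e) < t" using t e by auto
      then obtain q where q: "q \<in> dyadic_times" "max 0 (t - e) < q" "q < t" by (rule dyadic_between)
      have "\<delta> n q \<omega> \<le> ennreal t" for n
        using z
      proof
        assume "W t \<omega> = 0"
        then show ?thesis unfolding \<delta>_def using q by (intro INF_lower) auto
      next
        assume "((\<lambda>s. W s \<omega>) \<longlongrightarrow> 0) (at_left t)"
        then have "eventually (\<lambda>s. W s \<omega> < ennreal (1 / Suc n)) (at_left t)" by (rule order_tendstoD) simp
        then obtain b where b: "b < t" "\<And>s. b < s \<Longrightarrow> s < t \<Longrightarrow> W s \<omega> < ennreal (1 / Suc n)" by (auto simp: eventually_at_left_field)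
        define s where "s = (max b q + t) / 2"
        have s: "b < s" "q < s" "s < t" using b(1) q by (auto simp: s_def)
        then have "\<delta> n q \<omega> \<le> ennreal s" unfolding \<delta>_def using b(2)[of s] by (intro INF_lower) auto
        also have "\<dots> \<le> ennreal t" using s by (intro ennreal_leI) simp
        finally show ?thesis .
      qed
      from key[OF q(1) this] t obtain s where s: "\<sigma> q \<omega> = ennreal s" "q \<le> s" "s \<le> t" by auto
      moreover have "0 \<le> q" using q by (intro dyadic_nonneg)
      ultimately show "\<exists>y\<in>{enn2real (\<xi> r \<omega>) | r. 0 \<le> r \<and> \<xi> r \<omega> < \<infinity>}. dist y t < e"
        using q by (intro bexI[OF _ inR[of q s]]) (auto simp: dist_real_def)
    qed
  qed
qed

lemma zero_set_eq_range: "zero_set W \<omega> = range_closure (\<lambda>r. \<xi> r \<omega>)"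
proof
  show "range_closure (\<lambda>r. \<xi> r \<omega>) \<subseteq> zero_set W \<omega>"
    unfolding range_closure_def zero_set_def by (intro closure_mono) (auto intro: W_at_\<xi>)
  have "{t. 0 \<le> t \<and> W t \<omega> = 0} \<subseteq> range_closure (\<lambda>r. \<xi> r \<omega>)"
    using approach_in_range by (auto simp: order_le_less)
  then show "zero_set W \<omega> \<subseteq> range_closure (\<lambda>r. \<xi> r \<omega>)"
    unfolding zero_set_def by (intro closure_minimal) (auto simp: range_closure_def)
qed

lemma \<xi>_0: "\<xi> 0 \<omega> = 0"
proof -
  have "\<delta> n 0 \<omega> = 0" for n
    using reg INF_lower[of 0 "{s. 0 \<le> s \<and> W s \<omega> < ennreal (1 / Suc n)}" ennreal] by (auto simp: \<delta>_def regular_def)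
  moreover have "\<sigma> 0 \<omega> = (SUP n. \<delta> n 0 \<omega>)" using reg by (auto simp: regular_def)
  ultimately show ?thesis by (simp add: \<sigma>_def L_0[OF \<omega>])
qed

end

end

section \<open>The Laplace exponent of the inverse local time\<close>

context local_time_kernel
begin

text \<open>The past of the inverse local time up to level \<open>s\<close> is part of the past of
  \<open>W\<close> up to time \<open>\<xi> t\<close>: where \<open>\<xi> t < a\<close>, an earlier
  value \<open>\<xi> u\<close> equals its minimum with \<open>a\<close>, which is known at time
  \<open>a\<close>.\<close>

lemma past_stopping:
  assumes st: "0 \<le> s" "s \<le> t" and A: "A \<in> past M \<xi> s" and a: "0 < a"
  shows "{\<omega>\<in>A. \<xi> t \<omega> < ennreal a} \<in> sets (F a)"
  using A unfolding past_def
proof (induction rule: sigma_sets.induct)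
  case (Basic A)
  then obtain u B where u: "0 \<le> u" "u \<le> s" and B: "B \<in> sets borel" and A: "A = \<xi> u -` B \<inter> space M" by auto
  have [measurable]: "(\<lambda>\<omega>. min (\<xi> u \<omega>) (ennreal a)) \<in> borel_measurable (F a)"
  proof (rule borel_measurableI_less)
    fix y
    show "{\<omega>\<in>space (F a). min (\<xi> u \<omega>) (ennreal a) < y} \<in> sets (F a)"
    proof (cases "ennreal a < y")
      case True
      then have "{\<omega>\<in>space (F a). min (\<xi> u \<omega>) (ennreal a) < y} = space (F a)" by (auto simp: min_less_iff_disj)
      then show ?thesis by simp
    next
      case False
      then have "y < \<top>" by (auto simp: not_less intro: le_less_trans)
      then obtain b where b: "y = ennreal b" "0 \<le> b" by (cases y) auto
      with False a have "b \<le> a" by (simp add: not_less ennreal_le_iff)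
      have "{\<omega>\<in>space (F a). min (\<xi> u \<omega>) (ennreal a) < y} = {\<omega>\<in>space M. \<xi> u \<omega> < ennreal b}"
        using False a b by (auto simp: min_less_iff_disj)
      also have "\<dots> \<in> sets (F a)" using \<xi>_less_adapted[OF u(1) b(2)] F_mono[OF b(2) \<open>b \<le> a\<close>] by auto
      finally show ?thesis .
    qed
  qed
  have "min (\<xi> u \<omega>) (ennreal a) = \<xi> u \<omega>" if "\<omega> \<in> space M" "\<xi> t \<omega> < ennreal a" for \<omega>
  proof -
    have "\<xi> u \<omega> \<le> \<xi> t \<omega>" using \<xi>_mono_on[OF that(1)] u st by (auto simp: mono_on_def)
    with that have "\<xi> u \<omega> \<le> ennreal a" by (blast intro: less_imp_le le_less_trans)
    then show ?thesis by (simp add: min_def)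
  qed
  then have "{\<omega>\<in>A. \<xi> t \<omega> < ennreal a} = {\<omega>\<in>space (F a). min (\<xi> u \<omega>) (ennreal a) \<in> B} \<inter> {\<omega>\<in>space M. \<xi> t \<omega> < ennreal a}"
    using a by (auto simp: A)
  also have "\<dots> \<in> sets (F a)"
    using B \<xi>_less_adapted[of t a] st a by (intro sets.Int) (measurable, auto)
  finally show ?case .
next
  case Empty
  show ?case by simp
next
  case (Compl A)
  have "{\<omega>\<in>space M - A. \<xi> t \<omega> < ennreal a} = {\<omega>\<in>space M. \<xi> t \<omega> < ennreal a} - {\<omega>\<in>A. \<xi> t \<omega> < ennreal a}" by auto
  with Compl.IH \<xi>_less_adapted[of t a] st a show ?case by auto
next
  case (Union A)
  have "{\<omega>\<in>\<Union>i. A i. \<xi> t \<omega> < ennreal a} = (\<Union>i. {\<omega>\<in>A i. \<xi> t \<omega> < ennreal a})" by auto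
  with Union.IH show ?case by auto
qed

text \<open>The mean discounted local time from the state 0, and the reciprocal of the Laplace
  exponent of the inverse local time at \<open>n\<close>.\<close>

definition mean :: "nat \<Rightarrow> real" where
  "mean n = (LINT r:{0<..}|lborel. exp (- real n * r) * k r 0)"

lemma mean:
  assumes "0 < n" shows "ennreal (mean n) = potential n 0" and "0 < mean n"
proof -
  have "mean n = enn2real (\<integral>\<^sup>+r. ennreal (indicator {0<..} r *\<^sub>R (exp (- real n * r) * k r 0)) \<partial>lborel)"
    unfolding mean_def set_lebesgue_integral_def by (rule integral_eq_nn_integral) auto
  also have "(\<integral>\<^sup>+r. ennreal (indicator {0<..} r *\<^sub>R (exp (- real n * r) * k r 0)) \<partial>lborel) = potential n 0"
    unfolding potential_def by (intro nn_integral_cong) (auto simp: k_neg ennreal_mult split: split_indicator)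
  finally have m: "mean n = enn2real (potential n 0)" .
  have f: "potential n 0 < \<infinity>" using assms by (intro potential_finite) simp
  have "potential n 1 < potential n 0" using assms by (intro potential_less) simp_all
  then have f0: "0 < potential n 0" by (rule le_less_trans[OF zero_le])
  show "ennreal (mean n) = potential n 0" using f by (simp add: m)
  show "0 < mean n" using f f0 by (simp add: m enn2real_positive_iff)
qed

lemma laplace_\<xi>_joint: "(\<lambda>p. laplace_exp (real n) (\<xi> (max 0 (fst p)) (snd p))) \<in> borel_measurable (borel \<Otimes>\<^sub>M M)" if "0 < n"
proof (rule joint_measurable_right_dyadic[where X="\<lambda>t \<omega>. laplace_exp (real n) (\<xi> t \<omega>)"])
  show "(\<lambda>\<omega>. laplace_exp (real n) (\<xi> q \<omega>)) \<in> borel_measurable M" if "q \<in> dyadic_times" for q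
    using \<xi>_measurable[OF dyadic_nonneg[OF that]] by measurable
  show "(\<lambda>m. laplace_exp (real n) (\<xi> (right_dyadic m t) \<omega>)) \<longlonglongrightarrow> laplace_exp (real n) (\<xi> t \<omega>)"
    if "\<omega> \<in> space M" "0 \<le> t" for \<omega> t
    using \<open>0 < n\<close> by (intro isCont_tendsto_compose[OF isCont_laplace_exp] cadlag_dyadic_limit[OF \<xi>_cadlag[OF that(1)] that(2)]) simp
qed

text \<open>Optional stopping at \<open>\<xi> t\<close>. There \<open>W\<close> is 0, so the
  potential is the constant \<open>mean n\<close>, and \<open>J_\<xi>\<close> writes the remaining
  discounted local time as an integral over the levels r \<ge> t.\<close>

lemma \<xi>_tail_integral:
  assumes st: "0 \<le> s" "s \<le> t" and A: "A \<in> past M \<xi> s" and n: "0 < n"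
  shows "ennreal (mean n) * (\<integral>\<^sup>+\<omega>\<in>A. laplace_exp n (\<xi> t \<omega>) \<partial>M) = (\<integral>\<^sup>+r\<in>{t..}. (\<integral>\<^sup>+\<omega>\<in>A. laplace_exp n (\<xi> r \<omega>) \<partial>M) \<partial>lborel)"
proof -
  have [measurable]: "A \<in> sets M" by (rule subsetD[OF past_subset_sets A]) (rule \<xi>_measurable)
  have t0: "0 \<le> t" using st by simp
  have [measurable]: "\<xi> t \<in> borel_measurable M" by (rule \<xi>_measurable[OF t0])
  note laplace_\<xi>_joint[OF n, measurable]
  interpret P: pair_sigma_finite M lborel ..
  note os = optional_stopping[of A "\<xi> t" "real n", OF sets.sets_into_space[OF \<open>A \<in> sets M\<close>] past_stopping[OF st A]]
  have "ennreal (mean n) * (\<integral>\<^sup>+\<omega>\<in>A. laplace_exp n (\<xi> t \<omega>) \<partial>M) = (\<integral>\<^sup>+\<omega>. ennreal (mean n) * (ennreal (laplace_exp n (\<xi> t \<omega>)) * indicator A \<omega>) \<partial>M)"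
    by (rule nn_integral_cmult[symmetric]) measurable
  also have "\<dots> = (\<integral>\<^sup>+\<omega>\<in>{\<omega>\<in>A. \<xi> t \<omega> < \<infinity>}. ennreal (laplace_exp n (\<xi> t \<omega>)) * potential n (W (enn2real (\<xi> t \<omega>)) \<omega>) \<partial>M)"
  proof (rule nn_integral_cong_AE)
    show "AE \<omega> in M. ennreal (mean n) * (ennreal (laplace_exp n (\<xi> t \<omega>)) * indicator A \<omega>) =
      ennreal (laplace_exp n (\<xi> t \<omega>)) * potential n (W (enn2real (\<xi> t \<omega>)) \<omega>) * indicator {\<omega>\<in>A. \<xi> t \<omega> < \<infinity>} \<omega>"
      using AE_regular AE_space
    proof eventually_elim
      case (elim \<omega>)
      then show ?case using W_at_\<xi>[OF elim(2,1) t0] mean(1)[OF n]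
        by (cases "\<xi> t \<omega> < \<infinity>") (auto split: split_indicator simp: less_top[symmetric] mult.commute)
    qed
  qed
  also have "\<dots> = (\<integral>\<^sup>+\<omega>\<in>{\<omega>\<in>A. \<xi> t \<omega> < \<infinity>}. J n (enn2real (\<xi> t \<omega>)) \<omega> \<partial>M)"
    using n by (intro os) simp_all
  also have "\<dots> = (\<integral>\<^sup>+\<omega>. (\<integral>\<^sup>+r. ennreal (laplace_exp n (\<xi> (max 0 r) \<omega>)) * indicator {t..} r * indicator A \<omega> \<partial>lborel) \<partial>M)"
  proof (rule nn_integral_cong)
    fix \<omega> assume \<omega>: "\<omega> \<in> space M"
    have "(\<integral>\<^sup>+r. ennreal (laplace_exp n (\<xi> (max 0 r) \<omega>)) * indicator {t..} r \<partial>lborel) = (\<integral>\<^sup>+r\<in>{t..}. ennreal (laplace_exp n (\<xi> r \<omega>)) \<partial>lborel)"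
      using t0 by (intro nn_integral_cong) (auto split: split_indicator simp: max_def)
    also have "\<dots> = (if \<xi> t \<omega> < \<infinity> then J n (enn2real (\<xi> t \<omega>)) \<omega> else 0)"
    proof (cases "\<xi> t \<omega> < \<infinity>")
      case False
      then have "\<xi> r \<omega> = \<top>" if "t \<le> r" for r
        using mono_onD[OF \<xi>_mono_on[OF \<omega>], of t r] t0 that by (simp add: top_unique less_top[symmetric])
      then have "(\<integral>\<^sup>+r\<in>{t..}. ennreal (laplace_exp n (\<xi> r \<omega>)) \<partial>lborel) = (\<integral>\<^sup>+r. 0 \<partial>(lborel :: real measure))"
        by (intro nn_integral_cong) (auto split: split_indicator)
      with False show ?thesis by simp
    qed (use J_\<xi>[OF \<omega> t0, of n] n in simp)
    finally show "J n (enn2real (\<xi> t \<omega>)) \<omega> * indicator {\<omega>\<in>A. \<xi> t \<omega> < \<infinity>} \<omega> =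
        (\<integral>\<^sup>+r. ennreal (laplace_exp n (\<xi> (max 0 r) \<omega>)) * indicator {t..} r * indicator A \<omega> \<partial>lborel)"
      by (auto split: split_indicator)
  qed
  also have "\<dots> = (\<integral>\<^sup>+r. (\<integral>\<^sup>+\<omega>. ennreal (laplace_exp n (\<xi> (max 0 r) \<omega>)) * indicator {t..} r * indicator A \<omega> \<partial>M) \<partial>lborel)"
  proof (rule P.Fubini'[symmetric])
    have "(\<lambda>p. laplace_exp (real n) (\<xi> (max 0 (snd p)) (fst p))) \<in> borel_measurable (M \<Otimes>\<^sub>M lborel)"
      using measurable_compose[OF measurable_Pair[of snd "M \<Otimes>\<^sub>M lborel" borel fst M] laplace_\<xi>_joint[OF n]] by simp
    then show "(\<lambda>(\<omega>, r). ennreal (laplace_exp n (\<xi> (max 0 r) \<omega>)) * indicator {t..} r * indicator A \<omega>) \<in> borel_measurable (M \<Otimes>\<^sub>M lborel)"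
      by (simp add: split_beta')
  qed
  also have "\<dots> = (\<integral>\<^sup>+r\<in>{t..}. (\<integral>\<^sup>+\<omega>\<in>A. laplace_exp n (\<xi> r \<omega>) \<partial>M) \<partial>lborel)"
    using t0 by (intro nn_integral_cong) (auto split: split_indicator simp: max_def)
  finally show ?thesis .
qed

theorem laplace_increments_\<xi>: "laplace_increments M (\<lambda>n t. exp (- t / mean n)) \<xi>"
  unfolding laplace_increments_def
proof (intro conjI allI impI ballI)
  show "\<xi> t \<in> borel_measurable M" if "0 \<le> t" for t using that by (rule \<xi>_measurable)
  show "mono_on {0..} (\<lambda>t. \<xi> t \<omega>)" "cadlag (\<lambda>t. \<xi> t \<omega>)" if "\<omega> \<in> space M" for \<omega>
    using \<xi>_mono_on[OF that] \<xi>_cadlag[OF that] by auto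
  show "AE \<omega> in M. \<xi> 0 \<omega> = 0"
    using AE_regular AE_space by eventually_elim (rule \<xi>_0)
  fix s t :: real and A n assume s: "0 \<le> s" and t: "0 \<le> t" and A: "A \<in> past M \<xi> s" and n: "0 < (n::nat)"
  define I where "I r = (\<integral>\<^sup>+\<omega>\<in>A. laplace_exp n (\<xi> r \<omega>) \<partial>M)" for r
  have I1: "I r \<le> 1" for r
  proof -
    have "I r \<le> (\<integral>\<^sup>+\<omega>. 1 \<partial>M)" unfolding I_def by (intro nn_integral_mono) (auto simp: laplace_exp_le_1 split: split_indicator)
    then show ?thesis by (simp add: emeasure_space_1)
  qed
  then have Ifin: "I r < \<top>" for r by (rule le_less_trans) simp
  have anti: "I r' \<le> I r" if "s \<le> r" "r \<le> r'" for r r'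
    unfolding I_def using that s \<xi>_mono_on
    by (intro nn_integral_mono mult_right_mono ennreal_leI laplace_exp_antimono) (auto simp: mono_on_def)
  \<comment> \<open>The cut at \<open>s\<close> makes the function monotone on the whole line, hence
    measurable.\<close>
  define \<gamma> where "\<gamma> r = enn2real (I (max s r))" for r
  have \<gamma>: "ennreal (\<gamma> r) = I (max s r)" for r using Ifin by (simp add: \<gamma>_def)
  have \<gamma>_anti: "\<gamma> b \<le> \<gamma> a" if "a \<le> b" for a b
    unfolding \<gamma>_def using that anti[of "max s a" "max s b"] Ifin by (intro enn2real_mono) auto
  have meas: "\<gamma> \<in> borel_measurable borel"
  proof -
    have "mono (\<lambda>r. - \<gamma> r)" using \<gamma>_anti by (auto simp: mono_def)
    then have "(\<lambda>r. - (- \<gamma> r)) \<in> borel_measurable borel" by (intro borel_measurable_uminus borel_measurable_mono)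
    then show ?thesis by simp
  qed
  have tail: "ennreal (mean n * \<gamma> r) = (\<integral>\<^sup>+r'\<in>{r..}. ennreal (\<gamma> r') \<partial>lborel)" if "s \<le> r" for r
  proof -
    have "ennreal (mean n * \<gamma> r) = ennreal (mean n) * I r"
      using that mean(2)[OF n] by (simp add: ennreal_mult' \<gamma> max_def)
    also have "\<dots> = (\<integral>\<^sup>+r'\<in>{r..}. I r' \<partial>lborel)"
      unfolding I_def by (rule \<xi>_tail_integral[OF s that A n])
    also have "\<dots> = (\<integral>\<^sup>+r'\<in>{r..}. ennreal (\<gamma> r') \<partial>lborel)"
      using that by (intro nn_integral_cong) (auto simp: \<gamma> max_def split: split_indicator)
    finally show ?thesis .
  qed
  have "\<gamma> (s + t) = exp (- t / mean n) * \<gamma> s"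
    by (rule exponential_of_tail_integral[OF mean(2)[OF n] _ \<gamma>_anti tail meas t]) (simp add: \<gamma>_def)
  then have "ennreal (\<gamma> (s + t)) = ennreal (exp (- t / mean n)) * ennreal (\<gamma> s)"
    by (simp add: ennreal_mult' \<gamma>_def)
  then show "(\<integral>\<^sup>+\<omega>\<in>A. laplace_exp (real n) (\<xi> (s + t) \<omega>) \<partial>M) =
      ennreal (exp (- t / mean n)) * (\<integral>\<^sup>+\<omega>\<in>A. laplace_exp (real n) (\<xi> s \<omega>) \<partial>M)"
    using t by (simp add: \<gamma> I_def max_def)
qed

end

theorem (in regenerative_kernel) has_regenerative_density_zeros:
  assumes decay: "\<And>d. set_integrable lborel {0<..1} (\<lambda>r. k r 0) \<Longrightarrow> 0 < d \<Longrightarrow> ((\<lambda>h. k h d) \<longlongrightarrow> 0) (at_right 0)"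
    and closed: "\<And>\<omega>. \<omega> \<in> space M \<Longrightarrow> closed (R \<omega>)"
    and lower: "\<And>\<omega> t. \<omega> \<in> space M \<Longrightarrow> 0 \<le> t \<Longrightarrow> W t \<omega> = 0 \<Longrightarrow> t \<in> R \<omega>"
    and upper: "AE \<omega> in M. \<forall>t\<in>R \<omega>. t = 0 \<or> (0 < t \<and> (W t \<omega> = 0 \<or> ((\<lambda>s. W s \<omega>) \<longlongrightarrow> 0) (at_left t)))"
  shows "has_regenerative_density M R (\<lambda>r. k r 0)"
proof (cases "set_integrable lborel {0<..1} (\<lambda>r. k r 0)")
  case True
  interpret nonpolar_kernel M W F k
    using True decay by unfold_locales auto
  obtain L where L: "local_time L" using local_time_exists by blast
  interpret local_time_kernel M W F k L by unfold_locales (rule L)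
  have "AE \<omega> in M. R \<omega> = range_closure (\<lambda>t. \<xi> t \<omega>)"
    using AE_regular upper AE_space[of M]
  proof eventually_elim
    case (elim \<omega>)
    have "zero_set W \<omega> \<subseteq> R \<omega>"
      unfolding zero_set_def using lower[OF elim(3)] closed[OF elim(3)] by (intro closure_minimal) auto
    moreover have "R \<omega> \<subseteq> range_closure (\<lambda>t. \<xi> t \<omega>)"
      using elim(2) approach_in_range[OF elim(3,1)] by blast
    ultimately show ?case using zero_set_eq_range[OF elim(3,1)] by blast
  qed
  with laplace_increments_\<xi> True closed show ?thesis
    unfolding has_regenerative_density_def mean_def by auto
next
  case False
  have "AE \<omega> in M. R \<omega> = {0}"
    using polar_zero_set[OF False] upper W_0 AE_space
  proof eventually_elim
    case (elim \<omega>)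
    have "0 \<in> R \<omega>" using lower[OF elim(4), of 0] elim(3) by simp
    moreover have "t = 0" if "t \<in> R \<omega>" for t using elim(1,2) that by blast
    ultimately show ?case by blast
  qed
  with False closed show ?thesis by (simp add: has_regenerative_density_def)
qed

section \<open>Filtrations completed by null sets\<close>

definition completed_past :: "'w measure \<Rightarrow> (real \<Rightarrow> 'w \<Rightarrow> ennreal) \<Rightarrow> real \<Rightarrow> 'w measure" where
  "completed_past M W t = sigma (space M) {A\<in>sets M. \<exists>B\<in>past M W t. AE \<omega> in M. \<omega> \<in> A \<longleftrightarrow> \<omega> \<in> B}"

lemma space_completed_past [simp]: "space (completed_past M W t) = space M"
  unfolding completed_past_def by (rule space_measure_of) (auto dest: sets.sets_into_space)

lemma sets_completed_past:
  "sets (completed_past M W t) = {A\<in>sets M. \<exists>B\<in>past M W t. AE \<omega> in M. \<omega> \<in> A \<longleftrightarrow> \<omega> \<in> B}" (is "_ = ?G")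
proof -
  have "sigma_algebra (space M) ?G"
    unfolding sigma_algebra_iff2
  proof (intro conjI ballI allI impI)
    show "?G \<subseteq> Pow (space M)" by (auto dest: sets.sets_into_space)
    show "{} \<in> ?G" by (auto simp: past_def intro!: bexI[of _ "{}"] sigma_sets.Empty)
  next
    fix A assume "A \<in> ?G"
    then obtain B where A: "A \<in> sets M" and B: "B \<in> past M W t" "AE \<omega> in M. \<omega> \<in> A \<longleftrightarrow> \<omega> \<in> B" by auto
    have "space M - B \<in> past M W t" using B(1) unfolding past_def by (rule sigma_sets.Compl)
    moreover have "AE \<omega> in M. \<omega> \<in> space M - A \<longleftrightarrow> \<omega> \<in> space M - B" using B(2) by eventually_elim auto
    ultimately show "space M - A \<in> ?G" using A by blast
  next
    fix A :: "nat \<Rightarrow> 'a set" assume A: "range A \<subseteq> ?G"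
    then have "\<forall>i. \<exists>B. B \<in> past M W t \<and> (AE \<omega> in M. \<omega> \<in> A i \<longleftrightarrow> \<omega> \<in> B)" by blast
    then obtain B where B: "\<And>i. B i \<in> past M W t" "\<And>i. AE \<omega> in M. \<omega> \<in> A i \<longleftrightarrow> \<omega> \<in> B i" by metis
    have "(\<Union>i. B i) \<in> past M W t" using B(1) unfolding past_def by (rule sigma_sets.Union)
    moreover have "AE \<omega> in M. \<forall>i. \<omega> \<in> A i \<longleftrightarrow> \<omega> \<in> B i" using B(2) by (simp add: AE_all_countable)
    then have "AE \<omega> in M. \<omega> \<in> (\<Union>i. A i) \<longleftrightarrow> \<omega> \<in> (\<Union>i. B i)" by eventually_elim auto
    moreover have "(\<Union>i. A i) \<in> sets M" using A by auto
    ultimately show "(\<Union>i. A i) \<in> ?G" by blast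
  qed
  then show ?thesis unfolding completed_past_def by (rule sigma_algebra.sets_measure_of_eq)
qed

text \<open>Replacing an event of the past by an almost surely equal one changes no integral, so the
  shift identity carries over to the completed filtration.\<close>

lemma regenerative_kernel_completed_past:
  assumes M: "prob_space M"
    and W: "\<And>t. 0 \<le> t \<Longrightarrow> W t \<in> borel_measurable M"
    and cadlag: "\<And>\<omega>. \<omega> \<in> space M \<Longrightarrow> cadlag (\<lambda>t. W t \<omega>)"
    and W_0: "AE \<omega> in M. W 0 \<omega> = 0"
    and k_meas: "case_prod k \<in> borel_measurable (borel \<Otimes>\<^sub>M borel)"
    and k: "\<And>r x. 0 \<le> k r x" "\<And>r x. r \<le> 0 \<Longrightarrow> k r x = 0" "\<And>x y r. x \<le> y \<Longrightarrow> k r y \<le> k r x"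
      "\<And>x. AE r in lborel. isCont (k r) x" "\<And>r. 0 < r \<Longrightarrow> 0 < k r 0" "\<And>r r'. 0 < r \<Longrightarrow> r \<le> r' \<Longrightarrow> k r' 0 \<le> k r 0"
    and shift: "\<And>s t h A. 0 \<le> s \<Longrightarrow> 0 \<le> t \<Longrightarrow> 0 < h \<Longrightarrow> A \<in> past M W s \<Longrightarrow>
      (\<integral>\<^sup>+\<omega>\<in>A. k h (W (s + t) \<omega>) \<partial>M) = (\<integral>\<^sup>+\<omega>\<in>A. k (t + h) (W s \<omega>) \<partial>M)"
  shows "regenerative_kernel M W (completed_past M W) k"
proof -
  interpret prob_space M by fact
  show ?thesis
  proof unfold_locales
    fix t :: real assume t: "0 \<le> t"
    show "subalgebra M (completed_past M W t)" by (auto simp: subalgebra_def sets_completed_past)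
    show "N \<in> sets (completed_past M W t)" if "N \<in> null_sets M" for N
    proof -
      have "AE \<omega> in M. \<omega> \<in> N \<longleftrightarrow> \<omega> \<in> {}" using AE_not_in[OF that] by eventually_elim simp
      moreover have "{} \<in> past M W t" unfolding past_def by (rule sigma_sets.Empty)
      ultimately show ?thesis using that unfolding sets_completed_past by blast
    qed
    have "sets (past_algebra M W t) \<subseteq> sets (completed_past M W t)"
      using past_subset_sets[of W M t, OF W] by (auto simp: sets_past_algebra sets_completed_past)
    then have "subalgebra (completed_past M W t) (past_algebra M W t)" by (simp add: subalgebra_def)
    then show "W t \<in> borel_measurable (completed_past M W t)"
      using measurable_past_algebra[OF t order_refl] by (rule measurable_from_subalg)
  next
    fix s t :: real assume "0 \<le> s" "s \<le> t"
    then show "sets (completed_past M W s) \<subseteq> sets (completed_past M W t)"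
      using past_mono[of s t M W] by (auto simp: sets_completed_past)
  next
    fix s t h :: real and A assume st: "0 \<le> s" "0 \<le> t" "0 < h" and "A \<in> sets (completed_past M W s)"
    then obtain B where B: "B \<in> past M W s" "AE \<omega> in M. \<omega> \<in> A \<longleftrightarrow> \<omega> \<in> B" by (auto simp: sets_completed_past)
    have "(\<integral>\<^sup>+\<omega>\<in>A. f \<omega> \<partial>M) = (\<integral>\<^sup>+\<omega>\<in>B. f \<omega> \<partial>M)" for f
      by (rule nn_integral_cong_AE) (use B(2) in \<open>eventually_elim, auto split: split_indicator\<close>)
    then show "(\<integral>\<^sup>+\<omega>\<in>A. k h (W (s + t) \<omega>) \<partial>M) = (\<integral>\<^sup>+\<omega>\<in>A. k (t + h) (W s \<omega>) \<partial>M)"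
      using shift[OF st B(1)] by simp
  qed (use assms in auto)
qed

section \<open>Mechanisms\<close>

text \<open>For u < 1 and x = q u, the bounds 1 - x \<le> exp (- x) \<le> 1 / (1 + x) give 0 \<le>
  exp (- x) - 1 + x \<le> x^2. For u \<ge> 1 the compensator is absent and the integrand lies
  between -1 and 0.\<close>

lemma branching_integrand_bound:
  fixes q u :: real
  assumes "0 \<le> q" "0 < u"
  shows "\<bar>exp (- q * u) - 1 + q * u * indicator {0<..<1} u\<bar> \<le> (q\<^sup>2 + 1) * min 1 (u\<^sup>2)"
proof (cases "u < 1")
  case True
  have x: "0 \<le> q * u" using assms by simp
  have "1 + - (q * u) \<le> exp (- (q * u))" by (rule exp_ge_add_one_self)
  moreover have "exp (- (q * u)) \<le> 1 / (1 + q * u)"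
    using exp_ge_add_one_self[of "q * u"] x by (simp add: exp_minus field_simps)
  moreover have "1 / (1 + x) - 1 + x \<le> x\<^sup>2" if "0 \<le> x" for x :: real
  proof -
    have "1 / (1 + x) - 1 + x = x\<^sup>2 / (1 + x)" using that by (simp add: field_simps power2_eq_square)
    also have "\<dots> \<le> x\<^sup>2 / 1" using that by (intro divide_left_mono) auto
    finally show ?thesis by simp
  qed
  note this[OF x]
  moreover have "(q * u)\<^sup>2 \<le> (q\<^sup>2 + 1) * u\<^sup>2" by (simp add: power_mult_distrib algebra_simps)
  moreover have "min 1 (u\<^sup>2) = u\<^sup>2" using True assms power_le_one[of u 2] by (simp add: min_absorb2)
  ultimately show ?thesis using True assms by simp
next
  case False
  then have "min 1 (u\<^sup>2) = 1" "indicator {0<..<1} u = (0::real)"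
    using one_le_power[of u 2] by (simp_all add: min_absorb1)
  then have "\<bar>exp (- q * u) - 1 + q * u * indicator {0<..<1} u\<bar> = \<bar>exp (- q * u) - 1\<bar>"
    "(q\<^sup>2 + 1) * min 1 (u\<^sup>2) = q\<^sup>2 + 1" by simp_all
  moreover have "\<bar>e - 1\<bar> \<le> q\<^sup>2 + 1" if "0 \<le> e" "e \<le> 1" for e :: real
    using that zero_le_power2[of q] unfolding abs_le_iff by linarith
  then have "\<bar>exp (- q * u) - 1\<bar> \<le> q\<^sup>2 + 1" using assms by simp
  ultimately show ?thesis by linarith
qed

text \<open>Every term is convex in q, and the integrand has a quadratic bound. Convexity will drive
  uniqueness and positivity of solutions, the quadratic bound the speed of the descent from
  infinity.\<close>

lemma branching_mechanism_props:
  assumes "branching_mechanism \<Psi>"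
  shows "\<Psi> 0 = 0" and "convex_on {0..} \<Psi>" and "\<exists>C>0. \<forall>q\<ge>1. \<Psi> q \<le> C * q\<^sup>2"
proof -
  obtain d sigma2 :: real and \<nu> :: "real measure" where sigma2: "0 \<le> sigma2"
    and sets: "sets \<nu> = sets (restrict_space borel {0<..})"
    and fin: "(\<integral>\<^sup>+u. ennreal (min 1 (u\<^sup>2)) \<partial>\<nu>) < \<infinity>"
    and \<Psi>: "\<And>q. 0 \<le> q \<Longrightarrow> \<Psi> q = d * q + 1/2 * sigma2 * q\<^sup>2
          + (\<integral>u. exp (- q * u) - 1 + q * u * indicator {0<..<1} u \<partial>\<nu>)"
    using assms unfolding branching_mechanism_def by blast
  have space: "space \<nu> = {0<..}" using sets_eq_imp_space_eq[OF sets] by (simp add: space_restrict_space)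
  have meas: "f \<in> borel_measurable \<nu>" if "f \<in> borel_measurable borel" for f :: "real \<Rightarrow> real"
    using measurable_restrict_space1[OF that, of "{0<..}"] measurable_cong_sets[OF sets refl] by blast
  define h where "h q u = exp (- q * u) - 1 + q * u * indicator {0<..<1} u" for q u :: real
  have min: "integrable \<nu> (\<lambda>u. min 1 (u\<^sup>2))"
    by (rule integrableI_nonneg) (use fin in \<open>auto intro!: meas\<close>)
  have h: "integrable \<nu> (h q)" if "0 \<le> q" for q
    by (rule Bochner_Integration.integrable_bound[OF integrable_mult_right[OF min, of "q\<^sup>2 + 1"]])
      (use branching_integrand_bound[OF that] in \<open>auto simp: h_def[abs_def] space intro!: meas AE_I2 order_trans[OF _ abs_ge_self]\<close>)
  have \<Psi>h: "\<Psi> q = d * q + 1/2 * sigma2 * q\<^sup>2 + (\<integral>u. h q u \<partial>\<nu>)" if "0 \<le> q" for q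
    using \<Psi>[OF that] by (simp add: h_def)
  show "\<Psi> 0 = 0" using \<Psi>h[of 0] by (simp add: h_def)
  show "convex_on {0..} \<Psi>"
  proof (rule convex_onI)
    fix t x y :: real assume t: "0 < t" "t < 1" and xy: "x \<in> {0..}" "y \<in> {0..}"
    define z where "z = (1 - t) * x + t * y"
    have z: "0 \<le> z" using t xy by (simp add: z_def)
    have "(\<integral>u. h z u \<partial>\<nu>) \<le> (\<integral>u. (1 - t) * h x u + t * h y u \<partial>\<nu>)"
    proof (rule integral_mono)
      show "h z u \<le> (1 - t) * h x u + t * h y u" for u
      proof -
        have "exp ((1 - t) *\<^sub>R (- x * u) + t *\<^sub>R (- y * u)) \<le> (1 - t) * exp (- x * u) + t * exp (- y * u)"
          by (rule convex_onD[OF exp_convex]) (use t in auto)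
        moreover have "(1 - t) *\<^sub>R (- x * u) + t *\<^sub>R (- y * u) = - z * u" by (simp add: z_def algebra_simps)
        ultimately have "exp (- z * u) \<le> (1 - t) * exp (- x * u) + t * exp (- y * u)" by simp
        then show ?thesis unfolding h_def by (simp add: z_def algebra_simps)
      qed
    qed (use h z xy in auto)
    also have "\<dots> = (1 - t) * (\<integral>u. h x u \<partial>\<nu>) + t * (\<integral>u. h y u \<partial>\<nu>)" using h xy by simp
    finally have 1: "(\<integral>u. h z u \<partial>\<nu>) \<le> (1 - t) * (\<integral>u. h x u \<partial>\<nu>) + t * (\<integral>u. h y u \<partial>\<nu>)" .
    have "(1 - t) * x\<^sup>2 + t * y\<^sup>2 - z\<^sup>2 = t * (1 - t) * (x - y)\<^sup>2"
      by (simp add: z_def power2_eq_square algebra_simps)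
    moreover have "0 \<le> t * (1 - t) * (x - y)\<^sup>2" using t by simp
    ultimately have "z\<^sup>2 \<le> (1 - t) * x\<^sup>2 + t * y\<^sup>2" by linarith
    then have 2: "1/2 * sigma2 * z\<^sup>2 \<le> 1/2 * sigma2 * ((1 - t) * x\<^sup>2 + t * y\<^sup>2)"
      using sigma2 by (intro mult_left_mono) auto
    have 3: "d * z = (1 - t) * (d * x) + t * (d * y)" by (simp add: z_def algebra_simps)
    have "\<Psi> z \<le> ((1 - t) * (d * x) + t * (d * y)) + (1/2 * sigma2 * ((1 - t) * x\<^sup>2 + t * y\<^sup>2))
      + ((1 - t) * (\<integral>u. h x u \<partial>\<nu>) + t * (\<integral>u. h y u \<partial>\<nu>))"
      using 1 2 3 \<Psi>h[OF z] by linarith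
    also have "\<dots> = (1 - t) * \<Psi> x + t * \<Psi> y"
      using \<Psi>h[of x] \<Psi>h[of y] xy by (simp add: field_simps)
    finally have "\<Psi> z \<le> (1 - t) * \<Psi> x + t * \<Psi> y" .
    then show "\<Psi> ((1 - t) *\<^sub>R x + t *\<^sub>R y) \<le> (1 - t) * \<Psi> x + t * \<Psi> y" by (simp add: z_def)
  qed simp
  define I where "I = (\<integral>u. min 1 (u\<^sup>2) \<partial>\<nu>)"
  have I: "0 \<le> I" unfolding I_def by (rule Bochner_Integration.integral_nonneg) auto
  have "\<Psi> q \<le> (\<bar>d\<bar> + sigma2 + 2 * I + 1) * q\<^sup>2" if q: "1 \<le> q" for q
  proof -
    have "(\<integral>u. h q u \<partial>\<nu>) \<le> (\<integral>u. (q\<^sup>2 + 1) * min 1 (u\<^sup>2) \<partial>\<nu>)"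
    proof (intro integral_mono)
      show "h q u \<le> (q\<^sup>2 + 1) * min 1 (u\<^sup>2)" if "u \<in> space \<nu>" for u
        using branching_integrand_bound[of q u] q that by (simp add: space h_def abs_le_iff)
    qed (use h q min in auto)
    also have "\<dots> = (q\<^sup>2 + 1) * I" by (simp add: I_def)
    finally have 1: "(\<integral>u. h q u \<partial>\<nu>) \<le> (q\<^sup>2 + 1) * I" .
    have q2: "q \<le> q\<^sup>2" "1 \<le> q\<^sup>2" using q one_le_power[of q 2] by (simp_all add: power2_eq_square mult_le_cancel_left1)
    have "d * q \<le> \<bar>d\<bar> * q\<^sup>2" using q q2 by (intro mult_mono) auto
    moreover have "(q\<^sup>2 + 1) * I \<le> (2 * q\<^sup>2) * I" using q2 I by (intro mult_right_mono) auto
    moreover have "0 \<le> sigma2 * q\<^sup>2" using sigma2 by simp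
    moreover have "\<Psi> q = d * q + sigma2 * q\<^sup>2 / 2 + (\<integral>u. h q u \<partial>\<nu>)" using \<Psi>h[of q] q by simp
    moreover have "(\<bar>d\<bar> + sigma2 + 2 * I + 1) * q\<^sup>2 = \<bar>d\<bar> * q\<^sup>2 + sigma2 * q\<^sup>2 + (2 * q\<^sup>2) * I + q\<^sup>2"
      by (simp add: distrib_right)
    ultimately show ?thesis using 1 q2 by linarith
  qed
  moreover have "0 < \<bar>d\<bar> + sigma2 + 2 * I + 1" using sigma2 I by linarith
  ultimately show "\<exists>C>0. \<forall>q\<ge>1. \<Psi> q \<le> C * q\<^sup>2" by blast
qed

text \<open>Continuity is a consequence of concavity, hence on the open half-line, where the
  extinction function takes its values.\<close>

lemma immigration_mechanism_props:
  assumes "immigration_mechanism \<Phi>"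
  shows "\<And>q. 0 \<le> q \<Longrightarrow> 0 \<le> \<Phi> q" and "mono_on {0..} \<Phi>" and "continuous_on {0<..} \<Phi>"
proof -
  obtain \<beta> :: real and \<nu> :: "real measure" where \<beta>: "0 \<le> \<beta>"
    and sets: "sets \<nu> = sets (restrict_space borel {0<..})"
    and fin: "(\<integral>\<^sup>+u. ennreal (min 1 u) \<partial>\<nu>) < \<infinity>"
    and \<Phi>: "\<And>q. 0 \<le> q \<Longrightarrow> \<Phi> q = \<beta> * q + (\<integral>u. 1 - exp (- q * u) \<partial>\<nu>)"
    using assms unfolding immigration_mechanism_def by blast
  have space: "space \<nu> = {0<..}" using sets_eq_imp_space_eq[OF sets] by (simp add: space_restrict_space)
  have meas: "f \<in> borel_measurable \<nu>" if "f \<in> borel_measurable borel" for f :: "real \<Rightarrow> real"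
    using measurable_restrict_space1[OF that, of "{0<..}"] measurable_cong_sets[OF sets refl] by blast
  have min: "integrable \<nu> (\<lambda>u. min 1 u)"
    by (rule integrableI_nonneg) (use fin in \<open>auto intro!: meas simp: space\<close>)
  have bound: "\<bar>1 - exp (- q * u)\<bar> \<le> (q + 1) * min 1 u" if "0 \<le> q" "0 < u" for q u :: real
  proof -
    have "1 + - (q * u) \<le> exp (- (q * u))" by (rule exp_ge_add_one_self)
    moreover have "exp (- (q * u)) \<le> 1" using that by simp
    ultimately have "\<bar>1 - exp (- q * u)\<bar> \<le> q * u" "\<bar>1 - exp (- q * u)\<bar> \<le> 1" by auto
    then show ?thesis using that by (auto simp: min_def algebra_simps)
  qed
  have h: "integrable \<nu> (\<lambda>u. 1 - exp (- q * u))" if "0 \<le> q" for q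
    by (rule Bochner_Integration.integrable_bound[OF integrable_mult_right[OF min, of "q + 1"]])
      (use bound[OF that] in \<open>auto simp: space intro!: meas AE_I2 order_trans[OF _ abs_ge_self]\<close>)
  show "0 \<le> \<Phi> q" if "0 \<le> q" for q
    unfolding \<Phi>[OF that] using \<beta> that by (intro add_nonneg_nonneg Bochner_Integration.integral_nonneg) (auto simp: space)
  show "mono_on {0..} \<Phi>"
  proof (rule mono_onI)
    fix p q :: real assume "p \<in> {0..}" "q \<in> {0..}" "p \<le> q"
    moreover from this have "(\<integral>u. 1 - exp (- p * u) \<partial>\<nu>) \<le> (\<integral>u. 1 - exp (- q * u) \<partial>\<nu>)"
      by (intro integral_mono h) (auto simp: space)
    ultimately show "\<Phi> p \<le> \<Phi> q" using \<Phi>[of p] \<Phi>[of q] \<beta> by (auto intro: add_mono mult_left_mono)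
  qed
  have "convex_on {0..} (\<lambda>q. - \<Phi> q)"
  proof (rule convex_onI)
    fix t x y :: real assume t: "0 < t" "t < 1" and xy: "x \<in> {0..}" "y \<in> {0..}"
    define z where "z = (1 - t) * x + t * y"
    have z: "0 \<le> z" using t xy by (simp add: z_def)
    have "(\<integral>u. (1 - t) * (1 - exp (- x * u)) + t * (1 - exp (- y * u)) \<partial>\<nu>) \<le> (\<integral>u. 1 - exp (- z * u) \<partial>\<nu>)"
    proof (rule integral_mono)
      show "(1 - t) * (1 - exp (- x * u)) + t * (1 - exp (- y * u)) \<le> 1 - exp (- z * u)" for u
      proof -
        have "exp ((1 - t) *\<^sub>R (- x * u) + t *\<^sub>R (- y * u)) \<le> (1 - t) * exp (- x * u) + t * exp (- y * u)"
          by (rule convex_onD[OF exp_convex]) (use t in auto)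
        moreover have "(1 - t) *\<^sub>R (- x * u) + t *\<^sub>R (- y * u) = - z * u" by (simp add: z_def algebra_simps)
        ultimately have "exp (- z * u) \<le> (1 - t) * exp (- x * u) + t * exp (- y * u)" by simp
        then show ?thesis by (simp add: algebra_simps)
      qed
    qed (use h z xy in auto)
    moreover have "(\<integral>u. (1 - t) * (1 - exp (- x * u)) + t * (1 - exp (- y * u)) \<partial>\<nu>)
      = (1 - t) * (\<integral>u. 1 - exp (- x * u) \<partial>\<nu>) + t * (\<integral>u. 1 - exp (- y * u) \<partial>\<nu>)"
      using h xy by (simp del: Bochner_Integration.integral_diff)
    ultimately show "- \<Phi> ((1 - t) *\<^sub>R x + t *\<^sub>R y) \<le> (1 - t) * - \<Phi> x + t * - \<Phi> y"
      using \<Phi>[OF z] \<Phi>[of x] \<Phi>[of y] xy by (simp add: z_def algebra_simps)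
  qed simp
  then have "continuous_on {0<..} (\<lambda>q. - \<Phi> q)"
    by (intro convex_on_continuous) (auto intro: convex_on_subset)
  from continuous_on_minus[OF this] show "continuous_on {0<..} \<Phi>" by simp
qed

section \<open>Cumulants and the solution descending from infinity\<close>

locale branching =
  fixes \<Psi> :: "real \<Rightarrow> real"
  assumes Psi_0: "\<Psi> 0 = 0" and Psi_convex: "convex_on {0..} \<Psi>"
begin

text \<open>Positivity is built in because convexity yields continuity of \<open>\<Psi>\<close> away
  from 0 only; asking for the derivative inside the interval keeps one-sided derivatives
  out.\<close>

definition solves :: "(real \<Rightarrow> real) \<Rightarrow> real \<Rightarrow> bool" where
  "solves w T \<longleftrightarrow> continuous_on {0..T} w \<and> (\<forall>t\<in>{0..T}. 0 < w t) \<and>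
     (\<forall>t. 0 < t \<longrightarrow> t < T \<longrightarrow> (w has_real_derivative - \<Psi> (w t)) (at t))"

text \<open>Convexity and \<open>\<Psi> 0 = 0\<close>: the slope \<Psi> x / x of the chord from the
  origin is nondecreasing.\<close>

lemma Psi_scale:
  assumes "0 \<le> x" "x \<le> y" "0 < y"
  shows "y * \<Psi> x \<le> x * \<Psi> y"
proof -
  have "\<Psi> ((1 - x / y) *\<^sub>R 0 + (x / y) *\<^sub>R y) \<le> (1 - x / y) * \<Psi> 0 + (x / y) * \<Psi> y"
    by (rule convex_onD[OF Psi_convex]) (use assms in \<open>auto simp: divide_le_eq_1\<close>)
  then show ?thesis using assms by (simp add: Psi_0 field_simps)
qed

lemma Psi_continuous: "continuous_on {0<..} \<Psi>"
  by (rule convex_on_continuous) (auto intro: convex_on_subset[OF Psi_convex])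

text \<open>Chord slopes from the origin increase, so the slope at \<open>\<epsilon>\<close>, which
  may be negative, bounds all difference quotients to the right of \<open>\<epsilon>\<close> from
  below.\<close>

lemma Psi_difference:
  assumes "0 < \<epsilon>" "\<epsilon> \<le> x" "\<epsilon> \<le> y"
  shows "\<Psi> \<epsilon> / \<epsilon> * (x - y)\<^sup>2 \<le> (x - y) * (\<Psi> x - \<Psi> y)"
  using assms(2,3)
proof (induction x y rule: linorder_wlog)
  case (sym a b)
  then show ?case by (simp add: power2_commute algebra_simps)
next
  case (le y x)
  have "x * \<Psi> \<epsilon> \<le> \<epsilon> * \<Psi> x" "x * \<Psi> y \<le> y * \<Psi> x"
    using le assms(1) by (intro Psi_scale; simp)+
  then have 1: "\<Psi> \<epsilon> / \<epsilon> * x \<le> \<Psi> x" using assms(1) by (simp add: field_simps)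
  have "x * (\<Psi> \<epsilon> / \<epsilon> * (x - y)) = (x - y) * (\<Psi> \<epsilon> / \<epsilon> * x)" by simp
  also have "\<dots> \<le> (x - y) * \<Psi> x" using 1 le by (intro mult_left_mono) auto
  also have "\<dots> \<le> x * (\<Psi> x - \<Psi> y)" using \<open>x * \<Psi> y \<le> y * \<Psi> x\<close> by (simp add: algebra_simps)
  finally have "\<Psi> \<epsilon> / \<epsilon> * (x - y) \<le> \<Psi> x - \<Psi> y"
    using le assms(1) by (subst (asm) mult_le_cancel_left_pos) auto
  then have "(x - y) * (\<Psi> \<epsilon> / \<epsilon> * (x - y)) \<le> (x - y) * (\<Psi> x - \<Psi> y)"
    using le by (intro mult_left_mono) auto
  then have "\<Psi> \<epsilon> / \<epsilon> * (x - y)\<^sup>2 \<le> (x - y) * (\<Psi> x - \<Psi> y)"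
    by (simp add: power2_eq_square mult.left_commute mult.assoc)
  then show ?case by (metis minus_diff_eq mult_minus_left mult_minus_right power2_commute)
qed

lemma solves_bounded_below:
  assumes "solves w T" "0 \<le> T"
  obtains \<epsilon> where "0 < \<epsilon>" "\<And>t. t \<in> {0..T} \<Longrightarrow> \<epsilon> \<le> w t"
proof -
  obtain s where "s \<in> {0..T}" "\<forall>t\<in>{0..T}. w s \<le> w t"
    using continuous_attains_inf[of "{0..T}" w] assms by (auto simp: solves_def)
  then show thesis using that[of "w s"] assms by (auto simp: solves_def)
qed

text \<open>Convexity makes \<open>\<Psi>\<close> one-sided Lipschitz away from zero, so that the distance of two solutions
  grows at most exponentially.\<close>

lemma solves_unique:
  assumes w: "solves w T" and z: "solves z T" and "0 \<le> T" "w 0 = z 0"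
  shows "w T = z T"
proof -
  obtain a where a: "0 < a" "\<And>t. t \<in> {0..T} \<Longrightarrow> a \<le> w t" using solves_bounded_below[OF w \<open>0 \<le> T\<close>] by metis
  obtain b where b: "0 < b" "\<And>t. t \<in> {0..T} \<Longrightarrow> b \<le> z t" using solves_bounded_below[OF z \<open>0 \<le> T\<close>] by metis
  define \<epsilon> where "\<epsilon> = min a b"
  define K where "K = \<Psi> \<epsilon> / \<epsilon>"
  have \<epsilon>: "0 < \<epsilon>" "\<And>t. t \<in> {0..T} \<Longrightarrow> \<epsilon> \<le> w t \<and> \<epsilon> \<le> z t"
    using a(1) b(1) a(2) b(2) by (auto simp: \<epsilon>_def min_le_iff_disj)
  have "exp (2 * K * T) * (w T - z T)\<^sup>2 \<le> exp (2 * K * 0) * (w 0 - z 0)\<^sup>2"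
  proof (rule DERIV_nonpos_imp_decreasing_open[OF \<open>0 \<le> T\<close>])
    fix t assume t: "0 < t" "t < T"
    have dw: "(w has_real_derivative - \<Psi> (w t)) (at t)" "(z has_real_derivative - \<Psi> (z t)) (at t)"
      using w z t by (auto simp: solves_def)
    have "((\<lambda>t. exp (2 * K * t) * (w t - z t)\<^sup>2) has_real_derivative
        2 * exp (2 * K * t) * (K * (w t - z t)\<^sup>2 - (w t - z t) * (\<Psi> (w t) - \<Psi> (z t)))) (at t)"
      by (rule derivative_eq_intros dw refl)+ (simp add: power2_eq_square algebra_simps)
    moreover have "K * (w t - z t)\<^sup>2 - (w t - z t) * (\<Psi> (w t) - \<Psi> (z t)) \<le> 0"
      using Psi_difference[OF \<epsilon>(1), of "w t" "z t"] \<epsilon>(2)[of t] t by (auto simp: K_def)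
    then have "2 * exp (2 * K * t) * (K * (w t - z t)\<^sup>2 - (w t - z t) * (\<Psi> (w t) - \<Psi> (z t))) \<le> 0"
      by (intro mult_nonneg_nonpos) auto
    ultimately show "\<exists>y. ((\<lambda>t. exp (2 * K * t) * (w t - z t)\<^sup>2) has_real_derivative y) (at t) \<and> y \<le> 0"
      by blast
  next
    show "continuous_on {0..T} (\<lambda>t. exp (2 * K * t) * (w t - z t)\<^sup>2)"
      using w z by (intro continuous_intros) (auto simp: solves_def)
  qed
  then have "(w T - z T)\<^sup>2 \<le> 0" using assms(4) by (simp add: mult_le_0_iff not_le[symmetric])
  then show ?thesis by simp
qed

lemma solves_const: "0 < c \<Longrightarrow> \<Psi> c = 0 \<Longrightarrow> solves (\<lambda>_. c) T"
  by (auto simp: solves_def)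

lemma solves_shift:
  assumes "solves w T" "0 \<le> s" "s + T' \<le> T"
  shows "solves (\<lambda>t. w (s + t)) T'"
proof -
  have "((\<lambda>t. w (s + t)) has_real_derivative - \<Psi> (w (s + t))) (at t)" if "0 < t" "t < T'" for t
    using assms that DERIV_shift[of w "- \<Psi> (w (s + t))" t s] by (auto simp: solves_def add.commute)
  moreover have "continuous_on {0..T'} (\<lambda>t. w (s + t))"
    by (rule continuous_on_compose2[of "{0..T}" w]) (use assms in \<open>auto simp: solves_def intro!: continuous_intros\<close>)
  ultimately show ?thesis using assms by (auto simp: solves_def)
qed

context
  fixes v :: "real \<Rightarrow> real \<Rightarrow> real"
  assumes v: "cumulant_solution \<Psi> v"
begin

lemma cumulant_0: "0 < q \<Longrightarrow> v 0 q = q"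
proof -
  assume "0 < q"
  then have "v 0 q = q - (LINT s:{0..0}|lborel. \<Psi> (v s q))" using v unfolding cumulant_solution_def by blast
  moreover have "(LINT s:{0..0}|lborel. \<Psi> (v s q)) = 0"
    unfolding set_lebesgue_integral_def
    by (rule integral_eq_zero_AE) (use AE_lborel_singleton[of 0] in \<open>eventually_elim, auto split: split_indicator\<close>)
  ultimately show ?thesis by simp
qed

lemma cumulant_integral:
  assumes "0 < q" "0 \<le> t"
  shows "(\<lambda>s. \<Psi> (v s q)) integrable_on {0..t}" "v t q = q - integral {0..t} (\<lambda>s. \<Psi> (v s q))"
proof -
  have "set_integrable lborel {0..t} (\<lambda>s. \<Psi> (v s q))" "v t q = q - (LINT s:{0..t}|lborel. \<Psi> (v s q))"
    using v assms unfolding cumulant_solution_def by blast+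
  then show "(\<lambda>s. \<Psi> (v s q)) integrable_on {0..t}" "v t q = q - integral {0..t} (\<lambda>s. \<Psi> (v s q))"
    using set_borel_integral_eq_integral[of "{0..t}" "\<lambda>s. \<Psi> (v s q)"] by auto
qed

lemma cumulant_continuous:
  assumes "0 < q" shows "continuous_on {0..T} (\<lambda>t. v t q)"
proof (cases "0 \<le> T")
  case True
  have "continuous_on {0..T} (\<lambda>t. q - integral {0..t} (\<lambda>s. \<Psi> (v s q)))"
    by (intro continuous_intros indefinite_integral_continuous_1 cumulant_integral assms True)
  then show ?thesis by (rule continuous_on_eq) (use cumulant_integral(2) assms in auto)
qed simp

lemma cumulant_deriv:
  assumes "0 < q" "0 < t" "t < T" and pos: "\<And>s. s \<in> {0..T} \<Longrightarrow> s < T \<Longrightarrow> 0 < v s q"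
  shows "((\<lambda>t. v t q) has_real_derivative - \<Psi> (v t q)) (at t)"
proof -
  define S where "S = (t + T) / 2"
  have S: "t < S" "S < T" using assms by (auto simp: S_def)
  have cont: "continuous_on {0..S} (\<lambda>s. \<Psi> (v s q))"
    by (rule continuous_on_compose2[OF Psi_continuous cumulant_continuous[OF assms(1)]])
      (use S assms pos in auto)
  have "((\<lambda>t. integral {0..t} (\<lambda>s. \<Psi> (v s q))) has_real_derivative \<Psi> (v t q)) (at t within {0..S})"
    by (rule integral_has_real_derivative[OF cont]) (use S assms in auto)
  then have "((\<lambda>t. integral {0..t} (\<lambda>s. \<Psi> (v s q))) has_real_derivative \<Psi> (v t q)) (at t)"
    using S assms by (simp add: at_within_Icc_at)
  then have "((\<lambda>t. q - integral {0..t} (\<lambda>s. \<Psi> (v s q))) has_real_derivative - \<Psi> (v t q)) (at t)"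
    by (auto intro!: derivative_eq_intros)
  then show ?thesis
    by (rule DERIV_cong_ev[THEN iffD1, rotated 3])
      (use cumulant_integral(2)[OF assms(1)] eventually_gt_at_top in
        \<open>auto intro!: eventually_nhds_in_open[of "{0<..}" t, THEN eventually_mono] simp: assms\<close>)
qed

text \<open>Just before a first zero \<open>\<tau>\<close> one has 0 < v < 1, hence \<Psi> v \<le> v
  \<Psi> 1. There exp (\<Psi> 1 t) v is nondecreasing in t and cannot descend to 0.\<close>

lemma cumulant_pos:
  assumes "0 < q" "0 \<le> T" shows "0 < v T q"
proof (rule ccontr)
  assume "\<not> 0 < v T q"
  define Z where "Z = {t\<in>{0..T}. v t q \<le> 0}"
  have "closed Z" unfolding Z_def
    using continuous_closed_preimage[OF cumulant_continuous[OF assms(1), of T] closed_atLeastAtMost, of "{..0}"]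
    by (simp add: vimage_def Int_def)
  moreover have "Z \<noteq> {}" "bdd_below Z" using \<open>\<not> 0 < v T q\<close> assms(2) by (auto simp: Z_def intro!: bdd_belowI[of _ 0])
  ultimately have Inf: "Inf Z \<in> Z" using closed_contains_Inf by blast
  define \<tau> where "\<tau> = Inf Z"
  have \<tau>: "0 \<le> \<tau>" "\<tau> \<le> T" "v \<tau> q \<le> 0" using Inf by (auto simp: \<tau>_def Z_def)
  have pos: "0 < v s q" if "s \<in> {0..\<tau>}" "s < \<tau>" for s
  proof (rule ccontr)
    assume "\<not> 0 < v s q"
    then have "s \<in> Z" using that \<tau> by (auto simp: Z_def)
    then have "\<tau> \<le> s" unfolding \<tau>_def using \<open>bdd_below Z\<close> by (rule cInf_lower)
    then show False using that by simp
  qed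
  have "\<tau> \<noteq> 0" using \<tau> cumulant_0[OF assms(1)] assms(1) by auto
  with \<tau> have \<tau>_pos: "0 < \<tau>" by simp
  have cont: "continuous_on {0..\<tau>} (\<lambda>t. v t q)" by (rule cumulant_continuous[OF assms(1)])
  have "((\<lambda>t. v t q) \<longlongrightarrow> v \<tau> q) (at_left \<tau>)"
    using continuous_on_Icc_at_leftD[OF cont \<tau>_pos] .
  then have "eventually (\<lambda>t. v t q < 1) (at_left \<tau>)" using \<tau> by (intro order_tendstoD) auto
  then obtain b where b: "b < \<tau>" "\<And>t. b < t \<Longrightarrow> t < \<tau> \<Longrightarrow> v t q < 1"
    using \<tau>_pos by (auto simp: eventually_at_left[of 0])
  define s where "s = (max b 0 + \<tau>) / 2"
  have s: "0 < s" "b < s" "s < \<tau>" using b \<tau>_pos by (auto simp: s_def max_def)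
  define K where "K = \<Psi> 1"
  have "exp (K * s) * v s q \<le> exp (K * \<tau>) * v \<tau> q"
  proof (rule DERIV_nonneg_imp_increasing_open[OF less_imp_le[OF \<open>s < \<tau>\<close>]])
    fix t assume t: "s < t" "t < \<tau>"
    have d: "((\<lambda>t. v t q) has_real_derivative - \<Psi> (v t q)) (at t)"
      by (rule cumulant_deriv[OF assms(1) _ _ pos]) (use t s in auto)
    have "((\<lambda>t. exp (K * t) * v t q) has_real_derivative exp (K * t) * (K * v t q - \<Psi> (v t q))) (at t)"
      by (rule derivative_eq_intros d refl)+ (simp add: algebra_simps)
    moreover have "0 \<le> K * v t q - \<Psi> (v t q)"
      using Psi_scale[of "v t q" 1] pos[of t] b(2)[of t] s t by (simp add: K_def algebra_simps)
    ultimately show "\<exists>y. ((\<lambda>t. exp (K * t) * v t q) has_real_derivative y) (at t) \<and> 0 \<le> y"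
      by (meson exp_ge_zero mult_nonneg_nonneg)
  next
    show "continuous_on {s..\<tau>} (\<lambda>t. exp (K * t) * v t q)"
      using s by (intro continuous_intros continuous_on_subset[OF cont]) auto
  qed
  moreover have "0 < exp (K * s) * v s q" using pos[of s] s by simp
  moreover have "exp (K * \<tau>) * v \<tau> q \<le> 0" using \<tau> by (simp add: mult_nonneg_nonpos)
  ultimately show False by simp
qed

lemma cumulant_solves: "0 < q \<Longrightarrow> solves (\<lambda>t. v t q) T"
  unfolding solves_def
  by (auto intro!: cumulant_continuous cumulant_deriv[of q _ T] cumulant_pos)

lemma cumulant_eq: "solves w t \<Longrightarrow> 0 \<le> t \<Longrightarrow> v t (w 0) = w t"
  using solves_unique[OF cumulant_solves[of "w 0" t], of w] cumulant_0[of "w 0"] by (simp add: solves_def)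

lemma cumulant_flow: "0 < q \<Longrightarrow> 0 \<le> s \<Longrightarrow> 0 \<le> t \<Longrightarrow> v t (v s q) = v (s + t) q"
  using cumulant_eq[of "\<lambda>t. v (s + t) q" t] solves_shift[OF cumulant_solves, of q s t "s + t"] by simp

end

end

section \<open>The extinction function\<close>

context branching
begin

text \<open>The time in which a solution descends from \<open>\<infinity>\<close> to \<open>z\<close> is \<open>G z = \<integral>\<^sub>z\<^sup>\<infinity> 1 / \<Psi>\<close>, so the solution
  coming down from \<open>\<infinity>\<close> is the inverse of \<open>G\<close>.\<close>

lemma descent_from_infinity:
  assumes grey: "grey_condition \<Psi>" and C: "0 < C" "\<And>q. 1 \<le> q \<Longrightarrow> \<Psi> q \<le> C * q\<^sup>2"
  obtains V :: "real \<Rightarrow> real" and L \<theta> :: real where "0 < L" "0 < \<theta>" "\<And>z. \<theta> < z \<Longrightarrow> 0 < \<Psi> z"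
    "\<And>h. 0 < h \<Longrightarrow> h < L \<Longrightarrow> \<theta> < V h"
    "\<And>h. 0 < h \<Longrightarrow> h < L \<Longrightarrow> (V has_real_derivative - \<Psi> (V h)) (at h)"
    "\<And>h. 0 < h \<Longrightarrow> h < L \<Longrightarrow> 1 / (C * h) \<le> V h"
proof -
  obtain \<theta>0 where \<theta>0: "0 < \<theta>0" "\<And>z. \<theta>0 \<le> z \<Longrightarrow> 0 < \<Psi> z"
    and fin0: "(\<integral>\<^sup>+q\<in>{\<theta>0..}. ennreal (1 / \<Psi> q) \<partial>lborel) < \<infinity>"
    using grey unfolding grey_condition_def by blast
  \<comment> \<open>Raised to at least 1, where the quadratic bound on \<open>\<Psi>\<close>
    holds.\<close>
  define \<theta> where "\<theta> = max \<theta>0 1"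
  have \<theta>: "1 \<le> \<theta>" "\<And>z. \<theta> \<le> z \<Longrightarrow> 0 < \<Psi> z" using \<theta>0 by (auto simp: \<theta>_def)
  define f where "f q = 1 / \<Psi> q" for q
  have f_pos: "0 < f q" if "\<theta> \<le> q" for q using \<theta>(2)[OF that] by (simp add: f_def)
  have f_cont: "continuous_on {\<theta>..} f" unfolding f_def[abs_def]
    using \<theta> by (intro continuous_intros continuous_on_subset[OF Psi_continuous]) (auto dest: \<theta>(2) intro: less_imp_neq[symmetric])
  have f_int: "set_integrable lborel {\<theta>..} f" unfolding set_integrable_def
  proof (rule integrableI_nonneg)
    show "(\<lambda>x. indicator {\<theta>..} x *\<^sub>R f x) \<in> borel_measurable lborel"
      using borel_measurable_continuous_on_indicator[OF _ f_cont] by simp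
    show "AE x in lborel. 0 \<le> indicator {\<theta>..} x *\<^sub>R f x"
      using f_pos by (auto simp: less_imp_le split: split_indicator)
    have "(\<integral>\<^sup>+x. ennreal (indicator {\<theta>..} x *\<^sub>R f x) \<partial>lborel) \<le> (\<integral>\<^sup>+q\<in>{\<theta>0..}. ennreal (1 / \<Psi> q) \<partial>lborel)"
      by (rule nn_integral_mono) (auto simp: f_def \<theta>_def split: split_indicator)
    then show "(\<integral>\<^sup>+x. ennreal (indicator {\<theta>..} x *\<^sub>R f x) \<partial>lborel) < \<infinity>" using fin0 by (rule le_less_trans)
  qed
  define L where "L = (LINT q:{\<theta>..}|lborel. f q)"
  define G where "G z = L - integral {\<theta>..z} f" for z
  have G_tendsto: "(G \<longlongrightarrow> 0) at_top"
  proof -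
    have "((\<lambda>z. LINT q:{\<theta>..z}|lborel. f q) \<longlongrightarrow> L) at_top"
      unfolding L_def by (rule tendsto_set_lebesgue_integral_at_top[OF _ f_int]) simp
    moreover have "(LINT q:{\<theta>..z}|lborel. f q) = integral {\<theta>..z} f" for z
      by (intro set_borel_integral_eq_integral set_integrable_subset[OF f_int]) auto
    ultimately have "((\<lambda>z. L - integral {\<theta>..z} f) \<longlongrightarrow> L - L) at_top" by (intro tendsto_intros) simp
    then show ?thesis by (simp add: G_def[abs_def])
  qed
  have G_cont: "continuous_on {\<theta>..b} G" for b
    unfolding G_def[abs_def] by (intro continuous_intros indefinite_integral_continuous_1
      integrable_continuous_real continuous_on_subset[OF f_cont]) auto
  have G_deriv: "(G has_real_derivative - f z) (at z)" if "\<theta> < z" for z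
  proof -
    have "((\<lambda>z. integral {\<theta>..z} f) has_real_derivative f z) (at z within {\<theta>..z + 1})"
      by (rule integral_has_real_derivative) (use that in \<open>auto intro: continuous_on_subset[OF f_cont]\<close>)
    then have "((\<lambda>z. integral {\<theta>..z} f) has_real_derivative f z) (at z)"
      using that by (simp add: at_within_Icc_at)
    then show ?thesis unfolding G_def[abs_def] by (auto intro!: derivative_eq_intros)
  qed
  have G_less: "G y < G x" if "\<theta> \<le> x" "x < y" for x y
  proof (rule DERIV_neg_imp_decreasing_open[OF \<open>x < y\<close>])
    show "continuous_on {x..y} G" by (rule continuous_on_subset[OF G_cont[of y]]) (use that in auto)
    fix z assume "x < z" "z < y"
    then show "\<exists>d. (G has_real_derivative d) (at z) \<and> d < 0"
      using G_deriv[of z] f_pos[of z] that by (auto intro!: exI[of _ "- f z"])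
  qed
  have G_pos: "0 < G z" if "\<theta> \<le> z" for z
  proof -
    have "0 \<le> G (z + 1)"
    proof (rule tendsto_upperbound[OF G_tendsto])
      show "eventually (\<lambda>y. G y \<le> G (z + 1)) at_top"
        using eventually_gt_at_top[of "z + 1"] by eventually_elim (use G_less[of "z + 1"] that in \<open>auto intro: less_imp_le\<close>)
    qed simp
    also have "\<dots> < G z" using that by (intro G_less) auto
    finally show ?thesis .
  qed
  have G_\<theta>: "G \<theta> = L" by (simp add: G_def)
  have L: "0 < L" using G_pos[of \<theta>] by (simp add: G_\<theta>)
  have inv: "\<exists>z>\<theta>. G z = h" if h: "0 < h" "h < L" for h
  proof -
    have "eventually (\<lambda>z. G z < h \<and> \<theta> \<le> z) at_top"
      using order_tendstoD(2)[OF G_tendsto h(1)] eventually_ge_at_top by eventually_elim auto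
    then obtain b where b: "G b < h" "\<theta> \<le> b" by (auto simp: eventually_at_top_linorder)
    obtain z where "\<theta> \<le> z" "z \<le> b" "G z = h"
      using IVT2'[of G b h \<theta>] G_cont[of b] b h by (auto simp: G_\<theta>)
    then show ?thesis using h G_\<theta> by (intro exI[of _ z]) (auto simp: less_le)
  qed
  define V where "V h = (SOME z. \<theta> < z \<and> G z = h)" for h
  have V: "\<theta> < V h" "G (V h) = h" if "0 < h" "h < L" for h
    using someI_ex[of "\<lambda>z. \<theta> < z \<and> G z = h"] inv[OF that] unfolding V_def by auto
  have VG: "V (G z) = z" if "\<theta> < z" for z
  proof -
    have "0 < G z" "G z < L" using G_pos[of z] G_less[of \<theta> z] that by (auto simp: G_\<theta>)
    then have "\<theta> < V (G z)" "G (V (G z)) = G z" using V by blast+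
    then show ?thesis using G_less[of z "V (G z)"] G_less[of "V (G z)" z] that by (cases "V (G z)" z rule: linorder_cases) auto
  qed
  have V_deriv: "(V has_real_derivative - \<Psi> (V h)) (at h)" if h: "0 < h" "h < L" for h
  proof -
    have "isCont V (G (V h))"
    proof (rule isCont_inverse_function2[where f = G and g = V and a = "(V h + \<theta>) / 2" and b = "V h + 1"])
      show "isCont G z" if "(V h + \<theta>) / 2 \<le> z" for z
        by (rule DERIV_isCont[OF G_deriv]) (use that V[OF h] in auto)
      show "V (G z) = z" if "(V h + \<theta>) / 2 \<le> z" for z
        by (rule VG) (use that V[OF h] in auto)
    qed (use V[OF h] in auto)
    then have cont: "isCont V h" using V[OF h] by simp
    have nz: "- f (V h) \<noteq> 0" using f_pos[of "V h"] V[OF h] by auto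
    have "(V has_real_derivative inverse (- f (V h))) (at h)"
      by (rule DERIV_inverse_function[OF G_deriv nz h V(2) cont]) (use V[OF h] in auto)
    then show ?thesis by (simp add: f_def inverse_eq_divide)
  qed
  \<comment> \<open>G z and 1 / (C z) both vanish at infinity, and by \<Psi> z \<le> C z^2 the
    former decreases at least as fast. Hence 1 / (C z) \<le> G z, which is the claim at z = V
    h.\<close>
  have V_lower: "1 / (C * h) \<le> V h" if h: "0 < h" "h < L" for h
  proof -
    define g where "g z = G z - 1 / (C * z)" for z
    have g_anti: "g y \<le> g x" if "\<theta> < x" "x \<le> y" for x y
    proof (rule DERIV_nonpos_imp_nonincreasing[OF \<open>x \<le> y\<close>])
      fix z assume "x \<le> z" "z \<le> y"
      then have z: "\<theta> < z" "0 < z" using that \<theta> by auto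
      have "(g has_real_derivative - f z + 1 / (C * z\<^sup>2)) (at z)"
        unfolding g_def[abs_def] by (rule derivative_eq_intros G_deriv refl | use z C in \<open>simp; fail\<close>)+
          (use z C in \<open>simp add: power2_eq_square\<close>)
      moreover have "1 / (C * z\<^sup>2) \<le> f z"
        using C(2)[of z] \<theta>(2)[of z] z \<theta>(1) by (auto simp: f_def intro!: divide_left_mono)
      ultimately show "\<exists>d. (g has_real_derivative d) (at z) \<and> d \<le> 0" by (intro exI conjI) auto
    qed
    have "eventually (\<lambda>y. g y \<le> g (V h)) at_top"
      using eventually_ge_at_top[of "V h"] by eventually_elim (rule g_anti[OF V(1)[OF h]])
    moreover have "(g \<longlongrightarrow> 0 - 0) at_top"
      unfolding g_def[abs_def] using C(1)
      by (intro tendsto_diff G_tendsto tendsto_divide_0[OF tendsto_const] filterlim_at_top_imp_at_infinity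
        filterlim_tendsto_pos_mult_at_top[OF tendsto_const _ filterlim_ident])
    ultimately have "0 - 0 \<le> g (V h)" by (intro tendsto_upperbound[of g _ at_top]) auto
    then have "1 / (C * V h) \<le> h" using V[OF h] by (simp add: g_def)
    moreover have "0 < V h" using V[OF h] \<theta> by linarith
    ultimately show ?thesis using C h by (simp add: field_simps)
  qed
  show thesis by (rule that[of L \<theta> V]) (use L \<theta> V V_deriv V_lower in auto)
qed

text \<open>\<open>V\<close> is the cumulant started from q = \<infinity>: without immigration, exp
  (- x V h) is the probability that the process started at x is extinct by time h. Near 0 it is the
  descending solution; from time \<open>a\<close> on the given cumulant continues it, and uniqueness
  of solutions yields the flow property.\<close>

lemma extinction_function_exists:
  assumes v: "cumulant_solution \<Psi> v"
    and grey: "grey_condition \<Psi>" and C: "0 < C" "\<And>q. 1 \<le> q \<Longrightarrow> \<Psi> q \<le> C * q\<^sup>2"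
  shows "\<exists>V \<eta>. 0 < \<eta> \<and> (\<forall>h>0. 0 < V h \<and> (V has_real_derivative - \<Psi> (V h)) (at h) \<and>
    (\<forall>k\<ge>h. V k \<le> V h) \<and> (\<forall>t\<ge>0. v t (V h) = V (t + h)) \<and> (h < \<eta> \<longrightarrow> 1 / (C * h) \<le> V h))"
proof -
  obtain V0 L \<theta> where "0 < L" "0 < \<theta>" and \<theta>: "\<And>z. \<theta> < z \<Longrightarrow> 0 < \<Psi> z"
    and V0: "\<And>h. 0 < h \<Longrightarrow> h < L \<Longrightarrow> \<theta> < V0 h"
    and V0_deriv: "\<And>h. 0 < h \<Longrightarrow> h < L \<Longrightarrow> (V0 has_real_derivative - \<Psi> (V0 h)) (at h)"
    and V0_lower: "\<And>h. 0 < h \<Longrightarrow> h < L \<Longrightarrow> 1 / (C * h) \<le> V0 h"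
    using descent_from_infinity[OF grey C] by metis
  have V0_solves: "solves (\<lambda>t. V0 (b + t)) T" if "0 < b" "b + T < L" for b T
  proof -
    have d: "((\<lambda>t. V0 (b + t)) has_real_derivative - \<Psi> (V0 (b + t))) (at t)" if "0 \<le> t" "t \<le> T" for t
      using V0_deriv[of "b + t"] that \<open>0 < b\<close> \<open>b + T < L\<close> DERIV_shift[of V0 "- \<Psi> (V0 (b + t))" t b]
      by (simp add: add.commute)
    have "0 < V0 (b + t)" if "0 \<le> t" "t \<le> T" for t
      using V0[of "b + t"] that \<open>0 < b\<close> \<open>b + T < L\<close> \<open>0 < \<theta>\<close> by simp
    moreover have "continuous_on {0..T} (\<lambda>t. V0 (b + t))"
      using d by (intro continuous_at_imp_continuous_on ballI DERIV_isCont) auto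
    ultimately show ?thesis using d by (auto simp: solves_def)
  qed
  define a where "a = L / 2"
  have a: "0 < a" "a < L" using \<open>0 < L\<close> by (auto simp: a_def)
  define V where "V h = (if h < a then V0 h else v (h - a) (V0 a))" for h
  have V0_pos: "0 < V0 h" if "0 < h" "h < L" for h using V0[OF that] \<open>0 < \<theta>\<close> by simp
  have V_eq: "V h = v (h - b) (V0 b)" if "0 < b" "b \<le> a" "b \<le> h" for b h
  proof -
    have v0: "v t (V0 b) = V0 (b + t)" if "0 \<le> t" "b + t < L" for t
      using cumulant_eq[OF v V0_solves, of b t] that \<open>0 < b\<close> by simp
    show ?thesis
    proof (cases "h < a")
      case True
      then show ?thesis using v0[of "h - b"] that a by (simp add: V_def)
    next
      case False
      have "v (h - b) (V0 b) = v (h - a) (v (a - b) (V0 b))"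
        using cumulant_flow[OF v, of "V0 b" "a - b" "h - a"] V0_pos[of b] that a False by simp
      also have "v (a - b) (V0 b) = V0 a" using v0[of "a - b"] that a by simp
      finally show ?thesis using False by (simp add: V_def)
    qed
  qed
  have V_eq': "0 < min h a" "min h a \<le> a" "min h a \<le> h" if "0 < h" for h using that a by auto
  have V_pos: "0 < V h" if "0 < h" for h
    using V_eq[OF V_eq'[OF that]] cumulant_pos[OF v V0_pos, of "min h a" "h - min h a"] that a by auto
  have V_flow: "v t (V h) = V (t + h)" if "0 \<le> t" "0 < h" for t h
    using V_eq[OF V_eq'[OF \<open>0 < h\<close>]] V_eq[of "min h a" "t + h"] cumulant_flow[OF v V0_pos, of "min h a" "h - min h a" t] that a
    by (auto simp: algebra_simps)
  have V_deriv: "(V has_real_derivative - \<Psi> (V h)) (at h)" if h: "0 < h" for h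
  proof -
    define b where "b = min h a / 2"
    have b: "0 < b" "b \<le> a" "b < h" using h a by (auto simp: b_def)
    have "solves (\<lambda>t. v t (V0 b)) (h - b + 1)" using b a by (intro cumulant_solves[OF v] V0_pos) auto
    then have "((\<lambda>t. v t (V0 b)) has_real_derivative - \<Psi> (v (h - b) (V0 b))) (at (h - b))"
      using b by (auto simp: solves_def)
    then have "((\<lambda>x. v (x - b) (V0 b)) has_real_derivative - \<Psi> (V h)) (at h)"
      using DERIV_shift[of "\<lambda>x. v x (V0 b)" _ h "- b"] V_eq[of b h] b by simp
    moreover have "eventually (\<lambda>x. v (x - b) (V0 b) = V x) (nhds h)"
      using eventually_nhds_in_open[of "{b<..}" h] b by (auto elim!: eventually_mono simp: V_eq)
    ultimately show ?thesis using DERIV_cong_ev[of h h "\<lambda>x. v (x - b) (V0 b)" V] by simp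
  qed
  \<comment> \<open>Near 0 the value \<Psi> (V b) is positive. To become negative it would have to
    pass a zero of \<open>\<Psi>\<close>, which is a stationary solution, and by uniqueness
    \<open>V\<close> would stay there.\<close>
  have Psi_V: "0 \<le> \<Psi> (V h)" if h: "0 < h" for h
  proof (rule ccontr)
    assume "\<not> 0 \<le> \<Psi> (V h)"
    define b where "b = min h a / 2"
    have b: "0 < b" "b < a" "b < h" using h a by (auto simp: b_def)
    have "0 < \<Psi> (V b)" using b V0[of b] \<theta> a by (simp add: V_def)
    moreover have "continuous_on {b..h} (\<lambda>x. \<Psi> (V x))"
      by (rule continuous_on_compose2[OF Psi_continuous])
        (use b V_pos in \<open>auto intro!: continuous_at_imp_continuous_on DERIV_isCont[OF V_deriv]\<close>)
    ultimately obtain y where y: "b \<le> y" "y \<le> h" "\<Psi> (V y) = 0"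
      using IVT2'[of "\<lambda>x. \<Psi> (V x)" h 0 b] b \<open>\<not> 0 \<le> \<Psi> (V h)\<close> by auto
    have "v (h - y) (V y) = V y" using cumulant_eq[OF v solves_const[OF V_pos y(3)]] y b by simp
    then have "V h = V y" using V_flow[of "h - y" y] y b by simp
    then show False using y \<open>\<not> 0 \<le> \<Psi> (V h)\<close> by simp
  qed
  have V_anti: "V k \<le> V h" if "0 < h" "h \<le> k" for h k
  proof (rule DERIV_nonpos_imp_nonincreasing[OF \<open>h \<le> k\<close>])
    fix x assume "h \<le> x" "x \<le> k"
    then show "\<exists>d. (V has_real_derivative d) (at x) \<and> d \<le> 0"
      using that V_deriv[of x] Psi_V[of x] by (intro exI[of _ "- \<Psi> (V x)"]) auto
  qed
  have "1 / (C * h) \<le> V h" if "0 < h" "h < a" for h using V0_lower[of h] that a by (simp add: V_def)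
  then show ?thesis
    using a(1) V_pos V_deriv V_anti V_flow by (intro exI[of _ V] exI[of _ a]) auto
qed

end

text \<open>The base point of the integral is 1, since \<open>f\<close> may fail to be integrable at
  0.\<close>

lemma antiderivative_exists:
  fixes f :: "real \<Rightarrow> real"
  assumes "continuous_on {0<..} f"
  obtains F where "\<And>x. 0 < x \<Longrightarrow> (F has_real_derivative f x) (at x)"
proof
  fix x :: real assume x: "0 < x"
  define a where "a = min x 1 / 2"
  define b where "b = max x 1 + 1"
  have ab: "0 < a" "a < x" "x < b" "a \<le> 1" "1 \<le> b" using x by (auto simp: a_def b_def)
  have "((\<lambda>u. LBINT y=ereal 1..ereal u. f y) has_vector_derivative f x) (at x within {a..b})"
    by (rule interval_integral_FTC2) (use ab in \<open>auto intro: continuous_on_subset[OF assms]\<close>)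
  then show "((\<lambda>u. LBINT y=ereal 1..ereal u. f y) has_real_derivative f x) (at x)"
    using ab by (simp add: at_within_Icc_at has_real_derivative_iff_has_vector_derivative)
qed

section \<open>The zero set of a CBI process\<close>

lemma closed_zero_set: "closed (zero_set Y \<omega>)"
  by (simp add: zero_set_def)

lemma zero_set_I: "0 \<le> t \<Longrightarrow> Y t \<omega> = 0 \<Longrightarrow> t \<in> zero_set Y \<omega>"
  unfolding zero_set_def by (rule subsetD[OF closure_subset]) auto

text \<open>At a positive closure point that is not a zero, right continuity keeps the path away
  from 0 on the right. The zeros then accumulate from the left, and the left limit is 0.\<close>

lemma zero_set_cases:
  assumes cadlag: "cadlag (\<lambda>t. Y t \<omega>)" and t: "t \<in> zero_set Y \<omega>"
  shows "t = 0 \<or> (0 < t \<and> (Y t \<omega> = 0 \<or> ((\<lambda>s. Y s \<omega>) \<longlongrightarrow> 0) (at_left t)))"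
proof (rule ccontr)
  assume neg: "\<not> ?thesis"
  have "zero_set Y \<omega> \<subseteq> {0..}" unfolding zero_set_def by (rule closure_minimal) auto
  with t neg have t_pos: "0 < t" and Y: "Y t \<omega> \<noteq> 0" and not_lim: "\<not> ((\<lambda>s. Y s \<omega>) \<longlongrightarrow> 0) (at_left t)" by auto
  obtain l where l: "((\<lambda>s. Y s \<omega>) \<longlongrightarrow> l) (at_left t)" using cadlag t_pos by (auto simp: cadlag_def)
  with not_lim have "l \<noteq> 0" by auto
  with l have "eventually (\<lambda>s. Y s \<omega> \<noteq> 0) (at_left t)" by (rule tendsto_imp_eventually_ne)
  moreover have "((\<lambda>s. Y s \<omega>) \<longlongrightarrow> Y t \<omega>) (at_right t)" using cadlag t_pos by (auto simp: cadlag_def)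
  then have "eventually (\<lambda>s. Y s \<omega> \<noteq> 0) (at_right t)" using Y by (rule tendsto_imp_eventually_ne)
  ultimately have "eventually (\<lambda>s. Y s \<omega> \<noteq> 0) (nhds t)"
    using Y by (simp add: eventually_nhds_conv_at eventually_at_split)
  then obtain U where U: "open U" "t \<in> U" "\<forall>s\<in>U. Y s \<omega> \<noteq> 0" by (auto simp: eventually_nhds)
  then have "U \<inter> closure {t. 0 \<le> t \<and> Y t \<omega> = 0} = {}" by (subst open_Int_closure_eq_empty) auto
  then show False using t U by (auto simp: zero_set_def)
qed

text \<open>From events to functions: under the weight given by \<open>A\<close>, the law of
  \<open>X (s + t)\<close> is the law of \<open>X s\<close> composed with the kernel
  \<open>P t\<close>.\<close>

lemma markov_process_nn_integral:
  assumes M: "prob_space M" and markov: "markov_process M P X"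
    and P: "P t \<in> borel \<rightarrow>\<^sub>M prob_algebra borel"
    and st: "0 \<le> s" "0 \<le> t" and A: "A \<in> past M X s" and g [measurable]: "g \<in> borel_measurable borel"
  shows "(\<integral>\<^sup>+\<omega>\<in>A. g (X (s + t) \<omega>) \<partial>M) = (\<integral>\<^sup>+\<omega>\<in>A. (\<integral>\<^sup>+y. g y \<partial>P t (X s \<omega>)) \<partial>M)"
proof -
  have [measurable]: "X s \<in> borel_measurable M" "X (s + t) \<in> borel_measurable M"
    using markov st by (auto simp: markov_process_def)
  have [measurable]: "A \<in> sets M"
    using past_subset_sets[of X M s] A markov by (auto simp: markov_process_def)
  have [measurable]: "P t \<in> borel \<rightarrow>\<^sub>M subprob_algebra borel" by (rule measurable_prob_algebraD[OF P])
  define D where "D = density M (indicator A)"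
  have "distr D borel (X (s + t)) = distr D borel (X s) \<bind> P t"
  proof (rule measure_eqI)
    show "sets (distr D borel (X (s + t))) = sets (distr D borel (X s) \<bind> P t)"
      using P by (subst sets_bind[where N = borel]) (auto dest!: measurable_space[where x = "_ :: ennreal"] simp: space_prob_algebra)
  next
    fix B assume "B \<in> sets (distr D borel (X (s + t)))"
    then have [measurable]: "B \<in> sets borel" by simp
    have [measurable]: "(\<lambda>x. emeasure (P t x) B) \<in> borel_measurable borel"
      by (rule measurable_emeasure_kernel[of _ _ borel]) measurable
    have "emeasure (distr D borel (X (s + t))) B = emeasure M {\<omega>\<in>A. X (s + t) \<omega> \<in> B}"
    proof -
      have "emeasure (distr D borel (X (s + t))) B = emeasure D (X (s + t) -` B \<inter> space M)"
        by (subst emeasure_distr) (auto simp: D_def)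
      also have "\<dots> = emeasure M (A \<inter> (X (s + t) -` B \<inter> space M))"
        unfolding D_def by (subst emeasure_restricted) auto
      also have "A \<inter> (X (s + t) -` B \<inter> space M) = {\<omega>\<in>A. X (s + t) \<omega> \<in> B}"
        using sets.sets_into_space[OF \<open>A \<in> sets M\<close>] by auto
      finally show ?thesis .
    qed
    also have "\<dots> = (\<integral>\<^sup>+\<omega>\<in>A. emeasure (P t (X s \<omega>)) B \<partial>M)"
      using markov st A by (simp add: markov_process_def)
    also have "\<dots> = (\<integral>\<^sup>+\<omega>. emeasure (P t (X s \<omega>)) B \<partial>D)"
      unfolding D_def by (subst nn_integral_density) (auto simp: mult.commute)
    also have "\<dots> = (\<integral>\<^sup>+x. emeasure (P t x) B \<partial>distr D borel (X s))"
      by (rule nn_integral_distr[symmetric]) (auto simp: D_def)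
    also have "\<dots> = emeasure (distr D borel (X s) \<bind> P t) B"
      by (rule emeasure_bind[symmetric, where N = borel]) auto
    finally show "emeasure (distr D borel (X (s + t))) B = emeasure (distr D borel (X s) \<bind> P t) B" .
  qed
  then have "(\<integral>\<^sup>+y. g y \<partial>distr D borel (X (s + t))) = (\<integral>\<^sup>+y. g y \<partial>(distr D borel (X s) \<bind> P t))" by simp
  also have "\<dots> = (\<integral>\<^sup>+x. \<integral>\<^sup>+y. g y \<partial>P t x \<partial>distr D borel (X s))"
    by (rule nn_integral_bind[where B = borel]) auto
  also have "\<dots> = (\<integral>\<^sup>+\<omega>. \<integral>\<^sup>+y. g y \<partial>P t (X s \<omega>) \<partial>D)"
    by (rule nn_integral_distr) (auto simp: D_def intro!: nn_integral_measurable_subprob_algebra2[where N = borel])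
  also have "\<dots> = (\<integral>\<^sup>+\<omega>\<in>A. (\<integral>\<^sup>+y. g y \<partial>P t (X s \<omega>)) \<partial>M)"
    unfolding D_def
    by (subst nn_integral_density) (auto simp: mult.commute intro!: nn_integral_measurable_subprob_algebra2[where N = borel])
  also have "(\<integral>\<^sup>+y. g y \<partial>distr D borel (X (s + t))) = (\<integral>\<^sup>+\<omega>. g (X (s + t) \<omega>) \<partial>D)"
    by (rule nn_integral_distr) (auto simp: D_def)
  also have "\<dots> = (\<integral>\<^sup>+\<omega>\<in>A. g (X (s + t) \<omega>) \<partial>M)"
    unfolding D_def by (subst nn_integral_density) (auto simp: mult.commute)
  finally show ?thesis .
qed

lemma borel_measurable_continuous_on_greaterThan:
  fixes g :: "real \<Rightarrow> real"
  assumes "continuous_on {0<..} g" shows "(\<lambda>r. if 0 < r then g r else 0) \<in> borel_measurable borel"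
proof -
  have "(\<lambda>r. if 0 < r then g r else 0) = (\<lambda>r. indicator {0<..} r *\<^sub>R g r)" by (auto split: split_indicator)
  then show ?thesis using borel_measurable_continuous_on_indicator[OF _ assms] by simp
qed

text \<open>The decay of the kernel at positive states: near zero the extinction function is at least
  of order \<open>1 / h\<close>, and integrability bounds the density by a multiple of \<open>1 / h\<close>.\<close>

lemma laplace_kernel_decay:
  fixes u V :: "real \<Rightarrow> real"
  assumes u: "\<And>r. 0 < r \<Longrightarrow> 0 \<le> u r" "\<And>r r'. 0 < r \<Longrightarrow> r \<le> r' \<Longrightarrow> u r' \<le> u r"
    and int: "set_integrable lborel {0<..1} u"
    and V: "0 < \<eta>" "0 < C" "\<And>h. 0 < h \<Longrightarrow> h < \<eta> \<Longrightarrow> 1 / (C * h) \<le> V h"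
    and d: "0 < d"
  shows "((\<lambda>h. u h * laplace_exp (V h) d) \<longlongrightarrow> 0) (at_right 0)"
proof (cases "d = \<top>")
  case False
  define \<delta> where "\<delta> = enn2real d"
  have \<delta>: "0 < \<delta>" "d = ennreal \<delta>" using d False by (auto simp: \<delta>_def enn2real_positive_iff top.not_eq_extremum)
  define K where "K = (LINT r:{0<..1}|lborel. u r)"
  have uK: "h * u h \<le> K" if "0 < h" "h \<le> 1" for h
  proof -
    have u_int: "set_integrable lborel {0<..h} u" by (rule set_integrable_subset[OF int]) (use that in auto)
    have "h * u h = (LINT r:{0<..h}|lborel. u h)" using that by (simp add: set_integral_const)
    also have "\<dots> \<le> (LINT r:{0<..h}|lborel. u r)"
    proof (rule set_integral_mono)
      show "set_integrable lborel {0<..h} (\<lambda>x. u h)" using that by (simp add: set_integrable_def)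
    qed (use that u u_int in auto)
    also have "\<dots> \<le> K" unfolding K_def set_lebesgue_integral_def
    proof (rule integral_mono)
      show "integrable lborel (\<lambda>x. indicator {0<..h} x *\<^sub>R u x)"
        using u_int by (simp add: set_integrable_def)
      show "integrable lborel (\<lambda>x. indicator {0<..1} x *\<^sub>R u x)" using int by (simp add: set_integrable_def)
      show "indicator {0<..h} x *\<^sub>R u x \<le> indicator {0<..1} x *\<^sub>R u x" for x
        using u(1)[of x] that by (auto split: split_indicator)
    qed
    finally show ?thesis .
  qed
  have bound: "u h * laplace_exp (V h) d \<le> 2 * K * C\<^sup>2 / \<delta>\<^sup>2 * h" if h: "0 < h" "h < min \<eta> 1" for h
  proof -
    \<comment> \<open>The exponent is at least \<open>y\<close>, and exp (- y) \<le> 2 / y^2 is of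
      order h^2, which outweighs the order 1 / h of \<open>u\<close>.\<close>
    define y where "y = \<delta> / (C * h)"
    have y: "0 < y" using \<delta> V h by (simp add: y_def)
    have "y\<^sup>2 / 2 \<le> exp y" using exp_lower_Taylor_quadratic[of y] y by simp
    then have "exp (- y) \<le> 2 / y\<^sup>2" using y by (simp add: exp_minus field_simps)
    moreover have "laplace_exp (V h) d \<le> exp (- y)"
      using V(3)[of h] h \<delta> mult_left_mono[of "1 / (C * h)" "V h" \<delta>]
      by (simp add: \<delta>(2) laplace_exp_ennreal y_def mult.commute)
    ultimately have "laplace_exp (V h) d \<le> 2 / y\<^sup>2" by simp
    moreover have "u h \<le> K / h" using uK[of h] h by (simp add: field_simps)
    moreover have "0 \<le> u h" using u(1) h by simp
    ultimately have "u h * laplace_exp (V h) d \<le> (K / h) * (2 / y\<^sup>2)"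
      by (intro mult_mono) (auto intro: order_trans)
    also have "\<dots> = 2 * K * C\<^sup>2 / \<delta>\<^sup>2 * h" using h V \<delta> by (simp add: y_def field_simps power2_eq_square)
    finally show ?thesis .
  qed
  show ?thesis
  proof (rule tendsto_sandwich[OF _ _ tendsto_const])
    show "\<forall>\<^sub>F h in at_right 0. 0 \<le> u h * laplace_exp (V h) d"
      using eventually_at_right_less[of 0] by eventually_elim (simp add: u)
    show "\<forall>\<^sub>F h in at_right 0. u h * laplace_exp (V h) d \<le> 2 * K * C\<^sup>2 / \<delta>\<^sup>2 * h"
      by (rule eventually_at_rightI[of 0 "min \<eta> 1"]) (use bound V in auto)
    show "((\<lambda>h. 2 * K * C\<^sup>2 / \<delta>\<^sup>2 * h) \<longlongrightarrow> 0) (at_right 0)"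
      by (rule tendsto_eq_intros refl | simp)+
  qed
qed simp

text \<open>The Laplace formula is taken at q = V h: by the flow property the cumulant becomes V (t
  + h) and the immigration integral Q (t + h) - Q h. The normalization exp (- Q h) absorbs the
  latter, which is the shift identity. The properties of \<open>m\<close> and \<open>Q\<close> are
  those that a covering with tail function \<open>m\<close> requires.\<close>

theorem CBI_zero_set_density:
  fixes Y :: "real \<Rightarrow> 'w \<Rightarrow> ennreal"
  assumes M: "prob_space M" and \<Psi>: "branching_mechanism \<Psi>" "grey_condition \<Psi>"
    and \<Phi>: "immigration_mechanism \<Phi>" and Y: "CBI M \<Psi> \<Phi> 0 Y"
  obtains m Q :: "real \<Rightarrow> real" where "\<And>r. 0 < r \<Longrightarrow> 0 \<le> m r" "\<And>r s. 0 < r \<Longrightarrow> r \<le> s \<Longrightarrow> m s \<le> m r"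
    "continuous_on {0<..} m" "\<And>r. 0 < r \<Longrightarrow> (Q has_real_derivative m r) (at r)"
    "has_regenerative_density M (zero_set Y) (\<lambda>r. if 0 < r then exp (- Q r) else 0)"
proof -
  obtain P where P: "CBI_transition \<Psi> \<Phi> P" and markov: "markov_process M P Y"
    and cadlag: "\<And>\<omega>. \<omega> \<in> space M \<Longrightarrow> cadlag (\<lambda>t. Y t \<omega>)" and Y_0: "AE \<omega> in M. Y 0 \<omega> = 0"
    using Y by (auto simp: CBI_def)
  then obtain v where v: "cumulant_solution \<Psi> v"
    and trans: "\<And>q t x. 0 < q \<Longrightarrow> 0 \<le> t \<Longrightarrow> (\<integral>y. laplace_exp q y \<partial>P t x) =
      laplace_exp (v t q) x * exp (- (LINT s:{0..t}|lborel. \<Phi> (v s q)))"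
    unfolding CBI_transition_def by blast
  have P_meas: "P t \<in> borel \<rightarrow>\<^sub>M prob_algebra borel" if "0 \<le> t" for t
    using P that by (simp add: CBI_transition_def)
  interpret branching \<Psi> by unfold_locales (fact branching_mechanism_props[OF \<Psi>(1)])+
  obtain C where C: "0 < C" "\<And>q. 1 \<le> q \<Longrightarrow> \<Psi> q \<le> C * q\<^sup>2"
    using branching_mechanism_props(3)[OF \<Psi>(1)] by blast
  obtain V \<eta> where V: "0 < \<eta> \<and> (\<forall>h>0. 0 < V h \<and> (V has_real_derivative - \<Psi> (V h)) (at h) \<and>
    (\<forall>k\<ge>h. V k \<le> V h) \<and> (\<forall>t\<ge>0. v t (V h) = V (t + h)) \<and> (h < \<eta> \<longrightarrow> 1 / (C * h) \<le> V h))"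
    using extinction_function_exists[OF v \<Psi>(2) C] by blast
  then have V_pos: "\<And>h. 0 < h \<Longrightarrow> 0 < V h"
    and V_deriv: "\<And>h. 0 < h \<Longrightarrow> (V has_real_derivative - \<Psi> (V h)) (at h)"
    and V_anti: "\<And>h k. 0 < h \<Longrightarrow> h \<le> k \<Longrightarrow> V k \<le> V h"
    and V_flow: "\<And>t h. 0 \<le> t \<Longrightarrow> 0 < h \<Longrightarrow> v t (V h) = V (t + h)"
    and V_lower: "0 < \<eta>" "\<And>h. 0 < h \<Longrightarrow> h < \<eta> \<Longrightarrow> 1 / (C * h) \<le> V h"
    by simp_all
  have V_cont: "continuous_on {0<..} V"
    by (auto intro!: continuous_at_imp_continuous_on DERIV_isCont[OF V_deriv])
  define m where "m r = \<Phi> (V r)" for r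
  have m_nonneg: "0 \<le> m r" if "0 < r" for r
    unfolding m_def using V_pos[OF that] by (intro immigration_mechanism_props(1)[OF \<Phi>]) simp
  have m_anti: "m s \<le> m r" if "0 < r" "r \<le> s" for r s
    unfolding m_def by (rule mono_onD[OF immigration_mechanism_props(2)[OF \<Phi>]])
      (use V_pos[of r] V_pos[of s] V_anti that in \<open>auto intro: less_imp_le\<close>)
  have m_cont: "continuous_on {0<..} m" unfolding m_def[abs_def]
    by (rule continuous_on_compose2[OF immigration_mechanism_props(3)[OF \<Phi>] V_cont]) (use V_pos in auto)
  obtain Q where Q: "\<And>r. 0 < r \<Longrightarrow> (Q has_real_derivative m r) (at r)"
    using antiderivative_exists[OF m_cont] by metis
  have Q_cont: "continuous_on {0<..} Q"
    by (auto intro!: continuous_at_imp_continuous_on DERIV_isCont[OF Q])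
  have Q_mono: "Q r \<le> Q s" if "0 < r" "r \<le> s" for r s
  proof (rule DERIV_nonneg_imp_nondecreasing[OF \<open>r \<le> s\<close>])
    fix x assume "r \<le> x" "x \<le> s"
    then show "\<exists>d. (Q has_real_derivative d) (at x) \<and> 0 \<le> d"
      using that Q[of x] m_nonneg[of x] by (intro exI[of _ "m x"]) auto
  qed
  have Q_int: "(LINT s:{0..t}|lborel. \<Phi> (v s (V h))) = Q (t + h) - Q h" if "0 \<le> t" "0 < h" for t h
  proof -
    have "(LINT s:{0..t}|lborel. \<Phi> (v s (V h))) = (LINT s:{0..t}|lborel. m (s + h))"
      unfolding set_lebesgue_integral_def
      by (rule Bochner_Integration.integral_cong) (use that in \<open>auto simp: m_def V_flow split: split_indicator\<close>)
    also have "\<dots> = Q (t + h) - Q (0 + h)"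
      unfolding set_lebesgue_integral_def
    proof (rule integral_FTC_atLeastAtMost[OF \<open>0 \<le> t\<close>])
      show "continuous_on {0..t} (\<lambda>s. m (s + h))"
        by (rule continuous_on_compose2[OF m_cont]) (use that in \<open>auto intro!: continuous_intros\<close>)
      fix s assume "0 \<le> s" "s \<le> t"
      then have "((\<lambda>s. Q (s + h)) has_real_derivative m (s + h)) (at s)"
        using Q[of "s + h"] that by (simp add: DERIV_shift)
      then show "((\<lambda>s. Q (s + h)) has_vector_derivative m (s + h)) (at s within {0..t})"
        by (simp add: has_real_derivative_iff_has_vector_derivative has_vector_derivative_at_within)
    qed
    finally show ?thesis by simp
  qed
  define u where "u r = (if 0 < r then exp (- Q r) else 0)" for r
  \<comment> \<open>Cut off at 0 to make \<open>k\<close> jointly measurable; the factor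
    \<open>u\<close> vanishes there.\<close>
  define V' where "V' r = (if 0 < r then V r else 0)" for r
  define k where "k r x = u r * laplace_exp (V' r) x" for r x
  have [measurable]: "u \<in> borel_measurable borel" "V' \<in> borel_measurable borel"
    unfolding u_def[abs_def] V'_def[abs_def]
    by (intro borel_measurable_continuous_on_greaterThan continuous_intros Q_cont V_cont)+
  have shift: "(\<integral>\<^sup>+\<omega>\<in>A. k h (Y (s + t) \<omega>) \<partial>M) = (\<integral>\<^sup>+\<omega>\<in>A. k (t + h) (Y s \<omega>) \<partial>M)"
    if st: "0 \<le> s" "0 \<le> t" "0 < h" and A: "A \<in> past M Y s" for s t h A
  proof -
    have "(\<integral>\<^sup>+y. k h y \<partial>P t x) = k (t + h) x" for x
    proof -
      have "P t x \<in> space (prob_algebra borel)" using measurable_space[OF P_meas[OF st(2)], of x] by simp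
      then have Px: "prob_space (P t x)" and [measurable_cong]: "sets (P t x) = sets borel"
        by (auto simp: space_prob_algebra)
      interpret Px: prob_space "P t x" by fact
      have "integrable (P t x) (laplace_exp (V h))"
        by (rule Px.integrable_const_bound[of _ 1]) (use V_pos[OF st(3)] in \<open>auto intro!: AE_I2 laplace_exp_le_1\<close>)
      then have "(\<integral>\<^sup>+y. k h y \<partial>P t x) = ennreal (\<integral>y. u h * laplace_exp (V h) y \<partial>P t x)"
        using st by (subst nn_integral_eq_integral[symmetric]) (auto simp: k_def V'_def u_def)
      also have "(\<integral>y. u h * laplace_exp (V h) y \<partial>P t x) = u h * (laplace_exp (V (t + h)) x * exp (- (Q (t + h) - Q h)))"
        using trans[OF V_pos[OF st(3)] st(2), of x] Q_int[OF st(2,3)] V_flow[OF st(2,3)] by simp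
      also have "\<dots> = k (t + h) x"
        using st by (simp add: k_def u_def V'_def exp_minus exp_diff field_simps)
      finally show ?thesis .
    qed
    then show ?thesis
      using markov_process_nn_integral[OF M markov P_meas[OF st(2)] st(1,2) A, of "\<lambda>x. ennreal (k h x)"]
      by (simp add: k_def[abs_def])
  qed
  have "regenerative_kernel M Y (completed_past M Y) k"
  proof (rule regenerative_kernel_completed_past[OF M _ cadlag Y_0])
    show "Y t \<in> borel_measurable M" if "0 \<le> t" for t using markov that by (simp add: markov_process_def)
    show "case_prod k \<in> borel_measurable (borel \<Otimes>\<^sub>M borel)"
    proof -
      have "(\<lambda>z. u (fst z) * case_prod laplace_exp (V' (fst z), snd z)) \<in> borel_measurable (borel \<Otimes>\<^sub>M borel)"
        by measurable
      moreover have "case_prod k = (\<lambda>z. u (fst z) * case_prod laplace_exp (V' (fst z), snd z))"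
        by (auto simp: fun_eq_iff k_def)
      ultimately show ?thesis by simp
    qed
    show "0 \<le> k r x" for r x by (simp add: k_def u_def)
    show "k r x = 0" if "r \<le> 0" for r x using that by (simp add: k_def u_def)
    show "k r y \<le> k r x" if "x \<le> y" for x y r
      unfolding k_def u_def V'_def using V_pos[of r] that
      by (auto intro!: mult_left_mono laplace_exp_antimono)
    show "AE r in lborel. isCont (k r) x" for x
    proof (rule AE_I2)
      fix r show "isCont (k r) x"
        unfolding k_def[abs_def] u_def V'_def using isCont_laplace_exp[OF V_pos, of r]
        by (cases "0 < r") (auto intro!: continuous_intros)
    qed
    show "0 < k r 0" if "0 < r" for r using that by (simp add: k_def u_def)
    show "k r' 0 \<le> k r 0" if "0 < r" "r \<le> r'" for r r' using that Q_mono by (simp add: k_def u_def)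
  qed (use shift in auto)
  then interpret regenerative_kernel M Y "completed_past M Y" k .
  have k_0: "(\<lambda>r. k r 0) = u" by (simp add: k_def fun_eq_iff)
  have "has_regenerative_density M (zero_set Y) (\<lambda>r. k r 0)"
  proof (rule has_regenerative_density_zeros)
    fix d :: ennreal assume "set_integrable lborel {0<..1} (\<lambda>r. k r 0)" "0 < d"
    moreover have "0 \<le> u r" "0 < r \<Longrightarrow> r \<le> s \<Longrightarrow> u s \<le> u r" for r s using Q_mono by (simp_all add: u_def)
    ultimately have "((\<lambda>h. u h * laplace_exp (V h) d) \<longlongrightarrow> 0) (at_right 0)"
      unfolding k_0 using V_lower C(1) by (intro laplace_kernel_decay[where \<eta> = \<eta> and C = C])
    moreover have "\<forall>\<^sub>F h in at_right 0. u h * laplace_exp (V h) d = k h d"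
      using eventually_at_right_less[of 0] by eventually_elim (simp add: k_def V'_def)
    ultimately show "((\<lambda>h. k h d) \<longlongrightarrow> 0) (at_right 0)" by (rule Lim_transform_eventually)
  next
    show "AE \<omega> in M. \<forall>t\<in>zero_set Y \<omega>. t = 0 \<or> (0 < t \<and> (Y t \<omega> = 0 \<or> ((\<lambda>s. Y s \<omega>) \<longlongrightarrow> 0) (at_left t)))"
      by (intro AE_I2 ballI zero_set_cases cadlag)
  qed (auto intro!: closed_zero_set zero_set_I)
  then have "has_regenerative_density M (zero_set Y) (\<lambda>r. if 0 < r then exp (- Q r) else 0)"
    unfolding k_0 u_def[abs_def] .
  then show thesis using that[of m Q] m_nonneg m_anti m_cont Q by blast
qed

section \<open>Random coverings\<close>

text \<open>A point is a starting position with a mark; geometrically, the region strictly below the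
  graph of \<open>F\<close> contains none.\<close>

definition void_event :: "'a measure \<Rightarrow> ('a \<Rightarrow> (real \<times> real) set) \<Rightarrow> (real \<Rightarrow> real) \<Rightarrow> 'a set" where
  "void_event M P F = {\<omega>\<in>space M. \<forall>p\<in>P \<omega>. F (fst p) \<le> snd p}"

definition bounded_profile :: "(real \<Rightarrow> real) \<Rightarrow> bool" where
  "bounded_profile F \<longleftrightarrow> F \<in> borel_measurable borel \<and> (\<forall>r. 0 \<le> F r) \<and> (\<exists>B T. \<forall>r. F r \<le> B \<and> (r \<notin> {0..T} \<longrightarrow> F r = 0))"

text \<open>A Poisson process with intensity \<open>c\<close> times Lebesgue measure, described by
  its void probabilities for regions below graphs; the laws of coverings are computed from
  these.\<close>

locale point_process = prob_space M for M :: "'a measure" +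
  fixes P :: "'a \<Rightarrow> (real \<times> real) set" and c :: real
  assumes points_nonneg: "p \<in> P \<omega> \<Longrightarrow> 0 \<le> fst p \<and> 0 \<le> snd p"
    and points_finite: "finite (P \<omega> \<inter> {0..T} \<times> {0..Z})"
    and void_sets: "bounded_profile F \<Longrightarrow> void_event M P F \<in> sets M"
    and void_prob: "bounded_profile F \<Longrightarrow> measure M (void_event M P F) = exp (- c * (LINT r|lborel. F r))"
begin

abbreviation "void F \<equiv> void_event M P F"

lemma bounded_profile_integrable: "bounded_profile F \<Longrightarrow> integrable lborel F"
proof -
  assume F: "bounded_profile F"
  then obtain B T where BT: "\<And>r. F r \<le> B" "\<And>r. r \<notin> {0..T} \<Longrightarrow> F r = 0" unfolding bounded_profile_def by blast
  show ?thesis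
  proof (rule Bochner_Integration.integrable_bound)
    show "integrable lborel (\<lambda>r. indicator {0..T} r * B)"
      by (intro integrable_mult_left integrable_real_indicator) (auto simp: emeasure_lborel_Icc_eq)
    show "AE r in lborel. norm (F r) \<le> norm (indicator {0..T} r * B)"
      using BT F by (intro AE_I2) (force simp: bounded_profile_def split: split_indicator intro: order_trans[OF _ abs_ge_self])
  qed (use F in \<open>simp add: bounded_profile_def\<close>)
qed

lemma bounded_profile_max:
  assumes "bounded_profile F" "bounded_profile G" shows "bounded_profile (\<lambda>r. max (F r) (G r))"
proof -
  obtain B T B' T' where "\<And>r. F r \<le> B \<and> (r \<notin> {0..T} \<longrightarrow> F r = 0)" "\<And>r. G r \<le> B' \<and> (r \<notin> {0..T'} \<longrightarrow> G r = 0)"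
    using assms unfolding bounded_profile_def by metis
  then have "max (F r) (G r) \<le> max B B' \<and> (r \<notin> {0..max T T'} \<longrightarrow> max (F r) (G r) = 0)" for r
    using max.mono[of "F r" B "G r" B'] by (auto simp: le_max_iff_disj)
  then have "\<exists>B T. \<forall>r. max (F r) (G r) \<le> B \<and> (r \<notin> {0..T} \<longrightarrow> max (F r) (G r) = 0)" by blast
  then show ?thesis using assms unfolding bounded_profile_def
    by (intro conjI borel_measurable_max) (auto simp: le_max_iff_disj)
qed

lemma void_Int: "void F \<inter> void G = void (\<lambda>r. max (F r) (G r))"
  by (auto simp: void_event_def)

text \<open>Independence over disjoint sets of positions, because the integral in the exponent is
  additive.\<close>

lemma void_indep:
  assumes F: "bounded_profile F" and G: "bounded_profile G" and disj: "\<And>r. F r = 0 \<or> G r = 0"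
  shows "prob (void F \<inter> void G) = prob (void F) * prob (void G)"
proof -
  have "max (F r) (G r) = F r + G r" for r
    using F G disj[of r] by (auto simp: bounded_profile_def max_def add_nonneg_eq_0_iff antisym)
  then have "(LINT r|lborel. max (F r) (G r)) = (LINT r|lborel. F r) + (LINT r|lborel. G r)"
    using F G by (simp add: bounded_profile_integrable)
  then show ?thesis
    using F G by (simp add: void_Int void_prob bounded_profile_max exp_add[symmetric] algebra_simps)
qed

end

text \<open>For nonincreasing \<open>m\<close>, a point (r, z) covers the open interval that starts
  at r and has length sup {a. z < m a}, the generalized inverse of \<open>m\<close> at z. Under unit
  intensity, intervals longer than h start at rate m h.\<close>

definition uncovered_set :: "(real \<Rightarrow> real) \<Rightarrow> (real \<times> real) set \<Rightarrow> real set" where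
  "uncovered_set m A = {t. 0 \<le> t \<and> (\<forall>p\<in>A. fst p < t \<longrightarrow> m (t - fst p) \<le> snd p)}"

locale covering = point_process M P c for M :: "'a measure" and P :: "'a \<Rightarrow> (real \<times> real) set" and c :: real +
  fixes m Q :: "real \<Rightarrow> real"
  assumes c_pos: "0 < c"
    and m_nonneg: "0 < r \<Longrightarrow> 0 \<le> m r" and m_anti: "0 < r \<Longrightarrow> r \<le> s \<Longrightarrow> m s \<le> m r"
    and m_cont: "continuous_on {0<..} m"
    and Q_deriv: "0 < r \<Longrightarrow> (Q has_real_derivative m r) (at r)"
begin

definition cover_length :: "real \<Rightarrow> ennreal" where
  "cover_length z = Sup {ennreal a | a. 0 < a \<and> z < m a}"

text \<open>Intervals that begin exactly at \<open>t\<close> count with full length, which makes the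
  process right-continuous. Subtraction is truncated, so expired intervals contribute 0.\<close>

definition residual :: "real \<Rightarrow> 'a \<Rightarrow> ennreal" where
  "residual t \<omega> = (SUP p\<in>{p\<in>P \<omega>. fst p \<le> t}. cover_length (snd p) - ennreal (t - fst p))"

abbreviation uncovered :: "'a \<Rightarrow> real set" where
  "uncovered \<omega> \<equiv> uncovered_set m (P \<omega>)"

text \<open>Its void event says that no interval started in \<open>I\<close> extends beyond the time
  \<open>\<tau>\<close>.\<close>

definition profile :: "real set \<Rightarrow> real \<Rightarrow> real \<Rightarrow> real" where
  "profile I \<tau> r = (if r \<in> I then m (\<tau> - r) else 0)"

lemma m_isCont: "0 < r \<Longrightarrow> isCont m r"
  using m_cont by (simp add: continuous_on_eq_continuous_at)

text \<open>The forward direction rests on continuity of \<open>m\<close>: if z < m h, then z < m a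
  for some a > h, and the supremum exceeds \<open>h\<close>.\<close>

lemma cover_length_le:
  assumes "0 < h" shows "cover_length z \<le> ennreal h \<longleftrightarrow> m h \<le> z"
proof
  assume le: "cover_length z \<le> ennreal h"
  show "m h \<le> z"
  proof (rule ccontr)
    assume "\<not> m h \<le> z"
    then have "eventually (\<lambda>a. z < m a) (at h)"
      using m_isCont[OF assms] by (intro order_tendstoD(1)[of m "m h"]) (auto simp: isCont_def)
    then have "eventually (\<lambda>a. z < m a \<and> h < a) (at_right h)"
      using eventually_at_right_less[of h] by (auto simp: eventually_at_split elim: eventually_elim2)
    then obtain a where "z < m a" "h < a" using eventually_happens[of _ "at_right h"] by force
    then have "ennreal a \<le> cover_length z" unfolding cover_length_def using assms by (intro Sup_upper) auto
    then have "ennreal a \<le> ennreal h" using le by (rule order_trans)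
    then show False using \<open>h < a\<close> assms by simp
  qed
next
  assume le: "m h \<le> z"
  show "cover_length z \<le> ennreal h"
    unfolding cover_length_def
  proof (rule Sup_least)
    fix y assume "y \<in> {ennreal a | a. 0 < a \<and> z < m a}"
    then obtain a where "y = ennreal a" "0 < a" "z < m a" by auto
    then show "y \<le> ennreal h" using m_anti[OF assms, of a] le by (cases "h \<le> a") (auto intro: ennreal_leI)
  qed
qed

lemma residual_le:
  assumes "0 \<le> t" "0 < h"
  shows "residual t \<omega> \<le> ennreal h \<longleftrightarrow> (\<forall>p\<in>P \<omega>. fst p \<le> t \<longrightarrow> m (t + h - fst p) \<le> snd p)"
proof -
  have "cover_length z - ennreal (t - r) \<le> ennreal h \<longleftrightarrow> m (t + h - r) \<le> z" if "r \<le> t" for r z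
  proof -
    have "cover_length z - ennreal (t - r) \<le> ennreal h \<longleftrightarrow> cover_length z \<le> ennreal (t - r) + ennreal h"
      by (simp add: ennreal_minus_le_iff)
    also have "ennreal (t - r) + ennreal h = ennreal (t + h - r)"
      using that assms by (simp add: algebra_simps flip: ennreal_plus)
    also have "cover_length z \<le> ennreal (t + h - r) \<longleftrightarrow> m (t + h - r) \<le> z"
      using that assms by (intro cover_length_le) simp
    finally show ?thesis .
  qed
  then show ?thesis unfolding residual_def SUP_le_iff by auto
qed

lemma bounded_profile_profile:
  assumes "I \<in> sets borel" "I \<subseteq> {0..t}" "t < \<tau>" shows "bounded_profile (profile I \<tau>)"
proof -
  have "continuous_on {..<\<tau>} (\<lambda>r. m (\<tau> - r))"
    by (rule continuous_on_compose2[OF m_cont]) (auto intro!: continuous_intros)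
  then have "(\<lambda>r. indicator {..<\<tau>} r *\<^sub>R m (\<tau> - r)) \<in> borel_measurable borel"
    by (intro borel_measurable_continuous_on_indicator) auto
  then have "(\<lambda>r. indicator I r * (indicator {..<\<tau>} r *\<^sub>R m (\<tau> - r))) \<in> borel_measurable borel"
    using assms(1) by measurable
  moreover have "profile I \<tau> = (\<lambda>r. indicator I r * (indicator {..<\<tau>} r *\<^sub>R m (\<tau> - r)))"
    using assms by (auto simp: profile_def fun_eq_iff split: split_indicator)
  ultimately have meas: "profile I \<tau> \<in> borel_measurable borel" by simp
  have "profile I \<tau> r \<le> m (\<tau> - t)" "r \<notin> {0..t} \<longrightarrow> profile I \<tau> r = 0" "0 \<le> profile I \<tau> r" for r
    using assms m_anti[of "\<tau> - t" "\<tau> - r"] m_nonneg[of "\<tau> - t"] m_nonneg[of "\<tau> - r"] by (auto simp: profile_def subset_iff)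
  with meas show ?thesis unfolding bounded_profile_def by blast
qed

lemma residual_le_void:
  assumes "0 \<le> t" "0 < h"
  shows "{\<omega>\<in>space M. residual t \<omega> \<le> ennreal h} = void (profile {0..t} (t + h))"
  unfolding residual_le[OF assms] void_event_def profile_def
  using points_nonneg by (auto split: if_splits)

text \<open>Intervals are split by their start: those begun by time \<open>s\<close> are described
  by the residual at \<open>s\<close>, those begun in (s, s + t] by a void event on later
  positions.\<close>

lemma residual_shift_void:
  assumes "0 \<le> s" "0 \<le> t" "0 < h"
  shows "{\<omega>\<in>space M. residual (s + t) \<omega> \<le> ennreal h} =
    {\<omega>\<in>space M. residual s \<omega> \<le> ennreal (t + h)} \<inter> void (profile {s<..s + t} (s + t + h))"
proof -
  have "s + (t + h) = s + t + h" by simp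
  then have "{\<omega>\<in>space M. residual s \<omega> \<le> ennreal (t + h)} = void (profile {0..s} (s + t + h))"
    using residual_le_void[of s "t + h"] assms by (simp add: add.assoc del: ennreal_plus)
  moreover have "{\<omega>\<in>space M. residual (s + t) \<omega> \<le> ennreal h} = void (profile {0..s + t} (s + t + h))"
    using residual_le_void[of "s + t" h] assms by simp
  moreover have "profile {0..s + t} \<tau> r = max (profile {0..s} \<tau> r) (profile {s<..s + t} \<tau> r)"
    if "s + t < \<tau>" for \<tau> r
    using assms that m_nonneg[of "\<tau> - r"] by (auto simp: profile_def)
  then have "profile {0..s + t} (s + t + h) = (\<lambda>r. max (profile {0..s} (s + t + h) r) (profile {s<..s + t} (s + t + h) r))"
    using assms by (intro ext) simp
  ultimately show ?thesis by (simp add: void_Int)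
qed

lemma profile_integral:
  assumes "0 \<le> s" "0 \<le> t" "0 < h"
  shows "(LINT r|lborel. profile {s<..s + t} (s + t + h) r) = Q (t + h) - Q h"
proof -
  have "(LINT r|lborel. profile {s<..s + t} (s + t + h) r) = (LINT r|lborel. indicator {s..s + t} r *\<^sub>R m (s + t + h - r))"
  proof (rule integral_cong_AE)
    show "profile {s<..s + t} (s + t + h) \<in> borel_measurable lborel"
    proof -
      have "bounded_profile (profile {s<..s + t} (s + t + h))"
        by (rule bounded_profile_profile[of _ "s + t"]) (use assms in auto)
      then show ?thesis by (simp add: bounded_profile_def)
    qed
  next
    show "AE r in lborel. profile {s<..s + t} (s + t + h) r = indicator {s..s + t} r *\<^sub>R m (s + t + h - r)"
      using AE_lborel_singleton[of s] by eventually_elim (auto simp: profile_def split: split_indicator)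
  next
    have "continuous_on {s..s + t} (\<lambda>r. m (s + t + h - r))"
      by (rule continuous_on_compose2[OF m_cont]) (use assms in \<open>auto intro!: continuous_intros\<close>)
    then have "(\<lambda>r. indicator {s..s + t} r *\<^sub>R m (s + t + h - r)) \<in> borel_measurable borel"
      by (rule borel_measurable_continuous_on_indicator[rotated]) simp
    then show "(\<lambda>r. indicator {s..s + t} r *\<^sub>R m (s + t + h - r)) \<in> borel_measurable lborel" by simp
  qed
  also have "\<dots> = - Q (s + t + h - (s + t)) - (- Q (s + t + h - s))"
  proof (rule integral_FTC_atLeastAtMost)
    show "continuous_on {s..s + t} (\<lambda>r. m (s + t + h - r))"
      by (rule continuous_on_compose2[OF m_cont]) (use assms in \<open>auto intro!: continuous_intros\<close>)
    fix r assume r: "s \<le> r" "r \<le> s + t"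
    have "((\<lambda>r. - Q (s + t + h - r)) has_real_derivative - (m (s + t + h - r) * - 1)) (at r)"
      by (rule derivative_intros DERIV_chain2[OF Q_deriv])+ (use r assms in \<open>auto intro!: derivative_eq_intros\<close>)
    then show "((\<lambda>r. - Q (s + t + h - r)) has_vector_derivative m (s + t + h - r)) (at r within {s..s + t})"
      by (simp add: has_real_derivative_iff_has_vector_derivative has_vector_derivative_at_within)
  qed (use assms in simp)
  finally show ?thesis by (simp add: add.commute)
qed

text \<open>\<open>residual_le\<close> speaks of positive levels; level 0 is reached as a countable
  intersection.\<close>

lemma residual_measurable:
  assumes "space N = space M" "0 \<le> t" "\<And>h. 0 < h \<Longrightarrow> {\<omega>\<in>space M. residual t \<omega> \<le> ennreal h} \<in> sets N"
  shows "residual t \<in> borel_measurable N"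
proof (rule borel_measurableI_le)
  fix y
  consider "y = 0" | h where "0 < h" "y = ennreal h" | "y = \<top>"
    by (cases y) (auto simp: less_le)
  then show "{\<omega>\<in>space N. residual t \<omega> \<le> y} \<in> sets N"
  proof cases
    case 1
    have "residual t \<omega> \<le> 0 \<longleftrightarrow> (\<forall>n. residual t \<omega> \<le> ennreal (1 / Suc n))" for \<omega>
    proof safe
      assume *: "\<forall>n. residual t \<omega> \<le> ennreal (1 / real (Suc n))"
      have "(\<lambda>n. ennreal (1 / real (Suc n))) \<longlonglongrightarrow> ennreal 0"
        using LIMSEQ_inverse_real_of_nat by (intro tendsto_ennrealI) (simp add: inverse_eq_divide)
      then show "residual t \<omega> \<le> 0" using * by (intro tendsto_lowerbound[of _ 0 sequentially]) auto
    qed (auto intro: order_trans)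
    then have "{\<omega>\<in>space N. residual t \<omega> \<le> y} = (\<Inter>n. {\<omega>\<in>space M. residual t \<omega> \<le> ennreal (1 / Suc n)})"
      using assms(1) 1 by auto
    then show ?thesis using assms(3) by auto
  qed (use assms sets.top[of N] in auto)
qed

lemma residual_borel_measurable: "0 \<le> t \<Longrightarrow> residual t \<in> borel_measurable M"
  by (rule residual_measurable) (auto simp: residual_le_void intro!: void_sets bounded_profile_profile)

text \<open>The past of the residual up to \<open>s\<close> is contained in the sigma-algebra
  generated by void events of profiles supported in [0, s]. These are stable under intersection, and
  each is independent of \<open>void G\<close>.\<close>

lemma past_residual_indep:
  assumes s: "0 \<le> s" and A: "A \<in> past M residual s"
    and G: "bounded_profile G" "\<And>r. r \<le> s \<Longrightarrow> G r = 0"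
  shows "prob (A \<inter> void G) = prob A * prob (void G)"
proof -
  define \<F> where "\<F> = {void F | F. bounded_profile F \<and> (\<forall>r. s < r \<longrightarrow> F r = 0)}"
  have \<F>: "\<F> \<subseteq> Pow (space M)" by (auto simp: \<F>_def void_event_def)
  have "indep_set \<F> {void G}"
    unfolding indep_sets2_eq
  proof (intro conjI ballI)
    fix a b assume "a \<in> \<F>" "b \<in> {void G}"
    then obtain F where F: "bounded_profile F" "\<And>r. s < r \<Longrightarrow> F r = 0" "a = void F" "b = void G" by (auto simp: \<F>_def)
    have "F r = 0 \<or> G r = 0" for r using F(2)[of r] G(2)[of r] by (cases "s < r") auto
    then show "prob (a \<inter> b) = prob a * prob b" unfolding F(3,4) by (rule void_indep[OF F(1) G(1)])
  qed (use G in \<open>auto simp: \<F>_def intro: void_sets\<close>)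
  moreover have "Int_stable \<F>"
    unfolding Int_stable_def
  proof (intro ballI)
    fix a b assume "a \<in> \<F>" "b \<in> \<F>"
    then obtain F F' where "bounded_profile F" "\<forall>r. s < r \<longrightarrow> F r = 0" "a = void F"
      "bounded_profile F'" "\<forall>r. s < r \<longrightarrow> F' r = 0" "b = void F'" by (auto simp: \<F>_def)
    then show "a \<inter> b \<in> \<F>" unfolding \<F>_def
      by (auto simp: void_Int intro!: exI[of _ "\<lambda>r. max (F r) (F' r)"] bounded_profile_max)
  qed
  ultimately have "indep_set (sigma_sets (space M) \<F>) (sigma_sets (space M) {void G})"
    by (rule indep_set_sigma_sets) (simp add: Int_stable_def)
  moreover have "A \<in> sigma_sets (space M) \<F>"
  proof -
    have "past M residual s \<subseteq> sigma_sets (space M) \<F>"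
      unfolding past_def
    proof (intro sigma_sets_mono subsetI)
      fix E assume "E \<in> {residual u -` B \<inter> space M | u B. 0 \<le> u \<and> u \<le> s \<and> B \<in> sets borel}"
      then obtain u B where E: "E = residual u -` B \<inter> space M" "0 \<le> u" "u \<le> s" "B \<in> sets borel" by auto
      have "residual u \<in> borel_measurable (sigma (space M) \<F>)"
      proof (rule residual_measurable)
        fix h :: real assume "0 < h"
        then have "void (profile {0..u} (u + h)) \<in> \<F>" unfolding \<F>_def
          using E by (intro CollectI exI conjI) (auto intro!: bounded_profile_profile simp: profile_def)
        then show "{\<omega> \<in> space M. residual u \<omega> \<le> ennreal h} \<in> sets (sigma (space M) \<F>)"
          using E \<open>0 < h\<close> \<F> by (simp add: residual_le_void)
      qed (use E \<F> in \<open>auto simp: space_measure_of\<close>)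
      from measurable_sets[OF this E(4)] show "E \<in> sigma_sets (space M) \<F>"
        using E \<F> by (simp add: space_measure_of)
    qed
    then show ?thesis using A by blast
  qed
  ultimately show ?thesis by (intro indep_setD) (auto intro: sigma_sets.Basic)
qed

definition kernel :: "real \<Rightarrow> ennreal \<Rightarrow> real" where
  "kernel r x = (if 0 < r \<and> x \<le> ennreal r then exp (- c * Q r) else 0)"

text \<open>\<open>residual_shift_void\<close> and independence produce the factor exp (- c (Q (t +
  h) - Q h)), which is the quotient of the two normalizations in \<open>kernel\<close>.\<close>

lemma kernel_shift:
  assumes st: "0 \<le> s" "0 \<le> t" "0 < h" and A: "A \<in> past M residual s"
  shows "(\<integral>\<^sup>+\<omega>\<in>A. kernel h (residual (s + t) \<omega>) \<partial>M) = (\<integral>\<^sup>+\<omega>\<in>A. kernel (t + h) (residual s \<omega>) \<partial>M)"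
proof -
  have A_M: "A \<in> sets M" using past_subset_sets[of residual M s] A residual_borel_measurable by auto
  have B: "{\<omega>\<in>space M. residual t \<omega> \<le> ennreal h} \<in> sets M" if "0 \<le> t" for t h
    using residual_borel_measurable[OF that] by measurable
  define V where "V = void (profile {s<..s + t} (s + t + h))"
  have prof: "bounded_profile (profile {s<..s + t} (s + t + h))"
    by (rule bounded_profile_profile[of _ "s + t"]) (use st in auto)
  have int: "(\<integral>\<^sup>+\<omega>\<in>A. kernel h' (residual t' \<omega>) \<partial>M) = ennreal (exp (- c * Q h') * prob (A \<inter> {\<omega>\<in>space M. residual t' \<omega> \<le> ennreal h'}))"
    if "0 \<le> t'" "0 < h'" for t' h'
  proof -
    have "(\<integral>\<^sup>+\<omega>\<in>A. kernel h' (residual t' \<omega>) \<partial>M) =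
      (\<integral>\<^sup>+\<omega>. ennreal (exp (- c * Q h')) * indicator (A \<inter> {\<omega>\<in>space M. residual t' \<omega> \<le> ennreal h'}) \<omega> \<partial>M)"
      by (rule nn_integral_cong) (use that in \<open>auto simp: kernel_def split: split_indicator\<close>)
    also have "\<dots> = ennreal (exp (- c * Q h')) * emeasure M (A \<inter> {\<omega>\<in>space M. residual t' \<omega> \<le> ennreal h'})"
      by (rule nn_integral_cmult_indicator) (use A_M B[OF that(1)] in auto)
    finally show ?thesis by (simp add: emeasure_eq_measure ennreal_mult')
  qed
  have past: "A \<inter> {\<omega>\<in>space M. residual s \<omega> \<le> ennreal (t + h)} \<in> past M residual s"
  proof -
    have "{\<omega>\<in>space M. residual s \<omega> \<le> ennreal (t + h)} \<in> sets (past_algebra M residual s)"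
      using measurable_sets[OF measurable_past_algebra[OF st(1) order_refl, of residual M], of "{..ennreal (t + h)}"]
      by (simp add: vimage_def Int_def conj_commute)
    then show ?thesis using A sets.Int[of A "past_algebra M residual s"] by (simp add: sets_past_algebra)
  qed
  have "prob (A \<inter> {\<omega>\<in>space M. residual (s + t) \<omega> \<le> ennreal h}) =
      prob ((A \<inter> {\<omega>\<in>space M. residual s \<omega> \<le> ennreal (t + h)}) \<inter> V)"
    by (simp only: residual_shift_void[OF st] V_def Int_assoc)
  also have "\<dots> = prob (A \<inter> {\<omega>\<in>space M. residual s \<omega> \<le> ennreal (t + h)}) * prob V"
    unfolding V_def by (rule past_residual_indep[OF st(1) past prof]) (simp add: profile_def)
  also have "prob V = exp (- c * (Q (t + h) - Q h))"
    unfolding V_def using void_prob[OF prof] profile_integral[OF st] by simp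
  finally have "exp (- c * Q h) * prob (A \<inter> {\<omega>\<in>space M. residual (s + t) \<omega> \<le> ennreal h}) =
      exp (- c * Q (t + h)) * prob (A \<inter> {\<omega>\<in>space M. residual s \<omega> \<le> ennreal (t + h)})"
    by (simp add: mult.left_commute[of "exp _"] right_diff_distrib flip: mult.assoc exp_add)
  then show ?thesis using int[of "s + t" h] int[of s "t + h"] st by simp
qed

text \<open>To rise above the level \<open>h\<close> just after \<open>t\<close>, the residual needs
  a new point with mark below \<open>m h\<close>. A bounded time window contains finitely many of
  these, so none start immediately after \<open>t\<close>.\<close>

lemma residual_right_continuous:
  assumes "0 \<le> t" shows "((\<lambda>s. residual s \<omega>) \<longlongrightarrow> residual t \<omega>) (at_right t)"
proof (rule order_tendstoI)
  fix a assume "a < residual t \<omega>"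
  then obtain p where p: "p \<in> P \<omega>" "fst p \<le> t" "a < cover_length (snd p) - ennreal (t - fst p)"
    by (auto simp: residual_def less_SUP_iff)
  have "((\<lambda>s. cover_length (snd p) - ennreal (s - fst p)) \<longlongrightarrow> cover_length (snd p) - ennreal (t - fst p)) (at_right t)"
    by (intro tendsto_diff_ennreal_general tendsto_intros tendsto_ennrealI) auto
  then have "\<forall>\<^sub>F s in at_right t. a < cover_length (snd p) - ennreal (s - fst p)"
    using p(3) by (rule order_tendstoD)
  then show "\<forall>\<^sub>F s in at_right t. a < residual s \<omega>"
    using eventually_at_right_less[of t]
    unfolding residual_def less_SUP_iff by eventually_elim (use p in \<open>intro bexI[of _ p], auto\<close>)
next
  fix b assume "residual t \<omega> < b"
  then obtain y where "residual t \<omega> < y" "y < b" using dense by blast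
  then obtain h where h: "residual t \<omega> < ennreal h" "ennreal h < b" "0 < h"
  proof (cases y)
    case (real h)
    then have "0 < h" using \<open>residual t \<omega> < y\<close> by (cases "h = 0") auto
    then show ?thesis using that real \<open>residual t \<omega> < y\<close> \<open>y < b\<close> by blast
  qed (use \<open>y < b\<close> in auto)
  define D where "D = fst ` (P \<omega> \<inter> {0..t + 1} \<times> {0..m h}) \<inter> {t<..}"
  have "finite D" unfolding D_def using points_finite by auto
  then have "\<forall>\<^sub>F s in at_right t. \<forall>d\<in>D. s < d"
    by (rule eventually_ball_finite) (auto simp: D_def intro!: eventually_at_rightI[where b = "_ :: real"])
  moreover have "\<forall>\<^sub>F s in at_right t. s < t + 1" by (rule eventually_at_rightI[of _ "t + 1"]) auto
  ultimately show "\<forall>\<^sub>F s in at_right t. residual s \<omega> < b"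
    using eventually_at_right_less[of t]
  proof eventually_elim
    case (elim s)
    have "residual s \<omega> \<le> ennreal h"
      unfolding residual_def
    proof (rule SUP_least)
      fix p assume p: "p \<in> {p \<in> P \<omega>. fst p \<le> s}"
      show "cover_length (snd p) - ennreal (s - fst p) \<le> ennreal h"
      proof (cases "fst p \<le> t")
        case True
        have "cover_length (snd p) - ennreal (s - fst p) \<le> cover_length (snd p) - ennreal (t - fst p)"
          using elim by (intro ennreal_minus_mono ennreal_leI) auto
        also have "\<dots> \<le> residual t \<omega>" unfolding residual_def using p True by (intro SUP_upper) auto
        finally show ?thesis using h by simp
      next
        case False
        then have "fst p \<notin> D" using elim p by force
        moreover have "0 \<le> fst p" "0 \<le> snd p" using points_nonneg[of p \<omega>] p by auto
        moreover have "fst p \<in> D" if "snd p \<le> m h"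
          unfolding D_def using False elim p that \<open>0 \<le> fst p\<close> \<open>0 \<le> snd p\<close> by (auto intro!: image_eqI[of _ fst p] simp: mem_Times_iff)
        ultimately have "m h \<le> snd p" using linear[of "m h" "snd p"] by blast
        then have "cover_length (snd p) \<le> ennreal h" using cover_length_le[OF h(3)] by simp
        then show ?thesis using diff_le_self_ennreal order_trans by blast
      qed
    qed
    then show ?case using h by simp
  qed
qed

text \<open>An interval begun by s < t has at time s at most t - s more left than at time t, so
  letting s tend to t leaves the supremum over all earlier starts.\<close>

lemma residual_left_limit:
  "((\<lambda>s. residual s \<omega>) \<longlongrightarrow> (SUP p\<in>{p\<in>P \<omega>. fst p < t}. cover_length (snd p) - ennreal (t - fst p))) (at_left t)"
    (is "(_ \<longlongrightarrow> ?l) _")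
proof (rule order_tendstoI)
  fix a assume "a < ?l"
  then obtain p where p: "p \<in> P \<omega>" "fst p < t" "a < cover_length (snd p) - ennreal (t - fst p)"
    by (auto simp: less_SUP_iff)
  have "\<forall>\<^sub>F s in at_left t. fst p < s" using p(2) by (intro eventually_at_leftI) auto
  moreover have "\<forall>\<^sub>F s in at_left t. s < t" by (intro eventually_at_leftI[of "t - 1"]) auto
  ultimately show "\<forall>\<^sub>F s in at_left t. a < residual s \<omega>"
  proof eventually_elim
    case (elim s)
    have "cover_length (snd p) - ennreal (t - fst p) \<le> cover_length (snd p) - ennreal (s - fst p)"
      using elim by (intro ennreal_minus_mono ennreal_leI) auto
    also have "\<dots> \<le> residual s \<omega>" unfolding residual_def using p elim by (intro SUP_upper) auto
    finally show ?case using p(3) by simp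
  qed
next
  fix b assume b: "?l < b"
  have "((\<lambda>s. ?l + ennreal (t - s)) \<longlongrightarrow> ?l + ennreal (t - t)) (at_left t)"
    by (intro tendsto_intros tendsto_ennrealI)
  then have "\<forall>\<^sub>F s in at_left t. ?l + ennreal (t - s) < b" using b by (intro order_tendstoD) auto
  moreover have "\<forall>\<^sub>F s in at_left t. s < t" by (intro eventually_at_leftI[of "t - 1"]) auto
  ultimately show "\<forall>\<^sub>F s in at_left t. residual s \<omega> < b"
  proof eventually_elim
    case (elim s)
    have "residual s \<omega> \<le> ?l + ennreal (t - s)"
      unfolding residual_def
    proof (rule SUP_least)
      fix p assume p: "p \<in> {p \<in> P \<omega>. fst p \<le> s}"
      have "cover_length (snd p) - ennreal (t - fst p) \<le> ?l" using p elim by (intro SUP_upper) auto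
      then have "cover_length (snd p) \<le> ennreal (t - fst p) + ?l" by (simp add: ennreal_minus_le_iff)
      also have "ennreal (t - fst p) = ennreal (s - fst p) + ennreal (t - s)"
        using p elim by (simp flip: ennreal_plus)
      finally show "cover_length (snd p) - ennreal (s - fst p) \<le> ?l + ennreal (t - s)"
        by (simp add: ennreal_minus_le_iff ac_simps)
    qed
    then show ?case using elim by simp
  qed
qed

lemma residual_cadlag: "cadlag (\<lambda>t. residual t \<omega>)"
  unfolding cadlag_def using residual_right_continuous residual_left_limit by blast

lemma uncovered_closed: "closed (uncovered \<omega>)"
proof -
  have "uncovered \<omega> = {0..} \<inter> (\<Inter>p\<in>P \<omega>. - {t. fst p < t \<and> snd p < m (t - fst p)})"
    by (auto simp: uncovered_set_def not_less)
  moreover have "open {t. fst p < t \<and> snd p < m (t - fst p)}" for p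
  proof -
    have "continuous_on {fst p<..} (\<lambda>t. m (t - fst p))"
      by (rule continuous_on_compose2[OF m_cont]) (auto intro!: continuous_intros)
    then have "open ({fst p<..} \<inter> (\<lambda>t. m (t - fst p)) -` {snd p<..})"
      by (intro continuous_open_preimage) auto
    then show ?thesis by (simp add: vimage_def Int_def)
  qed
  ultimately show ?thesis by (auto intro!: closed_Int closed_INT)
qed

lemma residual_zero_uncovered:
  assumes "0 \<le> t" "residual t \<omega> = 0" shows "t \<in> uncovered \<omega>"
  unfolding uncovered_set_def
proof (intro CollectI conjI ballI impI)
  fix p assume p: "p \<in> P \<omega>" "fst p < t"
  then have "cover_length (snd p) - ennreal (t - fst p) \<le> residual t \<omega>"
    unfolding residual_def by (intro SUP_upper) auto
  then have "cover_length (snd p) - ennreal (t - fst p) \<le> 0" using assms by simp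
  then have "cover_length (snd p) \<le> ennreal (t - fst p)" unfolding ennreal_minus_le_iff by simp
  then show "m (t - fst p) \<le> snd p" using p cover_length_le[of "t - fst p"] by simp
qed fact

text \<open>The intervals begun before an uncovered \<open>t\<close> have expired at
  \<open>t\<close>. Another interval may begin at \<open>t\<close> itself, so the residual at
  \<open>t\<close> can be positive and the claim concerns the left limit.\<close>

lemma uncovered_left_limit:
  assumes "t \<in> uncovered \<omega>" shows "((\<lambda>s. residual s \<omega>) \<longlongrightarrow> 0) (at_left t)"
proof -
  have "(SUP p\<in>{p\<in>P \<omega>. fst p < t}. cover_length (snd p) - ennreal (t - fst p)) \<le> 0"
  proof (rule SUP_least)
    fix p assume "p \<in> {p \<in> P \<omega>. fst p < t}"
    then have "cover_length (snd p) \<le> ennreal (t - fst p)"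
      using assms cover_length_le[of "t - fst p"] by (auto simp: uncovered_set_def)
    then show "cover_length (snd p) - ennreal (t - fst p) \<le> 0" unfolding ennreal_minus_le_iff by simp
  qed
  then show ?thesis using residual_left_limit[where t = t and \<omega> = \<omega>] by simp
qed

text \<open>The relevant profile lives on the single position 0, so its integral vanishes and its
  void event has probability 1.\<close>

lemma residual_0: "AE \<omega> in M. residual 0 \<omega> = 0"
proof -
  have "AE \<omega> in M. residual 0 \<omega> \<le> ennreal h" if "0 < h" for h
  proof -
    have prof: "bounded_profile (profile {0..0} (0 + h))"
      by (rule bounded_profile_profile[of _ 0]) (use that in auto)
    have "(LINT r|lborel. profile {0..0} (0 + h) r) = 0"
      by (rule integral_eq_zero_AE)
        (use AE_lborel_singleton[of 0] in \<open>eventually_elim, auto simp: profile_def\<close>)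
    then have "prob {\<omega>\<in>space M. residual 0 \<omega> \<le> ennreal h} = 1"
      using void_prob[OF prof] residual_le_void[OF order_refl that] by simp
    then show ?thesis using measurable_sets[OF residual_borel_measurable[OF order_refl], of "{..ennreal h}"]
      by (subst (asm) prob_Collect_eq_1) (simp_all add: vimage_def Int_def conj_commute)
  qed
  then have "AE \<omega> in M. \<forall>n. residual 0 \<omega> \<le> ennreal (1 / real (Suc n))"
    by (subst AE_all_countable) auto
  then show ?thesis
  proof eventually_elim
    case (elim \<omega>)
    have "(\<lambda>n. ennreal (1 / real (Suc n))) \<longlonglongrightarrow> ennreal 0"
      using LIMSEQ_inverse_real_of_nat by (intro tendsto_ennrealI) (simp add: inverse_eq_divide)
    then have "residual 0 \<omega> \<le> 0" using elim by (intro tendsto_lowerbound[of _ 0 sequentially]) auto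
    then show ?case by simp
  qed
qed

theorem uncovered_density: "has_regenerative_density M uncovered (\<lambda>r. if 0 < r then exp (- c * Q r) else 0)"
proof -
  have Q_cont: "continuous_on {0<..} (\<lambda>r. exp (- c * Q r))"
    by (auto intro!: continuous_intros continuous_at_imp_continuous_on DERIV_isCont[OF Q_deriv])
  have Q_mono: "Q r \<le> Q s" if "0 < r" "r \<le> s" for r s
  proof (rule DERIV_nonneg_imp_nondecreasing[OF \<open>r \<le> s\<close>])
    fix x assume "r \<le> x" "x \<le> s"
    then show "\<exists>d. (Q has_real_derivative d) (at x) \<and> 0 \<le> d"
      using that Q_deriv[of x] m_nonneg[of x] by (intro exI[of _ "m x"]) auto
  qed
  have "regenerative_kernel M residual (completed_past M residual) kernel"
  proof (rule regenerative_kernel_completed_past[OF prob_space_axioms residual_borel_measurable residual_cadlag residual_0])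
    show "case_prod kernel \<in> borel_measurable (borel \<Otimes>\<^sub>M borel)"
    proof -
      note [measurable] = borel_measurable_continuous_on_greaterThan[OF Q_cont]
      have "(\<lambda>z. if snd z \<le> ennreal (fst z) then (if 0 < fst z then exp (- c * Q (fst z)) else 0) else 0)
          \<in> borel_measurable (borel \<Otimes>\<^sub>M borel)"
        by measurable
      moreover have "case_prod kernel = (\<lambda>z. if snd z \<le> ennreal (fst z) then (if 0 < fst z then exp (- c * Q (fst z)) else 0) else 0)"
        by (auto simp: kernel_def fun_eq_iff)
      ultimately show ?thesis by simp
    qed
    \<comment> \<open>As a function of the state the kernel jumps at x = r, so for given x a single
      r is exceptional.\<close>
    show "AE r in lborel. isCont (kernel r) x" for x
      using AE_lborel_singleton[of "enn2real x"]
    proof eventually_elim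
      case (elim r)
      consider "r \<le> 0" | "0 < r" "x < ennreal r" | "0 < r" "ennreal r < x"
        using elim by (cases x) (force simp: ennreal_less_iff linorder_neq_iff not_less ennreal_less_top)+
      then show ?case
      proof cases
        case 1
        then show ?thesis by (simp add: kernel_def[abs_def])
      next
        case 2
        then have "\<forall>\<^sub>F y in nhds x. kernel r y = exp (- c * Q r)"
          using eventually_nhds_in_open[of "{..<ennreal r}" x] by (auto elim!: eventually_mono simp: kernel_def)
        then show ?thesis by (subst isCont_cong) auto
      next
        case 3
        then have "\<forall>\<^sub>F y in nhds x. kernel r y = 0"
          using eventually_nhds_in_open[of "{ennreal r<..}" x] by (auto elim!: eventually_mono simp: kernel_def)
        then show ?thesis by (subst isCont_cong) auto
      qed
    qed
    show "kernel r' 0 \<le> kernel r 0" if "0 < r" "r \<le> r'" for r r'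
      using that Q_mono[OF that] c_pos by (simp add: kernel_def)
  qed (use kernel_shift in \<open>auto simp: kernel_def intro: order_trans\<close>)
  then interpret regenerative_kernel M residual "completed_past M residual" kernel .
  have "has_regenerative_density M uncovered (\<lambda>r. kernel r 0)"
  proof (rule has_regenerative_density_zeros)
    fix d :: ennreal assume "0 < d"
    have "((\<lambda>h. ennreal h) \<longlongrightarrow> ennreal 0) (at_right 0)" by (intro tendsto_ennrealI tendsto_ident_at)
    then have "\<forall>\<^sub>F h in at_right 0. ennreal h < d" using \<open>0 < d\<close> by (intro order_tendstoD) auto
    then have "\<forall>\<^sub>F h in at_right 0. 0 = kernel h d" by eventually_elim (auto simp: kernel_def)
    then show "((\<lambda>h. kernel h d) \<longlongrightarrow> 0) (at_right 0)" by (rule Lim_transform_eventually[OF tendsto_const])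
  next
    show "AE \<omega> in M. \<forall>t\<in>uncovered \<omega>. t = 0 \<or> (0 < t \<and> (residual t \<omega> = 0 \<or> ((\<lambda>s. residual s \<omega>) \<longlongrightarrow> 0) (at_left t)))"
      using uncovered_left_limit by (intro AE_I2) (auto simp: uncovered_set_def less_le)
  qed (auto intro: uncovered_closed residual_zero_uncovered)
  moreover have "(\<lambda>r. kernel r 0) = (\<lambda>r. if 0 < r then exp (- c * Q r) else 0)" by (auto simp: kernel_def)
  ultimately show ?thesis by simp
qed

end

section \<open>A Poisson point process\<close>

abbreviation unit_uniform :: "real measure" where "unit_uniform \<equiv> uniform_measure lborel {0..<1}"

text \<open>One unit cell: a Poisson number together with an infinite supply of candidate points, of
  which that many are used. This avoids a random index set.\<close>

definition cell_measure :: "(nat \<times> (nat \<Rightarrow> real \<times> real)) measure" where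
  "cell_measure = measure_pmf (poisson_pmf 1) \<Otimes>\<^sub>M (\<Pi>\<^sub>M j\<in>UNIV. unit_uniform \<Otimes>\<^sub>M unit_uniform)"

definition cells_measure :: "(nat \<Rightarrow> nat \<times> (nat \<Rightarrow> real \<times> real)) measure" where
  "cells_measure = (\<Pi>\<^sub>M c\<in>UNIV. cell_measure)"

text \<open>The points of the Poisson process in the unit cell with lower left corner \<open>prod_decode c\<close>:
  a Poisson number of independent uniform points. Coordinates outside of \<open>[0, 1)\<close>, which have
  probability zero, are discarded.\<close>

definition cells_points :: "(nat \<Rightarrow> nat \<times> (nat \<Rightarrow> real \<times> real)) \<Rightarrow> (real \<times> real) set" where
  "cells_points \<omega> = {(real (fst (prod_decode c)) + fst (snd (\<omega> c) j), real (snd (prod_decode c)) + snd (snd (\<omega> c) j)) |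
     c j. j < fst (\<omega> c) \<and> snd (\<omega> c) j \<in> {0..<1} \<times> {0..<1}}"

lemma prob_space_unit_uniform: "prob_space unit_uniform"
  by (rule prob_space_uniform_measure) auto

lemma prob_space_unit_square: "prob_space (unit_uniform \<Otimes>\<^sub>M unit_uniform)"
  by (intro prob_space_pair prob_space_unit_uniform)

lemma prob_space_cell_measure: "prob_space cell_measure"
  unfolding cell_measure_def
  by (intro prob_space_pair prob_space_PiM prob_space_unit_square prob_space_measure_pmf)

lemma prob_space_cells_measure: "prob_space cells_measure"
  unfolding cells_measure_def by (intro prob_space_PiM prob_space_cell_measure)

text \<open>Given k points the event has probability (1 - p) ^ k, and the generating function of the
  Poisson law with mean 1 takes the value exp (- p) at 1 - p.\<close>

lemma cell_void_prob:
  assumes B [measurable]: "B \<in> sets (unit_uniform \<Otimes>\<^sub>M unit_uniform)"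
  shows "{x\<in>space cell_measure. \<forall>j<fst x. snd x j \<notin> B} \<in> sets cell_measure"
    and "measure cell_measure {x\<in>space cell_measure. \<forall>j<fst x. snd x j \<notin> B} = exp (- measure (unit_uniform \<Otimes>\<^sub>M unit_uniform) B)"
proof -
  define U where "U = unit_uniform \<Otimes>\<^sub>M unit_uniform"
  interpret U: prob_space U unfolding U_def by (rule prob_space_unit_square)
  interpret PU: product_prob_space "\<lambda>_::nat. U" UNIV by unfold_locales
  interpret C: prob_space cell_measure by (rule prob_space_cell_measure)
  have [measurable]: "B \<in> sets U" using B by (simp add: U_def)
  let ?E = "{x\<in>space cell_measure. \<forall>j<fst x. snd x j \<notin> B}"
  have cell: "cell_measure = measure_pmf (poisson_pmf 1) \<Otimes>\<^sub>M (\<Pi>\<^sub>M j\<in>UNIV. U)" by (simp add: cell_measure_def U_def)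
  show E: "?E \<in> sets cell_measure" unfolding cell by measurable
  define p where "p = U.prob B"
  have p: "0 \<le> p" "p \<le> 1" by (simp_all add: p_def)
  have "emeasure cell_measure ?E = (\<integral>\<^sup>+k. emeasure (\<Pi>\<^sub>M j\<in>UNIV. U) (Pair k -` ?E) \<partial>measure_pmf (poisson_pmf 1))"
    unfolding cell by (rule PU.emeasure_pair_measure_alt) (use E in \<open>simp add: cell\<close>)
  also have "\<dots> = (\<integral>\<^sup>+k. ennreal ((1 - p) ^ k) \<partial>measure_pmf (poisson_pmf 1))"
  proof (rule nn_integral_cong)
    fix k
    have "Pair k -` ?E = {x\<in>space (\<Pi>\<^sub>M j\<in>UNIV. U). \<forall>j\<in>{..<k}. x j \<in> space U - B}"
      by (auto simp: cell space_pair_measure space_PiM)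
    also have "emeasure (\<Pi>\<^sub>M j\<in>UNIV. U) \<dots> = (\<Prod>j\<in>{..<k}. emeasure U (space U - B))"
      by (rule PU.emeasure_PiM_Collect) auto
    also have "emeasure U (space U - B) = ennreal (1 - p)"
      by (simp add: U.emeasure_eq_measure U.prob_compl p_def)
    finally show "emeasure (\<Pi>\<^sub>M j\<in>UNIV. U) (Pair k -` ?E) = ennreal ((1 - p) ^ k)"
      using p by (simp add: ennreal_power)
  qed
  also have "\<dots> = (\<Sum>k. ennreal (pmf (poisson_pmf 1) k * (1 - p) ^ k))"
    using p by (simp add: nn_integral_measure_pmf nn_integral_count_space_nat ennreal_mult del: pmf_poisson)
  also have "\<dots> = ennreal (exp (- p))"
  proof (rule sums_unique[symmetric, OF sums_ennreal[THEN iffD2]])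
    have "(\<lambda>k. (1 - p) ^ k / fact k * exp (-1)) sums (exp (1 - p) * exp (-1))"
      using exp_converges[of "1 - p"] by (intro sums_mult2) (simp add: divide_inverse mult.commute)
    then show "(\<lambda>k. pmf (poisson_pmf 1) k * (1 - p) ^ k) sums exp (- p)"
      by (simp add: mult.commute mult.left_commute exp_add[symmetric])
  qed (use p in auto)
  finally show "measure cell_measure ?E = exp (- measure (unit_uniform \<Otimes>\<^sub>M unit_uniform) B)"
    by (simp add: C.emeasure_eq_measure p_def U_def)
qed

lemma cells_points_nonneg: "p \<in> cells_points \<omega> \<Longrightarrow> 0 \<le> fst p \<and> 0 \<le> snd p"
  by (auto simp: cells_points_def)

lemma cells_points_finite: "finite (cells_points \<omega> \<inter> {0..T} \<times> {0..Z})"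
proof (rule finite_subset)
  let ?f = "\<lambda>c j. (real (fst (prod_decode c)) + fst (snd (\<omega> c) j), real (snd (prod_decode c)) + snd (snd (\<omega> c) j))"
  let ?C = "prod_encode ` ({..nat \<lfloor>T\<rfloor>} \<times> {..nat \<lfloor>Z\<rfloor>})"
  show "finite (\<Union>c\<in>?C. ?f c ` {..<fst (\<omega> c)})" by blast
  show "cells_points \<omega> \<inter> {0..T} \<times> {0..Z} \<subseteq> (\<Union>c\<in>?C. ?f c ` {..<fst (\<omega> c)})"
  proof
    fix p assume p: "p \<in> cells_points \<omega> \<inter> {0..T} \<times> {0..Z}"
    then have "p \<in> cells_points \<omega>" by simp
    then obtain c j where "p = ?f c j \<and> j < fst (\<omega> c) \<and> snd (\<omega> c) j \<in> {0..<1} \<times> {0..<1}"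
      unfolding cells_points_def mem_Collect_eq by (elim exE) (rule that)
    then have cj: "j < fst (\<omega> c)" "p = ?f c j" "snd (\<omega> c) j \<in> {0..<1} \<times> {0..<1}" by simp_all
    have "real (fst (prod_decode c)) \<le> T" "real (snd (prod_decode c)) \<le> Z"
      using p cj by (auto simp: mem_Times_iff)
    then have "prod_decode c \<in> {..nat \<lfloor>T\<rfloor>} \<times> {..nat \<lfloor>Z\<rfloor>}" by (simp add: mem_Times_iff le_nat_floor)
    then have "c \<in> ?C" using imageI[of "prod_decode c" _ prod_encode] by simp
    then show "p \<in> (\<Union>c\<in>?C. ?f c ` {..<fst (\<omega> c)})" using cj by blast
  qed
qed

text \<open>A height is cut into unit slices, one for each row of cells.\<close>

lemma sum_clamp: "0 \<le> x \<Longrightarrow> (\<Sum>b<n. min 1 (max 0 (x - real b))) = min (real n) x"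
  by (induction n) (auto simp: min_def max_def)

lemma sum_cell_indicator: "(\<Sum>a<n. indicator {real a..<real a + 1} r) = (indicator {0..<real n} r :: real)"
  by (induction n) (auto split: split_indicator)

text \<open>The part of the region below the graph of \<open>F\<close> that falls into cell
  \<open>c\<close>, moved to the unit square.\<close>

definition cell_profile :: "(real \<Rightarrow> real) \<Rightarrow> nat \<Rightarrow> (real \<times> real) set" where
  "cell_profile F c = {q \<in> {0..<1} \<times> {0..<1}.
     real (snd (prod_decode c)) + snd q < F (real (fst (prod_decode c)) + fst q)}"

lemma cell_profile_sets:
  assumes [measurable]: "F \<in> borel_measurable borel"
  shows "cell_profile F c \<in> sets (unit_uniform \<Otimes>\<^sub>M unit_uniform)"
proof -
  have "{q \<in> space (unit_uniform \<Otimes>\<^sub>M unit_uniform). 0 \<le> fst q \<and> fst q < 1 \<and> 0 \<le> snd q \<and> snd q < 1 \<and>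
      real (snd (prod_decode c)) + snd q < F (real (fst (prod_decode c)) + fst q)} \<in> sets (unit_uniform \<Otimes>\<^sub>M unit_uniform)"
    by measurable
  also have "{q \<in> space (unit_uniform \<Otimes>\<^sub>M unit_uniform). 0 \<le> fst q \<and> fst q < 1 \<and> 0 \<le> snd q \<and> snd q < 1 \<and>
      real (snd (prod_decode c)) + snd q < F (real (fst (prod_decode c)) + fst q)} = cell_profile F c"
    by (auto simp: cell_profile_def space_pair_measure)
  finally show ?thesis .
qed

text \<open>By Fubini: the vertical section at x is an interval from 0 whose length is the height of
  \<open>F\<close> above row \<open>b\<close>, clamped to [0, 1].\<close>

lemma measure_cell_profile:
  fixes F :: "real \<Rightarrow> real"
  assumes F [measurable]: "F \<in> borel_measurable borel" and c: "prod_decode c = (a, b)"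
  shows "measure (unit_uniform \<Otimes>\<^sub>M unit_uniform) (cell_profile F c) =
    (LINT r|lborel. indicator {real a..<real a + 1} r * min 1 (max 0 (F r - real b)))"
proof -
  interpret u: prob_space unit_uniform by (rule prob_space_unit_uniform)
  have div_1: "x / 1 = x" for x :: ennreal using mult_divide_eq_ennreal[of 1 x] by simp
  let ?g = "\<lambda>x. min 1 (max 0 (F (real a + x) - real b))"
  have int: "integrable lborel (\<lambda>x. indicator {0..<1} x * ?g x)"
    by (rule Bochner_Integration.integrable_bound[of _ "indicator {0..<1::real} :: real \<Rightarrow> real"])
      (auto intro!: integrable_real_indicator AE_I2 split: split_indicator)
  have "emeasure (unit_uniform \<Otimes>\<^sub>M unit_uniform) (cell_profile F c)
      = (\<integral>\<^sup>+x. emeasure unit_uniform (Pair x -` cell_profile F c) \<partial>unit_uniform)"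
    by (rule u.emeasure_pair_measure_alt[OF cell_profile_sets[OF F]])
  also have "\<dots> = (\<integral>\<^sup>+x. ennreal (indicator {0..<1} x * ?g x) \<partial>unit_uniform)"
  proof (rule nn_integral_cong)
    fix x
    have "Pair x -` cell_profile F c = (if x \<in> {0..<1} then {0..<?g x} else {})"
      using c by (auto simp: cell_profile_def)
    moreover have "emeasure unit_uniform {0..<?g x} = ennreal (?g x)"
    proof -
      have "{0..<1} \<inter> {0..<?g x} = {0..<?g x}" by auto
      then show ?thesis by (subst emeasure_uniform_measure) (auto simp: div_1)
    qed
    ultimately show "emeasure unit_uniform (Pair x -` cell_profile F c) = ennreal (indicator {0..<1} x * ?g x)" by auto
  qed
  also have "\<dots> = (\<integral>\<^sup>+x. ennreal (indicator {0..<1} x * ?g x) * indicator {0..<1} x \<partial>lborel) / emeasure lborel {0..<1::real}"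
    by (rule nn_integral_uniform_measure) auto
  also have "\<dots> = (\<integral>\<^sup>+x. ennreal (indicator {0..<1} x * ?g x) \<partial>lborel)"
    by (auto simp: div_1 intro!: nn_integral_cong split: split_indicator)
  also have "\<dots> = ennreal (LINT x|lborel. indicator {0..<1} x * ?g x)"
    by (rule nn_integral_eq_integral[OF int]) auto
  finally have "measure (unit_uniform \<Otimes>\<^sub>M unit_uniform) (cell_profile F c) = (LINT x|lborel. indicator {0..<1} x * ?g x)"
    by (simp add: measure_def)
  also have "\<dots> = (LINT x|lborel. indicator {real a..<real a + 1} (real a + 1 * x) * min 1 (max 0 (F (real a + 1 * x) - real b)))"
    by (rule Bochner_Integration.integral_cong) (auto split: split_indicator)
  also have "\<dots> = (LINT r|lborel. indicator {real a..<real a + 1} r * min 1 (max 0 (F r - real b)))"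
    using lborel_integral_real_affine[of 1 "\<lambda>r. indicator {real a..<real a + 1} r * min 1 (max 0 (F r - real b))" "real a"] by simp
  finally show ?thesis .
qed

text \<open>Finitely many cells meet the region below a bounded profile. The cells are independent,
  so their void probabilities multiply, and the areas of the pieces add up to the integral of
  \<open>F\<close>.\<close>

theorem point_process_cells: "point_process cells_measure cells_points 1"
proof -
  interpret C: prob_space cell_measure by (rule prob_space_cell_measure)
  interpret PC: product_prob_space "\<lambda>_::nat. cell_measure" UNIV by unfold_locales
  interpret N: prob_space cells_measure by (rule prob_space_cells_measure)
  have void: "void_event cells_measure cells_points F \<in> sets cells_measure \<and>
      measure cells_measure (void_event cells_measure cells_points F) = exp (- (LINT r|lborel. F r))"
    if prof: "bounded_profile F" for F
  proof -
    have [measurable]: "F \<in> borel_measurable borel" and F: "\<And>r. 0 \<le> F r"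
      using prof by (auto simp: bounded_profile_def)
    obtain B T where BT: "\<And>r. F r \<le> B" "\<And>r. r \<notin> {0..T} \<Longrightarrow> F r = 0"
      using prof unfolding bounded_profile_def by blast
    define b where "b = nat \<lceil>B\<rceil>"
    define a where "a = nat \<lfloor>T\<rfloor> + 1"
    have b: "F r \<le> real b" for r using BT(1)[of r] unfolding b_def by linarith
    have a: "F r = 0" if "r \<notin> {0..<real a}" for r using BT(2)[of r] that unfolding a_def by auto linarith
    \<comment> \<open>The first \<open>a\<close> columns and the first \<open>b\<close> rows of
      cells contain the whole region below the graph.\<close>
    define J where "J = prod_encode ` ({..<a} \<times> {..<b})"
    have J: "finite J" by (simp add: J_def)
    define X where "X c = {x\<in>space cell_measure. \<forall>j<fst x. snd x j \<notin> cell_profile F c}" for c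
    have empty: "cell_profile F c = {}" if "c \<notin> J" for c
    proof (rule ccontr)
      assume "cell_profile F c \<noteq> {}"
      then obtain q where q: "q \<in> {0..<1} \<times> {0..<1}" "real (snd (prod_decode c)) + snd q < F (real (fst (prod_decode c)) + fst q)"
        by (auto simp: cell_profile_def)
      have "snd (prod_decode c) < b" using q b[of "real (fst (prod_decode c)) + fst q"] by (auto simp: mem_Times_iff)
      moreover have "fst (prod_decode c) < a"
      proof (rule ccontr)
        assume "\<not> fst (prod_decode c) < a"
        then have "F (real (fst (prod_decode c)) + fst q) = 0" using q by (intro a) (auto simp: mem_Times_iff)
        then show False using q by (auto simp: mem_Times_iff)
      qed
      ultimately have "prod_decode c \<in> {..<a} \<times> {..<b}" by (simp add: mem_Times_iff)
      then show False using that imageI[of "prod_decode c" _ prod_encode] by (simp add: J_def)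
    qed
    have "(\<forall>p\<in>cells_points \<omega>. F (fst p) \<le> snd p) \<longleftrightarrow> (\<forall>c. \<forall>j<fst (\<omega> c). snd (\<omega> c) j \<notin> cell_profile F c)" for \<omega>
    proof -
      have "(\<forall>p\<in>cells_points \<omega>. F (fst p) \<le> snd p) \<longleftrightarrow> (\<forall>c j. j < fst (\<omega> c) \<longrightarrow> snd (\<omega> c) j \<in> {0..<1} \<times> {0..<1} \<longrightarrow>
          F (real (fst (prod_decode c)) + fst (snd (\<omega> c) j)) \<le> real (snd (prod_decode c)) + snd (snd (\<omega> c) j))"
        unfolding cells_points_def by force
      then show ?thesis by (simp add: cell_profile_def not_less)
    qed
    then have void_eq: "void_event cells_measure cells_points F = {\<omega>\<in>space cells_measure. \<forall>c\<in>J. \<omega> c \<in> X c}"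
      unfolding void_event_def X_def using empty by (auto simp: cells_measure_def space_PiM)
    have X: "X c \<in> sets cell_measure" for c
      unfolding X_def by (intro cell_void_prob(1) cell_profile_sets) simp
    then have void_sets: "{\<omega>\<in>space cells_measure. \<forall>c\<in>J. \<omega> c \<in> X c} \<in> sets cells_measure"
      unfolding cells_measure_def using J by measurable
    have "emeasure cells_measure {\<omega>\<in>space cells_measure. \<forall>c\<in>J. \<omega> c \<in> X c} = (\<Prod>c\<in>J. emeasure cell_measure (X c))"
      unfolding cells_measure_def using J X by (intro PC.emeasure_PiM_Collect) auto
    then have "measure cells_measure {\<omega>\<in>space cells_measure. \<forall>c\<in>J. \<omega> c \<in> X c} = (\<Prod>c\<in>J. measure cell_measure (X c))"
      by (simp add: N.emeasure_eq_measure C.emeasure_eq_measure prod_ennreal prod_nonneg)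
    also have "\<dots> = exp (- (\<Sum>c\<in>J. measure (unit_uniform \<Otimes>\<^sub>M unit_uniform) (cell_profile F c)))"
      unfolding X_def sum_negf[symmetric] exp_sum[OF J]
      by (intro prod.cong refl cell_void_prob(2) cell_profile_sets) simp
    also have "(\<Sum>c\<in>J. measure (unit_uniform \<Otimes>\<^sub>M unit_uniform) (cell_profile F c)) =
        (\<Sum>(i, k)\<in>{..<a} \<times> {..<b}. LINT r|lborel. indicator {real i..<real i + 1} r * min 1 (max 0 (F r - real k)))"
      unfolding J_def by (subst sum.reindex) (auto simp: inj_on_def measure_cell_profile intro!: sum.cong)
    also have "\<dots> = (LINT r|lborel. (\<Sum>(i, k)\<in>{..<a} \<times> {..<b}. indicator {real i..<real i + 1} r * min 1 (max 0 (F r - real k))))"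
    proof -
      have "integrable lborel (\<lambda>r. indicator {real i..<real i + 1} r * min 1 (max 0 (F r - real k)))" for i k
        by (rule Bochner_Integration.integrable_bound[of _ "indicator {real i..<real i + 1} :: real \<Rightarrow> real"])
          (auto intro!: integrable_real_indicator AE_I2 split: split_indicator)
      then show ?thesis by (subst Bochner_Integration.integral_sum) (auto simp: case_prod_beta)
    qed
    also have "(\<lambda>r. \<Sum>(i, k)\<in>{..<a} \<times> {..<b}. indicator {real i..<real i + 1} r * min 1 (max 0 (F r - real k))) = F"
    proof
      fix r
      have "(\<Sum>(i, k)\<in>{..<a} \<times> {..<b}. indicator {real i..<real i + 1} r * min 1 (max 0 (F r - real k)))
        = (\<Sum>i<a. indicator {real i..<real i + 1} r) * (\<Sum>k<b. min 1 (max 0 (F r - real k)))"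
        unfolding sum_product sum.cartesian_product ..
      also have "\<dots> = indicator {0..<real a} r * F r" using b[of r] F[of r] by (simp add: sum_cell_indicator sum_clamp)
      also have "\<dots> = F r" using a[of r] by (auto split: split_indicator)
      finally show "(\<Sum>(i, k)\<in>{..<a} \<times> {..<b}. indicator {real i..<real i + 1} r * min 1 (max 0 (F r - real k))) = F r" .
    qed
    finally show ?thesis using void_eq void_sets by simp
  qed
  show ?thesis
    by unfold_locales (use void in \<open>auto simp: cells_points_nonneg cells_points_finite\<close>)
qed

section \<open>Infinite divisibility\<close>

text \<open>Infinite divisibility is stated with sequences of functions from the reals to
  [0, \<infinity>] as sample points, so a configuration is stored injectively in one such function.
  For each cell, index 0 holds the count and the indices 2 j + 1 and 2 j + 2 the coordinates of
  point j; the exponential makes them nonnegative without loss.\<close>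

definition encode_cells :: "(nat \<Rightarrow> nat \<times> (nat \<Rightarrow> real \<times> real)) \<Rightarrow> real \<Rightarrow> ennreal" where
  "encode_cells \<omega> t = (case prod_decode (nat \<lfloor>t\<rfloor>) of (c, i) \<Rightarrow>
     if i = 0 then of_nat (fst (\<omega> c))
     else ennreal (exp ((if odd i then fst else snd) (snd (\<omega> c) ((i - 1) div 2)))))"

lemma inj_encode_cells: "inj encode_cells"
proof (rule injI)
  fix x y assume xy: "encode_cells x = encode_cells y"
  have "fst (x c) = fst (y c)" "snd (x c) j = snd (y c) j" for c j
    using fun_cong[OF xy, of "real (prod_encode (c, 0))"] fun_cong[OF xy, of "real (prod_encode (c, 2 * j + 1))"]
      fun_cong[OF xy, of "real (prod_encode (c, 2 * j + 2))"]
    by (auto simp: encode_cells_def prod_eq_iff)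
  then show "x = y" by (intro ext prod_eqI) auto
qed

text \<open>The sigma-algebra is pulled back along an inverse of the encoding, which makes encoding
  and decoding measurable by construction.\<close>

definition covering_measure :: "(real \<Rightarrow> ennreal) measure" where
  "covering_measure = distr cells_measure (vimage_algebra UNIV (inv encode_cells) cells_measure) encode_cells"

lemma space_cells_measure: "space cells_measure = UNIV"
  by (simp add: cells_measure_def cell_measure_def space_PiM space_pair_measure PiE_UNIV_domain)

lemma measurable_encode_cells [measurable]:
  "encode_cells \<in> cells_measure \<rightarrow>\<^sub>M vimage_algebra UNIV (inv encode_cells) cells_measure"
  by (rule measurable_vimage_algebra2) (simp_all add: inv_f_f[OF inj_encode_cells])

lemma measurable_inv_encode_cells: "inv encode_cells \<in> covering_measure \<rightarrow>\<^sub>M cells_measure"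
  unfolding covering_measure_def measurable_distr_eq1
  by (rule measurable_vimage_algebra1) (simp add: space_cells_measure)

lemma prob_space_covering_measure: "prob_space covering_measure"
  unfolding covering_measure_def by (rule prob_space.prob_space_distr[OF prob_space_cells_measure]) measurable

lemma distr_inv_encode_cells: "distr covering_measure cells_measure (inv encode_cells) = cells_measure"
  unfolding covering_measure_def
  by (subst distr_distr)
    (auto simp: comp_def inv_f_f[OF inj_encode_cells] space_cells_measure distr_id2 intro!: measurable_vimage_algebra1)

lemma point_process_compose:
  assumes "point_process N P c" "prob_space M" "X \<in> M \<rightarrow>\<^sub>M N" "distr M N X = N"
  shows "point_process M (\<lambda>\<omega>. P (X \<omega>)) c"
proof -
  interpret N: point_process N P c by fact
  interpret prob_space M by fact
  have "void_event M (\<lambda>\<omega>. P (X \<omega>)) F = X -` void_event N P F \<inter> space M" for F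
    using measurable_space[OF assms(3)] by (auto simp: void_event_def)
  moreover have "measure M (X -` void_event N P F \<inter> space M) = measure N (void_event N P F)"
    if "bounded_profile F" for F
    using measure_distr[OF assms(3) N.void_sets[OF that]] assms(4) by simp
  ultimately show ?thesis
    using N.points_nonneg N.points_finite measurable_sets[OF assms(3) N.void_sets] N.void_prob by unfold_locales auto
qed

text \<open>Superposition: a union has no point below a graph iff none of its members has one, so
  void probabilities multiply and intensities add.\<close>

lemma point_process_union:
  fixes J :: "nat set"
  assumes P: "point_process Q P c" and J: "finite J"
  shows "point_process (\<Pi>\<^sub>M i\<in>UNIV. Q) (\<lambda>\<omega>. \<Union>i\<in>J. P (\<omega> i)) (real (card J) * c)"
proof -
  interpret Q: point_process Q P c by fact
  interpret PQ: product_prob_space "\<lambda>_::nat. Q" UNIV by unfold_locales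
  define N where "N = (\<Pi>\<^sub>M i\<in>(UNIV::nat set). Q)"
  interpret N: prob_space N unfolding N_def by unfold_locales
  have void_eq: "void_event N (\<lambda>\<omega>. \<Union>i\<in>J. P (\<omega> i)) F = {\<omega>\<in>space N. \<forall>i\<in>J. \<omega> i \<in> Q.void F}" for F
    by (auto simp: void_event_def N_def space_PiM)
  have sets: "{\<omega>\<in>space N. \<forall>i\<in>J. \<omega> i \<in> Q.void F} \<in> sets N" if "bounded_profile F" for F
    using J Q.void_sets[OF that] unfolding N_def by measurable
  have "N.prob {\<omega>\<in>space N. \<forall>i\<in>J. \<omega> i \<in> Q.void F} = exp (- (real (card J) * c) * (LINT r|lborel. F r))"
    if F: "bounded_profile F" for F
  proof -
    have "emeasure N {\<omega>\<in>space N. \<forall>i\<in>J. \<omega> i \<in> Q.void F} = (\<Prod>i\<in>J. emeasure Q (Q.void F))"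
      unfolding N_def using J Q.void_sets[OF F] by (intro PQ.emeasure_PiM_Collect) auto
    then have "N.prob {\<omega>\<in>space N. \<forall>i\<in>J. \<omega> i \<in> Q.void F} = Q.prob (Q.void F) ^ card J"
      by (simp add: N.emeasure_eq_measure Q.emeasure_eq_measure ennreal_power)
    then show ?thesis by (simp add: Q.void_prob[OF F] exp_of_nat_mult[symmetric] mult.assoc)
  qed
  moreover have "finite ((\<Union>i\<in>J. P (\<omega> i)) \<inter> {0..T} \<times> {0..Z})" for \<omega> T Z
  proof -
    have "(\<Union>i\<in>J. P (\<omega> i)) \<inter> {0..T} \<times> {0..Z} = (\<Union>i\<in>J. P (\<omega> i) \<inter> {0..T} \<times> {0..Z})" by auto
    also have "finite \<dots>" using J Q.points_finite by (intro finite_UN_I) auto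
    finally show ?thesis .
  qed
  ultimately have "point_process N (\<lambda>\<omega>. \<Union>i\<in>J. P (\<omega> i)) (real (card J) * c)"
    using Q.points_nonneg sets by unfold_locales (auto simp: void_eq)
  then show ?thesis by (simp add: N_def)
qed

text \<open>The sets \<open>S i\<close> are measurable for the completion, while independence is
  known for versions \<open>S'\<close> on \<open>N\<close> itself. Almost surely equal versions have
  the same joint law, and independence is a property of that law.\<close>

lemma indep_vars_completion:
  assumes N: "prob_space N" and I: "finite I" "I \<noteq> {}"
    and S': "prob_space.indep_vars N M' S' I"
    and S: "\<And>i. i \<in> I \<Longrightarrow> S i \<in> completion N \<rightarrow>\<^sub>M M' i" and ae: "\<And>i. i \<in> I \<Longrightarrow> AE \<omega> in N. S i \<omega> = S' i \<omega>"
  shows "prob_space.indep_vars (completion N) M' S I"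
proof -
  interpret prob_space N by fact
  interpret C: prob_space "completion N" by (rule prob_space_completion)
  have S'_meas: "S' i \<in> N \<rightarrow>\<^sub>M M' i" if "i \<in> I" for i using S' that by (auto simp: indep_vars_def2)
  then have S'_measC: "S' i \<in> completion N \<rightarrow>\<^sub>M M' i" if "i \<in> I" for i using that by (intro measurable_completion) auto
  have "distr (completion N) (\<Pi>\<^sub>M i\<in>I. M' i) (\<lambda>x. \<lambda>i\<in>I. S i x) = distr (completion N) (\<Pi>\<^sub>M i\<in>I. M' i) (\<lambda>x. \<lambda>i\<in>I. S' i x)"
  proof (rule distr_cong_AE)
    have "AE \<omega> in N. \<forall>i\<in>I. S i \<omega> = S' i \<omega>" using I ae by (intro AE_finite_allI) auto
    then have "AE \<omega> in N. (\<lambda>i\<in>I. S i \<omega>) = (\<lambda>i\<in>I. S' i \<omega>)" by eventually_elim (auto simp: fun_eq_iff)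
    then show "AE \<omega> in completion N. (\<lambda>i\<in>I. S i \<omega>) = (\<lambda>i\<in>I. S' i \<omega>)" by (rule AE_completion)
  qed (use S S'_measC in \<open>auto intro!: measurable_restrict\<close>)
  also have "\<dots> = distr N (\<Pi>\<^sub>M i\<in>I. M' i) (\<lambda>x. \<lambda>i\<in>I. S' i x)"
    by (rule distr_completion) (use S'_meas in \<open>auto intro!: measurable_restrict\<close>)
  also have "\<dots> = (\<Pi>\<^sub>M i\<in>I. distr N (M' i) (S' i))"
    using S' indep_vars_iff_distr_eq_PiM'[of I S' M'] I S'_meas by simp
  also have "\<dots> = (\<Pi>\<^sub>M i\<in>I. distr (completion N) (M' i) (S i))"
  proof (rule PiM_cong[OF refl])
    fix i assume i: "i \<in> I"
    have "distr (completion N) (M' i) (S i) = distr (completion N) (M' i) (S' i)"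
      using S[OF i] S'_measC[OF i] AE_completion[OF ae[OF i]] by (intro distr_cong_AE) auto
    also have "\<dots> = distr N (M' i) (S' i)" by (rule distr_completion[OF S'_meas[OF i]])
    finally show "distr N (M' i) (S' i) = distr (completion N) (M' i) (S i)" ..
  qed
  finally show ?thesis using C.indep_vars_iff_distr_eq_PiM'[of I S M'] I S by simp
qed

lemma indep_vars_coordinates:
  assumes "prob_space Q" "finite I" "I \<noteq> {}"
  shows "prob_space.indep_vars (\<Pi>\<^sub>M i\<in>UNIV. Q) (\<lambda>_. Q) (\<lambda>i \<omega>. \<omega> i) (I :: nat set)"
proof -
  interpret Q: prob_space Q by fact
  interpret PQ: product_prob_space "\<lambda>_::nat. Q" UNIV by unfold_locales
  have "distr (\<Pi>\<^sub>M i\<in>UNIV. Q) (\<Pi>\<^sub>M i\<in>I. Q) (\<lambda>x. \<lambda>i\<in>I. x i) = (\<Pi>\<^sub>M i\<in>I. Q)"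
    using PQ.distr_PiM_restrict_finite[of I] assms by simp
  also have "\<dots> = (\<Pi>\<^sub>M i\<in>I. distr (\<Pi>\<^sub>M i\<in>UNIV. Q) Q (\<lambda>x. x i))"
    by (rule PiM_cong) (auto simp: PQ.PiM_component)
  finally show ?thesis using assms by (subst PQ.indep_vars_iff_distr_eq_PiM') auto
qed

lemma uncovered_set_UN: "I \<noteq> {} \<Longrightarrow> uncovered_set m (\<Union>i\<in>I. A i) = (\<Inter>i\<in>I. uncovered_set m (A i))"
  by (auto simp: uncovered_set_def)

theorem proposition5:
  fixes M :: "'w measure"
    and \<Psi> \<Phi> :: "real \<Rightarrow> real"
    and Y :: "real \<Rightarrow> 'w \<Rightarrow> ennreal"
  assumes "prob_space M"
    and "branching_mechanism \<Psi>"
    and "grey_condition \<Psi>"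
    and "immigration_mechanism \<Phi>"
    and "CBI M \<Psi> \<Phi> 0 Y"
  shows "infinitely_divisible_set M (zero_set Y)"
proof -
  obtain m Q where m: "\<And>r. 0 < r \<Longrightarrow> 0 \<le> m r" "\<And>r s. 0 < r \<Longrightarrow> r \<le> s \<Longrightarrow> m s \<le> m r" "continuous_on {0<..} m"
    and Q: "\<And>r. 0 < r \<Longrightarrow> (Q has_real_derivative m r) (at r)"
    and Z: "has_regenerative_density M (zero_set Y) (\<lambda>r. if 0 < r then exp (- Q r) else 0)"
    using CBI_zero_set_density[OF assms] by blast
  define N where "N = (\<Pi>\<^sub>M i\<in>(UNIV::nat set). covering_measure)"
  define P where "P f = cells_points (inv encode_cells f)" for f
  interpret C: prob_space covering_measure by (rule prob_space_covering_measure)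
  interpret PC: product_prob_space "\<lambda>_::nat. covering_measure" UNIV by unfold_locales
  have N: "prob_space N" unfolding N_def by (rule PC.P.prob_space_axioms)
  have P: "point_process covering_measure P 1" unfolding P_def
    by (rule point_process_compose[OF point_process_cells prob_space_covering_measure measurable_inv_encode_cells distr_inv_encode_cells])
  show ?thesis
    unfolding infinitely_divisible_set_def
  proof (intro conjI allI impI)
    show "regenerative_set M (zero_set Y)" by (rule has_regenerative_density_regenerative_set[OF assms(1) Z])
    fix n :: nat assume n: "1 \<le> n"
    \<comment> \<open>The parameter \<open>c\<close> is the intensity of the point process, with
      tail function m / n: it is 1 for a single copy and n for the union of n copies, where
      \<open>u\<close> becomes exp (- Q).\<close>
    define u where "u c r = (if 0 < r then exp (- c * (Q r / real n)) else 0)" for c r :: real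
    define S where "S f = uncovered_set (\<lambda>r. m r / real n) (P f)" for f
    have density: "has_regenerative_density M' (\<lambda>\<omega>. uncovered_set (\<lambda>r. m r / real n) (P' \<omega>)) (u c)"
      if "point_process M' P' c" "0 < c" for M' :: "'c measure" and P' c
    proof -
      have "covering_axioms c (\<lambda>r. m r / real n) (\<lambda>r. Q r / real n)"
        using m Q n that(2)
        by unfold_locales (auto intro!: divide_right_mono continuous_intros DERIV_cdivide)
      then interpret covering M' P' c "\<lambda>r. m r / real n" "\<lambda>r. Q r / real n"
        using that(1) by (intro covering.intro)
      show ?thesis using uncovered_density unfolding u_def[abs_def] .
    qed
    \<comment> \<open>The union over the singleton {i} expresses that the \<open>i\<close>-th
      coordinate carries a point process of intensity 1.\<close>
    have S_density: "has_regenerative_density N (\<lambda>\<omega>. S (\<omega> i)) (u 1)" for i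
      using density[OF point_process_union[OF P, of "{i}"]] by (simp add: S_def N_def)
    have S_meas: "random_closed_set N (\<lambda>\<omega>. S (\<omega> i))" for i
      using has_regenerative_density_regenerative_set[OF N S_density] by (simp add: regenerative_set_def)
    have Int: "(\<lambda>\<omega>. \<Inter>i<n. S (\<omega> i)) = (\<lambda>\<omega>. uncovered_set (\<lambda>r. m r / real n) (\<Union>i\<in>{..<n}. P (\<omega> i)))"
      using n by (subst uncovered_set_UN) (auto simp: S_def lessThan_empty_iff)
    have "has_regenerative_density N (\<lambda>\<omega>. \<Inter>i<n. S (\<omega> i)) (u (real n))"
      unfolding Int using density[OF point_process_union[OF P, of "{..<n}"]] n by (simp add: N_def)
    moreover have "u (real n) = (\<lambda>r. if 0 < r then exp (- Q r) else 0)" using n by (auto simp: u_def)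
    ultimately have "same_law M (zero_set Y) N (\<lambda>\<omega>. \<Inter>i<n. S (\<omega> i))"
      using has_regenerative_density_same_law[OF assms(1) N Z] by simp
    moreover have "prob_space.indep_vars (completion N) (\<lambda>_. closed_sets) (\<lambda>i \<omega>. S (\<omega> i)) {..<n}"
    proof -
      \<comment> \<open>On a single factor \<open>S\<close> has an almost surely equal version that
        is measurable before completion; composed with the independent coordinates, this version
        gives independence.\<close>
      have "has_regenerative_density covering_measure S (u 1)" using density[OF P] by (simp add: S_def[abs_def])
      then obtain \<kappa> \<xi> where \<xi>: "laplace_increments covering_measure \<kappa> \<xi>"
        and ae: "AE \<omega> in covering_measure. S \<omega> = range_closure (\<lambda>t. \<xi> t \<omega>)"
        by (rule has_regenerative_density_cases) blast
      define S' where "S' \<omega> = range_closure (\<lambda>t. \<xi> t \<omega>)" for \<omega>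
      have "S' \<in> covering_measure \<rightarrow>\<^sub>M closed_sets"
        using \<xi> unfolding S'_def[abs_def] by (intro range_closure_measurable) (auto simp: laplace_increments_def)
      moreover have "prob_space.indep_vars N (\<lambda>_. covering_measure) (\<lambda>i \<omega>. \<omega> i) {..<n}"
        unfolding N_def using n by (intro indep_vars_coordinates prob_space_covering_measure) (auto simp: lessThan_empty_iff)
      ultimately have "prob_space.indep_vars N (\<lambda>_. closed_sets) (\<lambda>i \<omega>. S' (\<omega> i)) {..<n}"
        by (intro prob_space.indep_vars_compose2[OF N, where X = "\<lambda>i \<omega>. \<omega> i" and Y = "\<lambda>_. S'" and M' = "\<lambda>_. covering_measure"])
      moreover have "AE \<omega> in N. S (\<omega> i) = S' (\<omega> i)" for i
        unfolding N_def S'_def by (rule PC.AE_component[OF UNIV_I ae])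
      ultimately show ?thesis
        using S_meas n by (intro indep_vars_completion[OF N]) (auto simp: random_closed_set_def lessThan_empty_iff)
    qed
    ultimately show "\<exists>(N :: (nat \<Rightarrow> real \<Rightarrow> ennreal) measure) S.
        prob_space N \<and>
        (\<forall>i<n. regenerative_set N (S i)) \<and>
        (\<forall>i<n. \<forall>j<n. same_law N (S i) N (S j)) \<and>
        prob_space.indep_vars (completion N) (\<lambda>_. closed_sets) S {..<n} \<and>
        same_law M (zero_set Y) N (\<lambda>\<omega>. \<Inter>i<n. S i \<omega>)"
      using N has_regenerative_density_regenerative_set[OF N S_density] has_regenerative_density_same_law[OF N N S_density S_density]
      by (intro exI[of _ N] exI[of _ "\<lambda>i \<omega>. S (\<omega> i)"]) blast
  qed
qed

end
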